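(* Let $p$ be a prime number, let $k$ be an algebraically closed field with $\operatorname{char} k\neq p$, and let $H$ be a pointed Hopf algebra over $k$ with $\dim_k H=p^2$. Then $H$ is isomorphic (as a Hopf algebra) to a Taft algebra $T_{p,\omega}$ for some primitive $p$th root of unity $\omega\in k$, or to a group algebra $kG$ where $G\cong C_p\times C_p$ or $G\cong C_{p^2}$.
   Context: All vector spaces, algebras, coalgebras, Hopf algebras and tensor products are over $k$. $C_m$ denotes the cyclic group of order $m$. Group algebras carry the usual Hopf algebra structure with $\Delta(g)=g\otimes g$, $\epsilon(g)=1$, $S(g)=g^{-1}$ for $g\in G$. A Hopf algebra is pointed if every simple subcoalgebra is one-dimensional, of the form $kg$ with $g$ a group-like element. For $\operatorname{char} k\neq p$ and a primitive $p$th root of unity $\omega\in k$, the Taft algebra is $$T_{p,\omega}=k\langle g,x\rangle/\left(g^p-1,\ x^p,\ gx-\omega xg\right)$$ with Hopf algebra structure determined by $\Delta(g)=g\otimes g$, $\epsilon(g)=1$, $S(g)=g^{-1}$, $\Delta(x)=x\otimes 1+g\otimes x$, $\epsilon(x)=0$, $S(x)=-g^{-1}x$. *)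

theory Defs
  imports
    "HOL-Algebra.QuotRing"
    "HOL-Algebra.Module"
    "HOL-Algebra.Elementary_Groups"
    "HOL-Library.Poly_Mapping"
    "HOL-Computational_Algebra.Polynomial"
begin

section \<open>Vector spaces and algebras over a field\<close>

text \<open>
  The ground field is a type \<open>'k :: field\<close>; vector spaces and algebras over it are
  \<^type>\<open>module\<close> records with an explicit carrier, so that quotients by ideals depending on
  parameters are available. In records that only describe vector spaces the fields
  \<^const>\<open>monoid.mult\<close> and \<^const>\<open>one\<close> carry no information.
\<close>

definition scalars :: "('k::field, 'k) module" where
  "scalars = \<lparr>carrier = UNIV, monoid.mult = (*), one = 1, ring.zero = 0, add = (+), module.smult = (*)\<rparr>"

locale k_algebra = ring A + Module.module scalars A
  for A :: "('k::field, 'a, 'm) module_scheme" (structure) +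
  assumes smult_mult_left:
      "\<lbrakk>x \<in> carrier A; y \<in> carrier A\<rbrakk> \<Longrightarrow> (c \<odot> x) \<otimes> y = c \<odot> (x \<otimes> y)"
    and smult_mult_right:
      "\<lbrakk>x \<in> carrier A; y \<in> carrier A\<rbrakk> \<Longrightarrow> x \<otimes> (c \<odot> y) = c \<odot> (x \<otimes> y)"

definition linear_maps ::
  "('k::field, 'a, 'm) module_scheme \<Rightarrow> ('k, 'b, 'n) module_scheme \<Rightarrow> ('a \<Rightarrow> 'b) set" where
  "linear_maps V W = {f \<in> carrier V \<rightarrow> carrier W.
     (\<forall>x\<in>carrier V. \<forall>y\<in>carrier V. f (x \<oplus>\<^bsub>V\<^esub> y) = f x \<oplus>\<^bsub>W\<^esub> f y) \<and>
     (\<forall>c. \<forall>x\<in>carrier V. f (c \<odot>\<^bsub>V\<^esub> x) = c \<odot>\<^bsub>W\<^esub> f x)}"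

definition is_basis :: "('k::field, 'a, 'm) module_scheme \<Rightarrow> 'a set \<Rightarrow> bool" where
  "is_basis V B \<longleftrightarrow> finite B \<and> B \<subseteq> carrier V \<and>
     (\<forall>v\<in>carrier V. \<exists>!c. c \<in> B \<rightarrow>\<^sub>E UNIV \<and> v = (\<Oplus>\<^bsub>V\<^esub>b\<in>B. c b \<odot>\<^bsub>V\<^esub> b))"

definition has_dimension :: "('k::field, 'a, 'm) module_scheme \<Rightarrow> nat \<Rightarrow> bool" where
  "has_dimension V n \<longleftrightarrow> (\<exists>B. is_basis V B \<and> card B = n)"

definition quot_alg :: "('k::field, 'a, 'm) module_scheme \<Rightarrow> 'a set \<Rightarrow> ('k, 'a set) module" where
  "quot_alg A I = ring.extend (A Quot I) (module.fields (\<lambda>c Y. \<Union>x\<in>Y. I +>\<^bsub>A\<^esub> (c \<odot>\<^bsub>A\<^esub> x)))"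

text \<open>The monoid algebra, with \<^term>\<open>Poly_Mapping.single m 1\<close> as the basis element of \<open>m\<close>.\<close>

definition monoid_algebra :: "('a, 'm) monoid_scheme \<Rightarrow> ('k::field, 'a \<Rightarrow>\<^sub>0 'k) module" where
  "monoid_algebra M =
     \<lparr>carrier = {f. Poly_Mapping.keys f \<subseteq> carrier M},
      monoid.mult = (\<lambda>f h. \<Sum>x\<in>Poly_Mapping.keys f. \<Sum>y\<in>Poly_Mapping.keys h.
                Poly_Mapping.single (x \<otimes>\<^bsub>M\<^esub> y) (Poly_Mapping.lookup f x * Poly_Mapping.lookup h y)),
      one = Poly_Mapping.single \<one>\<^bsub>M\<^esub> 1, ring.zero = 0, add = (+),
      module.smult = (\<lambda>c. Poly_Mapping.map ((*) c))\<rparr>"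

definition linear_extension ::
  "('k::field, 'b, 'm) module_scheme \<Rightarrow> ('a \<Rightarrow> 'b) \<Rightarrow> ('a \<Rightarrow>\<^sub>0 'k) \<Rightarrow> 'b" where
  "linear_extension V f u = (\<Oplus>\<^bsub>V\<^esub>x\<in>Poly_Mapping.keys u. Poly_Mapping.lookup u x \<odot>\<^bsub>V\<^esub> f x)"


section \<open>Tensor products\<close>

text \<open>
  \<open>V \<otimes> W\<close> is the vector space freely spanned by \<open>V \<times> W\<close> modulo the bilinearity relations.
  Taking for that free vector space the monoid algebra of \<open>V \<times> W\<close> equips \<open>V \<otimes> W\<close>,
  for algebras \<open>V\<close> and \<open>W\<close>, with the usual product \<open>(a \<otimes> b)(c \<otimes> d) = ac \<otimes> bd\<close>;
  if \<open>V\<close> and \<open>W\<close> are mere vector spaces, that product is meaningless and never used.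
\<close>

definition tensor_relations ::
  "('k::field, 'a, 'm) module_scheme \<Rightarrow> ('k, 'b, 'n) module_scheme \<Rightarrow> ('a \<times> 'b \<Rightarrow>\<^sub>0 'k) set" where
  "tensor_relations V W =
     {Poly_Mapping.single (v \<oplus>\<^bsub>V\<^esub> v', w) 1
        - Poly_Mapping.single (v, w) 1 - Poly_Mapping.single (v', w) 1
      | v v' w. v \<in> carrier V \<and> v' \<in> carrier V \<and> w \<in> carrier W} \<union>
     {Poly_Mapping.single (v, w \<oplus>\<^bsub>W\<^esub> w') 1
        - Poly_Mapping.single (v, w) 1 - Poly_Mapping.single (v, w') 1
      | v w w'. v \<in> carrier V \<and> w \<in> carrier W \<and> w' \<in> carrier W} \<union>
     {Poly_Mapping.single (c \<odot>\<^bsub>V\<^esub> v, w) 1 - Poly_Mapping.single (v, w) c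
      | c v w. v \<in> carrier V \<and> w \<in> carrier W} \<union>
     {Poly_Mapping.single (v, c \<odot>\<^bsub>W\<^esub> w) 1 - Poly_Mapping.single (v, w) c
      | c v w. v \<in> carrier V \<and> w \<in> carrier W}"

definition tensor_kernel ::
  "('k::field, 'a, 'm) module_scheme \<Rightarrow> ('k, 'b, 'n) module_scheme \<Rightarrow> ('a \<times> 'b \<Rightarrow>\<^sub>0 'k) set" where
  "tensor_kernel V W =
     \<Inter>{N. submodule N scalars (monoid_algebra (V \<times>\<times> W)) \<and> tensor_relations V W \<subseteq> N}"

definition tensor ::
  "('k::field, 'a, 'm) module_scheme \<Rightarrow> ('k, 'b, 'n) module_scheme
    \<Rightarrow> ('k, ('a \<times> 'b \<Rightarrow>\<^sub>0 'k) set) module" where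
  "tensor V W = quot_alg (monoid_algebra (V \<times>\<times> W)) (tensor_kernel V W)"

definition tensor_class ::
  "('k::field, 'a, 'm) module_scheme \<Rightarrow> ('k, 'b, 'n) module_scheme
    \<Rightarrow> ('a \<times> 'b \<Rightarrow>\<^sub>0 'k) \<Rightarrow> ('a \<times> 'b \<Rightarrow>\<^sub>0 'k) set" where
  "tensor_class V W u = tensor_kernel V W +>\<^bsub>monoid_algebra (V \<times>\<times> W)\<^esub> u"

definition pure_tensor ::
  "('k::field, 'a, 'm) module_scheme \<Rightarrow> ('k, 'b, 'n) module_scheme
    \<Rightarrow> 'a \<Rightarrow> 'b \<Rightarrow> ('a \<times> 'b \<Rightarrow>\<^sub>0 'k) set" where
  "pure_tensor V W v w = tensor_class V W (Poly_Mapping.single (v, w) 1)"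

text \<open>
  The linear map \<open>V \<otimes> W \<rightarrow> U\<close> induced by a bilinear map \<open>f\<close>: by bilinearity, the linear
  extension of \<open>f\<close> takes a single value on each class \<open>t\<close>.
\<close>

definition tensor_lift ::
  "('k::field, 'c, 'm) module_scheme \<Rightarrow> ('a \<Rightarrow> 'b \<Rightarrow> 'c) \<Rightarrow> ('a \<times> 'b \<Rightarrow>\<^sub>0 'k) set \<Rightarrow> 'c" where
  "tensor_lift U f t = the_elem (linear_extension U (case_prod f) ` t)"

definition tensor_map ::
  "('k::field, 'c, 'm) module_scheme \<Rightarrow> ('k, 'd, 'n) module_scheme \<Rightarrow> ('a \<Rightarrow> 'c) \<Rightarrow> ('b \<Rightarrow> 'd)
    \<Rightarrow> ('a \<times> 'b \<Rightarrow>\<^sub>0 'k) set \<Rightarrow> ('c \<times> 'd \<Rightarrow>\<^sub>0 'k) set" where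
  "tensor_map V W f g = tensor_lift (tensor V W) (\<lambda>a b. pure_tensor V W (f a) (g b))"

text \<open>The canonical isomorphism \<open>(U \<otimes> V) \<otimes> W \<rightarrow> U \<otimes> (V \<otimes> W)\<close>.\<close>

definition tensor_assoc ::
  "('k::field, 'a, 'l) module_scheme \<Rightarrow> ('k, 'b, 'm) module_scheme \<Rightarrow> ('k, 'c, 'n) module_scheme
    \<Rightarrow> (('a \<times> 'b \<Rightarrow>\<^sub>0 'k) set \<times> 'c \<Rightarrow>\<^sub>0 'k) set
    \<Rightarrow> ('a \<times> ('b \<times> 'c \<Rightarrow>\<^sub>0 'k) set \<Rightarrow>\<^sub>0 'k) set" where
  "tensor_assoc U V W =
     (let UVW = tensor U (tensor V W)
      in tensor_lift UVW
           (\<lambda>t c. tensor_lift UVW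
              (\<lambda>a b. pure_tensor U (tensor V W) a (pure_tensor V W b c)) t))"


section \<open>Hopf algebras\<close>

record (overloaded) ('k::zero, 'h) hopf = "('k, 'h) module" +
  comult :: "'h \<Rightarrow> ('h \<times> 'h \<Rightarrow>\<^sub>0 'k) set"
  counit :: "'h \<Rightarrow> 'k"
  antipode :: "'h \<Rightarrow> 'h"

locale k_coalgebra = Module.module scalars H
  for H :: "('k::field, 'h, 'm) hopf_scheme" (structure) +
  assumes comult_linear: "comult H \<in> linear_maps H (tensor H H)"
    and counit_linear: "counit H \<in> linear_maps H (scalars :: ('k, 'k) module)"
    and coassoc: "x \<in> carrier H \<Longrightarrow>
      tensor_assoc H H H (tensor_map (tensor H H) H (comult H) id (comult H x))
      = tensor_map H (tensor H H) id (comult H) (comult H x)"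
    and counit_left: "x \<in> carrier H \<Longrightarrow>
      tensor_lift H (\<lambda>a b. counit H a \<odot> b) (comult H x) = x"
    and counit_right: "x \<in> carrier H \<Longrightarrow>
      tensor_lift H (\<lambda>a b. counit H b \<odot> a) (comult H x) = x"

locale bialgebra = k_algebra H + k_coalgebra H
  for H :: "('k::field, 'h, 'm) hopf_scheme" (structure) +
  assumes comult_hom: "comult H \<in> ring_hom H (tensor H H)"
    and counit_hom: "counit H \<in> ring_hom H (scalars :: ('k, 'k) module)"

locale hopf_algebra = bialgebra H
  for H :: "('k::field, 'h, 'm) hopf_scheme" (structure) +
  assumes antipode_linear: "antipode H \<in> linear_maps H H"
    and antipode_left: "x \<in> carrier H \<Longrightarrow>
      tensor_lift H (\<lambda>a b. antipode H a \<otimes> b) (comult H x) = counit H x \<odot> \<one>"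
    and antipode_right: "x \<in> carrier H \<Longrightarrow>
      tensor_lift H (\<lambda>a b. a \<otimes> antipode H b) (comult H x) = counit H x \<odot> \<one>"

definition hopf_iso :: "('k::field, 'a, 'm) hopf_scheme \<Rightarrow> ('k, 'b, 'n) hopf_scheme \<Rightarrow> ('a \<Rightarrow> 'b) set"
  where
  "hopf_iso H L = {\<phi> \<in> ring_iso H L \<inter> linear_maps H L. \<forall>x\<in>carrier H.
     comult L (\<phi> x) = tensor_map L L \<phi> \<phi> (comult H x) \<and>
     counit L (\<phi> x) = counit H x \<and>
     antipode L (\<phi> x) = \<phi> (antipode H x)}"

definition hopf_isomorphic :: "('k::field, 'a, 'm) hopf_scheme \<Rightarrow> ('k, 'b, 'n) hopf_scheme \<Rightarrow> bool"
  where "hopf_isomorphic H L \<longleftrightarrow> hopf_iso H L \<noteq> {}"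


section \<open>Pointedness\<close>

definition grouplike :: "('k::field, 'h, 'm) hopf_scheme \<Rightarrow> 'h \<Rightarrow> bool" where
  "grouplike H g \<longleftrightarrow>
     g \<in> carrier H \<and> comult H g = pure_tensor H H g g \<and> counit H g = 1"

text \<open>The condition \<open>\<Delta>(C) \<subseteq> C \<otimes> C\<close> refers to the image of \<open>C \<otimes> C\<close> in \<open>H \<otimes> H\<close>.\<close>

definition subcoalgebra :: "('k::field, 'h, 'm) hopf_scheme \<Rightarrow> 'h set \<Rightarrow> bool" where
  "subcoalgebra H C \<longleftrightarrow> submodule C scalars H \<and>
     comult H ` C \<subseteq> tensor_class H H ` {u. Poly_Mapping.keys u \<subseteq> C \<times> C}"

definition simple_subcoalgebra :: "('k::field, 'h, 'm) hopf_scheme \<Rightarrow> 'h set \<Rightarrow> bool" where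
  "simple_subcoalgebra H C \<longleftrightarrow> subcoalgebra H C \<and> C \<noteq> {\<zero>\<^bsub>H\<^esub>} \<and>
     (\<forall>D. subcoalgebra H D \<and> D \<subseteq> C \<longrightarrow> D = {\<zero>\<^bsub>H\<^esub>} \<or> D = C)"

definition pointed :: "('k::field, 'h, 'm) hopf_scheme \<Rightarrow> bool" where
  "pointed H \<longleftrightarrow> (\<forall>C. simple_subcoalgebra H C \<longrightarrow>
     (\<exists>g. grouplike H g \<and> C = range (\<lambda>c. c \<odot>\<^bsub>H\<^esub> g)))"


section \<open>Group algebras\<close>

definition group_algebra :: "('g, 'm) monoid_scheme \<Rightarrow> ('k::field, 'g \<Rightarrow>\<^sub>0 'k) hopf" where
  "group_algebra G =
     (let kG = monoid_algebra G; e = (\<lambda>x. Poly_Mapping.single x 1)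
      in module.extend kG (hopf.fields
           (linear_extension (tensor kG kG) (\<lambda>x. pure_tensor kG kG (e x) (e x)))
           (linear_extension scalars (\<lambda>x. 1))
           (linear_extension kG (\<lambda>x. e (inv\<^bsub>G\<^esub> x)))))"


section \<open>Taft algebras\<close>

datatype taft_gen = Gen_g | Gen_x

definition words :: "'a list monoid" where
  "words = \<lparr>carrier = UNIV, monoid.mult = (@), one = []\<rparr>"

abbreviation free_algebra :: "('k::field, 'a list \<Rightarrow>\<^sub>0 'k) module" where
  "free_algebra \<equiv> monoid_algebra words"

definition word :: "'a list \<Rightarrow> ('a list \<Rightarrow>\<^sub>0 'k::field)" where
  "word w = Poly_Mapping.single w 1"

text \<open>The algebra map from the free algebra to \<open>A\<close> with prescribed values on the generators.\<close>

definition free_eval ::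
  "('k::field, 'b, 'm) module_scheme \<Rightarrow> ('a \<Rightarrow> 'b) \<Rightarrow> ('a list \<Rightarrow>\<^sub>0 'k) \<Rightarrow> 'b" where
  "free_eval A f = linear_extension A (\<lambda>w. foldr (\<lambda>i y. f i \<otimes>\<^bsub>A\<^esub> y) w \<one>\<^bsub>A\<^esub>)"

definition opposite_alg :: "('k::field, 'a, 'm) module_scheme \<Rightarrow> ('k, 'a, 'm) module_scheme" where
  "opposite_alg A = A\<lparr>monoid.mult := \<lambda>x y. y \<otimes>\<^bsub>A\<^esub> x\<rparr>"

definition taft_relations :: "nat \<Rightarrow> 'k::field \<Rightarrow> (taft_gen list \<Rightarrow>\<^sub>0 'k) set" where
  "taft_relations p \<omega> =
     {word (replicate p Gen_g) - word [], word (replicate p Gen_x),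
      word [Gen_g, Gen_x] - Poly_Mapping.single [Gen_x, Gen_g] \<omega>}"

definition taft_ideal :: "nat \<Rightarrow> 'k::field \<Rightarrow> (taft_gen list \<Rightarrow>\<^sub>0 'k) set" where
  "taft_ideal p \<omega> = Idl\<^bsub>free_algebra\<^esub> (taft_relations p \<omega>)"

definition taft_alg :: "nat \<Rightarrow> 'k::field \<Rightarrow> ('k, (taft_gen list \<Rightarrow>\<^sub>0 'k) set) module" where
  "taft_alg p \<omega> = quot_alg free_algebra (taft_ideal p \<omega>)"

definition taft_elem :: "nat \<Rightarrow> 'k::field \<Rightarrow> taft_gen \<Rightarrow> (taft_gen list \<Rightarrow>\<^sub>0 'k) set" where
  "taft_elem p \<omega> i = taft_ideal p \<omega> +>\<^bsub>free_algebra\<^esub> word [i]"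

text \<open>
  The structure maps are the (anti-)algebra maps induced on the quotient by their values on the
  generators; the antipode, an antihomomorphism, is an algebra map to the opposite algebra.
\<close>

definition taft_comult_gen ::
  "nat \<Rightarrow> 'k::field \<Rightarrow> taft_gen
    \<Rightarrow> ((taft_gen list \<Rightarrow>\<^sub>0 'k) set \<times> (taft_gen list \<Rightarrow>\<^sub>0 'k) set \<Rightarrow>\<^sub>0 'k) set" where
  "taft_comult_gen p \<omega> i =
     (let T = taft_alg p \<omega>; g = taft_elem p \<omega> Gen_g; x = taft_elem p \<omega> Gen_x
      in case i of
           Gen_g \<Rightarrow> pure_tensor T T g g
         | Gen_x \<Rightarrow> pure_tensor T T x \<one>\<^bsub>T\<^esub> \<oplus>\<^bsub>tensor T T\<^esub> pure_tensor T T g x)"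

definition taft_counit_gen :: "taft_gen \<Rightarrow> 'k::field" where
  "taft_counit_gen i = (case i of Gen_g \<Rightarrow> 1 | Gen_x \<Rightarrow> 0)"

definition taft_antipode_gen ::
  "nat \<Rightarrow> 'k::field \<Rightarrow> taft_gen \<Rightarrow> (taft_gen list \<Rightarrow>\<^sub>0 'k) set" where
  "taft_antipode_gen p \<omega> i =
     (let T = taft_alg p \<omega>; g = taft_elem p \<omega> Gen_g; x = taft_elem p \<omega> Gen_x
      in case i of Gen_g \<Rightarrow> inv\<^bsub>T\<^esub> g | Gen_x \<Rightarrow> \<ominus>\<^bsub>T\<^esub> (inv\<^bsub>T\<^esub> g \<otimes>\<^bsub>T\<^esub> x))"

definition taft :: "nat \<Rightarrow> 'k::field \<Rightarrow> ('k, (taft_gen list \<Rightarrow>\<^sub>0 'k) set) hopf" where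
  "taft p \<omega> =
     (let T = taft_alg p \<omega>
      in module.extend T (hopf.fields
           (\<lambda>Y. the_elem (free_eval (tensor T T) (taft_comult_gen p \<omega>) ` Y))
           (\<lambda>Y. the_elem (free_eval scalars taft_counit_gen ` Y))
           (\<lambda>Y. the_elem (free_eval (opposite_alg T) (taft_antipode_gen p \<omega>) ` Y))))"

definition primitive_root_of_unity :: "nat \<Rightarrow> 'k::field \<Rightarrow> bool" where
  "primitive_root_of_unity n \<omega> \<longleftrightarrow> n > 0 \<and> \<omega> ^ n = 1 \<and> (\<forall>m. 0 < m \<and> m < n \<longrightarrow> \<omega> ^ m \<noteq> 1)"

end

theory Submission
  imports Defs "HOL-Library.Function_Algebras" "HOL-Algebra.Multiplicative_Group"
begin

text \<open>
  Let \<open>H\<close> be a pointed Hopf algebra of dimension \<open>p\<^sup>2\<close>, with \<open>p\<close> invertible in the ground field. Group-like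
  elements are independent, because they have distinct weights under the coaction. If they span \<open>H\<close>, then \<open>H\<close> is the
  group algebra of a group of order \<open>p\<^sup>2\<close>, and there are only two of these (\<open>group_prime_squared\<close>).

  Otherwise, there are a group-like \<open>u\<close> and an \<open>x\<close> with \<open>\<Delta> x = x \<otimes> 1 + u \<otimes> x\<close> that do not commute
  (\<open>noncommuting_skew\<close>). If all such pairs commuted, \<open>S\<^sup>2\<close> would fix every skew-primitive element, hence, by the theorem of
  Taft and Wilson (\<open>taft_wilson\<close>), the first term of the coradical filtration. A coalgebra map with this property is
  unipotent (\<open>D_unipotent\<close>), so \<open>S\<^sup>2\<close> would have trace \<open>p\<^sup>2 \<noteq> 0\<close>. The form \<open>h \<mapsto> tr(h S\<^sup>2)\<close> is an
  integral in the dual of \<open>H\<close> (\<open>trace_integral\<close>); if its value at \<open>1\<close> is nonzero, all skew-primitives are spanned by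
  group-likes, and so is \<open>H\<close>.

  The number of group-likes divides \<open>p\<^sup>2\<close> (\<open>card_GL_dvd\<close>), so that conjugation by \<open>u\<close> has finite order invertible in the
  field. Over an algebraically closed field it has an eigenvector among the skew-primitives with eigenvalue \<open>\<omega> \<noteq> 1\<close>
  (\<open>skew_eigenvector\<close>). Replacing \<open>x\<close> by it, \<open>u x = \<omega> x u\<close>, and counting shows that \<open>u\<close> and \<open>\<omega>\<close> have order \<open>p\<close>. The
  monomials \<open>u\<^sup>a x\<^sup>l\<close> with \<open>a, l < p\<close> are independent: weights under the coaction separate the exponents \<open>a\<close>,
  eigenvalues under conjugation the exponents \<open>l\<close> (\<open>mm_indep\<close>). There are \<open>p\<^sup>2\<close> of them, so they form a basis, from
  which \<open>x\<^sup>p = 0\<close> follows (\<open>pw_x_p\<close>). The Taft algebra is spanned by the corresponding monomials (\<open>spans_T\<close>), and so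
  its evaluation at \<open>u\<close> and \<open>x\<close> is bijective (\<open>taft_iso\<close>).

  The coalgebra theory is developed for subspaces of a type, with \<open>\<Delta>\<close> given by structure constants and
  Sweedler sums written as \<open>sw F x\<close>. A Hopf algebra with a carrier set and a basis is transported to this setting by its
  coordinates (locale \<open>hopf_basis\<close>).
\<close>


section \<open>Finite-dimensional coalgebras and Hopf algebras\<close>

text \<open>
  A vector space on a whole type. The point of this setting is that forms and endomorphisms are total
  functions, so that all identities between them can be proved by rewriting.
\<close>

locale kspace = vector_space scale
  for scale :: "'a::field \<Rightarrow> 'b::ab_group_add \<Rightarrow> 'b" (infixr "*s" 75)
begin

definition lform :: "('b \<Rightarrow> 'a) \<Rightarrow> bool" where
  "lform \<alpha> \<longleftrightarrow> (\<forall>x y. \<alpha> (x + y) = \<alpha> x + \<alpha> y) \<and> (\<forall>c x. \<alpha> (c *s x) = c * \<alpha> x)"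

definition lmap :: "('b \<Rightarrow> 'b) \<Rightarrow> bool" where
  "lmap f \<longleftrightarrow> (\<forall>x y. f (x + y) = f x + f y) \<and> (\<forall>c x. f (c *s x) = c *s f x)"

definition bil :: "('b \<Rightarrow> 'b \<Rightarrow> 'b) \<Rightarrow> bool" where
  "bil F \<longleftrightarrow> (\<forall>y. lmap (\<lambda>x. F x y)) \<and> (\<forall>x. lmap (F x))"

text \<open>
  Gives access to the extension of linear maps from independent sets.
\<close>

lemma lform_linear: "lform \<alpha> \<longleftrightarrow> Vector_Spaces.linear scale (*) \<alpha>"
proof -
  interpret pr: vector_space_pair scale "(*)"
    by unfold_locales (auto simp: algebra_simps)
  show ?thesis unfolding lform_def Vector_Spaces.linear_iff using pr.vector_space_pair_axioms by (auto simp: vector_space_pair_def)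
qed

lemma lform_add: "lform \<alpha> \<Longrightarrow> \<alpha> (x + y) = \<alpha> x + \<alpha> y"
  and lform_scale: "lform \<alpha> \<Longrightarrow> \<alpha> (c *s x) = c * \<alpha> x"
  by (auto simp: lform_def)

lemma lform_0: "lform \<alpha> \<Longrightarrow> \<alpha> 0 = 0"
  using lform_scale[of \<alpha> 0 0] by simp

lemma lform_diff: "lform \<alpha> \<Longrightarrow> \<alpha> (x - y) = \<alpha> x - \<alpha> y"
  using lform_add[of \<alpha> "x - y" y] by simp

lemma lform_minus: "lform \<alpha> \<Longrightarrow> \<alpha> (- y) = - \<alpha> y"
  using lform_diff[of \<alpha> 0 y] by (simp add: lform_0)

lemma lform_sum: "lform \<alpha> \<Longrightarrow> \<alpha> (sum f I) = (\<Sum>i\<in>I. \<alpha> (f i))"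
  by (induction I rule: infinite_finite_induct) (auto simp: lform_0 lform_add)

lemmas lform_simps = lform_add lform_scale lform_0 lform_diff lform_minus lform_sum

lemma lmap_add: "lmap f \<Longrightarrow> f (x + y) = f x + f y"
  and lmap_scale: "lmap f \<Longrightarrow> f (c *s x) = c *s f x"
  by (auto simp: lmap_def)

lemma lmap_0: "lmap f \<Longrightarrow> f 0 = 0"
  using lmap_scale[of f 0 0] by simp

lemma lmap_diff: "lmap f \<Longrightarrow> f (x - y) = f x - f y"
  using lmap_add[of f "x - y" y] by simp

lemma lmap_minus: "lmap f \<Longrightarrow> f (- y) = - f y"
  using lmap_diff[of f 0 y] by (simp add: lmap_0)

lemma lmap_sum: "lmap f \<Longrightarrow> f (sum g I) = (\<Sum>i\<in>I. f (g i))"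
  by (induction I rule: infinite_finite_induct) (auto simp: lmap_0 lmap_add)

lemmas lmap_simps = lmap_add lmap_scale lmap_0 lmap_diff lmap_minus lmap_sum

lemma bil_simps:
  assumes "bil F"
  shows "F (x + y) z = F x z + F y z" "F z (x + y) = F z x + F z y"
    "F (c *s x) z = c *s F x z" "F z (c *s x) = c *s F z x"
    "F 0 z = 0" "F z 0 = 0" "F (x - y) z = F x z - F y z" "F z (x - y) = F z x - F z y"
    "F (- x) z = - F x z" "F z (- x) = - F z x"
    "F (sum h I) z = (\<Sum>i\<in>I. F (h i) z)" "F z (sum h I) = (\<Sum>i\<in>I. F z (h i))"
proof -
  have l: "lmap (\<lambda>x. F x z)" "lmap (F z)" for z using assms by (auto simp: bil_def)
  show "F (x + y) z = F x z + F y z" "F z (x + y) = F z x + F z y"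
    "F (c *s x) z = c *s F x z" "F z (c *s x) = c *s F z x"
    "F 0 z = 0" "F z 0 = 0" "F (x - y) z = F x z - F y z" "F z (x - y) = F z x - F z y"
    "F (- x) z = - F x z" "F z (- x) = - F z x"
    "F (sum h I) z = (\<Sum>i\<in>I. F (h i) z)" "F z (sum h I) = (\<Sum>i\<in>I. F z (h i))"
    using l(1)[of z, THEN lmap_add] l(2)[of z, THEN lmap_add] l(1)[of z, THEN lmap_scale]
      l(2)[of z, THEN lmap_scale] l(1)[of z, THEN lmap_0] l(2)[of z, THEN lmap_0]
      l(1)[of z, THEN lmap_diff] l(2)[of z, THEN lmap_diff]
      l(1)[of z, THEN lmap_minus] l(2)[of z, THEN lmap_minus]
      l(1)[of z, THEN lmap_sum] l(2)[of z, THEN lmap_sum] by auto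
qed

lemma lform_extend:
  assumes "independent E"
  obtains \<alpha> where "lform \<alpha>" "\<And>e. e \<in> E \<Longrightarrow> \<alpha> e = t e"
proof -
  interpret pr: vector_space_pair scale "(*)"
    by unfold_locales (auto simp: algebra_simps)
  from pr.linear_independent_extend[OF assms, of t] that show ?thesis
    unfolding lform_linear by auto
qed

lemma separating_form:
  assumes "subspace S" "x \<notin> S"
  obtains \<alpha> where "lform \<alpha>" "\<And>y. y \<in> S \<Longrightarrow> \<alpha> y = 0" "\<alpha> x = 1"
proof -
  obtain E where E: "E \<subseteq> S" "independent E" "S \<subseteq> span E"
    using basis_exists by metis
  have SE: "span E = S" using E assms(1) span_minimal by blast
  with assms have "x \<notin> span E" by simp
  then have "independent (insert x E)" and xE: "x \<notin> E"
    using E(2) independent_insertI span_base by blast+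
  then obtain \<alpha> where a: "lform \<alpha>" "\<And>e. e \<in> insert x E \<Longrightarrow> \<alpha> e = (if e = x then 1 else 0)"
    using lform_extend[of "insert x E" "\<lambda>e. if e = x then 1 else 0"] by blast
  have "\<alpha> y = 0" if "y \<in> S" for y
  proof -
    have "y \<in> span E" using that SE by simp
    then show ?thesis
      by (induction rule: span_induct_alt) (use a xE in \<open>auto simp: lform_simps\<close>)
  qed
  with a show ?thesis by (intro that[of \<alpha>]) auto
qed

text \<open>
  The tool for proving equalities between elements: compare their values under forms.
\<close>

lemma eq_by_forms: "(\<And>\<alpha>. lform \<alpha> \<Longrightarrow> \<alpha> x = \<alpha> y) \<Longrightarrow> x = y"
proof (rule ccontr)
  assume h: "\<And>\<alpha>. lform \<alpha> \<Longrightarrow> \<alpha> x = \<alpha> y" "x \<noteq> y"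
  then have "x - y \<notin> {0}" by simp
  then obtain \<alpha> where "lform \<alpha>" "\<alpha> (x - y) = 1"
    using separating_form[OF subspace_single_0] by metis
  with h(1)[of \<alpha>] show False by (simp add: lform_diff)
qed

definition dual :: "'b set \<Rightarrow> 'b \<Rightarrow> 'b \<Rightarrow> 'a" where
  "dual E e = (SOME \<alpha>. lform \<alpha> \<and> (\<forall>e'\<in>E. \<alpha> e' = (if e' = e then 1 else 0)))"

lemma dual:
  assumes "independent E"
  shows "lform (dual E e)" "e' \<in> E \<Longrightarrow> dual E e e' = (if e' = e then 1 else 0)"
proof -
  obtain \<alpha> where "lform \<alpha>" "\<And>e'. e' \<in> E \<Longrightarrow> \<alpha> e' = (if e' = e then 1 else 0)"
    using lform_extend[OF assms, of "\<lambda>e'. if e' = e then 1 else 0"] by blast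
  then have "\<exists>\<alpha>. lform \<alpha> \<and> (\<forall>e'\<in>E. \<alpha> e' = (if e' = e then 1 else 0))" by blast
  from someI_ex[OF this] show "lform (dual E e)" "e' \<in> E \<Longrightarrow> dual E e e' = (if e' = e then 1 else 0)"
    unfolding dual_def by blast+
qed

lemma dual_expand:
  assumes "independent E" "finite E" "x \<in> span E"
  shows "x = (\<Sum>e\<in>E. dual E e x *s e)"
  using assms(3)
proof (induction rule: span_induct_alt)
  case base then show ?case using dual(1)[OF assms(1)] by (simp add: lform_simps)
next
  case (step c e y)
  have "(\<Sum>i\<in>E. dual E i (c *s e + y) *s i) = (\<Sum>i\<in>E. (c * dual E i e) *s i) + (\<Sum>i\<in>E. dual E i y *s i)"
    using dual(1)[OF assms(1)] by (simp add: lform_simps scale_left_distrib sum.distrib)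
  also have "(\<Sum>i\<in>E. (c * dual E i e) *s i) = (\<Sum>i\<in>E. if i = e then c *s e else 0)"
    by (intro sum.cong refl) (use step dual(2)[OF assms(1)] in auto)
  also have "\<dots> = c *s e" using step assms(2) by simp
  finally show ?case using step by simp
qed

end

text \<open>
  The coalgebra is the subspace \<open>V\<close> with basis \<open>B\<close>, and \<open>dl x b c\<close> is the coefficient of
  \<open>b \<otimes> c\<close> in \<open>\<Delta> x\<close>. No tensor product is formed: the image of \<open>\<Delta> x\<close> under the linear map induced by
  a bilinear \<open>F\<close> is the element \<open>sw F x\<close> below, in Sweedler notation \<open>F(x\<^sub>1, x\<^sub>2)\<close>, and \<open>swk\<close> is
  the analogue for scalar-valued \<open>F\<close>.
\<close>

locale fd_coalgebra = kspace scale
  for scale :: "'k::field \<Rightarrow> 'v::ab_group_add \<Rightarrow> 'v" (infixr "*s" 75) +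
  fixes V B :: "'v set" and dl :: "'v \<Rightarrow> 'v \<Rightarrow> 'v \<Rightarrow> 'k" and eps :: "'v \<Rightarrow> 'k"
  assumes finB: "finite B" and indepB: "independent B" and V_span: "V = span B"
    and dl_add: "dl (x + y) b c = dl x b c + dl y b c"
    and dl_scale: "dl (r *s x) b c = r * dl x b c"
    and eps_form: "lform eps"
    and coassoc_dl: "\<lbrakk>b \<in> B; c \<in> B; d \<in> B\<rbrakk> \<Longrightarrow>
      (\<Sum>e\<in>B. dl x e d * dl e b c) = (\<Sum>e\<in>B. dl x b e * dl e c d)"
    and counit_l_dl: "x \<in> V \<Longrightarrow> (\<Sum>b\<in>B. \<Sum>c\<in>B. dl x b c *s (eps b *s c)) = x"
    and counit_r_dl: "x \<in> V \<Longrightarrow> (\<Sum>b\<in>B. \<Sum>c\<in>B. dl x b c *s (eps c *s b)) = x"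
begin

definition sw :: "('v \<Rightarrow> 'v \<Rightarrow> 'v) \<Rightarrow> 'v \<Rightarrow> 'v" where
  "sw F x = (\<Sum>b\<in>B. \<Sum>c\<in>B. dl x b c *s F b c)"

definition swk :: "('v \<Rightarrow> 'v \<Rightarrow> 'k) \<Rightarrow> 'v \<Rightarrow> 'k" where
  "swk F x = (\<Sum>b\<in>B. \<Sum>c\<in>B. dl x b c * F b c)"

lemma B_V: "b \<in> B \<Longrightarrow> b \<in> V" by (simp add: V_span span_base)

lemma subspace_V [simp]: "subspace V" by (simp add: V_span)

lemma V_add [simp]: "x \<in> V \<Longrightarrow> y \<in> V \<Longrightarrow> x + y \<in> V"
  and V_diff [simp]: "x \<in> V \<Longrightarrow> y \<in> V \<Longrightarrow> x - y \<in> V"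
  and V_minus [simp]: "x \<in> V \<Longrightarrow> - x \<in> V"
  and V_scale [simp]: "x \<in> V \<Longrightarrow> c *s x \<in> V"
  and V_0 [simp]: "0 \<in> V"
  and V_sum: "(\<And>i. i \<in> I \<Longrightarrow> f i \<in> V) \<Longrightarrow> sum f I \<in> V"
  by (auto simp: V_span span_add span_diff span_neg span_scale span_zero span_sum)

text \<open>
  As congruence rules these lemmas let the simplifier use that Sweedler factors lie in \<open>V\<close>.
\<close>

lemma sw_cong [cong]:
  "(\<And>a b. a \<in> V \<Longrightarrow> b \<in> V \<Longrightarrow> F a b = G a b) \<Longrightarrow> x = y \<Longrightarrow> sw F x = sw G y"
  unfolding sw_def by (intro sum.cong refl) (auto simp: B_V)

lemma swk_cong [cong]:
  "(\<And>a b. a \<in> V \<Longrightarrow> b \<in> V \<Longrightarrow> F a b = G a b) \<Longrightarrow> x = y \<Longrightarrow> swk F x = swk G y"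
  unfolding swk_def by (intro sum.cong refl) (auto simp: B_V)

lemma sw_add [simp]: "sw F (x + y) = sw F x + sw F y"
  by (simp add: sw_def dl_add scale_left_distrib sum.distrib)

lemma sw_scale [simp]: "sw F (c *s x) = c *s sw F x"
  by (simp add: sw_def dl_scale scale_sum_right)

lemma lmap_sw: "lmap (sw F)" by (simp add: lmap_def)

lemma sw_lin [simp]: "sw F 0 = 0" "sw F (x - y) = sw F x - sw F y" "sw F (- x) = - sw F x"
  "sw F (sum h I) = (\<Sum>i\<in>I. sw F (h i))"
  using lmap_sw[of F] by (auto simp: lmap_simps)

lemma sw_plus: "sw (\<lambda>a b. F a b + G a b) x = sw F x + sw G x"
  by (simp add: sw_def scale_right_distrib sum.distrib)

lemma sw_smult: "sw (\<lambda>a b. c *s F a b) x = c *s sw F x"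
  by (simp add: sw_def scale_sum_right mult.commute)

lemma sw_minus: "sw (\<lambda>a b. F a b - G a b) x = sw F x - sw G x"
  by (simp add: sw_def scale_right_diff_distrib sum_subtractf)

lemma sw_uminus: "sw (\<lambda>a b. - F a b) x = - sw F x"
  by (simp add: sw_def sum_negf)

lemma sw_zero: "sw (\<lambda>a b. 0) x = 0"
  by (simp add: sw_def)

lemma sw_sum: "sw (\<lambda>a b. \<Sum>i\<in>I. F i a b) x = (\<Sum>i\<in>I. sw (F i) x)"
  by (induction I rule: infinite_finite_induct) (simp_all add: sw_plus sw_zero)

lemmas sw_inner = sw_plus sw_smult sw_minus sw_uminus sw_zero sw_sum

lemma lmap_of_sw: "lmap f \<Longrightarrow> f (sw F x) = sw (\<lambda>a b. f (F a b)) x"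
  by (simp add: sw_def lmap_simps)

lemma lform_of_sw: "lform f \<Longrightarrow> f (sw F x) = swk (\<lambda>a b. f (F a b)) x"
  by (simp add: sw_def swk_def lform_simps)

lemma sum_swap4:
  "(\<Sum>a\<in>A. \<Sum>b\<in>A. \<Sum>c\<in>C. \<Sum>d\<in>C. f a b c d) = (\<Sum>c\<in>C. \<Sum>d\<in>C. \<Sum>a\<in>A. \<Sum>b\<in>A. f a b c d)"
proof -
  have "(\<Sum>a\<in>A. \<Sum>b\<in>A. \<Sum>c\<in>C. \<Sum>d\<in>C. f a b c d) = (\<Sum>a\<in>A. \<Sum>c\<in>C. \<Sum>b\<in>A. \<Sum>d\<in>C. f a b c d)"
    by (intro sum.cong refl) (rule sum.swap)
  also have "\<dots> = (\<Sum>c\<in>C. \<Sum>a\<in>A. \<Sum>d\<in>C. \<Sum>b\<in>A. f a b c d)"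
    by (subst sum.swap, intro sum.cong refl) (rule sum.swap)
  also have "\<dots> = (\<Sum>c\<in>C. \<Sum>d\<in>C. \<Sum>a\<in>A. \<Sum>b\<in>A. f a b c d)"
    by (intro sum.cong refl) (rule sum.swap)
  finally show ?thesis .
qed

lemma sw_swap: "sw (\<lambda>a b. sw (\<lambda>c d. F a b c d) y) x = sw (\<lambda>c d. sw (\<lambda>a b. F a b c d) x) y"
  unfolding sw_def by (simp add: scale_sum_right mult.commute, rule sum_swap4)

text \<open>
  Coassociativity in the form in which it is used: nested Sweedler sums can be regrouped.
  The left side reads \<open>F(x\<^sub>1\<^sub>1, x\<^sub>1\<^sub>2, x\<^sub>2)\<close>, the right side \<open>F(x\<^sub>1, x\<^sub>2\<^sub>1, x\<^sub>2\<^sub>2)\<close>.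
\<close>

lemma sw_coassoc:
  "sw (\<lambda>a b. sw (\<lambda>c d. F c d b) a) x = sw (\<lambda>a b. sw (\<lambda>c d. F a c d) b) x"
proof -
  have "sw (\<lambda>a b. sw (\<lambda>c d. F c d b) a) x
    = (\<Sum>e\<in>B. \<Sum>d\<in>B. \<Sum>b\<in>B. \<Sum>c\<in>B. (dl x e d * dl e b c) *s F b c d)"
    by (simp add: sw_def scale_sum_right)
  also have "\<dots> = (\<Sum>b\<in>B. \<Sum>c\<in>B. \<Sum>e\<in>B. \<Sum>d\<in>B. (dl x e d * dl e b c) *s F b c d)"
    by (rule sum_swap4)
  also have "\<dots> = (\<Sum>b\<in>B. \<Sum>c\<in>B. \<Sum>d\<in>B. \<Sum>e\<in>B. (dl x e d * dl e b c) *s F b c d)"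
    by (rule sum.cong[OF refl], rule sum.cong[OF refl], rule sum.swap)
  also have "\<dots> = (\<Sum>b\<in>B. \<Sum>c\<in>B. \<Sum>d\<in>B. \<Sum>e\<in>B. (dl x b e * dl e c d) *s F b c d)"
    by (rule sum.cong[OF refl], rule sum.cong[OF refl], rule sum.cong[OF refl])
      (simp add: scale_sum_left[symmetric] coassoc_dl)
  also have "\<dots> = (\<Sum>b\<in>B. \<Sum>e\<in>B. \<Sum>c\<in>B. \<Sum>d\<in>B. (dl x b e * dl e c d) *s F b c d)"
  proof (rule sum.cong[OF refl])
    fix b
    have "(\<Sum>c\<in>B. \<Sum>d\<in>B. \<Sum>e\<in>B. (dl x b e * dl e c d) *s F b c d)
      = (\<Sum>c\<in>B. \<Sum>e\<in>B. \<Sum>d\<in>B. (dl x b e * dl e c d) *s F b c d)"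
      by (rule sum.cong[OF refl], rule sum.swap)
    also have "\<dots> = (\<Sum>e\<in>B. \<Sum>c\<in>B. \<Sum>d\<in>B. (dl x b e * dl e c d) *s F b c d)"
      by (rule sum.swap)
    finally show "(\<Sum>c\<in>B. \<Sum>d\<in>B. \<Sum>e\<in>B. (dl x b e * dl e c d) *s F b c d)
      = (\<Sum>e\<in>B. \<Sum>c\<in>B. \<Sum>d\<in>B. (dl x b e * dl e c d) *s F b c d)" .
  qed
  also have "\<dots> = sw (\<lambda>a b. sw (\<lambda>c d. F a c d) b) x"
    by (simp add: sw_def scale_sum_right)
  finally show ?thesis .
qed

lemma sw_counit_l: "x \<in> V \<Longrightarrow> lmap f \<Longrightarrow> sw (\<lambda>a b. eps a *s f b) x = f x"
  using lmap_of_sw[of f "\<lambda>a b. eps a *s b" x] counit_l_dl[of x, folded sw_def]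
  by (simp add: lmap_scale)

lemma sw_counit_r: "x \<in> V \<Longrightarrow> lmap f \<Longrightarrow> sw (\<lambda>a b. eps b *s f a) x = f x"
  using lmap_of_sw[of f "\<lambda>a b. eps b *s a" x] counit_r_dl[of x, folded sw_def]
  by (simp add: lmap_scale)

lemma sw_in_subspace: "subspace W \<Longrightarrow> (\<And>a b. a \<in> V \<Longrightarrow> b \<in> V \<Longrightarrow> F a b \<in> W) \<Longrightarrow> sw F x \<in> W"
  unfolding sw_def by (intro subspace_sum subspace_scale) (auto simp: B_V)

lemma sw_V: "(\<And>a b. a \<in> V \<Longrightarrow> b \<in> V \<Longrightarrow> F a b \<in> V) \<Longrightarrow> sw F x \<in> V"
  by (rule sw_in_subspace) simp_all

end

text \<open>
  The compatibility of \<open>\<Delta>\<close> with products is stated for all bilinear \<open>F\<close>, which replaces the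
  product on \<open>V \<otimes> V\<close>.
\<close>

locale fd_hopf = fd_coalgebra scale V B dl eps
  for scale :: "'k::field \<Rightarrow> 'v::ab_group_add \<Rightarrow> 'v" (infixr "*s" 75) and V B dl eps +
  fixes mul :: "'v \<Rightarrow> 'v \<Rightarrow> 'v" (infixl "\<star>" 77) and e1 :: 'v and S :: "'v \<Rightarrow> 'v"
  assumes mul_bil: "bil (\<star>)"
    and mul_V [simp]: "x \<star> y \<in> V"
    and mul_assoc: "(x \<star> y) \<star> z = x \<star> (y \<star> z)"
    and e1_V [simp]: "e1 \<in> V"
    and e1_l [simp]: "x \<in> V \<Longrightarrow> e1 \<star> x = x"
    and e1_r [simp]: "x \<in> V \<Longrightarrow> x \<star> e1 = x"
    and comult_mul: "bil F \<Longrightarrow> sw F (x \<star> y) = sw (\<lambda>a b. sw (\<lambda>c d. F (a \<star> c) (b \<star> d)) y) x"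
    and comult_e1: "bil F \<Longrightarrow> sw F e1 = F e1 e1"
    and eps_mul [simp]: "eps (x \<star> y) = eps x * eps y"
    and eps_e1 [simp]: "eps e1 = 1"
    and S_map: "lmap S"
    and S_V [simp]: "S x \<in> V"
    and S_l: "sw (\<lambda>a b. S a \<star> b) x = eps x *s e1"
    and S_r: "sw (\<lambda>a b. a \<star> S b) x = eps x *s e1"
begin

lemmas mul_simps [simp] = bil_simps[OF mul_bil]
lemmas S_simps [simp] = lmap_simps[OF S_map]
lemmas eps_simps [simp] = lform_simps[OF eps_form]

lemma mul_lmap [simp]: "lmap (\<lambda>x. a \<star> x)" "lmap (\<lambda>x. x \<star> a)" by (simp_all add: lmap_def)

lemma S_e1: "S e1 = e1"
proof -
  have "bil (\<lambda>a b. S a \<star> b)" by (simp add: bil_def lmap_def)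
  then have "sw (\<lambda>a b. S a \<star> b) e1 = S e1 \<star> e1" by (rule comult_e1)
  then show ?thesis using S_l[of e1] by simp
qed

text \<open>Both sides are the convolution inverse of the multiplication.\<close>

lemma S_anti_mul:
  assumes "x \<in> V" "y \<in> V"
  shows "S (x \<star> y) = S y \<star> S x"
proof -
  \<comment> \<open>With Sweedler factors \<open>a, a', a''\<close> of \<open>x\<close> and \<open>b, b', b''\<close> of \<open>y\<close>, this collapses to \<open>S(x \<star> y)\<close> from the right and to \<open>S y \<star> S x\<close> from the left.\<close>
  define G where "G a b a' b' b'' a'' = S (a \<star> b) \<star> (a' \<star> (b' \<star> (S b'' \<star> S a'')))" for a b a' b' b'' a''
  have r: "sw (\<lambda>b b'. a \<star> (b \<star> (S b' \<star> c))) y = eps y *s (a \<star> c)" if "c \<in> V" for a c y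
  proof -
    have "sw (\<lambda>b b'. a \<star> (b \<star> (S b' \<star> c))) y = a \<star> (sw (\<lambda>b b'. b \<star> S b') y \<star> c)"
      by (simp add: lmap_of_sw[of "\<lambda>x. a \<star> (x \<star> c)"] lmap_def mul_assoc)
    then show ?thesis using that by (simp add: S_r)
  qed
  have l: "sw (\<lambda>a a'. sw (\<lambda>b b'. S (a \<star> b) \<star> (a' \<star> (b' \<star> c))) y) x = eps x *s eps y *s c"
    if "c \<in> V" for c x y
  proof -
    have "sw (\<lambda>a a'. sw (\<lambda>b b'. S (a \<star> b) \<star> (a' \<star> b')) y) x = sw (\<lambda>a b. S a \<star> b) (x \<star> y)"
      by (rule comult_mul[symmetric]) (simp add: bil_def lmap_def)
    then have "sw (\<lambda>a a'. sw (\<lambda>b b'. S (a \<star> b) \<star> (a' \<star> b')) y) x \<star> c = (eps x * eps y) *s c"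
      using that by (simp add: S_l)
    then show ?thesis
      by (simp add: lmap_of_sw[of "\<lambda>z. z \<star> c"] mul_assoc)
  qed
  have "sw (\<lambda>a a1. sw (\<lambda>b b1. sw (\<lambda>a' a''. sw (\<lambda>b' b''. G a b a' b' b'' a'') b1) a1) y) x
    = sw (\<lambda>a a1. sw (\<lambda>a' a''. sw (\<lambda>b b1. sw (\<lambda>b' b''. G a b a' b' b'' a'') b1) y) a1) x"
    by (subst sw_swap) simp
  also have "\<dots> = sw (\<lambda>a1 a''. sw (\<lambda>a a'. sw (\<lambda>b b1. sw (\<lambda>b' b''. G a b a' b' b'' a'') b1) y) a1) x"
    by (rule sw_coassoc[symmetric])
  also have "\<dots> = sw (\<lambda>a1 a''. sw (\<lambda>a a'. sw (\<lambda>b1 b''. sw (\<lambda>b b'. G a b a' b' b'' a'') b1) y) a1) x"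
    by (subst (2) sw_coassoc) simp
  also have "\<dots> = sw (\<lambda>a1 a''. sw (\<lambda>b1 b''. sw (\<lambda>a a'. sw (\<lambda>b b'. G a b a' b' b'' a'') b1) a1) y) x"
    by (subst sw_swap) simp
  also have "\<dots> = sw (\<lambda>a1 a''. sw (\<lambda>b1 b''. eps a1 *s eps b1 *s (S b'' \<star> S a'')) y) x"
    unfolding G_def by (simp add: l)
  also have "\<dots> = sw (\<lambda>a1 a''. eps a1 *s (S y \<star> S a'')) x"
    by (simp add: sw_smult sw_counit_l[of _ "\<lambda>z. S z \<star> c" for c] lmap_def assms del: scale_scale)
  also have "\<dots> = S y \<star> S x"
    by (simp add: sw_counit_l[of _ "\<lambda>z. S y \<star> S z"] lmap_def assms)
  finally have 1: "sw (\<lambda>a a1. sw (\<lambda>b b1. sw (\<lambda>a' a''. sw (\<lambda>b' b''. G a b a' b' b'' a'') b1) a1) y) x = S y \<star> S x" .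
  have "sw (\<lambda>a' a''. sw (\<lambda>b' b''. G a b a' b' b'' a'') b1) a1 = eps b1 *s eps a1 *s S (a \<star> b)" for a b a1 b1
  proof -
    have "sw (\<lambda>a' a''. sw (\<lambda>b' b''. G a b a' b' b'' a'') b1) a1
      = S (a \<star> b) \<star> sw (\<lambda>a' a''. sw (\<lambda>b' b''. a' \<star> (b' \<star> (S b'' \<star> S a''))) b1) a1"
      unfolding G_def by (simp add: lmap_of_sw[of "\<lambda>z. S (a \<star> b) \<star> z"])
    then show ?thesis by (simp add: r sw_smult S_r)
  qed
  then have "S y \<star> S x = sw (\<lambda>a a1. sw (\<lambda>b b1. eps b1 *s eps a1 *s S (a \<star> b)) y) x"
    using 1 by simp
  also have "\<dots> = sw (\<lambda>a a1. eps a1 *s S (a \<star> y)) x"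
  proof -
    have "sw (\<lambda>b b1. eps b1 *s eps a1 *s S (a \<star> b)) y = eps a1 *s S (a \<star> y)" for a a1
      by (rule sw_counit_r) (auto simp: lmap_def assms scale_right_distrib mult.commute)
    then show ?thesis by (simp del: scale_scale)
  qed
  also have "\<dots> = S (x \<star> y)"
    by (simp add: sw_counit_r[of _ "\<lambda>z. S (z \<star> y)"] lmap_def assms)
  finally show ?thesis by simp
qed

end


section \<open>Coideals and group-like elements\<close>

context fd_coalgebra begin

text \<open>
  The ambient type may be infinite-dimensional, so that dimension arguments have to stay inside \<open>V\<close>.
\<close>

lemma finite_basis:
  assumes "subspace W" "W \<subseteq> V"
  obtains E where "finite E" "independent E" "span E = W" "card E = dim W" "E \<subseteq> W"
proof -
  obtain E where E: "E \<subseteq> W" "independent E" "W \<subseteq> span E" "card E = dim W"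
    using basis_exists by metis
  then have "span E = W" using assms(1) span_minimal by blast
  moreover have "finite E"
    using independent_span_bound[OF finB E(2)] E(1) assms(2) V_span by auto
  ultimately show ?thesis using that E by blast
qed

lemma dim_span_insert:
  assumes "subspace W" "W \<subseteq> V" "x \<in> V" "x \<notin> W"
  shows "dim (span (insert x W)) = Suc (dim W)"
proof -
  obtain E where E: "finite E" "independent E" "span E = W" "card E = dim W" "E \<subseteq> W"
    using finite_basis[OF assms(1,2)] .
  have "independent (insert x E)" using E assms(4) independent_insertI by blast
  moreover have "span (insert x W) = span (insert x E)"
    using E(3) span_insert by (metis span_span)
  ultimately have "dim (span (insert x W)) = card (insert x E)"
    using dim_span_eq_card_independent by metis
  moreover have "x \<notin> E" using E assms(4) by blast
  ultimately show ?thesis using E by simp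
qed

lemma dim_mono_V:
  assumes "W \<subseteq> W'" "subspace W'" "subspace W" "W' \<subseteq> V"
  shows "dim W \<le> dim W'"
proof -
  obtain E where E: "finite E" "independent E" "span E = W'" "card E = dim W'" "E \<subseteq> W'"
    using finite_basis[OF assms(2,4)] .
  show ?thesis using dim_le_card[of W E] E assms by auto
qed

lemma dim_strict_mono_V:
  assumes "W \<subset> W'" "subspace W'" "subspace W" "W' \<subseteq> V"
  shows "dim W < dim W'"
proof -
  obtain x where x: "x \<in> W'" "x \<notin> W" using assms(1) by blast
  have "W \<subseteq> V" "x \<in> V" using x assms by auto
  have "span (insert x W) \<subseteq> W'" using x assms by (intro span_minimal) auto
  then have "dim (span (insert x W)) \<le> dim W'"
    using assms by (intro dim_mono_V) auto
  then show ?thesis using dim_span_insert[OF assms(3) \<open>W \<subseteq> V\<close> \<open>x \<in> V\<close> x(2)] by simp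
qed

lemma dim_V: "dim V = card B"
  using indepB by (simp add: V_span dim_eq_card_independent)

lemma eq_V_if_dim: "subspace W \<Longrightarrow> W \<subseteq> V \<Longrightarrow> card B \<le> dim W \<Longrightarrow> W = V"
  using dim_strict_mono_V[of W V] dim_V by (cases "W = V") auto

text \<open>
  The two actions of the dual algebra: \<open>R \<alpha> x = x\<^sub>1 \<alpha>(x\<^sub>2)\<close> and \<open>L \<alpha> x = \<alpha>(x\<^sub>1) x\<^sub>2\<close>. They commute, they
  are adjoint to each other (\<open>form_R_L\<close>), and knowing \<open>R \<alpha> x\<close> for all forms \<open>\<alpha>\<close> amounts to knowing
  \<open>\<Delta> x\<close> (\<open>sw_via_R\<close>).
\<close>

definition R :: "('v \<Rightarrow> 'k) \<Rightarrow> 'v \<Rightarrow> 'v" where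
  "R \<alpha> x = sw (\<lambda>a b. \<alpha> b *s a) x"

definition L :: "('v \<Rightarrow> 'k) \<Rightarrow> 'v \<Rightarrow> 'v" where
  "L \<alpha> x = sw (\<lambda>a b. \<alpha> a *s b) x"

lemma R_simps [simp]: "R \<alpha> (x + y) = R \<alpha> x + R \<alpha> y" "R \<alpha> (c *s x) = c *s R \<alpha> x" "R \<alpha> 0 = 0"
    "R \<alpha> (x - y) = R \<alpha> x - R \<alpha> y" "R \<alpha> (- x) = - R \<alpha> x" "R \<alpha> (sum h I) = (\<Sum>i\<in>I. R \<alpha> (h i))"
  and L_simps [simp]: "L \<alpha> (x + y) = L \<alpha> x + L \<alpha> y" "L \<alpha> (c *s x) = c *s L \<alpha> x" "L \<alpha> 0 = 0"
    "L \<alpha> (x - y) = L \<alpha> x - L \<alpha> y" "L \<alpha> (- x) = - L \<alpha> x" "L \<alpha> (sum h I) = (\<Sum>i\<in>I. L \<alpha> (h i))"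
  by (simp_all add: R_def L_def)

lemma R_V [simp]: "R \<alpha> x \<in> V" and L_V [simp]: "L \<alpha> x \<in> V"
  by (simp_all add: R_def L_def sw_V)

lemma R_lmap: "lmap (R \<alpha>)" and L_lmap: "lmap (L \<alpha>)" by (simp_all add: lmap_def)

lemma R_form: "R (\<lambda>z. \<alpha> z + \<beta> z) x = R \<alpha> x + R \<beta> x" "R (\<lambda>z. \<alpha> z - \<beta> z) x = R \<alpha> x - R \<beta> x"
    "R (\<lambda>z. c * \<alpha> z) x = c *s R \<alpha> x" "R (\<lambda>z. \<Sum>i\<in>I. f i z) x = (\<Sum>i\<in>I. R (f i) x)"
    "R (\<lambda>z. \<alpha> z * c) x = c *s R \<alpha> x"
  by (simp_all add: R_def scale_left_distrib scale_left_diff_distrib scale_sum_left sw_plus sw_minus sw_sum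
      sw_smult[symmetric] mult.commute)

lemma L_form: "L (\<lambda>z. \<alpha> z + \<beta> z) x = L \<alpha> x + L \<beta> x" "L (\<lambda>z. \<alpha> z - \<beta> z) x = L \<alpha> x - L \<beta> x"
    "L (\<lambda>z. c * \<alpha> z) x = c *s L \<alpha> x" "L (\<lambda>z. \<Sum>i\<in>I. f i z) x = (\<Sum>i\<in>I. L (f i) x)"
    "L (\<lambda>z. \<alpha> z * c) x = c *s L \<alpha> x"
  by (simp_all add: L_def scale_left_distrib scale_left_diff_distrib scale_sum_left sw_plus sw_minus sw_sum
      sw_smult[symmetric] mult.commute)

lemma form_R: "lform \<alpha> \<Longrightarrow> \<alpha> (R \<beta> x) = swk (\<lambda>a b. \<alpha> a * \<beta> b) x"
  by (simp add: R_def lform_of_sw lform_simps mult.commute)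

lemma form_L: "lform \<beta> \<Longrightarrow> \<beta> (L \<alpha> x) = swk (\<lambda>a b. \<alpha> a * \<beta> b) x"
  by (simp add: L_def lform_of_sw lform_simps)

lemma form_R_L: "lform \<alpha> \<Longrightarrow> lform \<beta> \<Longrightarrow> \<alpha> (R \<beta> x) = \<beta> (L \<alpha> x)"
  by (simp add: form_R form_L)

lemma lform_R [simp]: "lform \<alpha> \<Longrightarrow> lform (\<lambda>z. \<alpha> (R \<beta> z))"
  and lform_L [simp]: "lform \<alpha> \<Longrightarrow> lform (\<lambda>z. \<alpha> (L \<beta> z))"
  by (simp_all add: lform_def)

lemma sw_swk: "sw (\<lambda>a b. k a b *s v) x = swk k x *s v"
  by (simp add: sw_def swk_def scale_sum_left)

lemma R_R: "lform \<alpha> \<Longrightarrow> R \<alpha> (R \<beta> x) = R (\<lambda>z. \<alpha> (R \<beta> z)) x"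
proof -
  assume a: "lform \<alpha>"
  have "R \<alpha> (R \<beta> x) = sw (\<lambda>a b. sw (\<lambda>c d. (\<alpha> d * \<beta> b) *s c) a) x"
    by (simp add: R_def[of \<beta>] lmap_of_sw[OF R_lmap]) (simp add: R_def sw_smult[symmetric] mult.commute)
  also have "\<dots> = sw (\<lambda>a b. sw (\<lambda>c d. (\<alpha> c * \<beta> d) *s a) b) x" by (rule sw_coassoc)
  also have "\<dots> = R (\<lambda>z. \<alpha> (R \<beta> z)) x"
    by (simp add: sw_swk form_R[OF a]) (simp add: R_def)
  finally show ?thesis .
qed

lemma L_L: "lform \<alpha> \<Longrightarrow> L \<alpha> (L \<beta> x) = L (\<lambda>z. \<alpha> (L \<beta> z)) x"
proof -
  assume a: "lform \<alpha>"
  have "L \<alpha> (L \<beta> x) = sw (\<lambda>a b. sw (\<lambda>c d. (\<beta> a * \<alpha> c) *s d) b) x"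
    by (simp add: L_def[of \<beta>] lmap_of_sw[OF L_lmap]) (simp add: L_def sw_smult[symmetric])
  also have "\<dots> = sw (\<lambda>a b. sw (\<lambda>c d. (\<beta> c * \<alpha> d) *s b) a) x" by (rule sw_coassoc[symmetric])
  also have "\<dots> = L (\<lambda>z. \<alpha> (L \<beta> z)) x"
    by (simp add: sw_swk form_L[OF a]) (simp add: L_def)
  finally show ?thesis .
qed

lemma L_R: "L \<alpha> (R \<beta> x) = R \<beta> (L \<alpha> x)"
proof -
  have "L \<alpha> (R \<beta> x) = sw (\<lambda>a b. sw (\<lambda>c d. (\<alpha> c * \<beta> b) *s d) a) x"
    by (simp add: R_def lmap_of_sw[OF L_lmap]) (simp add: L_def sw_smult[symmetric] mult.commute)
  also have "\<dots> = sw (\<lambda>a b. sw (\<lambda>c d. (\<alpha> a * \<beta> d) *s c) b) x" by (rule sw_coassoc)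
  also have "\<dots> = R \<beta> (L \<alpha> x)"
    by (simp add: L_def lmap_of_sw[OF R_lmap]) (simp add: R_def sw_smult[symmetric])
  finally show ?thesis .
qed

lemma R_eps [simp]: "x \<in> V \<Longrightarrow> R eps x = x" and L_eps [simp]: "x \<in> V \<Longrightarrow> L eps x = x"
  using sw_counit_r[of x "\<lambda>x. x"] sw_counit_l[of x "\<lambda>x. x"] by (auto simp: R_def L_def lmap_def)

lemma sw_via_R:
  assumes F: "bil F"
  shows "sw F x = (\<Sum>c\<in>B. F (R (dual B c) x) c)"
proof -
  have "sw F x = sw (\<lambda>a b. \<Sum>c\<in>B. dual B c b *s F a c) x"
  proof (rule sw_cong)
    fix a b assume "b \<in> V"
    then have "F a b = F a (\<Sum>c\<in>B. dual B c b *s c)"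
      using dual_expand[OF indepB finB] V_span by simp
    then show "F a b = (\<Sum>c\<in>B. dual B c b *s F a c)" by (simp add: bil_simps[OF F])
  qed simp
  also have "\<dots> = (\<Sum>c\<in>B. F (R (dual B c) x) c)"
  proof (simp add: sw_sum, rule sum.cong[OF refl])
    fix c
    have "lmap (\<lambda>x. F x c)" using F by (auto simp: bil_def)
    from lmap_of_sw[OF this] show "sw (\<lambda>a b. dual B c b *s F a c) x = F (R (dual B c) x) c"
      by (simp add: R_def bil_simps[OF F])
  qed
  finally show ?thesis .
qed

text \<open>
  The condition on \<open>R\<close> says \<open>\<Delta> g = g \<otimes> g\<close>.
\<close>

definition glike :: "'v \<Rightarrow> bool" where
  "glike g \<longleftrightarrow> g \<in> V \<and> eps g = 1 \<and> (\<forall>\<alpha>. lform \<alpha> \<longrightarrow> R \<alpha> g = \<alpha> g *s g)"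

lemma glikeD: "glike g \<Longrightarrow> g \<in> V" "glike g \<Longrightarrow> eps g = 1" "glike g \<Longrightarrow> lform \<alpha> \<Longrightarrow> R \<alpha> g = \<alpha> g *s g"
  by (auto simp: glike_def)

lemma glike_nz: "glike g \<Longrightarrow> g \<noteq> 0"
  using lform_0[OF eps_form] by (auto simp: glike_def)

text \<open>The element \<open>x\<close> is \<open>(g, h)\<close>-primitive: \<open>\<Delta> x = x \<otimes> g + h \<otimes> x\<close>.\<close>

definition skew :: "'v \<Rightarrow> 'v \<Rightarrow> 'v \<Rightarrow> bool" where
  "skew h g x \<longleftrightarrow> x \<in> V \<and> (\<forall>\<alpha>. lform \<alpha> \<longrightarrow> R \<alpha> x = \<alpha> g *s x + \<alpha> x *s h)"

lemma glike_sw: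
  assumes "glike g" "bil F" shows "sw F g = F g g"
proof -
  have "sw F g = F g (\<Sum>c\<in>B. dual B c g *s c)"
    using sw_via_R[OF assms(2), of g] glikeD(3)[OF assms(1)] dual(1)[OF indepB]
    by (simp add: bil_simps[OF assms(2)])
  then show ?thesis using dual_expand[OF indepB finB, of g] glikeD(1)[OF assms(1)] V_span by simp
qed

lemma skew_sw:
  assumes "skew h g x" "bil F" "g \<in> V" shows "sw F x = F x g + F h x"
proof -
  have "sw F x = F x (\<Sum>c\<in>B. dual B c g *s c) + F h (\<Sum>c\<in>B. dual B c x *s c)"
    using sw_via_R[OF assms(2), of x] assms(1) dual(1)[OF indepB]
    by (simp add: bil_simps[OF assms(2)] skew_def sum.distrib)
  moreover have "x \<in> V" "g \<in> V" using assms by (auto simp: skew_def)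
  then have "x \<in> span B" "g \<in> span B" using V_span by simp_all
  ultimately show ?thesis using dual_expand[OF indepB finB, of x] dual_expand[OF indepB finB, of g] by simp
qed

text \<open>
  These are the right coideals, \<open>\<Delta> W \<subseteq> W \<otimes> V\<close>.
\<close>

definition Rstable :: "'v set \<Rightarrow> bool" where
  "Rstable W \<longleftrightarrow> subspace W \<and> W \<subseteq> V \<and> (\<forall>\<alpha> x. lform \<alpha> \<longrightarrow> x \<in> W \<longrightarrow> R \<alpha> x \<in> W)"

text \<open>
  Stability under both actions describes subcoalgebras. Every nonzero one contains a simple one, so
  asking for a group-like in each of them is pointedness.
\<close>

definition pointed_coalg :: bool where
  "pointed_coalg \<longleftrightarrow> (\<forall>C. Rstable C \<longrightarrow> (\<forall>\<alpha> x. lform \<alpha> \<longrightarrow> x \<in> C \<longrightarrow> L \<alpha> x \<in> C) \<longrightarrow> C \<noteq> {0} \<longrightarrow>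
     (\<exists>g\<in>C. glike g))"

lemma RstableD: "Rstable W \<Longrightarrow> subspace W" "Rstable W \<Longrightarrow> W \<subseteq> V"
    "Rstable W \<Longrightarrow> lform \<alpha> \<Longrightarrow> x \<in> W \<Longrightarrow> R \<alpha> x \<in> W"
  by (auto simp: Rstable_def)

lemma Rstable_V: "Rstable V" by (simp add: Rstable_def)

text \<open>
  Choose a right coideal \<open>W\<close> minimal over \<open>W0\<close>. The coefficients of \<open>W / W0\<close> span a subcoalgebra, which
  contains a group-like \<open>g\<close>, so a form annihilating \<open>W / W0\<close> vanishes at \<open>g\<close>. Some finite set \<open>F\<close> and element
  \<open>m\<close> mark the place where the annihilator of a growing set of vectors starts to vanish at \<open>g\<close>. If \<open>a\<close>
  annihilates \<open>F\<close> and \<open>a g \<noteq> 0\<close>, then \<open>R a m\<close> has weight \<open>g\<close> by minimality of \<open>W\<close>. In terms of comodules,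
  it spans a one-dimensional subcomodule of \<open>V / W0\<close>.
\<close>

lemma pointed_quotient:
  assumes P: "pointed_coalg" and W0: "Rstable W0" "W0 \<noteq> V"
  obtains x g where "x \<in> V" "x \<notin> W0" "glike g" "\<And>\<alpha>. lform \<alpha> \<Longrightarrow> R \<alpha> x - \<alpha> g *s x \<in> W0"
proof -
  note s0 = RstableD(1)[OF W0(1)]
  have "Rstable V \<and> W0 \<subset> V" using W0 RstableD(2) Rstable_V by blast
  then obtain W where W: "Rstable W" "W0 \<subset> W"
    and Wmin: "\<And>W'. Rstable W' \<and> W0 \<subset> W' \<Longrightarrow> dim W \<le> dim W'"
    using ex_has_least_nat[of "\<lambda>W. Rstable W \<and> W0 \<subset> W" V dim] by blast
  have Wmin': "W' = W" if "Rstable W'" "W0 \<subset> W'" "W' \<subseteq> W" for W'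
    using Wmin[of W'] dim_strict_mono_V[of W' W] that W RstableD[of W] RstableD[of W'] by fastforce
  note sW = RstableD(1)[OF W(1)]
  \<comment> \<open>The coefficients of the comodule \<open>W / W0\<close>, and their span \<open>C\<close>.\<close>
  define T where "T = {L \<tau> w | \<tau> w. lform \<tau> \<and> (\<forall>v\<in>W0. \<tau> v = 0) \<and> w \<in> W}"
  define C where "C = span T"
  have TV: "T \<subseteq> V" by (auto simp: T_def)
  have lin_stable: "f x \<in> C" if "lmap f" "\<And>t. t \<in> T \<Longrightarrow> f t \<in> T" "x \<in> C" for f x
    using that(3) unfolding C_def
    by (induction rule: span_induct_alt) (auto simp: lmap_simps[OF that(1)] span_zero span_add span_scale span_base that(2))
  have RT: "R \<alpha> t \<in> T" if "lform \<alpha>" "t \<in> T" for \<alpha> t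
    using that W(1) unfolding T_def by (auto simp: L_R[symmetric] Rstable_def) blast
  have LT: "L \<alpha> t \<in> T" if a: "lform \<alpha>" and tT: "t \<in> T" for \<alpha> t
  proof -
    obtain \<tau> w where t: "t = L \<tau> w" "lform \<tau>" "\<forall>v\<in>W0. \<tau> v = 0" "w \<in> W" using tT unfolding T_def by blast
    have "L \<alpha> t = L (\<lambda>z. \<alpha> (L \<tau> z)) w" by (simp add: t L_L[OF a])
    moreover have "\<forall>v\<in>W0. \<alpha> (L \<tau> v) = 0"
      using t(3) RstableD(3)[OF W0(1) a] by (simp add: form_R_L[OF t(2) a, symmetric])
    ultimately show ?thesis using t(4) lform_L[OF a, of \<tau>] unfolding T_def by blast
  qed
  have "Rstable C"
    unfolding Rstable_def using span_minimal[OF TV] lin_stable[OF R_lmap RT] by (auto simp: C_def)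
  moreover have "\<forall>\<alpha> x. lform \<alpha> \<longrightarrow> x \<in> C \<longrightarrow> L \<alpha> x \<in> C" using lin_stable[OF L_lmap LT] by blast
  moreover have "C \<noteq> {0}"
  proof -
    obtain w where w: "w \<in> W" "w \<notin> W0" using W(2) by blast
    obtain \<tau> where t: "lform \<tau>" "\<And>v. v \<in> W0 \<Longrightarrow> \<tau> v = 0" "\<tau> w = 1" using separating_form[OF s0 w(2)] by blast
    have "L \<tau> w \<in> C" using w t by (auto simp: C_def T_def intro!: span_base)
    moreover have "eps (L \<tau> w) = 1"
      using form_R_L[OF t(1) eps_form, of w] t w RstableD(2)[OF W(1)] by auto
    ultimately show ?thesis using lform_0[OF eps_form] by auto
  qed
  ultimately obtain g where g: "g \<in> C" "glike g" using P unfolding pointed_coalg_def by blast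
  have ann: "a g = 0" if a: "lform a" "\<And>w. w \<in> W \<Longrightarrow> R a w \<in> W0" for a
  proof -
    have aT: "a t = 0" if "t \<in> T" for t
    proof -
      obtain \<tau> w where t: "t = L \<tau> w" "lform \<tau>" "\<forall>v\<in>W0. \<tau> v = 0" "w \<in> W" using \<open>t \<in> T\<close> unfolding T_def by blast
      then show ?thesis using form_R_L[OF t(2) a(1), of w] a(2) by simp
    qed
    show ?thesis using g(1) unfolding C_def
      by (induction rule: span_induct_alt) (auto simp: lform_simps[OF a(1)] aT)
  qed
  \<comment> \<open>Annihilators in the dual algebra; they are stable under \<open>b \<mapsto> \<alpha> \<circ> R b\<close>.\<close>
  define K where "K F = {a. lform a \<and> (\<forall>m\<in>F. R a m \<in> W0)}" for F
  obtain E where E: "finite E" "span E = W" "E \<subseteq> W"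
    using finite_basis[OF sW RstableD(2)[OF W(1)]] by metis
  have KE: "\<forall>a\<in>K E. a g = 0"
  proof
    fix a assume a: "a \<in> K E"
    have "R a w \<in> W0" if "w \<in> W" for w
      using that E(2)[symmetric] unfolding \<open>W = span E\<close>
    proof (induction rule: span_induct_alt)
      case base then show ?case using s0 subspace_0 by simp
    next
      case (step c x y)
      then show ?case using a s0 by (simp add: K_def subspace_add subspace_scale)
    qed
    then show "a g = 0" using a ann by (simp add: K_def)
  qed
  have "\<exists>F m. F \<subseteq> W \<and> m \<in> W \<and> (\<forall>a\<in>K (insert m F). a g = 0) \<and> (\<exists>a\<in>K F. a g \<noteq> 0)"
    using E(1,3) KE
  proof (induction E rule: finite_induct)
    case empty
    have "eps \<in> K {}" by (simp add: K_def eps_form)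
    then show ?case using empty glikeD(2)[OF g(2)] by force
  next
    case (insert m F)
    then show ?case by (cases "\<forall>a\<in>K F. a g = 0") auto
  qed
  then obtain F m a where F: "F \<subseteq> W" "m \<in> W" "\<And>a. a \<in> K (insert m F) \<Longrightarrow> a g = 0"
    and a: "a \<in> K F" "a g \<noteq> 0" by blast
  have conv_K: "(\<lambda>z. \<alpha> (R b z)) \<in> K F" if "lform \<alpha>" "b \<in> K F" for \<alpha> b
    using that RstableD(3)[OF W0(1) that(1)] by (auto simp: K_def R_R[OF that(1), symmetric])
  have diff_K: "(\<lambda>z. b z - b' z) \<in> K F" if "b \<in> K F" "b' \<in> K F" for b b'
    using that s0 by (auto simp: K_def R_form subspace_diff lform_def algebra_simps)
  have scale_K: "(\<lambda>z. c * b z) \<in> K F" if "b \<in> K F" for b c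
    using that s0 by (auto simp: K_def R_form subspace_scale lform_def algebra_simps)
  have add_K: "(\<lambda>z. b z + b' z) \<in> K F" if "b \<in> K F" "b' \<in> K F" for b b'
    using that s0 by (auto simp: K_def R_form subspace_add lform_def algebra_simps)
  have conv_g: "\<alpha> (R b g) = \<alpha> g * b g" if "lform \<alpha>" "b \<in> K F" for \<alpha> b
    using that glikeD(3)[OF g(2), of b] by (simp add: K_def lform_simps)
  define W1 where "W1 = {R b m + v | b v. b \<in> K F \<and> b g = 0 \<and> v \<in> W0}"
  have zK: "(\<lambda>z. 0) \<in> K F" using s0 subspace_0[OF s0] R_form(3)[of 0 "\<lambda>z. 0"] by (simp add: K_def lform_def)
  have R0: "R (\<lambda>z. 0) x = 0" for x using R_form(3)[of 0 "\<lambda>z. 0" x] by simp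
  have W1W0: "W0 \<subseteq> W1" unfolding W1_def using zK R0 by force
  have W1I: "R b m \<in> W1" if "b \<in> K F" "b g = 0" for b
  proof -
    have "R b m = R b m + 0" by simp
    then show ?thesis unfolding W1_def using that subspace_0[OF s0] by blast
  qed
  have W1W: "W1 \<subseteq> W"
    unfolding W1_def using F(2) W RstableD(3)[OF W(1)] sW by (auto simp: K_def intro!: subspace_add)
  have "subspace W1"
  proof (rule subspaceI)
    show "0 \<in> W1" using W1W0 subspace_0[OF s0] by blast
  next
    fix x y assume "x \<in> W1" "y \<in> W1"
    then obtain b v b' v' where "x = R b m + v" "b \<in> K F" "b g = 0" "v \<in> W0"
      "y = R b' m + v'" "b' \<in> K F" "b' g = 0" "v' \<in> W0" unfolding W1_def by blast
    then show "x + y \<in> W1" unfolding W1_def using add_K[of b b'] subspace_add[OF s0, of v v']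
      by (auto intro!: exI[of _ "\<lambda>z. b z + b' z"] exI[of _ "v + v'"] simp: R_form algebra_simps)
  next
    fix c x assume "x \<in> W1"
    then obtain b v where "x = R b m + v" "b \<in> K F" "b g = 0" "v \<in> W0" unfolding W1_def by blast
    then show "c *s x \<in> W1" unfolding W1_def using scale_K[of b c] subspace_scale[OF s0, of v c]
      by (auto intro!: exI[of _ "\<lambda>z. c * b z"] exI[of _ "c *s v"] simp: R_form scale_right_distrib)
  qed
  moreover have "R \<alpha> x \<in> W1" if al: "lform \<alpha>" and "x \<in> W1" for \<alpha> x
  proof -
    from that obtain b v where "x = R b m + v" "b \<in> K F" "b g = 0" "v \<in> W0" unfolding W1_def by blast
    then show ?thesis unfolding W1_def using conv_K[OF al, of b] conv_g[OF al, of b] RstableD(3)[OF W0(1) al, of v]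
      by (auto intro!: exI[of _ "\<lambda>z. \<alpha> (R b z)"] exI[of _ "R \<alpha> v"] simp: R_R[OF al])
  qed
  ultimately have W1: "Rstable W1" using W1W RstableD(2)[OF W(1)] by (auto simp: Rstable_def)
  \<comment> \<open>By minimality of \<open>W\<close>, the coideal \<open>W1\<close> generated by these \<open>R b m\<close> is \<open>W0\<close> or \<open>W\<close>; the latter would put some \<open>a - b\<close> with nonzero value at \<open>g\<close> into \<open>K (insert m F)\<close>.\<close>
  have key: "R d m \<in> W0" if d: "d \<in> K F" "d g = 0" for d
  proof (rule ccontr)
    assume "R d m \<notin> W0"
    then have "W0 \<subset> W1" using W1W0 W1I[OF d] by blast
    then have "W1 = W" using Wmin'[OF W1 _ W1W] by blast
    then have "R a m \<in> W1" using F(2) RstableD(3)[OF W(1)] a by (auto simp: K_def)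
    then obtain b v where b: "R a m = R b m + v" "b \<in> K F" "b g = 0" "v \<in> W0" unfolding W1_def by blast
    then have "R (\<lambda>z. a z - b z) m \<in> W0" by (simp add: R_form)
    then have "(\<lambda>z. a z - b z) \<in> K (insert m F)" using diff_K[OF a(1) b(2)] by (simp add: K_def)
    from F(3)[OF this] show False using a(2) b(3) by simp
  qed
  show ?thesis
  proof (rule that[of "R a m" g])
    show "R a m \<in> V" by simp
    show "R a m \<notin> W0"
    proof
      assume "R a m \<in> W0"
      then have "a \<in> K (insert m F)" using a by (simp add: K_def)
      then show False using F(3) a(2) by blast
    qed
    show "glike g" by fact
    fix \<alpha> assume al: "lform \<alpha>"
    have "(\<lambda>z. \<alpha> (R a z) - \<alpha> g * a z) \<in> K F"
      by (intro diff_K conv_K scale_K al a)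
    then have "R (\<lambda>z. \<alpha> (R a z) - \<alpha> g * a z) m \<in> W0" using conv_g[OF al a(1)] by (intro key) simp_all
    then show "R \<alpha> (R a m) - \<alpha> g *s R a m \<in> W0" by (simp add: R_form R_R[OF al])
  qed
qed

end


section \<open>The coradical filtration\<close>

context fd_coalgebra begin

text \<open>
  The usual argument for eigenvectors, modulo \<open>W\<close>: a form separating the weights of \<open>x i\<close> and \<open>x j\<close>
  removes the summand \<open>x j\<close>.
\<close>

lemma weights_independent:
  assumes W: "Rstable W" and F: "finite F"
    and w: "inj_on w F" and x: "\<And>i \<alpha>. i \<in> F \<Longrightarrow> lform \<alpha> \<Longrightarrow> R \<alpha> (x i) - \<alpha> (w i) *s x i \<in> W"
    and s: "sum x F \<in> W"
  shows "\<forall>i\<in>F. x i \<in> W"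
  using F w x s
proof (induction F arbitrary: x rule: finite_induct)
  case empty then show ?case by simp
next
  case (insert j F)
  note sW = RstableD(1)[OF W]
  have "x i \<in> W" if i: "i \<in> F" for i
  proof -
    have "w i \<noteq> w j" using insert.prems(1) insert.hyps i by (auto simp: inj_on_def)
    then obtain \<alpha> where a: "lform \<alpha>" "\<alpha> (w i) \<noteq> \<alpha> (w j)" using eq_by_forms by blast
    define y where "y i = (\<alpha> (w i) - \<alpha> (w j)) *s x i" for i
    have p1: "R \<alpha> (sum x (insert j F)) \<in> W" using RstableD(3)[OF W a(1) insert.prems(3)] .
    have p2: "\<alpha> (w j) *s sum x (insert j F) \<in> W" using subspace_scale[OF sW insert.prems(3)] .
    have p3: "(\<Sum>i\<in>insert j F. R \<alpha> (x i) - \<alpha> (w i) *s x i) \<in> W"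
      using insert.prems(2) a(1) by (intro subspace_sum[OF sW]) auto
    have "R \<alpha> (sum x (insert j F)) - \<alpha> (w j) *s sum x (insert j F)
        - (\<Sum>i\<in>insert j F. R \<alpha> (x i) - \<alpha> (w i) *s x i) \<in> W"
      by (rule subspace_diff[OF sW subspace_diff[OF sW p1 p2] p3])
    also have "R \<alpha> (sum x (insert j F)) - \<alpha> (w j) *s sum x (insert j F)
        - (\<Sum>i\<in>insert j F. R \<alpha> (x i) - \<alpha> (w i) *s x i) = (\<Sum>i\<in>insert j F. y i)"
      by (simp add: scale_sum_right sum_subtractf[symmetric] y_def scale_left_diff_distrib del: sum.insert)
    also have "\<dots> = sum y F" using insert.hyps by (simp add: y_def)
    finally have sy: "sum y F \<in> W" .
    have "R \<beta> (y i) - \<beta> (w i) *s y i \<in> W" if "i \<in> F" "lform \<beta>" for i \<beta>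
    proof -
      have "R \<beta> (y i) - \<beta> (w i) *s y i = (\<alpha> (w i) - \<alpha> (w j)) *s (R \<beta> (x i) - \<beta> (w i) *s x i)"
        by (simp add: y_def scale_right_diff_distrib mult.commute)
      then show ?thesis using insert.prems(2)[of i \<beta>] that sW by (simp add: subspace_scale)
    qed
    then have "y i \<in> W" using insert.IH[of y] insert.prems(1) sy i by auto
    then have "inverse (\<alpha> (w i) - \<alpha> (w j)) *s y i \<in> W" using sW by (rule subspace_scale[rotated])
    then show ?thesis using a(2) by (simp add: y_def)
  qed
  moreover have "sum x F \<in> W" using calculation by (intro subspace_sum[OF sW]) auto
  then have "sum x (insert j F) - sum x F \<in> W"
    by (rule subspace_diff[OF sW insert.prems(3)])
  then have "x j \<in> W" using insert.hyps by simp
  ultimately show ?case by auto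
qed

definition GL :: "'v set" where "GL = {g. glike g}"

lemma GL_V: "GL \<subseteq> V" by (auto simp: GL_def glike_def)

lemma Rstable_0: "Rstable {0}" by (auto simp: Rstable_def)

lemma indep_GL: "independent GL"
  unfolding independent_explicit_finite_subsets
proof (intro allI impI)
  fix F u assume F: "F \<subseteq> GL" "finite F" "(\<Sum>v\<in>F. u v *s v) = 0"
  have "\<forall>v\<in>F. u v *s v \<in> {0}"
    by (rule weights_independent[OF Rstable_0 F(2), of "\<lambda>v. v"])
      (use F in \<open>auto simp: GL_def glikeD mult.commute\<close>)
  then show "\<forall>v\<in>F. u v = 0" using F glike_nz by (auto simp: GL_def)
qed

lemma finite_GL: "finite GL"
  using independent_span_bound[OF finB indep_GL] GL_V V_span by auto

lemma GL_coeff_zero: "(\<Sum>h\<in>GL. u h *s h) = 0 \<Longrightarrow> h \<in> GL \<Longrightarrow> u h = 0"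
  using indep_GL[unfolded independent_explicit_finite_subsets, rule_format, of GL u h] finite_GL by simp

text \<open>
  In a pointed coalgebra these forms are the Jacobson radical of the dual algebra, so that \<open>D\<close> below is the
  coradical filtration.
\<close>

definition killG :: "('v \<Rightarrow> 'k) \<Rightarrow> bool" where
  "killG \<alpha> \<longleftrightarrow> lform \<alpha> \<and> (\<forall>g\<in>GL. \<alpha> g = 0)"

primrec D :: "nat \<Rightarrow> 'v set" where
  "D 0 = span GL"
| "D (Suc n) = {x \<in> V. \<forall>\<alpha>. killG \<alpha> \<longrightarrow> R \<alpha> x \<in> D n}"

lemma killG_lform: "killG \<alpha> \<Longrightarrow> lform \<alpha>" by (simp add: killG_def)

lemma killG_span: "killG \<alpha> \<Longrightarrow> x \<in> span GL \<Longrightarrow> \<alpha> x = 0"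
proof -
  assume a: "killG \<alpha>" and x: "x \<in> span GL"
  then have l: "lform \<alpha>" by (simp add: killG_def)
  show "\<alpha> x = 0" using x by (induction rule: span_induct_alt) (use a in \<open>auto simp: lform_simps[OF l] killG_def\<close>)
qed

lemma span_GL_by_killG: "(\<And>\<alpha>. killG \<alpha> \<Longrightarrow> \<alpha> x = 0) \<Longrightarrow> x \<in> span GL"
proof (rule ccontr)
  assume h: "\<And>\<alpha>. killG \<alpha> \<Longrightarrow> \<alpha> x = 0" "x \<notin> span GL"
  obtain \<alpha> where "lform \<alpha>" "\<And>y. y \<in> span GL \<Longrightarrow> \<alpha> y = 0" "\<alpha> x = 1"
    using separating_form[OF subspace_span h(2)] by blast
  then show False using h(1)[of \<alpha>] by (simp add: killG_def span_base)
qed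

lemma D_V: "D n \<subseteq> V"
  using span_minimal[OF GL_V subspace_V] by (cases n) auto

lemma D_subspace: "subspace (D n)"
proof (induction n)
  case 0 show ?case by simp
next
  case (Suc n) then show ?case
    by (intro subspaceI) (auto simp: subspace_0 subspace_add subspace_scale)
qed

lemma R_spanGL: "lform \<alpha> \<Longrightarrow> x \<in> span GL \<Longrightarrow> R \<alpha> x \<in> span GL"
proof -
  assume a: "lform \<alpha>" and x: "x \<in> span GL"
  have g: "R \<alpha> g \<in> span GL" if "g \<in> GL" for g
    using that glikeD(3)[OF _ a] by (simp add: GL_def span_scale span_base)
  show ?thesis using x
    by (induction rule: span_induct_alt) (simp_all add: span_zero span_add span_scale g)
qed

lemma killG_R: "lform \<beta> \<Longrightarrow> killG \<alpha> \<Longrightarrow> killG (\<lambda>z. \<alpha> (R \<beta> z))"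
  by (auto simp: killG_def GL_def glikeD lform_simps)

lemma D_R: "lform \<alpha> \<Longrightarrow> x \<in> D n \<Longrightarrow> R \<alpha> x \<in> D n"
proof (cases n)
  case 0 then show "lform \<alpha> \<Longrightarrow> x \<in> D n \<Longrightarrow> R \<alpha> x \<in> D n" by (simp add: R_spanGL)
next
  case (Suc m)
  show "lform \<alpha> \<Longrightarrow> x \<in> D n \<Longrightarrow> R \<alpha> x \<in> D n"
    using killG_R by (auto simp: Suc R_R killG_lform)
qed

lemma D_Suc: "x \<in> D n \<Longrightarrow> x \<in> D (Suc n)"
proof -
  assume x: "x \<in> D n"
  have "R \<alpha> x \<in> D n" if "killG \<alpha>" for \<alpha> using D_R[OF killG_lform[OF that] x] .
  then show ?thesis using x D_V by auto
qed

lemma D_Rstable: "Rstable (D n)"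
  using D_subspace D_V D_R by (auto simp: Rstable_def)

text \<open>
  Whatever \<open>D n\<close> misses, \<open>pointed_quotient\<close> provides an element outside of \<open>D n\<close> on which \<open>R \<alpha>\<close> acts by
  \<open>\<alpha> g\<close> modulo \<open>D n\<close>; it lies in \<open>D (Suc n)\<close>.
\<close>

lemma D_exhausts:
  assumes P: "pointed_coalg" shows "\<exists>n. D n = V"
proof -
  have "\<exists>n. \<forall>m. dim (D m) \<le> dim (D n)"
    using ex_has_greatest_nat[of "\<lambda>_. True" 0 "\<lambda>n. dim (D n)" "Suc (card B)"]
      dim_mono_V[OF D_V subspace_V D_subspace] dim_V by (auto simp: less_Suc_eq_le)
  then obtain n where n: "\<And>m. dim (D m) \<le> dim (D n)" by blast
  have eq: "D (Suc n) = D n"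
  proof (rule ccontr)
    assume "D (Suc n) \<noteq> D n"
    then have "D n \<subset> D (Suc n)" using D_Suc by blast
    from dim_strict_mono_V[OF this D_subspace D_subspace D_V] show False using n[of "Suc n"] by simp
  qed
  have "D n = V"
  proof (rule ccontr)
    assume "D n \<noteq> V"
    from pointed_quotient[OF P D_Rstable this] obtain x g
      where x: "x \<in> V" "x \<notin> D n" "glike g" "\<And>\<alpha>. lform \<alpha> \<Longrightarrow> R \<alpha> x - \<alpha> g *s x \<in> D n" by blast
    have "R \<alpha> x \<in> D n" if "killG \<alpha>" for \<alpha>
      using x(4)[of \<alpha>] x(3) that by (simp add: killG_def GL_def)
    then have "x \<in> D (Suc n)" using x by simp
    with eq x show False by blast
  qed
  then show ?thesis by blast
qed

text \<open>
  The filtration is left-right symmetric, because \<open>L\<close> and \<open>R\<close> commute and are adjoint.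
\<close>

lemma D_L: "killG \<alpha> \<Longrightarrow> x \<in> D (Suc n) \<Longrightarrow> L \<alpha> x \<in> D n"
proof (induction n arbitrary: x)
  case 0
  have "L \<alpha> x \<in> span GL"
  proof (rule span_GL_by_killG)
    fix \<beta> assume b: "killG \<beta>"
    have "\<beta> (L \<alpha> x) = \<alpha> (R \<beta> x)" using 0 b by (simp add: form_R_L killG_def)
    then show "\<beta> (L \<alpha> x) = 0" using 0 b killG_span by simp
  qed
  then show ?case by simp
next
  case (Suc n)
  have "R \<beta> (L \<alpha> x) \<in> D n" if "killG \<beta>" for \<beta>
    using Suc.IH[OF Suc.prems(1), of "R \<beta> x"] Suc.prems(2) that by (simp add: L_R[symmetric])
  then show ?case by simp
qed

text \<open>
  This is \<open>\<Delta>(D (k + m + 1)) \<subseteq> D m \<otimes> V + V \<otimes> D k\<close>, dualised.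
\<close>

lemma D_kill:
  "\<lbrakk>lform \<gamma>; \<And>y. y \<in> D k \<Longrightarrow> \<gamma> y = 0; x \<in> D (k + Suc m)\<rbrakk> \<Longrightarrow> R \<gamma> x \<in> D m"
proof (induction m arbitrary: k \<gamma> x)
  case 0
  have "R \<gamma> x \<in> span GL"
  proof (rule span_GL_by_killG)
    fix \<beta> assume b: "killG \<beta>"
    have "\<beta> (R \<gamma> x) = \<gamma> (L \<beta> x)" using 0 b by (simp add: form_R_L killG_def)
    then show "\<beta> (R \<gamma> x) = 0" using D_L[OF b, of x k] 0 by simp
  qed
  then show ?case by simp
next
  case (Suc m)
  have "R \<beta> (R \<gamma> x) \<in> D m" if b: "killG \<beta>" for \<beta>
  proof -
    have lb: "lform \<beta>" using b by (simp add: killG_def)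
    have "R (\<lambda>z. \<beta> (R \<gamma> z)) x \<in> D m"
    proof (rule Suc.IH[of _ "Suc k"])
      fix y assume "y \<in> D (Suc k)"
      then show "\<beta> (R \<gamma> y) = 0"
        using form_R_L[OF lb Suc.prems(1), of y] D_L[OF b] Suc.prems(2) by simp
    qed (use Suc.prems lb in auto)
    then show ?thesis by (simp add: R_R[OF lb])
  qed
  then show ?case by simp
qed

text \<open>
  For a coalgebra map \<open>f\<close>, the assumption \<open>fR\<close>, one compares \<open>R \<alpha> (f x)\<close> and \<open>R \<alpha> x\<close>: besides a term
  covered by induction there is \<open>R \<gamma> x\<close> with \<open>\<gamma> = \<alpha> \<circ> f - \<alpha>\<close>. This form vanishes on \<open>D 1\<close>, so that it lowers the
  degree by two.
\<close>

lemma D_unipotent: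
  assumes f: "lmap f" "\<And>x. x \<in> V \<Longrightarrow> f x \<in> V"
    and fR: "\<And>\<alpha> x. lform \<alpha> \<Longrightarrow> x \<in> V \<Longrightarrow> R \<alpha> (f x) = f (R (\<lambda>z. \<alpha> (f z)) x)"
    and f1: "\<And>x. x \<in> D 1 \<Longrightarrow> f x = x"
  shows "x \<in> D (Suc n) \<Longrightarrow> f x - x \<in> D n"
proof (induction n arbitrary: x)
  case 0
  then have "f x - x = 0" using f1[of x] by simp
  then show ?case using subspace_0[OF D_subspace] by metis
next
  case (Suc n)
  have xV: "x \<in> V" using Suc.prems by simp
  have "R \<alpha> (f x - x) \<in> D n" if a: "killG \<alpha>" for \<alpha>
  proof -
    have la: "lform \<alpha>" using a by (simp add: killG_def)
    have laf: "lform (\<lambda>z. \<alpha> (f z))" using la by (simp add: lform_def lmap_simps[OF f(1)])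
    have GD: "g \<in> D 1" if "g \<in> GL" for g using D_Suc[of g 0] span_base[OF that] by simp
    have kaf: "killG (\<lambda>z. \<alpha> (f z))" using a laf f1[OF GD] by (simp add: killG_def)
    define \<gamma> where "\<gamma> = (\<lambda>z. \<alpha> (f z) - \<alpha> z)"
    have "R \<gamma> x \<in> D n"
    proof (rule D_kill[of \<gamma> 1])
      show "lform \<gamma>" using la laf by (simp add: lform_def \<gamma>_def algebra_simps)
      show "\<gamma> y = 0" if "y \<in> D 1" for y using f1[OF that] by (simp add: \<gamma>_def)
      show "x \<in> D (1 + Suc n)" using Suc.prems by simp
    qed
    moreover have "f (R (\<lambda>z. \<alpha> (f z)) x) - R (\<lambda>z. \<alpha> (f z)) x \<in> D n"
      using Suc.IH Suc.prems kaf by simp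
    moreover have "R \<alpha> (f x - x) = (f (R (\<lambda>z. \<alpha> (f z)) x) - R (\<lambda>z. \<alpha> (f z)) x) + R \<gamma> x"
      by (simp add: fR[OF la xV] \<gamma>_def R_form)
    ultimately show ?thesis using subspace_add[OF D_subspace] by metis
  qed
  then show ?case using xV f(2) by simp
qed

text \<open>
  The theorem of Taft and Wilson on the first term of the coradical filtration. Since forms vanishing
  on group-likes move \<open>z\<close> into the span of the group-likes, \<open>\<Delta> z = \<Sum> b\<^sub>g \<otimes> g + \<Sum> h \<otimes> a\<^sub>h\<close> with sums over
  group-likes (the fact \<open>Rz\<close>). Coassociativity then gives \<open>\<Delta> b\<^sub>g = b\<^sub>g \<otimes> g + \<Sum> h \<otimes> c\<^sub>h\<^sub>g\<close> with
  skew-primitive \<open>c\<^sub>h\<^sub>g\<close>. The dual forms of the group-likes take the place of the idempotents of the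
  dual algebra.
\<close>

lemma taft_wilson:
  assumes z: "z \<in> D 1"
  shows "z \<in> span (GL \<union> {c. \<exists>h\<in>GL. \<exists>g\<in>GL. skew h g c})"
proof -
  define e where "e = dual GL"
  have e: "lform (e g)" "g' \<in> GL \<Longrightarrow> e g g' = (if g' = g then 1 else 0)" for g g'
    using dual[OF indep_GL] by (simp_all add: e_def)
  have zV: "z \<in> V" using z by simp
  \<comment> \<open>The subtracted terms in \<open>b\<close> and \<open>c\<close> avoid counting the components \<open>h \<otimes> g\<close> twice.\<close>
  define a where "a h = L (e h) z" for h
  define b where "b g = R (e g) z - (\<Sum>h\<in>GL. e g (a h) *s h)" for g
  define c where "c h g = R (e g) (a h) - e g (a h) *s h" for h g
  have Rz: "R \<alpha> z = (\<Sum>g\<in>GL. \<alpha> g *s b g) + (\<Sum>h\<in>GL. \<alpha> (a h) *s h)" if al: "lform \<alpha>" for \<alpha>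
  proof -
    define \<alpha>' where "\<alpha>' = (\<lambda>z. \<alpha> z - (\<Sum>g\<in>GL. \<alpha> g * e g z))"
    have la: "lform \<alpha>'" unfolding \<alpha>'_def lform_def
      using al e(1) by (simp add: lform_simps sum.distrib sum_distrib_left algebra_simps)
    have "\<alpha>' g = 0" if "g \<in> GL" for g
      using that finite_GL by (simp add: \<alpha>'_def e(2) if_distrib[of "\<lambda>t. _ * t"] cong: if_cong)
    then have "killG \<alpha>'" using la by (simp add: killG_def)
    then have "R \<alpha>' z \<in> span GL" using z by simp
    then have "R \<alpha>' z = (\<Sum>h\<in>GL. e h (R \<alpha>' z) *s h)"
      unfolding e_def by (rule dual_expand[OF indep_GL finite_GL])
    also have "\<dots> = (\<Sum>h\<in>GL. \<alpha>' (a h) *s h)" by (simp add: form_R_L[OF e(1) la] a_def)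
    also have "\<dots> = (\<Sum>h\<in>GL. \<alpha> (a h) *s h) - (\<Sum>h\<in>GL. \<Sum>g\<in>GL. (\<alpha> g * e g (a h)) *s h)"
      by (simp add: \<alpha>'_def scale_left_diff_distrib sum_subtractf scale_sum_left)
    also have "(\<Sum>h\<in>GL. \<Sum>g\<in>GL. (\<alpha> g * e g (a h)) *s h) = (\<Sum>g\<in>GL. \<alpha> g *s (\<Sum>h\<in>GL. e g (a h) *s h))"
      by (subst sum.swap) (simp add: scale_sum_right)
    finally have 1: "R \<alpha>' z = (\<Sum>h\<in>GL. \<alpha> (a h) *s h) - (\<Sum>g\<in>GL. \<alpha> g *s (\<Sum>h\<in>GL. e g (a h) *s h))" .
    have "R \<alpha>' z = R \<alpha> z - (\<Sum>g\<in>GL. \<alpha> g *s R (e g) z)" by (simp add: \<alpha>'_def R_form)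
    with 1 show ?thesis by (simp add: b_def scale_right_diff_distrib sum_subtractf algebra_simps)
  qed
  have Rb: "R \<beta> (b g) = \<beta> g *s b g + (\<Sum>h\<in>GL. \<beta> (c h g) *s h)" if be: "lform \<beta>" and g: "g \<in> GL" for \<beta> g
  proof -
    have "R \<beta> (R (e g) z) = R (\<lambda>z. \<beta> (R (e g) z)) z" by (rule R_R[OF be])
    also have "\<dots> = (\<Sum>g'\<in>GL. \<beta> (R (e g) g') *s b g') + (\<Sum>h\<in>GL. \<beta> (R (e g) (a h)) *s h)"
      by (rule Rz) (simp add: be)
    also have "(\<Sum>g'\<in>GL. \<beta> (R (e g) g') *s b g') = (\<Sum>g'\<in>GL. if g' = g then \<beta> g *s b g else 0)"
      by (intro sum.cong refl) (auto simp: GL_def glikeD(3)[OF _ e(1)] e(2)[unfolded GL_def] lform_simps[OF be])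
    also have "\<dots> = \<beta> g *s b g" using finite_GL g by simp
    finally have 1: "R \<beta> (R (e g) z) = \<beta> g *s b g + (\<Sum>h\<in>GL. \<beta> (R (e g) (a h)) *s h)" .
    have 2: "R \<beta> (\<Sum>h\<in>GL. e g (a h) *s h) = (\<Sum>h\<in>GL. (e g (a h) * \<beta> h) *s h)"
      by simp (intro sum.cong refl, simp add: GL_def glikeD(3)[OF _ be])
    show ?thesis unfolding b_def c_def using 1 2
      by (simp add: lform_simps[OF be] scale_left_diff_distrib sum_subtractf b_def)
  qed
  have bV: "b g \<in> V" for g using GL_V by (auto simp: b_def intro!: V_diff V_sum)
  have cV: "c h g \<in> V" if "h \<in> GL" for h g using GL_V that by (auto simp: c_def)
  have b_c: "b g = eps (b g) *s g + (\<Sum>h\<in>GL. c h g)" if g: "g \<in> GL" for g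
  proof (rule eq_by_forms)
    fix \<beta> assume be: "lform \<beta>"
    have "\<beta> (b g) = eps (R \<beta> (b g))" using form_R_L[OF eps_form be, of "b g"] bV by simp
    also have "\<dots> = \<beta> g * eps (b g) + (\<Sum>h\<in>GL. \<beta> (c h g))"
      by (simp add: Rb[OF be g] lform_simps[OF eps_form]) (intro sum.cong refl, simp add: GL_def glikeD)
    finally show "\<beta> (b g) = \<beta> (eps (b g) *s g + (\<Sum>h\<in>GL. c h g))"
      by (simp add: lform_simps[OF be] mult.commute)
  qed
  have sk: "skew h g (c h g)" if h: "h \<in> GL" and g: "g \<in> GL" for h g
    unfolding skew_def
  proof (intro conjI allI impI cV h)
    fix \<beta> assume be: "lform \<beta>"
    show "R \<beta> (c h g) = \<beta> g *s c h g + \<beta> (c h g) *s h"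
    proof (rule eq_by_forms)
      fix \<gamma> assume ga: "lform \<gamma>"
      have gg: "\<gamma> (R \<beta> g) = \<beta> g * \<gamma> g" using g by (simp add: GL_def glikeD(3)[OF _ be] lform_simps[OF ga])
      have "R \<gamma> (R \<beta> (b g)) = R (\<lambda>z. \<gamma> (R \<beta> z)) (b g)" by (rule R_R[OF ga])
      also have "\<dots> = (\<beta> g * \<gamma> g) *s b g + (\<Sum>h\<in>GL. \<gamma> (R \<beta> (c h g)) *s h)"
        using Rb[of "\<lambda>z. \<gamma> (R \<beta> z)" g] ga g by (simp add: gg)
      finally have 1: "R \<gamma> (R \<beta> (b g)) = \<dots>" .
      have "R \<gamma> (\<Sum>h\<in>GL. \<beta> (c h g) *s h) = (\<Sum>h\<in>GL. (\<beta> (c h g) * \<gamma> h) *s h)"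
        by simp (intro sum.cong refl, simp add: GL_def glikeD(3)[OF _ ga])
      then have "R \<gamma> (R \<beta> (b g)) = (\<beta> g * \<gamma> g) *s b g + (\<Sum>h\<in>GL. (\<beta> g * \<gamma> (c h g)) *s h)
          + (\<Sum>h\<in>GL. (\<beta> (c h g) * \<gamma> h) *s h)"
        by (simp add: Rb[OF be g] Rb[OF ga g] scale_right_distrib scale_sum_right)
      with 1 have "(\<Sum>h\<in>GL. (\<beta> g * \<gamma> (c h g) + \<beta> (c h g) * \<gamma> h - \<gamma> (R \<beta> (c h g))) *s h) = 0"
        by (simp add: scale_left_distrib scale_left_diff_distrib sum.distrib sum_subtractf algebra_simps)
      then have "\<beta> g * \<gamma> (c h g) + \<beta> (c h g) * \<gamma> h - \<gamma> (R \<beta> (c h g)) = 0"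
        using h by (rule GL_coeff_zero)
      then show "\<gamma> (R \<beta> (c h g)) = \<gamma> (\<beta> g *s c h g + \<beta> (c h g) *s h)"
        by (simp add: lform_simps[OF ga])
    qed
  qed
  have "z = R eps z" using zV by simp
  also have "\<dots> = (\<Sum>g\<in>GL. eps g *s b g) + (\<Sum>h\<in>GL. eps (a h) *s h)" by (rule Rz[OF eps_form])
  also have "\<dots> = (\<Sum>g\<in>GL. eps g *s (eps (b g) *s g + (\<Sum>h\<in>GL. c h g))) + (\<Sum>h\<in>GL. eps (a h) *s h)"
    using b_c by simp
  also have "\<dots> \<in> span (GL \<union> {c. \<exists>h\<in>GL. \<exists>g\<in>GL. skew h g c})" (is "_ \<in> span ?X")
  proof -
    have "g \<in> span ?X" if "g \<in> GL" for g using that by (blast intro: span_base)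
    moreover have "c h g \<in> span ?X" if "h \<in> GL" "g \<in> GL" for h g
      using sk[OF that] that by (intro span_base) blast
    ultimately show ?thesis by (intro span_add span_sum span_scale) auto
  qed
  finally show ?thesis .
qed

text \<open>
  A unipotent map has a triangular basis. It is built greedily: the next basis vector is taken from the
  lowest step of the filtration that is not yet in the span.
\<close>

lemma adapted_basis:
  assumes P: "pointed_coalg" and f: "lmap f"
    and f1: "\<And>x. x \<in> D 0 \<Longrightarrow> f x = x" and f2: "\<And>n x. x \<in> D (Suc n) \<Longrightarrow> f x - x \<in> D n"
  obtains E where "finite E" "independent E" "span E = V" "\<And>e. e \<in> E \<Longrightarrow> dual E e (f e) = 1"
proof -
  define Q where "Q E \<longleftrightarrow> finite E \<and> independent E \<and> E \<subseteq> V \<and> (\<forall>e\<in>E. f e - e \<in> span E \<and> dual E e (f e - e) = 0)" for E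
  have bound: "card E \<le> card B" if "Q E" for E
    using that independent_span_bound[OF finB, of E] V_span by (auto simp: Q_def)
  have "Q {}" by (simp add: Q_def independent_empty)
  then obtain E where E: "Q E" and Emax: "\<And>E'. Q E' \<Longrightarrow> card E' \<le> card E"
    using ex_has_greatest_nat[of Q "{}" card "Suc (card B)"] bound by (auto simp: less_Suc_eq_le)
  have EV: "span E \<subseteq> V" using E by (intro span_minimal) (auto simp: Q_def)
  have "span E = V"
  proof (rule ccontr)
    assume ne: "span E \<noteq> V"
    obtain N where "D N = V" using D_exhausts[OF P] by blast
    then have ex: "\<exists>n. \<not> D n \<subseteq> span E" using ne EV by blast
    define n where "n = (LEAST n. \<not> D n \<subseteq> span E)"
    have n: "\<not> D n \<subseteq> span E" unfolding n_def by (rule LeastI_ex[OF ex])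
    have nm: "D m \<subseteq> span E" if "m < n" for m using not_less_Least[of m "\<lambda>n. \<not> D n \<subseteq> span E"] that by (auto simp: n_def)
    from n obtain x where x: "x \<in> D n" "x \<notin> span E" by blast
    have fx: "f x - x \<in> span E"
    proof (cases n)
      case 0 then show ?thesis using x f1[of x] by (simp add: span_zero)
    next
      case (Suc m) then show ?thesis using x f2[of x m] nm[of m] by auto
    qed
    have ind: "independent (insert x E)" and indE: "independent E" and xE: "x \<notin> E" and fE: "finite E"
      using E x(2) independent_insertI span_base by (auto simp: Q_def)
    have d1: "dual (insert x E) x y = 0" if "y \<in> span E" for y
      using that dual[OF ind] xE by (induction rule: span_induct_alt) (auto simp: lform_simps)
    have d2: "dual (insert x E) e y = dual E e y" if "e \<in> E" "y \<in> span E" for e y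
      using that(2) that(1) dual[OF ind] dual[OF indE] by (induction rule: span_induct_alt) (auto simp: lform_simps)
    have "span E \<subseteq> span (insert x E)" by (rule span_mono) auto
    then have "Q (insert x E)"
      using E ind fx d1[OF fx] d2 x(1) D_V[of n] by (auto simp: Q_def)
    then show False using Emax[of "insert x E"] xE fE by simp
  qed
  moreover have "dual E e (f e) = 1" if "e \<in> E" for e
  proof -
    have ind: "independent E" using E by (simp add: Q_def)
    have "dual E e (f e - e) = 0" using E that by (simp add: Q_def)
    then show ?thesis using dual[OF ind, of e] that by (simp add: lform_simps)
  qed
  ultimately show ?thesis using that E by (auto simp: Q_def)
qed

end


section \<open>The antipode and its trace\<close>

context fd_hopf begin

lemma e1_glike: "glike e1"
  unfolding glike_def R_def by (auto simp: comult_e1 bil_def lmap_def lform_def scale_right_distrib scale_left_distrib mult.commute)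

lemma R_mul: "lform \<alpha> \<Longrightarrow> R \<alpha> (x \<star> y) = sw (\<lambda>a b. sw (\<lambda>c d. \<alpha> (b \<star> d) *s (a \<star> c)) y) x"
  unfolding R_def by (rule comult_mul) (auto simp: bil_def lmap_def lform_def scale_right_distrib scale_left_distrib mult.commute)

lemma L_mul: "lform \<alpha> \<Longrightarrow> L \<alpha> (x \<star> y) = sw (\<lambda>a b. sw (\<lambda>c d. \<alpha> (a \<star> c) *s (b \<star> d)) y) x"
  unfolding L_def by (rule comult_mul) (auto simp: bil_def lmap_def lform_def scale_right_distrib scale_left_distrib mult.commute)

lemma lform_mul [simp]: "lform \<alpha> \<Longrightarrow> lform (\<lambda>z. \<alpha> (h \<star> z))" "lform \<alpha> \<Longrightarrow> lform (\<lambda>z. \<alpha> (z \<star> h))"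
  by (auto simp: lform_def)

lemma R_skew_mul:
  assumes al: "lform \<alpha>" and "skew h g x" "g \<in> V"
  shows "R \<alpha> (x \<star> y) = x \<star> R (\<lambda>z. \<alpha> (g \<star> z)) y + h \<star> R (\<lambda>z. \<alpha> (x \<star> z)) y"
proof -
  have b: "bil (\<lambda>a b. sw (\<lambda>c d. \<alpha> (b \<star> d) *s (a \<star> c)) y)"
    by (auto simp: bil_def lmap_def lform_simps[OF al] scale_right_distrib scale_left_distrib sw_inner
        sw_smult[symmetric] mult.commute)
  show ?thesis
    unfolding R_mul[OF al] skew_sw[OF assms(2) b assms(3)]
    by (simp add: R_def lmap_of_sw[of "\<lambda>z. x \<star> z"] lmap_of_sw[of "\<lambda>z. h \<star> z"])
qed

lemma R_glike_mul:
  assumes al: "lform \<alpha>" and g: "glike g"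
  shows "R \<alpha> (g \<star> y) = g \<star> R (\<lambda>z. \<alpha> (g \<star> z)) y"
proof -
  have b: "bil (\<lambda>a b. sw (\<lambda>c d. \<alpha> (b \<star> d) *s (a \<star> c)) y)"
    by (auto simp: bil_def lmap_def lform_simps[OF al] scale_right_distrib scale_left_distrib sw_inner
        sw_smult[symmetric] mult.commute)
  show ?thesis
    unfolding R_mul[OF al] glike_sw[OF g b] by (simp add: R_def lmap_of_sw[of "\<lambda>z. g \<star> z"])
qed

lemma R_mul_glike:
  assumes al: "lform \<alpha>" and g: "glike g"
  shows "R \<alpha> (y \<star> g) = R (\<lambda>z. \<alpha> (z \<star> g)) y \<star> g"
proof -
  have b: "bil (\<lambda>c d. \<alpha> (b \<star> d) *s (a \<star> c))" for a b
    by (auto simp: bil_def lmap_def lform_simps[OF al] scale_right_distrib scale_left_distrib mult.commute)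
  show ?thesis
    unfolding R_mul[OF al] glike_sw[OF g b] by (simp add: R_def lmap_of_sw[of "\<lambda>z. z \<star> g"])
qed

lemma S_inv: assumes "glike g" shows "S g \<star> g = e1" "g \<star> S g = e1"
proof -
  have "bil (\<lambda>a b. S a \<star> b)" "bil (\<lambda>a b. a \<star> S b)" by (auto simp: bil_def lmap_def)
  from this[THEN glike_sw[OF assms]] show "S g \<star> g = e1" "g \<star> S g = e1"
    using S_l[of g] S_r[of g] glikeD[OF assms] by auto
qed

lemma mul_S_cancel [simp]:
  assumes "glike g" "y \<in> V"
  shows "S g \<star> (g \<star> y) = y" "g \<star> (S g \<star> y) = y"
  using S_inv[OF assms(1)] assms(2) by (auto simp: mul_assoc[symmetric])

lemma glike_mul: "glike g \<Longrightarrow> glike h \<Longrightarrow> glike (g \<star> h)"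
  unfolding glike_def[of "g \<star> h"] by (auto simp: glikeD R_glike_mul)

text \<open>Both \<open>\<Delta> \<circ> S\<close> and the twisted \<open>S \<otimes> S\<close> are convolution inverses of \<open>\<Delta>\<close>.\<close>

lemma S_anti_comult:
  assumes x: "x \<in> V" and F: "bil F"
  shows "sw F (S x) = sw (\<lambda>a b. F (S b) (S a)) x"
proof -
  \<comment> \<open>With Sweedler factors \<open>a1, ..., a5\<close> of \<open>x\<close> this is \<open>F\<close> at \<open>\<Delta>(S a1) (a2 \<otimes> a3) (S a5 \<otimes> S a4)\<close>.\<close>
  define \<Phi> where "\<Phi> a1 a2 a3 a4 a5 = sw (\<lambda>p q. F (p \<star> (a2 \<star> S a5)) (q \<star> (a3 \<star> S a4))) (S a1)" for a1 a2 a3 a4 a5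
  note Fs = bil_simps[OF F]
  \<comment> \<open>Collapsing \<open>a3 \<star> S a4\<close> and then \<open>a2 \<star> S a5\<close> leaves \<open>\<Delta>(S x)\<close>.\<close>
  have A3: "sw (\<lambda>a3 a4. \<Phi> a1 a2 a3 a4 a5) m = eps m *s sw (\<lambda>p q. F (p \<star> (a2 \<star> S a5)) q) (S a1)" for a1 a2 a5 m
  proof -
    define h where "h z = sw (\<lambda>p q. F (p \<star> (a2 \<star> S a5)) (q \<star> z)) (S a1)" for z
    have h: "lmap h" unfolding h_def lmap_def by (simp add: Fs sw_inner)
    have "sw (\<lambda>a3 a4. \<Phi> a1 a2 a3 a4 a5) m = h (sw (\<lambda>a3 a4. a3 \<star> S a4) m)"
      by (simp only: lmap_of_sw[OF h]) (simp add: h_def \<Phi>_def)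
    also have "\<dots> = eps m *s h e1" by (simp only: S_r lmap_scale[OF h])
    also have "h e1 = sw (\<lambda>p q. F (p \<star> (a2 \<star> S a5)) q) (S a1)" by (simp add: h_def)
    finally show ?thesis .
  qed
  have A2: "sw (\<lambda>a2 r2. sw (\<lambda>m a5. sw (\<lambda>a3 a4. \<Phi> a1 a2 a3 a4 a5) m) r2) r = eps r *s sw F (S a1)" for a1 r
  proof -
    define h where "h z = sw (\<lambda>p q. F (p \<star> z) q) (S a1)" for z
    have h: "lmap h" unfolding h_def lmap_def by (simp add: Fs sw_inner)
    have "sw (\<lambda>m a5. sw (\<lambda>a3 a4. \<Phi> a1 a2 a3 a4 a5) m) r2 = h (a2 \<star> S r2)"
      if "r2 \<in> V" for a2 r2
      unfolding A3 h_def by (rule sw_counit_l[OF that]) (simp add: lmap_def Fs sw_inner)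
    then have "sw (\<lambda>a2 r2. sw (\<lambda>m a5. sw (\<lambda>a3 a4. \<Phi> a1 a2 a3 a4 a5) m) r2) r = h (sw (\<lambda>a2 r2. a2 \<star> S r2) r)"
      unfolding lmap_of_sw[OF h] by simp
    also have "\<dots> = eps r *s h e1" by (simp only: S_r lmap_scale[OF h])
    also have "h e1 = sw F (S a1)" by (simp add: h_def)
    finally show ?thesis .
  qed
  have A: "sw (\<lambda>a1 r. sw (\<lambda>a2 r2. sw (\<lambda>m a5. sw (\<lambda>a3 a4. \<Phi> a1 a2 a3 a4 a5) m) r2) r) x = sw F (S x)"
    unfolding A2 by (rule sw_counit_r[OF x]) (simp add: lmap_def)
  \<comment> \<open>Collapsing \<open>\<Delta>(S a1) \<Delta>(a2)\<close> leaves \<open>S a5 \<otimes> S a4\<close>.\<close>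
  have B1: "sw (\<lambda>a1 s. sw (\<lambda>a2 a3. \<Phi> a1 a2 a3 a4 a5) s) t = eps t *s F (S a5) (S a4)" for a4 a5 t
  proof -
    define F' where "F' y z = F (y \<star> S a5) (z \<star> S a4)" for y z
    have F': "bil F'" by (simp add: bil_def lmap_def F'_def Fs)
    have "sw (\<lambda>a2 a3. \<Phi> a1 a2 a3 a4 a5) s = sw F' (S a1 \<star> s)" for a1 s
      unfolding comult_mul[OF F'] \<Phi>_def F'_def by (subst sw_swap) (simp add: mul_assoc)
    then have "sw (\<lambda>a1 s. sw (\<lambda>a2 a3. \<Phi> a1 a2 a3 a4 a5) s) t = sw F' (sw (\<lambda>a1 s. S a1 \<star> s) t)"
      by (simp add: lmap_of_sw[OF lmap_sw])
    also have "\<dots> = eps t *s F' e1 e1" by (simp add: S_l comult_e1[OF F'])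
    also have "\<dots> = eps t *s F (S a5) (S a4)" by (simp add: F'_def)
    finally show ?thesis .
  qed
  have "sw (\<lambda>a1 r. sw (\<lambda>a2 r2. sw (\<lambda>m a5. sw (\<lambda>a3 a4. \<Phi> a1 a2 a3 a4 a5) m) r2) r) x
    = sw (\<lambda>a1 r. sw (\<lambda>a2 r2. sw (\<lambda>a3 w. sw (\<lambda>a4 a5. \<Phi> a1 a2 a3 a4 a5) w) r2) r) x"
    by (subst sw_coassoc) simp
  also have "\<dots> = sw (\<lambda>a1 r. sw (\<lambda>s w. sw (\<lambda>a2 a3. sw (\<lambda>a4 a5. \<Phi> a1 a2 a3 a4 a5) w) s) r) x"
    by (subst (2) sw_coassoc[symmetric]) simp
  also have "\<dots> = sw (\<lambda>t w. sw (\<lambda>a1 s. sw (\<lambda>a2 a3. sw (\<lambda>a4 a5. \<Phi> a1 a2 a3 a4 a5) w) s) t) x"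
    by (rule sw_coassoc[symmetric])
  also have "\<dots> = sw (\<lambda>t w. sw (\<lambda>a4 a5. sw (\<lambda>a1 s. sw (\<lambda>a2 a3. \<Phi> a1 a2 a3 a4 a5) s) t) w) x"
  proof (rule sw_cong[OF _ refl])
    fix t w
    have "sw (\<lambda>a1 s. sw (\<lambda>a2 a3. sw (\<lambda>a4 a5. \<Phi> a1 a2 a3 a4 a5) w) s) t
      = sw (\<lambda>a1 s. sw (\<lambda>a4 a5. sw (\<lambda>a2 a3. \<Phi> a1 a2 a3 a4 a5) s) w) t"
      by (rule sw_cong[OF sw_swap refl])
    also have "\<dots> = sw (\<lambda>a4 a5. sw (\<lambda>a1 s. sw (\<lambda>a2 a3. \<Phi> a1 a2 a3 a4 a5) s) t) w" by (rule sw_swap)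
    finally show "sw (\<lambda>a1 s. sw (\<lambda>a2 a3. sw (\<lambda>a4 a5. \<Phi> a1 a2 a3 a4 a5) w) s) t
      = sw (\<lambda>a4 a5. sw (\<lambda>a1 s. sw (\<lambda>a2 a3. \<Phi> a1 a2 a3 a4 a5) s) t) w" .
  qed
  also have "\<dots> = sw (\<lambda>t w. eps t *s sw (\<lambda>a b. F (S b) (S a)) w) x"
    by (simp add: B1 sw_smult)
  also have "\<dots> = sw (\<lambda>a b. F (S b) (S a)) x" by (rule sw_counit_l[OF x lmap_sw])
  finally show ?thesis using A by simp
qed

lemma eps_S: assumes x: "x \<in> V" shows "eps (S x) = eps x"
proof -
  define h where "h z = eps z *s e1" for z
  have h: "lmap h" by (simp add: lmap_def h_def scale_left_distrib)
  have "eps x *s e1 = h (sw (\<lambda>a b. S a \<star> b) x)" by (simp add: S_l h_def)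
  also have "\<dots> = sw (\<lambda>a b. eps b *s (eps (S a) *s e1)) x"
    unfolding lmap_of_sw[OF h] by (simp add: h_def mult.commute)
  also have "\<dots> = eps (S x) *s e1" by (rule sw_counit_r[OF x]) (simp add: lmap_def scale_left_distrib)
  finally have "eps (eps x *s e1) = eps (eps (S x) *s e1)" by (rule arg_cong)
  then show ?thesis by simp
qed

lemma glike_S: assumes "glike g" shows "glike (S g)"
proof -
  have gV: "g \<in> V" using assms by (rule glikeD)
  have "R \<alpha> (S g) = \<alpha> (S g) *s S g" if al: "lform \<alpha>" for \<alpha>
  proof -
    have b: "bil (\<lambda>a b. \<alpha> b *s a)"
      by (auto simp: bil_def lmap_def lform_simps[OF al] scale_right_distrib scale_left_distrib mult.commute)
    have b': "bil (\<lambda>a b. \<alpha> (S a) *s S b)"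
      by (auto simp: bil_def lmap_def lform_simps[OF al] scale_right_distrib scale_left_distrib mult.commute)
    show ?thesis unfolding R_def S_anti_comult[OF gV b] glike_sw[OF assms b'] ..
  qed
  then show ?thesis using eps_S[OF gV] glikeD(2)[OF assms] by (simp add: glike_def)
qed

definition S2 :: "'v \<Rightarrow> 'v" where "S2 x = S (S x)"

lemma S2_lmap: "lmap S2" by (simp add: S2_def lmap_def)
lemma S2_V [simp]: "S2 x \<in> V" by (simp add: S2_def)

text \<open>
  The two flips caused by \<open>S_anti_comult\<close> cancel.
\<close>

lemma S2_comult:
  assumes x: "x \<in> V" and F: "bil F"
  shows "sw F (S2 x) = sw (\<lambda>a b. F (S2 a) (S2 b)) x"
proof -
  have b: "bil (\<lambda>a b. F (S b) (S a))" using bil_simps[OF F] by (simp add: bil_def lmap_def)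
  show ?thesis unfolding S2_def S_anti_comult[OF S_V F] S_anti_comult[OF x b] ..
qed

lemma R_S2:
  assumes al: "lform \<alpha>" and x: "x \<in> V"
  shows "R \<alpha> (S2 x) = S2 (R (\<lambda>z. \<alpha> (S2 z)) x)"
proof -
  have b: "bil (\<lambda>a b. \<alpha> b *s a)"
    by (auto simp: bil_def lmap_def lform_simps[OF al] scale_right_distrib scale_left_distrib mult.commute)
  show ?thesis unfolding R_def S2_comult[OF x b] lmap_of_sw[OF S2_lmap] by (simp add: lmap_scale[OF S2_lmap])
qed

lemma S2_glike: assumes g: "glike g" shows "S2 g = g"
proof -
  have "S2 g = S2 g \<star> (S g \<star> g)" using S_inv[OF g] by simp
  also have "\<dots> = (S (S g) \<star> S g) \<star> g" by (simp add: mul_assoc S2_def)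
  also have "\<dots> = g" using S_inv[OF glike_S[OF g]] glikeD(1)[OF g] by simp
  finally show ?thesis .
qed

text \<open>
  If \<open>\<Delta> c = c \<otimes> g + h \<otimes> c\<close>, then \<open>S c = - h\<inverse> c g\<inverse>\<close>, and \<open>S c\<close> is again skew-primitive, with \<open>h\<inverse>\<close> and
  \<open>g\<inverse>\<close>. Apply the formula twice.
\<close>

lemma S2_skew:
  assumes c: "skew h g c" and h: "glike h" and g: "glike g"
  shows "S2 c = g \<star> (S h \<star> (c \<star> (S g \<star> h)))"
proof -
  note V = glikeD(1)[OF g] glikeD(1)[OF h]
  have cV: "c \<in> V" using c by (simp add: skew_def)
  have sk: "S c = - (S h \<star> (c \<star> S g))" if c: "skew h g c" and h: "glike h" and g: "glike g" for h g c
  proof -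
    have cV: "c \<in> V" using c by (simp add: skew_def)
    note V = glikeD(1)[OF g] glikeD(1)[OF h]
    have "R eps c = c + eps c *s h" using c glikeD(2)[OF g] by (simp add: skew_def eps_form)
    then have "eps c *s h = 0" using cV by simp
    then have e0: "eps c = 0" using glike_nz[OF h] by simp
    have "bil (\<lambda>a b. S a \<star> b)" by (auto simp: bil_def lmap_def)
    from skew_sw[OF c this] V have "S c \<star> g + S h \<star> c = 0" by (simp add: S_l e0)
    then have "(S c \<star> g + S h \<star> c) \<star> S g = 0" by simp
    then have "S c + S h \<star> (c \<star> S g) = 0" using S_inv[OF g] by (simp add: mul_assoc)
    then show ?thesis by (simp add: eq_neg_iff_add_eq_0)
  qed
  have "skew (S g) (S h) (S c)"
    unfolding skew_def
  proof (intro conjI allI impI S_V)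
    fix \<alpha> assume al: "lform \<alpha>"
    have b: "bil (\<lambda>a b. \<alpha> b *s a)"
      by (auto simp: bil_def lmap_def lform_simps[OF al] scale_right_distrib scale_left_distrib mult.commute)
    have b': "bil (\<lambda>a b. \<alpha> (S a) *s S b)"
      by (auto simp: bil_def lmap_def lform_simps[OF al] scale_right_distrib scale_left_distrib mult.commute)
    show "R \<alpha> (S c) = \<alpha> (S h) *s S c + \<alpha> (S c) *s S g"
      unfolding R_def S_anti_comult[OF cV b] skew_sw[OF c b' V(1)] by simp
  qed
  from sk[OF this glike_S[OF g] glike_S[OF h]]
  have "S2 c = - (S2 g \<star> (S c \<star> S2 h))" by (simp add: S2_def)
  also have "\<dots> = g \<star> (S h \<star> (c \<star> (S g \<star> h)))"
    by (simp add: S2_glike g h sk[OF c h g] mul_assoc)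
  finally show ?thesis .
qed

text \<open>
  The trace, computed from the diagonal coordinates in a basis \<open>E\<close>.
\<close>

definition tr :: "'v set \<Rightarrow> ('v \<Rightarrow> 'v) \<Rightarrow> 'k" where
  "tr E T = (\<Sum>e\<in>E. dual E e (T e))"

lemma tr_comm:
  assumes E: "finite E" "independent E" "span E = V"
    and X: "lmap X" "\<And>x. x \<in> V \<Longrightarrow> X x \<in> V" and Y: "lmap Y" "\<And>x. x \<in> V \<Longrightarrow> Y x \<in> V"
  shows "tr E (\<lambda>a. X (Y a)) = tr E (\<lambda>a. Y (X a))"
proof -
  have *: "dual E e (P (Q e)) = (\<Sum>e'\<in>E. dual E e' (Q e) * dual E e (P e'))"
    if "e \<in> E" "lmap P" "\<And>x. x \<in> V \<Longrightarrow> Q x \<in> V" for e P Q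
  proof -
    have "e \<in> V" using that E(3) span_base by blast
    then have "Q e = (\<Sum>e'\<in>E. dual E e' (Q e) *s e')" using that E by (intro dual_expand) auto
    then have "dual E e (P (Q e)) = dual E e (P (\<Sum>e'\<in>E. dual E e' (Q e) *s e'))" by simp
    then show ?thesis by (simp add: lmap_simps[OF that(2)] lform_simps[OF dual(1)[OF E(2)]])
  qed
  have "tr E (\<lambda>a. X (Y a)) = (\<Sum>e\<in>E. \<Sum>e'\<in>E. dual E e' (Y e) * dual E e (X e'))"
    unfolding tr_def by (intro sum.cong refl *[OF _ X(1) Y(2)])
  also have "\<dots> = (\<Sum>e'\<in>E. \<Sum>e\<in>E. dual E e (X e') * dual E e' (Y e))"
    by (subst sum.swap) (simp add: mult.commute)
  also have "\<dots> = tr E (\<lambda>a. Y (X a))"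
    unfolding tr_def by (intro sum.cong refl *[OF _ Y(1) X(2), symmetric])
  finally show ?thesis .
qed

lemma S2_S: "sw (\<lambda>a c. S2 c \<star> S a) w = eps w *s e1"
proof -
  have "sw (\<lambda>a c. S2 c \<star> S a) w = sw (\<lambda>a c. S (a \<star> S c)) w"
    by (simp add: S2_def S_anti_mul)
  also have "\<dots> = S (sw (\<lambda>a c. a \<star> S c) w)" by (simp only: lmap_of_sw[OF S_map])
  finally show ?thesis by (simp add: S_r S_e1)
qed

text \<open>
  The form \<open>h \<mapsto> tr(a \<mapsto> h S\<^sup>2(a))\<close> is an integral of the dual Hopf algebra. Write \<open>c\<close> for the basis
  vectors, \<open>c\<^sup>*\<close> for their dual forms and \<open>\<gamma> c = \<beta>(_ S c)\<close>. From \<open>S\<^sup>2(a\<^sub>2) S(a\<^sub>1) = \<epsilon>(a) 1\<close> one gets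
  \<open>\<beta>(h\<^sub>1) h\<^sub>2 S\<^sup>2(a) = \<Sum>\<^sub>c L (\<gamma> c) (h S\<^sup>2(L c\<^sup>* a))\<close>. Taking traces, \<open>L c\<^sup>*\<close> can be moved to the front, and
  \<open>\<Sum>\<^sub>c L c\<^sup>* \<circ> L (\<gamma> c) = \<beta>(1) id\<close> by the defining property of the antipode.
\<close>

lemma trace_integral:
  assumes E: "finite E" "independent E" "span E = V" and be: "lform \<beta>" and h: "h \<in> V"
  defines "lam \<equiv> \<lambda>h. tr E (\<lambda>a. h \<star> S2 a)"
  shows "\<beta> (R lam h) = \<beta> e1 * lam h"
proof -
  note dl' = dual(1)[OF E(2)]
  note bes = lform_simps[OF be]
  define \<gamma> where "\<gamma> c = (\<lambda>y. \<beta> (y \<star> S c))" for c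
  have lam: "lform lam"
    by (simp add: lform_def lam_def tr_def lform_simps[OF dl'] sum.distrib sum_distrib_left)
  have eE: "(\<Sum>c\<in>E. dual E c a *s c) = a" if "a \<in> V" for a
    using dual_expand[OF E(2,1), of a] that E(3) by simp
  have step1: "L \<beta> h \<star> S2 a = (\<Sum>c\<in>E. L (\<gamma> c) (h \<star> S2 (L (dual E c) a)))" if a: "a \<in> V" for a
  proof -
    have "L (\<gamma> c) (h \<star> S2 (L (dual E c) a)) = sw (\<lambda>a1 a2. dual E c a1 *s L (\<gamma> c) (h \<star> S2 a2)) a" for c
      unfolding L_def[of "dual E c"]
      by (simp add: lmap_of_sw[of "\<lambda>z. L (\<gamma> c) (h \<star> S2 z)"] lmap_def lmap_simps[OF S2_lmap])
    then have "(\<Sum>c\<in>E. L (\<gamma> c) (h \<star> S2 (L (dual E c) a)))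
      = sw (\<lambda>a1 a2. \<Sum>c\<in>E. dual E c a1 *s L (\<gamma> c) (h \<star> S2 a2)) a" by (simp add: sw_sum)
    also have "\<dots> = sw (\<lambda>a1 a2. L (\<lambda>z. \<beta> (z \<star> S a1)) (h \<star> S2 a2)) a"
    proof (rule sw_cong[OF _ refl])
      fix a1 a2 assume "a1 \<in> V"
      have "(\<Sum>c\<in>E. dual E c a1 *s L (\<gamma> c) (h \<star> S2 a2)) = L (\<lambda>z. \<Sum>c\<in>E. dual E c a1 * \<gamma> c z) (h \<star> S2 a2)"
        by (simp add: L_form)
      also have "(\<lambda>z. \<Sum>c\<in>E. dual E c a1 * \<gamma> c z) = (\<lambda>z. \<beta> (z \<star> S (\<Sum>c\<in>E. dual E c a1 *s c)))"
        by (simp add: \<gamma>_def bes)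
      finally show "(\<Sum>c\<in>E. dual E c a1 *s L (\<gamma> c) (h \<star> S2 a2)) = L (\<lambda>z. \<beta> (z \<star> S a1)) (h \<star> S2 a2)"
        using eE[OF \<open>a1 \<in> V\<close>] by simp
    qed
    also have "\<dots> = sw (\<lambda>a1 a2. sw (\<lambda>h1 h2. sw (\<lambda>c d. \<beta> (h1 \<star> (S2 c \<star> S a1)) *s (h2 \<star> S2 d)) a2) h) a"
    proof (rule sw_cong[OF _ refl])
      fix a1 a2 assume a2: "a2 \<in> V"
      have "bil (\<lambda>c d. \<beta> ((h1 \<star> c) \<star> S a1) *s (h2 \<star> d))" for h1 h2
        by (auto simp: bil_def lmap_def bes scale_right_distrib scale_left_distrib mult.commute)
      from S2_comult[OF a2 this]
      show "L (\<lambda>z. \<beta> (z \<star> S a1)) (h \<star> S2 a2)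
        = sw (\<lambda>h1 h2. sw (\<lambda>c d. \<beta> (h1 \<star> (S2 c \<star> S a1)) *s (h2 \<star> S2 d)) a2) h"
        by (simp add: L_mul be mul_assoc)
    qed
    also have "\<dots> = sw (\<lambda>h1 h2. sw (\<lambda>a1 a2. sw (\<lambda>c d. \<beta> (h1 \<star> (S2 c \<star> S a1)) *s (h2 \<star> S2 d)) a2) a) h"
      by (rule sw_swap)
    also have "\<dots> = sw (\<lambda>h1 h2. sw (\<lambda>w d. sw (\<lambda>a1 c. \<beta> (h1 \<star> (S2 c \<star> S a1)) *s (h2 \<star> S2 d)) w) a) h"
      by (subst sw_coassoc[symmetric]) simp
    also have "\<dots> = sw (\<lambda>h1 h2. sw (\<lambda>w d. eps w *s (\<beta> h1 *s (h2 \<star> S2 d))) a) h"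
    proof (intro sw_cong refl)
      fix h1 h2 w d assume h1: "h1 \<in> V"
      define k where "k z = \<beta> (h1 \<star> z) *s (h2 \<star> S2 d)" for z
      have k: "lmap k" by (simp add: lmap_def k_def bes scale_left_distrib)
      have "sw (\<lambda>a1 c. k (S2 c \<star> S a1)) w = eps w *s k e1"
        unfolding lmap_of_sw[OF k, symmetric] S2_S lmap_scale[OF k] ..
      then show "sw (\<lambda>a1 c. \<beta> (h1 \<star> (S2 c \<star> S a1)) *s (h2 \<star> S2 d)) w = eps w *s (\<beta> h1 *s (h2 \<star> S2 d))"
        using h1 by (simp add: k_def)
    qed
    also have "\<dots> = sw (\<lambda>h1 h2. \<beta> h1 *s (h2 \<star> S2 a)) h"
    proof (intro sw_cong refl)
      fix h1 h2
      show "sw (\<lambda>w d. eps w *s (\<beta> h1 *s (h2 \<star> S2 d))) a = \<beta> h1 *s (h2 \<star> S2 a)"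
        by (rule sw_counit_l[OF a]) (simp add: lmap_def lmap_simps[OF S2_lmap] scale_right_distrib mult.commute)
    qed
    also have "\<dots> = L \<beta> h \<star> S2 a"
      by (simp add: L_def lmap_of_sw[of "\<lambda>z. z \<star> S2 a"])
    finally show ?thesis by simp
  qed
  have step2: "(\<Sum>c\<in>E. L (dual E c) (L (\<gamma> c) y)) = \<beta> e1 *s y" if y: "y \<in> V" for y
  proof -
    have "(\<Sum>c\<in>E. L (dual E c) (L (\<gamma> c) y)) = L (\<lambda>z. \<Sum>c\<in>E. dual E c (L (\<gamma> c) z)) y"
      by (simp add: L_L[OF dl'] L_form)
    also have "(\<lambda>z. \<Sum>c\<in>E. dual E c (L (\<gamma> c) z)) = (\<lambda>z. \<beta> e1 * eps z)"
    proof
      fix z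
      have "(\<Sum>c\<in>E. dual E c (L (\<gamma> c) z)) = (\<Sum>c\<in>E. swk (\<lambda>a b. \<gamma> c a * dual E c b) z)"
        by (simp add: form_L[OF dl'])
      also have "\<dots> = swk (\<lambda>a b. \<Sum>c\<in>E. \<gamma> c a * dual E c b) z"
        unfolding swk_def sum_distrib_left by (subst sum.swap, rule sum.cong[OF refl], rule sum.swap)
      also have "\<dots> = swk (\<lambda>a b. \<beta> (a \<star> S b)) z"
      proof (rule swk_cong[OF _ refl])
        fix a b assume b: "b \<in> V"
        have "(\<Sum>c\<in>E. \<gamma> c a * dual E c b) = \<beta> (a \<star> S (\<Sum>c\<in>E. dual E c b *s c))"
          by (simp add: \<gamma>_def bes mult.commute)
        then show "(\<Sum>c\<in>E. \<gamma> c a * dual E c b) = \<beta> (a \<star> S b)" using eE[OF b] by simp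
      qed
      also have "\<dots> = \<beta> (sw (\<lambda>a b. a \<star> S b) z)" by (simp add: lform_of_sw[OF be])
      finally show "(\<Sum>c\<in>E. dual E c (L (\<gamma> c) z)) = \<beta> e1 * eps z" by (simp add: S_r bes)
    qed
    also have "L (\<lambda>z. \<beta> e1 * eps z) y = \<beta> e1 *s y" using y by (simp add: L_form)
    finally show ?thesis .
  qed
  have eV: "e \<in> V" if "e \<in> E" for e using that E(3) span_base by blast
  have "\<beta> (R lam h) = lam (L \<beta> h)" by (rule form_R_L[OF be lam])
  also have "\<dots> = (\<Sum>c\<in>E. tr E (\<lambda>a. L (\<gamma> c) (h \<star> S2 (L (dual E c) a))))"
    unfolding lam_def tr_def
    by (subst sum.swap) (intro sum.cong refl, simp add: step1 eV lform_simps[OF dl'])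
  also have "\<dots> = (\<Sum>c\<in>E. tr E (\<lambda>a. L (dual E c) (L (\<gamma> c) (h \<star> S2 a))))"
    by (intro sum.cong refl tr_comm[OF E, of "\<lambda>z. L (\<gamma> c) (h \<star> S2 z)" "L (dual E c)" for c])
      (simp_all add: lmap_def lmap_simps[OF S2_lmap])
  also have "\<dots> = tr E (\<lambda>a. \<beta> e1 *s (h \<star> S2 a))"
    unfolding tr_def
    by (subst sum.swap) (intro sum.cong refl, simp add: step2[symmetric] lform_simps[OF dl'])
  also have "\<dots> = \<beta> e1 * lam h" by (simp add: lam_def tr_def lform_simps[OF dl'] sum_distrib_left)
  finally show ?thesis .
qed

text \<open>
  Suppose that every skew-primitive commutes with its group-like. Then \<open>S\<^sup>2\<close> is the identity on the first
  term of the coradical filtration by \<open>taft_wilson\<close> and \<open>S2_skew\<close>, hence unipotent, and its trace is the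
  dimension of \<open>V\<close>. So the integral \<open>lam\<close> of \<open>trace_integral\<close> is nonzero at \<open>1\<close>. For \<open>x\<close> with
  \<open>\<Delta> x = x \<otimes> 1 + u \<otimes> x\<close> the identity \<open>R lam x = lam x 1\<close> reads \<open>lam 1 x = lam x (1 - u)\<close>: all skew-primitives
  are spanned by group-likes, and the filtration stops at \<open>D 0\<close>.
\<close>

lemma noncommuting_skew:
  assumes P: "pointed_coalg" and N: "of_nat (card B) \<noteq> (0::'k)" and ne: "V \<noteq> span GL"
  obtains u x where "glike u" "skew u e1 x" "u \<star> x \<noteq> x \<star> u"
proof (rule ccontr)
  assume "\<not> thesis"
  with that have comm: "u \<star> x = x \<star> u" if "glike u" "skew u e1 x" for u x using that by blast
  have S2c: "S2 c = c" if c: "skew h g c" and h: "glike h" and g: "glike g" for h g c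
  proof -
    have cV: "c \<in> V" using c by (simp add: skew_def)
    have gi: "glike (S g)" and u: "glike (h \<star> S g)" using g h glike_S glike_mul by auto
    have gV: "g \<in> V" "h \<in> V" using g h by (auto dest: glikeD)
    \<comment> \<open>Right translation by \<open>S g\<close> turns \<open>c\<close> into a \<open>(1, u)\<close>-primitive element with \<open>u = h \<star> S g\<close>.\<close>
    have "skew (h \<star> S g) e1 (c \<star> S g)"
      unfolding skew_def
    proof (intro conjI allI impI mul_V)
      fix \<alpha> assume al: "lform \<alpha>"
      show "R \<alpha> (c \<star> S g) = \<alpha> e1 *s (c \<star> S g) + \<alpha> (c \<star> S g) *s (h \<star> S g)"
        using c S_inv[OF g] by (simp add: R_mul_glike[OF al gi] skew_def al)
    qed
    from comm[OF u this] have "(h \<star> S g) \<star> (c \<star> S g) = (c \<star> S g) \<star> (h \<star> S g)" .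
    then have "S h \<star> ((h \<star> S g) \<star> (c \<star> S g)) = S h \<star> ((c \<star> S g) \<star> (h \<star> S g))" by simp
    then have "S g \<star> (c \<star> S g) = S h \<star> (c \<star> (S g \<star> (h \<star> S g)))" using h by (simp add: mul_assoc)
    then have "g \<star> ((S g \<star> (c \<star> S g)) \<star> g) = g \<star> ((S h \<star> (c \<star> (S g \<star> (h \<star> S g)))) \<star> g)" by simp
    then have "c = g \<star> (S h \<star> (c \<star> (S g \<star> h)))" using g S_inv[OF g] cV gV by (simp add: mul_assoc)
    then show ?thesis using S2_skew[OF c h g] by simp
  qed
  have D1: "S2 z = z" if "z \<in> D 1" for z
    using taft_wilson[OF that]
    by (induction rule: span_induct_alt)
      (auto simp: lmap_simps[OF S2_lmap] GL_def S2_glike S2c)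
  have "S2 x - x \<in> D n" if "x \<in> D (Suc n)" for x n
    by (rule D_unipotent[OF S2_lmap _ R_S2 D1 that]) auto
  then obtain E where E: "finite E" "independent E" "span E = V" and Ed: "\<And>e. e \<in> E \<Longrightarrow> dual E e (S2 e) = 1"
    using adapted_basis[OF P S2_lmap] D1 D_Suc[of _ 0] by (metis One_nat_def)
  define lam where "lam h = tr E (\<lambda>a. h \<star> S2 a)" for h
  have "card E = card B"
    using dim_V dim_eq_card_independent[OF E(2)] dim_span[of E] E(3) by simp
  then have lam1: "lam e1 \<noteq> 0" using N by (simp add: lam_def tr_def Ed)
  have lamf: "lform lam"
    by (simp add: lform_def lam_def tr_def lform_simps[OF dual(1)[OF E(2)]] sum.distrib sum_distrib_left)
  have Rlam: "R lam h = lam h *s e1" if "h \<in> V" for h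
    using trace_integral[OF E _ that] by (intro eq_by_forms) (simp add: lam_def[abs_def] lform_simps mult.commute)
  have triv: "c \<in> span GL" if c: "skew h g c" and h: "glike h" and g: "glike g" for h g c
  proof -
    have cV: "c \<in> V" using c by (simp add: skew_def)
    have gi: "glike (S g)" and u: "glike (h \<star> S g)" using g h glike_S glike_mul by auto
    have gV: "g \<in> V" "h \<in> V" using g h by (auto dest: glikeD)
    have "R lam (c \<star> S g) = lam e1 *s (c \<star> S g) + lam (c \<star> S g) *s (h \<star> S g)"
      using c S_inv[OF g] by (simp add: R_mul_glike[OF lamf gi] skew_def lamf)
    then have "lam e1 *s (c \<star> S g) = lam (c \<star> S g) *s (e1 - h \<star> S g)"
      by (simp add: Rlam scale_right_diff_distrib)
    then have "(lam e1 *s (c \<star> S g)) \<star> g = (lam (c \<star> S g) *s (e1 - h \<star> S g)) \<star> g" by simp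
    then have "lam e1 *s c = lam (c \<star> S g) *s (g - h)"
      using S_inv[OF g] cV gV by (simp add: mul_assoc)
    then have "inverse (lam e1) *s (lam e1 *s c) = inverse (lam e1) *s (lam (c \<star> S g) *s (g - h))" by simp
    then have "c = inverse (lam e1) *s (lam (c \<star> S g) *s (g - h))" using lam1 by simp
    also have "\<dots> \<in> span GL" using g h by (intro span_scale span_diff span_base) (auto simp: GL_def)
    finally show ?thesis .
  qed
  have "D 1 \<subseteq> span GL"
  proof
    fix z assume "z \<in> D 1"
    have "span (GL \<union> {c. \<exists>h\<in>GL. \<exists>g\<in>GL. skew h g c}) \<subseteq> span GL"
      using triv by (intro span_minimal) (auto simp: GL_def intro: span_base)
    then show "z \<in> span GL" using taft_wilson[OF \<open>z \<in> D 1\<close>] by blast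
  qed
  then have "D n \<subseteq> span GL" for n by (induction n) auto
  then show False using D_exhausts[OF P] ne D_V[of 0] by auto
qed

end


section \<open>The number of group-like elements\<close>

context fd_coalgebra begin

lemma family_spans:
  assumes I: "finite I" "card I = card B" and f: "\<And>i. i \<in> I \<Longrightarrow> f i \<in> V"
    and ind: "\<And>c. (\<Sum>i\<in>I. c i *s f i) = 0 \<Longrightarrow> \<forall>i\<in>I. c i = 0"
    and v: "v \<in> V"
  obtains c where "v = (\<Sum>i\<in>I. c i *s f i)"
proof -
  have inj: "inj_on f I"
  proof (rule inj_onI, rule ccontr)
    fix i j assume ij: "i \<in> I" "j \<in> I" "f i = f j" "i \<noteq> j"
    define c where "c k = (if k = i then 1 else if k = j then - 1 else (0::'k))" for k
    have "(\<Sum>k\<in>I. c k *s f k) = (\<Sum>k\<in>I. (if k = i then f i else 0) - (if k = j then f j else 0))"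
      using ij by (intro sum.cong) (auto simp: c_def)
    also have "\<dots> = 0" using ij I by (simp add: sum_subtractf)
    finally have "c i = 0" using ind ij by blast
    then show False by (simp add: c_def)
  qed
  have "independent (f ` I)"
  proof (rule independent_if_scalars_zero)
    show "finite (f ` I)" using I by simp
    fix c x assume "(\<Sum>x\<in>f ` I. c x *s x) = 0" "x \<in> f ` I"
    then show "c x = 0" using ind[of "\<lambda>i. c (f i)"] inj by (auto simp: sum.reindex)
  qed
  moreover have "f ` I \<subseteq> V" using f by auto
  ultimately have "span (f ` I) = V"
    using I inj by (intro eq_V_if_dim span_minimal) (auto simp: dim_eq_card_independent card_image)
  then have "v = (\<Sum>x\<in>f ` I. dual (f ` I) x v *s x)"
    using dual_expand[OF \<open>independent (f ` I)\<close>, of v] I v by simp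
  then show ?thesis using that[of "\<lambda>i. dual (f ` I) (f i) v"] inj by (simp add: sum.reindex)
qed

end

context fd_hopf begin

text \<open>
  Take \<open>x\<close> of weight \<open>g\<close> modulo \<open>W\<close>. The translates \<open>h x\<close> by group-likes \<open>h\<close> have the pairwise distinct weights
  \<open>h g\<close>, so they are independent modulo \<open>W\<close>.
\<close>

lemma GL_extend:
  assumes P: "pointed_coalg" and W: "Rstable W" "W \<noteq> V"
    and GW: "\<And>h x. glike h \<Longrightarrow> x \<in> W \<Longrightarrow> h \<star> x \<in> W"
  obtains W' where "Rstable W'" "\<And>h x. glike h \<Longrightarrow> x \<in> W' \<Longrightarrow> h \<star> x \<in> W'"
    "dim W' = dim W + card GL"
proof -
  obtain x g where x: "x \<in> V" "x \<notin> W" "glike g" "\<And>\<alpha>. lform \<alpha> \<Longrightarrow> R \<alpha> x - \<alpha> g *s x \<in> W"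
    using pointed_quotient[OF P W] by blast
  note sW = RstableD(1)[OF W(1)]
  define y where "y h = h \<star> x" for h
  define Wf where "Wf F = span (W \<union> y ` F)" for F
  have yW: "R \<alpha> (y h) - \<alpha> (h \<star> g) *s y h \<in> W" if "lform \<alpha>" "glike h" for \<alpha> h
  proof -
    have "R \<alpha> (y h) - \<alpha> (h \<star> g) *s y h = h \<star> (R (\<lambda>z. \<alpha> (h \<star> z)) x - \<alpha> (h \<star> g) *s x)"
      by (simp add: y_def R_glike_mul that)
    also have "\<dots> \<in> W" using x(4)[of "\<lambda>z. \<alpha> (h \<star> z)"] that by (intro GW) simp_all
    finally show ?thesis .
  qed
  have WfV: "Wf F \<subseteq> V" for F
    unfolding Wf_def using RstableD(2)[OF W(1)] by (intro span_minimal) (auto simp: y_def)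
  have rep: "\<exists>c. z - (\<Sum>h\<in>F. c h *s y h) \<in> W" if "finite F" "z \<in> Wf F" for F z
    using that
  proof (induction F arbitrary: z rule: finite_induct)
    case empty then show ?case using span_eq_iff[THEN iffD2, OF sW] by (simp add: Wf_def)
  next
    case (insert h F)
    then obtain k where "z - k *s y h \<in> Wf F" by (auto simp: Wf_def span_breakdown_eq)
    from insert.IH[OF this] obtain c where "(z - k *s y h) - (\<Sum>h\<in>F. c h *s y h) \<in> W" by blast
    moreover have "(\<Sum>i\<in>insert h F. (c(h := k)) i *s y i) = k *s y h + (\<Sum>i\<in>F. c i *s y i)"
    proof -
      have "(\<Sum>i\<in>F. (c(h := k)) i *s y i) = (\<Sum>i\<in>F. c i *s y i)"
        using insert.hyps by (intro sum.cong) auto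
      then show ?thesis using insert.hyps by simp
    qed
    ultimately show ?case by (intro exI[of _ "c(h := k)"]) (simp add: algebra_simps)
  qed
  have notin: "y h \<notin> Wf F" if F: "finite F" "F \<subseteq> GL" "h \<in> GL" "h \<notin> F" for F h
  proof
    assume "y h \<in> Wf F"
    then obtain c where c: "y h - (\<Sum>i\<in>F. c i *s y i) \<in> W" using rep F by blast
    define x' where "x' i = (if i = h then y h else - c i *s y i)" for i
    have "\<forall>i\<in>insert h F. x' i \<in> W"
    proof (rule weights_independent[OF W(1), of _ "\<lambda>i. i \<star> g"])
      show "finite (insert h F)" using F by simp
      show "inj_on (\<lambda>i. i \<star> g) (insert h F)"
      proof (rule inj_onI)
        fix i j assume "i \<in> insert h F" "j \<in> insert h F" "i \<star> g = j \<star> g"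
        then have "(i \<star> g) \<star> S g = (j \<star> g) \<star> S g" "i \<in> V" "j \<in> V" using F GL_V by auto
        then show "i = j" using S_inv[OF x(3)] by (simp add: mul_assoc)
      qed
      show "R \<alpha> (x' i) - \<alpha> (i \<star> g) *s x' i \<in> W" if "i \<in> insert h F" "lform \<alpha>" for i \<alpha>
      proof -
        have gi: "glike i" using that F by (auto simp: GL_def)
        have "R \<alpha> (x' i) - \<alpha> (i \<star> g) *s x' i
          = (if i = h then 1 else - c i) *s (R \<alpha> (y i) - \<alpha> (i \<star> g) *s y i)"
          by (auto simp: x'_def scale_right_diff_distrib mult.commute)
        then show ?thesis using subspace_scale[OF sW yW[OF that(2) gi]] by simp
      qed
      have "sum x' (insert h F) = y h - (\<Sum>i\<in>F. c i *s y i)"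
      proof -
        have "sum x' F = (\<Sum>i\<in>F. - c i *s y i)" using F by (intro sum.cong) (auto simp: x'_def)
        then show ?thesis using F by (simp add: x'_def sum_negf)
      qed
      then show "sum x' (insert h F) \<in> W" using c by simp
    qed
    then have "y h \<in> W" by (simp add: x'_def)
    then have "S h \<star> y h \<in> W" using F by (intro GW glike_S) (auto simp: GL_def)
    then show False using x(1,2) F by (simp add: y_def GL_def)
  qed
  have dimF: "dim (Wf F) = dim W + card F" if "finite F" "F \<subseteq> GL" for F
    using that
  proof (induction F rule: finite_induct)
    case empty then show ?case by (simp add: Wf_def)
  next
    case (insert h F)
    have "Wf (insert h F) = span (insert (y h) (Wf F))"
    proof (rule antisym)
      show "Wf (insert h F) \<subseteq> span (insert (y h) (Wf F))"
        unfolding Wf_def by (intro span_mono) (auto intro: span_base)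
      show "span (insert (y h) (Wf F)) \<subseteq> Wf (insert h F)"
      proof (rule span_minimal)
        have "y h \<in> Wf (insert h F)" by (auto simp: Wf_def intro: span_base)
        moreover have "Wf F \<subseteq> Wf (insert h F)" unfolding Wf_def by (intro span_mono) auto
        ultimately show "insert (y h) (Wf F) \<subseteq> Wf (insert h F)" by blast
        show "subspace (Wf (insert h F))" by (simp add: Wf_def)
      qed
    qed
    then have "dim (Wf (insert h F)) = Suc (dim (Wf F))"
      using dim_span_insert[of "Wf F" "y h"] notin[of F h] insert WfV[of F]
      by (simp add: Wf_def y_def)
    then show ?case using insert by simp
  qed
  show ?thesis
  proof (rule that[of "Wf GL"])
    show "dim (Wf GL) = dim W + card GL" by (rule dimF[OF finite_GL subset_refl])
    have lin: "f z \<in> Wf GL" if f: "lmap f" "\<And>w. w \<in> W \<Longrightarrow> f w \<in> Wf GL"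
      "\<And>h. glike h \<Longrightarrow> f (y h) \<in> Wf GL" "z \<in> Wf GL" for f z
      using that(4) unfolding Wf_def
    proof (induction rule: span_induct_alt)
      case base then show ?case by (simp add: lmap_simps[OF f(1)] span_zero)
    next
      case (step c a b)
      then have "f a \<in> span (W \<union> y ` GL)" using f(2,3) by (auto simp: Wf_def GL_def)
      with step(2) show ?case by (simp add: lmap_simps[OF f(1)] span_add span_scale)
    qed
    have WW: "w \<in> Wf GL" if "w \<in> W" for w using that by (auto simp: Wf_def intro: span_base)
    have yy: "y h \<in> Wf GL" if "glike h" for h using that by (auto simp: Wf_def GL_def intro: span_base)
    have sWf: "subspace (Wf GL)" by (simp add: Wf_def)
    show "h \<star> z \<in> Wf GL" if h: "glike h" "z \<in> Wf GL" for h z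
    proof (rule lin[OF _ _ _ h(2)])
      show "h \<star> y h' \<in> Wf GL" if "glike h'" for h'
        using yy[OF glike_mul[OF h(1) that]] by (simp add: y_def mul_assoc)
    qed (use WW GW h in auto)
    show "Rstable (Wf GL)"
      unfolding Rstable_def
    proof (intro conjI allI impI sWf WfV)
      fix \<alpha> z assume al: "lform \<alpha>" and z: "z \<in> Wf GL"
      show "R \<alpha> z \<in> Wf GL"
      proof (rule lin[OF R_lmap _ _ z])
        show "R \<alpha> w \<in> Wf GL" if "w \<in> W" for w using WW RstableD(3)[OF W(1) al that] .
        show "R \<alpha> (y h) \<in> Wf GL" if "glike h" for h
        proof -
          have "(R \<alpha> (y h) - \<alpha> (h \<star> g) *s y h) + \<alpha> (h \<star> g) *s y h \<in> Wf GL"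
            using WW[OF yW[OF al that]] yy[OF that] sWf by (intro subspace_add subspace_scale)
          then show ?thesis by simp
        qed
      qed
    qed
  qed
qed

text \<open>
  A substitute for the freeness of \<open>V\<close> over the group algebra of its group-likes: by \<open>GL_extend\<close>, a
  maximal member of a family of subspaces with dimension divisible by \<open>card GL\<close> is \<open>V\<close>.
\<close>

lemma card_GL_dvd:
  assumes P: "pointed_coalg" shows "card GL dvd card B"
proof -
  define Q where "Q W \<longleftrightarrow> Rstable W \<and> (\<forall>h x. glike h \<longrightarrow> x \<in> W \<longrightarrow> h \<star> x \<in> W) \<and> card GL dvd dim W" for W
  have "dim {0} = 0" using dim_span_eq_card_independent[OF independent_empty] by (simp add: span_empty)
  then have "Q {0}" using Rstable_0 by (simp add: Q_def)
  moreover have "\<forall>W. Q W \<longrightarrow> dim W < Suc (card B)"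
    using dim_mono_V[OF RstableD(2) subspace_V RstableD(1)] dim_V by (auto simp: Q_def less_Suc_eq_le)
  ultimately obtain W where W: "Q W" "\<And>W'. Q W' \<Longrightarrow> dim W' \<le> dim W"
    using ex_has_greatest_nat[of Q "{0}" dim "Suc (card B)"] by blast
  have "W = V"
  proof (rule ccontr)
    assume "W \<noteq> V"
    with GL_extend[OF P] W(1) obtain W' where "Rstable W'" "\<And>h x. glike h \<Longrightarrow> x \<in> W' \<Longrightarrow> h \<star> x \<in> W'"
      "dim W' = dim W + card GL" unfolding Q_def by (metis (full_types))
    then have "Q W'" "dim W' = dim W + card GL" using W(1) by (auto simp: Q_def)
    then have "card GL = 0" using W(2) by fastforce
    then show False using finite_GL e1_glike by (auto simp: GL_def)
  qed
  then show ?thesis using W(1) dim_V by (simp add: Q_def)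
qed

primrec pw :: "'v \<Rightarrow> nat \<Rightarrow> 'v" where
  "pw x 0 = e1" | "pw x (Suc n) = x \<star> pw x n"

lemma pw_V [simp]: "pw x n \<in> V" by (cases n) auto

lemma pw_add: "pw x (m + n) = pw x m \<star> pw x n"
  by (induction m) (auto simp: mul_assoc)

lemma pw_comm: "x \<in> V \<Longrightarrow> pw x n \<star> x = x \<star> pw x n"
  using pw_add[of x n 1] pw_add[of x 1 n] by simp

lemma pw_glike: "glike u \<Longrightarrow> glike (pw u n)"
  by (induction n) (auto simp: e1_glike glike_mul)

text \<open>
  The group-likes as a group record, for Lagrange's theorem.
\<close>

definition GG :: "'v monoid" where "GG = \<lparr>carrier = GL, monoid.mult = (\<star>), one = e1\<rparr>"

lemma group_GG: "group GG"
proof (rule groupI)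
  fix x assume x: "x \<in> carrier GG"
  have "S x \<in> carrier GG \<and> S x \<otimes>\<^bsub>GG\<^esub> x = \<one>\<^bsub>GG\<^esub>"
    using x glike_S[of x] S_inv[of x] by (simp add: GG_def GL_def)
  then show "\<exists>y\<in>carrier GG. y \<otimes>\<^bsub>GG\<^esub> x = \<one>\<^bsub>GG\<^esub>" by blast
qed (auto simp: GG_def GL_def glike_mul e1_glike mul_assoc dest: glikeD)

lemma pow_GG: "u \<in> GL \<Longrightarrow> u [^]\<^bsub>GG\<^esub> (n::nat) = pw u n"
proof (induction n)
  case 0 then show ?case by (simp add: GG_def nat_pow_def)
next
  case (Suc n)
  interpret group GG by (rule group_GG)
  have "u [^]\<^bsub>GG\<^esub> Suc n = pw u n \<star> u" using Suc by (simp add: GG_def)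
  then show ?case using Suc.prems GL_V by (simp add: pw_comm subset_iff)
qed

lemma pw_card_GL: "glike u \<Longrightarrow> pw u (card GL) = e1"
proof -
  assume "glike u"
  then have u: "u \<in> GL" by (simp add: GL_def)
  interpret group GG by (rule group_GG)
  have "u [^]\<^bsub>GG\<^esub> Coset.order GG = \<one>\<^bsub>GG\<^esub>" using u by (intro pow_order_eq_1) (simp add: GG_def)
  then show ?thesis using pow_GG[OF u] by (simp add: Coset.order_def GG_def)
qed

end


section \<open>Group-likes and skew-primitives generating a Taft algebra\<close>

context kspace begin

text \<open>
  If \<open>q(T) z = 0\<close>, split a linear factor \<open>t - \<omega>\<close> off \<open>q\<close>: either \<open>(T - \<omega>) z = 0\<close>, or the remaining
  factor kills \<open>(T - \<omega>) z\<close>.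
\<close>

lemma eigenvector_of_root:
  fixes q :: "'a poly"
  assumes AC: "\<And>q :: 'a poly. Polynomial.degree q > 0 \<Longrightarrow> \<exists>z. poly q z = 0"
    and T: "lmap T" and P: "subspace P" "\<And>z. z \<in> P \<Longrightarrow> T z \<in> P"
  shows "\<lbrakk>q \<noteq> 0; Polynomial.degree q \<le> n; z \<in> P; z \<noteq> 0; (\<Sum>i\<le>n. Polynomial.coeff q i *s (T ^^ i) z) = 0\<rbrakk> \<Longrightarrow>
    \<exists>\<omega> z'. poly q \<omega> = 0 \<and> z' \<in> P \<and> z' \<noteq> 0 \<and> T z' = \<omega> *s z'"
proof (induction n arbitrary: q z)
  case 0
  then have "q = [:Polynomial.coeff q 0:]" using degree_eq_zeroE[of q] by force
  moreover have "Polynomial.coeff q 0 = 0" using 0 by simp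
  ultimately show ?case using 0 by simp
next
  case (Suc n)
  show ?case
  proof (cases "Polynomial.degree q = 0")
    case True
    then obtain c where c: "q = [:c:]" using degree_eq_zeroE by blast
    have "(\<Sum>i\<le>Suc n. Polynomial.coeff q i *s (T ^^ i) z) = (\<Sum>i\<le>Suc n. if i = 0 then c *s z else 0)"
      by (intro sum.cong) (auto simp: c coeff_pCons split: nat.splits)
    then show ?thesis using Suc.prems c by simp
  next
    case False
    then obtain \<omega> where w: "poly q \<omega> = 0" using AC by blast
    then obtain r where r: "q = [:- \<omega>, 1:] * r" using poly_eq_0_iff_dvd by blast
    have r0: "r \<noteq> 0" using Suc.prems(1) r by auto
    have dr: "Polynomial.degree r \<le> n" using Suc.prems(2) r0 by (simp add: r degree_mult_eq del: mult_pCons_left)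
    have Ti: "lmap (T ^^ i)" for i using T by (induction i) (auto simp: lmap_def)
    define y where "y = T z - \<omega> *s z"
    have q: "Polynomial.coeff q i = (case i of 0 \<Rightarrow> 0 | Suc j \<Rightarrow> Polynomial.coeff r j) - \<omega> * Polynomial.coeff r i" for i
      by (simp add: r coeff_pCons split: nat.splits)
    have "(\<Sum>i\<le>Suc n. Polynomial.coeff q i *s (T ^^ i) z)
      = (\<Sum>i\<le>Suc n. (case i of 0 \<Rightarrow> 0 | Suc j \<Rightarrow> Polynomial.coeff r j) *s (T ^^ i) z)
        - (\<Sum>i\<le>Suc n. (\<omega> * Polynomial.coeff r i) *s (T ^^ i) z)"
      by (simp add: q scale_left_diff_distrib sum_subtractf del: sum.atMost_Suc)
    also have "(\<Sum>i\<le>Suc n. (case i of 0 \<Rightarrow> 0 | Suc j \<Rightarrow> Polynomial.coeff r j) *s (T ^^ i) z)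
      = (\<Sum>i\<le>n. Polynomial.coeff r i *s (T ^^ i) (T z))"
      by (simp add: sum.atMost_Suc_shift funpow_swap1 del: sum.atMost_Suc)
    also have "(\<Sum>i\<le>Suc n. (\<omega> * Polynomial.coeff r i) *s (T ^^ i) z) = (\<Sum>i\<le>n. Polynomial.coeff r i *s (T ^^ i) (\<omega> *s z))"
      using dr by (simp add: coeff_eq_0 lmap_scale[OF Ti] mult.commute)
    finally have "(\<Sum>i\<le>n. Polynomial.coeff r i *s (T ^^ i) y) = 0"
      using Suc.prems(5) by (simp add: y_def lmap_diff[OF Ti] scale_right_diff_distrib sum_subtractf)
    moreover have "y \<in> P" unfolding y_def using Suc.prems(3) P by (intro subspace_diff subspace_scale) auto
    ultimately show ?thesis
    proof (cases "y = 0")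
      case True
      then have "T z = \<omega> *s z" by (simp add: y_def)
      then show ?thesis using w Suc.prems by blast
    next
      case False
      with Suc.IH[OF r0 dr \<open>y \<in> P\<close> False] \<open>(\<Sum>i\<le>n. Polynomial.coeff r i *s (T ^^ i) y) = 0\<close> obtain \<omega>' z'
        where "poly r \<omega>' = 0" "z' \<in> P" "z' \<noteq> 0" "T z' = \<omega>' *s z'" by blast
      moreover have "poly q \<omega>' = 0" using calculation(1) by (simp add: r del: mult_pCons_left)
      ultimately show ?thesis by blast
    qed
  qed
qed

end

context fd_hopf begin

lemma conj_lmap: "lmap (\<lambda>z. u \<star> (z \<star> v))" by (simp add: lmap_def)

text \<open>
  Conjugation \<open>T\<close> by \<open>u\<close> acts on the skew-primitives for \<open>u\<close> and satisfies \<open>T\<^sup>n x = x\<close> for \<open>n = card GL\<close>. So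
  \<open>q = 1 + t + ... + t\<^bsup>n - 1\<^esup>\<close> kills \<open>T x - x\<close>, which is nonzero. An eigenvalue that is a root of \<open>q\<close>
  differs from \<open>1\<close> because \<open>q(1) = n\<close> is invertible.
\<close>

lemma skew_eigenvector:
  assumes AC: "\<And>q :: 'k poly. Polynomial.degree q > 0 \<Longrightarrow> \<exists>z. poly q z = 0"
    and N: "of_nat (card GL) \<noteq> (0::'k)"
    and u: "glike u" and x: "skew u e1 x" and ne: "u \<star> x \<noteq> x \<star> u"
  obtains z \<omega> where "skew u e1 z" "z \<noteq> 0" "\<omega> \<noteq> 1" "u \<star> z = \<omega> *s (z \<star> u)"
proof -
  define n where "n = card GL"
  define T where "T z = u \<star> (z \<star> S u)" for z
  have T: "lmap T" using conj_lmap[of u "S u"] by (simp add: T_def[abs_def])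
  have uV: "u \<in> V" and xV: "x \<in> V" using u x by (auto simp: glikeD skew_def)
  note Su = glike_S[OF u]
  define P where "P = {z. skew u e1 z}"
  have P: "subspace P"
    by (rule subspaceI) (auto simp: P_def skew_def lform_simps scale_right_distrib scale_left_distrib mult.commute algebra_simps)
  have TP: "T z \<in> P" if "z \<in> P" for z
  proof -
    have z: "skew u e1 z" using that by (simp add: P_def)
    have "R \<alpha> (T z) = \<alpha> e1 *s T z + \<alpha> (T z) *s u" if al: "lform \<alpha>" for \<alpha>
    proof -
      have "R \<alpha> (T z) = u \<star> (R (\<lambda>y. \<alpha> (u \<star> (y \<star> S u))) z \<star> S u)"
        by (simp add: T_def R_glike_mul[OF al u] R_mul_glike[OF _ Su] al)
      also have "R (\<lambda>y. \<alpha> (u \<star> (y \<star> S u))) z = \<alpha> e1 *s z + \<alpha> (T z) *s u"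
      proof -
        have "lform (\<lambda>y. \<alpha> (u \<star> (y \<star> S u)))" using al by (simp add: lform_def)
        then have "R (\<lambda>y. \<alpha> (u \<star> (y \<star> S u))) z = \<alpha> (u \<star> (e1 \<star> S u)) *s z + \<alpha> (u \<star> (z \<star> S u)) *s u"
          using z unfolding skew_def by blast
        then show ?thesis using S_inv[OF u] by (simp add: T_def)
      qed
      also have "u \<star> ((\<alpha> e1 *s z + \<alpha> (T z) *s u) \<star> S u) = \<alpha> e1 *s T z + \<alpha> (T z) *s u"
        using S_inv[OF u] uV by (simp add: T_def)
      finally show ?thesis .
    qed
    then show ?thesis by (simp add: P_def skew_def T_def)
  qed
  have Ti: "(T ^^ i) z = pw u i \<star> (z \<star> pw (S u) i)" if "z \<in> V" for i z
    using that
  proof (induction i)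
    case (Suc i)
    then show ?case using pw_comm[of "S u" i] by (simp add: T_def mul_assoc)
  qed simp
  have Tn: "(T ^^ n) x = x"
    using Ti[OF xV, of n] pw_card_GL[OF u] pw_card_GL[OF Su] xV by (simp add: n_def)
  define y where "y = T x - x"
  have "x \<in> P" using x by (simp add: P_def)
  then have yP: "y \<in> P" unfolding y_def using P TP by (intro subspace_diff) auto
  have y0: "y \<noteq> 0"
  proof
    assume "y = 0"
    then have "(u \<star> (x \<star> S u)) \<star> u = x \<star> u" by (simp add: y_def T_def)
    then show False using ne S_inv[OF u] xV by (simp add: mul_assoc)
  qed
  have Tl: "lmap (T ^^ i)" for i using T by (induction i) (auto simp: lmap_def)
  define q :: "'k poly" where "q = (\<Sum>i<n. Polynomial.monom 1 i)"
  have cq: "Polynomial.coeff q i = (if i < n then 1 else 0)" for i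
    by (simp add: q_def coeff_sum)
  have q1: "poly q 1 = of_nat n" by (simp add: q_def poly_sum poly_monom)
  have "q \<noteq> 0" using q1 N by (auto simp: n_def)
  moreover have "Polynomial.degree q \<le> n" by (rule degree_le) (simp add: cq)
  moreover have "(\<Sum>i\<le>n. Polynomial.coeff q i *s (T ^^ i) y) = 0"
  proof -
    have "(\<Sum>i\<le>n. Polynomial.coeff q i *s (T ^^ i) y) = (\<Sum>i<n. (T ^^ i) y)"
      by (simp add: cq lessThan_Suc_atMost[symmetric])
    also have "\<dots> = (\<Sum>i<n. (T ^^ Suc i) x - (T ^^ i) x)"
      by (simp add: y_def lmap_diff[OF Tl] funpow_swap1)
    also have "\<dots> = (T ^^ n) x - (T ^^ 0) x" by (rule sum_lessThan_telescope)
    finally show ?thesis using Tn by simp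
  qed
  ultimately obtain \<omega> z where z: "poly q \<omega> = 0" "z \<in> P" "z \<noteq> 0" "T z = \<omega> *s z"
    using eigenvector_of_root[OF AC T P TP, of q n y] yP y0 by blast
  have zV: "z \<in> V" using z(2) by (simp add: P_def skew_def)
  have "T z \<star> u = (\<omega> *s z) \<star> u" using z(4) by simp
  then have "u \<star> z = \<omega> *s (z \<star> u)" using S_inv[OF u] zV by (simp add: T_def mul_assoc)
  moreover have "\<omega> \<noteq> 1" using z(1) q1 N by (auto simp: n_def)
  ultimately show ?thesis using that z by (auto simp: P_def)
qed

end

text \<open>
  The remaining relation \<open>x\<^sup>p = 0\<close> of the Taft algebra is derived in \<open>pw_x_p\<close>.
\<close>

locale taft_pair = fd_hopf +
  fixes u x :: 'b and \<omega> :: 'a and p :: nat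
  assumes u: "glike u" and x: "skew u e1 x" and x0: "x \<noteq> 0"
    and ux: "u \<star> x = \<omega> *s (x \<star> u)"
    and p2: "2 \<le> p" and wp: "\<omega> ^ p = 1" and wm: "\<And>m. 0 < m \<Longrightarrow> m < p \<Longrightarrow> \<omega> ^ m \<noteq> 1"
    and up: "pw u p = e1" and cB: "card B = p ^ 2"
begin

lemma uV [simp]: "u \<in> V" and xV [simp]: "x \<in> V" using u x by (auto simp: glikeD skew_def)

lemma w0: "\<omega> \<noteq> 0" using wp p2 by (auto simp: power_0_left)

lemma w_inj: "\<omega> ^ a = \<omega> ^ b \<Longrightarrow> a < p \<Longrightarrow> b < p \<Longrightarrow> a = b"
proof (induction a b rule: linorder_wlog)
  case (le a b)
  have "\<omega> ^ a * \<omega> ^ (b - a) = \<omega> ^ (a + (b - a))" by (rule power_add[symmetric])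
  then have "\<omega> ^ b = \<omega> ^ a * \<omega> ^ (b - a)" using le(1) by simp
  then have "\<omega> ^ (b - a) = 1" using le(2) w0 by simp
  then show ?case using wm[of "b - a"] le by force
next
  case (sym a b) then show ?case by metis
qed

lemma w_neq: "l < m \<Longrightarrow> m < p \<Longrightarrow> \<omega> ^ m \<noteq> \<omega> ^ l"
  using w_inj[of m l] by force

text \<open>
  The prospective basis of monomials \<open>u\<^sup>a x\<^sup>l\<close>, and the filtration \<open>VV\<close> by degree in \<open>x\<close>.
\<close>

definition mm :: "nat \<Rightarrow> nat \<Rightarrow> 'b" where "mm a l = pw u a \<star> pw x l"

definition VV :: "nat \<Rightarrow> 'b set" where "VV i = span {mm a l | a l. l < i}"

lemma mm_V [simp]: "mm a l \<in> V" by (simp add: mm_def)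

lemma VV_V: "VV i \<subseteq> V" unfolding VV_def by (intro span_minimal) auto

lemma VV_sub [simp]: "subspace (VV i)" by (simp add: VV_def)

lemma mm_VV: "l < i \<Longrightarrow> mm a l \<in> VV i" unfolding VV_def by (intro span_base) blast

lemma VV_mono: "i \<le> j \<Longrightarrow> VV i \<subseteq> VV j"
  unfolding VV_def by (intro span_mono) (use less_le_trans in blast)

lemma VV_map:
  assumes f: "lmap f" "\<And>a l. l < i \<Longrightarrow> f (mm a l) \<in> W" and W: "subspace W" and v: "v \<in> VV i"
  shows "f v \<in> W"
  using v unfolding VV_def
proof (induction rule: span_induct_alt)
  case base then show ?case using subspace_0[OF W] by (simp add: lmap_0[OF f(1)])
next
  case (step c a b)
  then have "f a \<in> W" using f(2) by blast
  with step(2) show ?case by (simp add: lmap_simps[OF f(1)] subspace_add[OF W] subspace_scale[OF W])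
qed

lemma u_pw_x: "u \<star> pw x l = \<omega> ^ l *s (pw x l \<star> u)"
proof (induction l)
  case (Suc l)
  have "u \<star> pw x (Suc l) = (u \<star> x) \<star> pw x l" by (simp add: mul_assoc)
  also have "\<dots> = \<omega> *s (x \<star> (u \<star> pw x l))" by (simp only: ux mul_simps mul_assoc)
  finally show ?case by (simp add: Suc mul_assoc)
qed simp

lemma x_pw_u: "x \<star> pw u a = inverse \<omega> ^ a *s (pw u a \<star> x)"
proof (induction a)
  case (Suc a)
  have "inverse \<omega> *s (u \<star> x) = x \<star> u" using w0 by (simp add: ux)
  then have "x \<star> u = inverse \<omega> *s (u \<star> x)" by simp
  then have "x \<star> pw u (Suc a) = inverse \<omega> *s (u \<star> (x \<star> pw u a))" by (simp add: mul_assoc[symmetric])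
  then show ?case by (simp add: Suc mul_assoc)
qed simp

text \<open>
  Conjugation by \<open>u\<close>; it has the eigenvalue \<open>\<omega>\<^sup>l\<close> on the monomials of degree \<open>l\<close>.
\<close>

definition T :: "'b \<Rightarrow> 'b" where "T v = u \<star> (v \<star> S u)"

lemma T_lmap: "lmap T" using conj_lmap[of u "S u"] by (simp add: T_def[abs_def])

lemma T_mm: "T (mm a l) = \<omega> ^ l *s mm a l"
proof -
  have "T (mm a l) = (u \<star> pw u a) \<star> (pw x l \<star> S u)" by (simp add: T_def mm_def mul_assoc)
  also have "u \<star> pw u a = pw u a \<star> u" by (simp add: pw_comm)
  also have "(pw u a \<star> u) \<star> (pw x l \<star> S u) = pw u a \<star> ((u \<star> pw x l) \<star> S u)" by (simp add: mul_assoc)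
  also have "\<dots> = \<omega> ^ l *s mm a l" using S_inv[OF u] by (simp add: u_pw_x mul_assoc mm_def)
  finally show ?thesis .
qed

lemma VV_T: "v \<in> VV (Suc i) \<Longrightarrow> T v - \<omega> ^ i *s v \<in> VV i"
proof (rule VV_map[of "\<lambda>v. T v - \<omega> ^ i *s v" "Suc i"])
  show "lmap (\<lambda>v. T v - \<omega> ^ i *s v)"
    by (simp add: lmap_def lmap_simps[OF T_lmap] algebra_simps)
  show "T (mm a l) - \<omega> ^ i *s mm a l \<in> VV i" if "l < Suc i" for a l
    using that mm_VV[of l i a] by (cases "l = i") (auto simp: T_mm subspace_0 subspace_diff subspace_scale)
qed auto

text \<open>
  Below degree \<open>i\<close> only the eigenvalues \<open>\<omega>\<^sup>l\<close> with \<open>l < i\<close> occur, even before the monomials are known to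
  be independent.
\<close>

lemma VV_eig: "\<lbrakk>v \<in> VV i; T v = \<mu> *s v; \<And>l. l < i \<Longrightarrow> \<mu> \<noteq> \<omega> ^ l\<rbrakk> \<Longrightarrow> v = 0"
proof (induction i)
  case 0 then show ?case by (simp add: VV_def)
next
  case (Suc i)
  have "(\<mu> - \<omega> ^ i) *s v \<in> VV i"
    using VV_T[OF Suc.prems(1)] Suc.prems(2) by (simp add: scale_left_diff_distrib)
  then have "inverse (\<mu> - \<omega> ^ i) *s ((\<mu> - \<omega> ^ i) *s v) \<in> VV i" by (rule subspace_scale[OF VV_sub])
  then have "v \<in> VV i" using Suc.prems(3)[of i] by simp
  then show ?case using Suc.IH Suc.prems by simp
qed

lemma VV_x: "v \<in> VV i \<Longrightarrow> x \<star> v \<in> VV (Suc i)"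
proof (rule VV_map[of "\<lambda>v. x \<star> v" i])
  show "x \<star> mm a l \<in> VV (Suc i)" if "l < i" for a l
  proof -
    have "x \<star> mm a l = inverse \<omega> ^ a *s mm a (Suc l)"
      by (simp add: mm_def mul_assoc[symmetric] x_pw_u)
    then show ?thesis using that mm_VV[of "Suc l" "Suc i" a] by (simp add: subspace_scale)
  qed
qed auto

lemma VV_u: "v \<in> VV i \<Longrightarrow> u \<star> v \<in> VV i"
proof (rule VV_map[of "\<lambda>v. u \<star> v" i])
  show "u \<star> mm a l \<in> VV i" if "l < i" for a l
    using that mm_VV[of l i "Suc a"] by (simp add: mm_def mul_assoc)
qed auto

lemma VV_pw_u: "v \<in> VV i \<Longrightarrow> pw u a \<star> v \<in> VV i"
  using VV_V[of i] by (induction a) (auto simp: VV_u mul_assoc)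

text \<open>
  The quantum integer of \<open>m\<close> at \<open>\<omega>\<inverse>\<close>.
\<close>

definition ss :: "nat \<Rightarrow> 'a" where "ss m = (\<Sum>l<m. inverse \<omega> ^ l)"

lemma ss_Suc: "ss (Suc m) = 1 + inverse \<omega> * ss m"
  unfolding ss_def by (simp add: sum.lessThan_Suc_shift sum_distrib_left del: sum.lessThan_Suc)

lemma ss_nz: assumes "0 < m" "m < p" shows "ss m \<noteq> 0"
proof
  assume "ss m = 0"
  then have "inverse \<omega> ^ m = 1" using ss_Suc[of m] by (simp add: ss_def)
  then have "\<omega> ^ m = 1" by (simp add: power_inverse)
  then show False using wm assms by blast
qed

lemma pw_x_VV: "pw x l \<in> VV (Suc l)"
  using mm_VV[of l "Suc l" 0] by (simp add: mm_def)

text \<open>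
  The two leading terms of the quantum binomial formula for \<open>\<Delta>(x\<^sup>m\<^sup>+\<^sup>1)\<close>, where the left tensor factors
  are taken modulo degree less than \<open>m\<close>.
\<close>

lemma R_pw_x:
  "lform \<alpha> \<Longrightarrow> R \<alpha> (pw x (Suc m)) - (\<alpha> e1 *s pw x (Suc m) + (ss (Suc m) * \<alpha> x) *s (u \<star> pw x m)) \<in> VV m"
proof (induction m arbitrary: \<alpha>)
  case 0
  then have "R \<alpha> x = \<alpha> e1 *s x + \<alpha> x *s u" using x by (simp add: skew_def)
  then show ?case by (simp add: ss_def subspace_0)
next
  case (Suc m)
  note al = Suc.prems
  define y where "y = pw x (Suc m)"
  define v where "v \<alpha> = R \<alpha> y - (\<alpha> e1 *s y + (ss (Suc m) * \<alpha> x) *s (u \<star> pw x m))" for \<alpha>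
  have v: "v \<alpha> \<in> VV m" if "lform \<alpha>" for \<alpha> using Suc.IH[OF that] by (simp add: v_def y_def)
  have Ry: "R \<alpha> y = \<alpha> e1 *s y + (ss (Suc m) * \<alpha> x) *s (u \<star> pw x m) + v \<alpha>" for \<alpha> by (simp add: v_def)
  have xu: "x \<star> (u \<star> pw x m) = inverse \<omega> *s (u \<star> y)"
    using x_pw_u[of 1] by (simp add: mul_assoc[symmetric] y_def)
  have yV: "y \<in> V" by (simp add: y_def)
  define al1 where "al1 = (\<lambda>z. \<alpha> (e1 \<star> z))"
  define al2 where "al2 = (\<lambda>z. \<alpha> (x \<star> z))"
  have l12: "lform al1" "lform al2" using al by (simp_all add: al1_def al2_def)
  have "R \<alpha> (x \<star> y) = x \<star> R al1 y + u \<star> R al2 y"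
    unfolding al1_def al2_def by (rule R_skew_mul[OF al x e1_V])
  also have "\<dots> = \<alpha> e1 *s (x \<star> y) + (ss (Suc m) * \<alpha> x) *s (inverse \<omega> *s (u \<star> y)) + x \<star> v al1
      + (\<alpha> x *s (u \<star> y) + (ss (Suc m) * al2 x) *s (u \<star> (u \<star> pw x m)) + u \<star> v al2)"
    unfolding Ry using xu yV by (simp add: al1_def al2_def)
  finally have "R \<alpha> (x \<star> y) - (\<alpha> e1 *s (x \<star> y) + (ss (Suc (Suc m)) * \<alpha> x) *s (u \<star> y))
      = x \<star> v al1 + ((ss (Suc m) * al2 x) *s (u \<star> (u \<star> pw x m)) + u \<star> v al2)"
    by (simp add: ss_Suc[of "Suc m"] scale_left_distrib distrib_left distrib_right mult.commute mult.left_commute)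
  also have "\<dots> \<in> VV (Suc m)"
    using VV_mono[of m "Suc m"] v l12 pw_x_VV
    by (intro subspace_add subspace_scale VV_x VV_u VV_sub) auto
  finally show ?case by (simp add: y_def)
qed

lemma mm_weight: "lform \<alpha> \<Longrightarrow> R \<alpha> (mm a l) - \<alpha> (pw u a) *s mm a l \<in> VV l"
proof -
  assume al: "lform \<alpha>"
  note ua = pw_glike[OF u, of a]
  define \<beta> where "\<beta> = (\<lambda>z. \<alpha> (pw u a \<star> z))"
  have be: "lform \<beta>" using al by (simp add: \<beta>_def)
  have "R \<beta> (pw x l) - \<beta> e1 *s pw x l \<in> VV l"
  proof (cases l)
    case 0 then show ?thesis using glikeD(3)[OF e1_glike be] by (simp add: subspace_0)
  next
    case (Suc m)
    have "(R \<beta> (pw x (Suc m)) - (\<beta> e1 *s pw x (Suc m) + (ss (Suc m) * \<beta> x) *s (u \<star> pw x m)))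
        + (ss (Suc m) * \<beta> x) *s (u \<star> pw x m) \<in> VV (Suc m)"
      using R_pw_x[OF be] VV_mono[of m "Suc m"] pw_x_VV by (intro subspace_add subspace_scale VV_u VV_sub) auto
    then show ?thesis by (simp add: Suc algebra_simps)
  qed
  from VV_pw_u[OF this, of a] show ?thesis
    by (simp add: mm_def R_glike_mul[OF al ua] \<beta>_def)
qed

lemma VV_Rstable: "Rstable (VV i)"
  unfolding Rstable_def
proof (intro conjI allI impI VV_sub VV_V)
  fix \<alpha> v assume al: "lform \<alpha>" and v: "v \<in> VV i"
  show "R \<alpha> v \<in> VV i"
  proof (rule VV_map[OF R_lmap _ VV_sub v])
    fix a l assume l: "l < i"
    have "(R \<alpha> (mm a l) - \<alpha> (pw u a) *s mm a l) + \<alpha> (pw u a) *s mm a l \<in> VV i"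
      using mm_weight[OF al, of a l] VV_mono[of l i] mm_VV[OF l] l
      by (intro subspace_add subspace_scale VV_sub) auto
    then show "R \<alpha> (mm a l) \<in> VV i" by simp
  qed
qed

text \<open>
  If \<open>x\<^sup>m\<^sup>+\<^sup>1 = 0\<close>, the second term of \<open>R_pw_x\<close> puts \<open>u x\<^sup>m\<close> into degree less than \<open>m\<close>, which its
  eigenvalue under conjugation forbids.
\<close>

lemma pw_x_nz: "i < p \<Longrightarrow> pw x i \<noteq> 0"
proof (induction i)
  case 0 then show ?case using glike_nz[OF e1_glike] by simp
next
  case (Suc m)
  show ?case
  proof
    assume xm: "pw x (Suc m) = 0"
    have "x \<notin> {0}" using x0 by simp
    then obtain \<alpha> where al: "lform \<alpha>" "\<alpha> x = 1" using separating_form[OF subspace_single_0] by metis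
    have "- (ss (Suc m) *s (u \<star> pw x m)) \<in> VV m"
      using R_pw_x[OF al(1), of m] xm al(2) by simp
    then have "(- inverse (ss (Suc m))) *s - (ss (Suc m) *s (u \<star> pw x m)) \<in> VV m"
      by (rule subspace_scale[OF VV_sub])
    then have "u \<star> pw x m \<in> VV m" using ss_nz[of "Suc m"] Suc.prems by simp
    moreover have "T (u \<star> pw x m) = \<omega> ^ m *s (u \<star> pw x m)" using T_mm[of 1 m] by (simp add: mm_def)
    ultimately have "u \<star> pw x m = 0" using w_neq[of _ m] Suc.prems by (intro VV_eig[of _ m "\<omega> ^ m"]) auto
    then have "S u \<star> (u \<star> pw x m) = 0" by simp
    then show False using u Suc by simp
  qed
qed

lemma mm_nz: "l < p \<Longrightarrow> mm a l \<noteq> 0"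
proof
  assume l: "l < p" and "mm a l = 0"
  then have "S (pw u a) \<star> mm a l = 0" by simp
  then show False using pw_glike[OF u, of a] pw_x_nz[OF l] by (simp add: mm_def)
qed

lemma pw_u_inj: "inj_on (pw u) {..<p}"
proof (rule inj_onI)
  fix a b assume ab: "a \<in> {..<p}" "b \<in> {..<p}" "pw u a = pw u b"
  have "inverse \<omega> ^ a *s mm a 1 = x \<star> pw u a" by (simp add: x_pw_u mm_def)
  also have "\<dots> = inverse \<omega> ^ b *s mm b 1" unfolding ab(3) by (simp add: x_pw_u mm_def)
  also have "mm b 1 = mm a 1" using ab(3) by (simp add: mm_def)
  finally have "inverse \<omega> ^ a = inverse \<omega> ^ b"
    unfolding scale_cancel_right using mm_nz[of 1 a] p2 by simp
  then show "a = b" using w_inj[of a b] ab by (simp add: power_inverse)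
qed

text \<open>
  In top degree, weights under the coaction separate the exponents of \<open>u\<close>; each single monomial is then
  of lower degree, and its eigenvalue under conjugation makes it vanish.
\<close>

lemma mm_indep:
  "m \<le> p \<Longrightarrow> (\<Sum>l<m. \<Sum>a<p. c a l *s mm a l) = 0 \<Longrightarrow> l < m \<Longrightarrow> a < p \<Longrightarrow> c a l = 0"
proof (induction m arbitrary: l a)
  case (Suc m)
  have low: "(\<Sum>l<m. \<Sum>a<p. c a l *s mm a l) \<in> VV m"
    by (intro subspace_sum subspace_scale VV_sub mm_VV) auto
  have "(\<Sum>a<p. c a m *s mm a m) = - (\<Sum>l<m. \<Sum>a<p. c a l *s mm a l)"
    using Suc.prems(2) by (simp add: eq_neg_iff_add_eq_0 add.commute)
  then have s: "(\<Sum>a<p. c a m *s mm a m) \<in> VV m" using subspace_neg[OF VV_sub low] by simp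
  have "\<forall>a\<in>{..<p}. c a m *s mm a m \<in> VV m"
  proof (rule weights_independent[OF VV_Rstable, of _ "pw u"])
    fix a \<alpha> assume "a \<in> {..<p}" and al: "lform \<alpha>"
    have "c a m *s (R \<alpha> (mm a m) - \<alpha> (pw u a) *s mm a m) \<in> VV m"
      by (intro subspace_scale VV_sub mm_weight al)
    then show "R \<alpha> (c a m *s mm a m) - \<alpha> (pw u a) *s c a m *s mm a m \<in> VV m"
      by (simp add: scale_right_diff_distrib mult.commute)
  qed (use pw_u_inj s in auto)
  moreover have "T (c a m *s mm a m) = \<omega> ^ m *s (c a m *s mm a m)" for a
    by (simp add: lmap_scale[OF T_lmap] T_mm mult.commute)
  ultimately have cm: "c a m *s mm a m = 0" if "a < p" for a
    using w_neq[of _ m] Suc.prems(1) that by (intro VV_eig[of _ m "\<omega> ^ m"]) auto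
  then have top: "c a m = 0" if "a < p" for a
    using mm_nz[of m a] Suc.prems(1) cm[OF that] by simp
  then have "(\<Sum>l<m. \<Sum>a<p. c a l *s mm a l) = 0" using Suc.prems(2) by simp
  then show ?case using Suc.IH[of l a] Suc.prems top by (cases "l = m") auto
qed simp

lemma mm_coeff_zero: "(\<Sum>l<p. \<Sum>a<p. c a l *s mm a l) = 0 \<Longrightarrow> l < p \<Longrightarrow> a < p \<Longrightarrow> c a l = 0"
  using mm_indep[of p c l a] by simp

text \<open>
  There are \<open>p\<^sup>2\<close> monomials, as many as the dimension.
\<close>

lemma mm_spans:
  assumes "v \<in> V" obtains c where "v = (\<Sum>l<p. \<Sum>a<p. c a l *s mm a l)"
proof -
  let ?I = "{..<p} \<times> {..<p}"
  have "\<exists>c. v = (\<Sum>i\<in>?I. c i *s (\<lambda>(l, a). mm a l) i)"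
  proof (rule family_spans[OF _ _ _ _ assms, of ?I "\<lambda>(l, a). mm a l"])
    fix c assume "(\<Sum>i\<in>?I. c i *s (\<lambda>(l, a). mm a l) i) = 0"
    then have "(\<Sum>l<p. \<Sum>a<p. c (l, a) *s mm a l) = 0"
      by (simp add: sum.cartesian_product split_def)
    then show "\<forall>i\<in>?I. c i = 0" using mm_coeff_zero[of "\<lambda>a l. c (l, a)"] by auto
  qed (auto simp: cB power2_eq_square)
  then obtain c where "v = (\<Sum>i\<in>?I. c i *s (\<lambda>(l, a). mm a l) i)" ..
  then show ?thesis using that[of "\<lambda>a l. c (l, a)"] by (simp add: sum.cartesian_product split_def)
qed

lemma eps_x: "eps x = 0"
proof -
  have "R eps x = x + eps x *s u" using x by (simp add: skew_def eps_form)
  then have "eps x *s u = 0" by simp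
  then show ?thesis using glike_nz[OF u] by simp
qed

text \<open>
  The power \<open>x\<^sup>p\<close> is fixed by conjugation with \<open>u\<close>, so that it is a combination of powers of \<open>u\<close>. As it
  commutes with \<open>x\<close>, it is a multiple of \<open>1\<close>, and the counit kills it.
\<close>

lemma pw_x_p: "pw x p = 0"
proof -
  obtain c where c: "pw x p = (\<Sum>l<p. \<Sum>a<p. c a l *s mm a l)" using mm_spans[of "pw x p"] by auto
  have "T (pw x p) = pw x p" using T_mm[of 0 p] wp by (simp add: mm_def)
  then have "(\<Sum>l<p. \<Sum>a<p. (c a l * (\<omega> ^ l - 1)) *s mm a l) = 0"
    unfolding c by (simp add: lmap_simps[OF T_lmap] T_mm right_diff_distrib scale_left_diff_distrib sum_subtractf)
  then have "c a l * (\<omega> ^ l - 1) = 0" if "a < p" "l < p" for a l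
    using mm_coeff_zero[of "\<lambda>a l. c a l * (\<omega> ^ l - 1)"] that by blast
  then have cl: "c a l = 0" if "a < p" "l < p" "l \<noteq> 0" for a l using wm[of l] that by force
  have c0: "pw x p = (\<Sum>a<p. c a 0 *s pw u a)"
  proof -
    have "pw x p = (\<Sum>l<p. if l = 0 then (\<Sum>a<p. c a 0 *s pw u a) else 0)"
      unfolding c by (intro sum.cong refl) (auto simp: cl mm_def)
    then show ?thesis using p2 by simp
  qed
  have "x \<star> pw x p = pw x p \<star> x" by (simp add: pw_comm)
  then have *: "(\<Sum>a<p. (c a 0 * (inverse \<omega> ^ a - 1)) *s mm a 1) = 0"
    unfolding c0 by (simp add: x_pw_u mm_def right_diff_distrib scale_left_diff_distrib sum_subtractf)
  define d where "d a l = (if l = 1 then c a 0 * (inverse \<omega> ^ a - 1) else 0)" for a l :: nat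
  have "(\<Sum>l<p. \<Sum>a<p. d a l *s mm a l) = (\<Sum>l<p. if l = 1 then (\<Sum>a<p. (c a 0 * (inverse \<omega> ^ a - 1)) *s mm a 1) else 0)"
    by (intro sum.cong refl) (auto simp: d_def)
  also have "\<dots> = 0" using * by simp
  finally have "d a 1 = 0" if "a < p" for a using mm_coeff_zero[of d 1 a] p2 that by simp
  then have ca: "c a 0 = 0" if "a < p" "a \<noteq> 0" for a
    using wm[of a] that by (force simp: d_def power_inverse)
  have "pw x p = (\<Sum>a<p. if a = 0 then c 0 0 *s e1 else 0)"
    unfolding c0 by (intro sum.cong refl) (auto simp: ca)
  then have 1: "pw x p = c 0 0 *s e1" using p2 by simp
  have "eps (pw x p) = 0" using p2 eps_x by (cases p) auto
  then show ?thesis using 1 by simp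
qed

end

context fd_hopf begin

text \<open>
  By \<open>noncommuting_skew\<close> and \<open>skew_eigenvector\<close> there are \<open>u\<close> and \<open>z\<close> with \<open>u z = \<omega> z u\<close> and \<open>\<omega> \<noteq> 1\<close>. The number of
  group-likes divides \<open>p\<^sup>2\<close> and is neither \<open>1\<close> (\<open>u\<close> is not the unit) nor \<open>p\<^sup>2\<close>, so it is \<open>p\<close>. Hence
  \<open>u\<^sup>p = 1\<close>, and \<open>\<omega>\<close> is a primitive root of unity of order \<open>p\<close>.
\<close>

theorem pointed_p2_cases:
  assumes AC: "\<And>q :: 'k poly. Polynomial.degree q > 0 \<Longrightarrow> \<exists>z. poly q z = 0"
    and P: "pointed_coalg" and p: "prime p" and ch: "of_nat p \<noteq> (0::'k)" and cB: "card B = p ^ 2"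
    and ne: "V \<noteq> span GL"
  obtains u x \<omega> where "taft_pair scale V B dl eps mul e1 S u x \<omega> p"
proof -
  have N: "of_nat (card B) \<noteq> (0::'k)" using ch by (simp add: cB)
  obtain u x where ux: "glike u" "skew u e1 x" "u \<star> x \<noteq> x \<star> u"
    using noncommuting_skew[OF P N ne] by blast
  obtain m where m: "card B = card GL * m" using card_GL_dvd[OF P] by blast
  have "of_nat (card GL) \<noteq> (0::'k)" using N by (auto simp: m)
  from skew_eigenvector[OF AC this ux] obtain z \<omega>
    where z: "skew u e1 z" "z \<noteq> 0" "\<omega> \<noteq> 1" "u \<star> z = \<omega> *s (z \<star> u)" by blast
  have zV: "z \<in> V" using z by (simp add: skew_def)
  have "card GL dvd p ^ 2" using card_GL_dvd[OF P] cB by simp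
  then obtain i where i: "i \<le> 2" "card GL = p ^ i" using divides_primepow_nat[OF p] by blast
  have uG: "u \<in> GL" "e1 \<in> GL" using ux e1_glike by (auto simp: GL_def)
  have ue: "u \<noteq> e1"
    using z zV by (auto simp: scale_left_imp_eq) (metis scale_cancel_right scale_one)
  have "card GL \<noteq> 1" using uG ue by (auto simp: card_1_singleton_iff)
  then have i0: "i \<noteq> 0" using i by auto
  have "i \<noteq> 2"
  proof
    assume "i = 2"
    then have "dim (span GL) = card B" using i cB indep_GL by (simp add: dim_eq_card_independent)
    then show False using eq_V_if_dim[of "span GL"] ne GL_V by (simp add: span_minimal)
  qed
  with i i0 have cG: "card GL = p" by (auto simp: numeral_2_eq_2 le_Suc_eq)
  have up: "pw u p = e1" using pw_card_GL[OF ux(1)] cG by simp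
  have comm: "pw u a \<star> z = \<omega> ^ a *s (z \<star> pw u a)" for a
  proof (induction a)
    case (Suc a)
    have "pw u (Suc a) \<star> z = u \<star> (pw u a \<star> z)" by (simp add: mul_assoc)
    also have "\<dots> = \<omega> ^ a *s ((u \<star> z) \<star> pw u a)" by (simp add: Suc mul_assoc)
    finally show ?case by (simp add: z(4) mul_assoc mult.commute)
  qed (use zV in simp)
  from comm[of p] have "(\<omega> ^ p - 1) *s z = 0" using up zV by (simp add: scale_left_diff_distrib)
  then have wp: "\<omega> ^ p = 1" using z by simp
  have "\<omega> ^ m \<noteq> 1" if m: "0 < m" "m < p" for m
  proof
    assume wm: "\<omega> ^ m = 1"
    have "coprime m p" using p m by (metis coprime_commute nat_dvd_not_less prime_imp_coprime)
    then obtain a b where "m * a = p * b + 1" using m bezout_nat[of m p] by (auto simp: coprime_iff_gcd_eq_1)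
    then have ab: "a * m = b * p + 1" by (simp add: mult.commute)
    have "\<omega> = \<omega> ^ (b * p + 1)" using wp by (simp add: power_mult mult.commute[of b])
    also have "\<dots> = 1" unfolding ab[symmetric] using wm by (simp add: power_mult mult.commute[of a])
    finally show False using z by simp
  qed
  then have "taft_pair scale V B dl eps mul e1 S u z \<omega> p"
    using ux z wp up cB prime_ge_2_nat[OF p] by unfold_locales auto
  then show ?thesis by (rule that)
qed

end


section \<open>Vector spaces and monoid algebras\<close>

lemma scalars_simps [simp]:
  "carrier scalars = UNIV" "monoid.mult scalars = (*)" "one scalars = 1" "ring.zero scalars = 0"
  "add scalars = (+)" "module.smult scalars = (*)"
  by (simp_all add: scalars_def)

lemma cring_scalars: "cring (scalars :: ('k::field, 'k) module)"
proof (rule cringI)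
  show "abelian_group (scalars :: ('k, 'k) module)"
    by (rule abelian_groupI) (auto simp: add.assoc add.commute intro: exI[of _ "- x" for x])
  show "Group.comm_monoid (scalars :: ('k, 'k) module)"
    by (rule comm_monoidI) (auto simp: mult_ac)
qed (auto simp: algebra_simps)

lemma finsum_scalars: "finsum (scalars :: ('k::field, 'k) module) f A = sum f A"
proof -
  interpret cring "scalars :: ('k, 'k) module" by (rule cring_scalars)
  show ?thesis
    by (induction A rule: infinite_finite_induct) (auto simp: finsum_infinite)
qed

text \<open>
  Vector spaces with a carrier. The facts of the module locale are restated with the operations of the
  ground field in place of those of the record \<open>scalars\<close>.
\<close>

locale kvec = Module.module scalars V for V :: "('k::field, 'a, 'm) module_scheme" (structure)
begin

lemma smult_in [simp, intro]: "x \<in> carrier V \<Longrightarrow> c \<odot> x \<in> carrier V"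
  using smult_closed by simp

lemma smult_add_l: "x \<in> carrier V \<Longrightarrow> (c + d) \<odot> x = c \<odot> x \<oplus> d \<odot> x"
  using smult_l_distr by simp

lemma smult_add_r: "x \<in> carrier V \<Longrightarrow> y \<in> carrier V \<Longrightarrow> c \<odot> (x \<oplus> y) = c \<odot> x \<oplus> c \<odot> y"
  using smult_r_distr by simp

lemma smult_smult: "x \<in> carrier V \<Longrightarrow> c \<odot> (d \<odot> x) = (c * d) \<odot> x"
  using smult_assoc1 by simp

lemma smult_1 [simp]: "x \<in> carrier V \<Longrightarrow> 1 \<odot> x = x"
  using smult_one by simp

lemma smult_0 [simp]: "x \<in> carrier V \<Longrightarrow> 0 \<odot> x = \<zero>"
  using smult_l_null by simp

lemma smult_zero [simp]: "c \<odot> \<zero> = \<zero>"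
  using smult_r_null by simp

lemma smult_m1: "x \<in> carrier V \<Longrightarrow> (- 1) \<odot> x = \<ominus> x"
  using smult_add_l[of x "- 1" 1] M.minus_equality[of "(- 1) \<odot> x" x] by auto

lemma smult_finsum: "f \<in> A \<rightarrow> carrier V \<Longrightarrow> c \<odot> finsum V f A = (\<Oplus>i\<in>A. c \<odot> f i)"
proof (induction A rule: infinite_finite_induct)
  case (insert i A)
  then have "f \<in> A \<rightarrow> carrier V" "(\<lambda>i. c \<odot> f i) \<in> A \<rightarrow> carrier V" by auto
  with insert show ?case by (simp add: smult_add_r Pi_iff)
qed (auto simp: M.finsum_infinite)

end

lemma kvecI: "Module.module scalars V \<Longrightarrow> kvec V" by (simp add: kvec_def)

lemma kvec_scalars: "kvec (scalars :: ('k::field, 'k) module)"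
proof -
  interpret cring "scalars :: ('k, 'k) module" by (rule cring_scalars)
  show ?thesis
    by (rule kvecI, rule moduleI) (auto simp: algebra_simps cring_axioms abelian_group_axioms)
qed

lemma (in k_algebra) kvec: "kvec A" by (rule kvecI) unfold_locales

lemma (in k_algebra) ring_A: "ring A" by unfold_locales

text \<open>
  Inside an algebra the ring laws of the scalars and of the algebra share their names; these copies name
  the ring explicitly.
\<close>

lemma ring_distrs:
  assumes "ring A" "x \<in> carrier A" "y \<in> carrier A" "z \<in> carrier A"
  shows "(x \<oplus>\<^bsub>A\<^esub> y) \<otimes>\<^bsub>A\<^esub> z = x \<otimes>\<^bsub>A\<^esub> z \<oplus>\<^bsub>A\<^esub> y \<otimes>\<^bsub>A\<^esub> z"
    "z \<otimes>\<^bsub>A\<^esub> (x \<oplus>\<^bsub>A\<^esub> y) = z \<otimes>\<^bsub>A\<^esub> x \<oplus>\<^bsub>A\<^esub> z \<otimes>\<^bsub>A\<^esub> y"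
    "(x \<otimes>\<^bsub>A\<^esub> y) \<otimes>\<^bsub>A\<^esub> z = x \<otimes>\<^bsub>A\<^esub> (y \<otimes>\<^bsub>A\<^esub> z)"
proof -
  interpret ring A by fact
  show "(x \<oplus>\<^bsub>A\<^esub> y) \<otimes>\<^bsub>A\<^esub> z = x \<otimes>\<^bsub>A\<^esub> z \<oplus>\<^bsub>A\<^esub> y \<otimes>\<^bsub>A\<^esub> z"
    "z \<otimes>\<^bsub>A\<^esub> (x \<oplus>\<^bsub>A\<^esub> y) = z \<otimes>\<^bsub>A\<^esub> x \<oplus>\<^bsub>A\<^esub> z \<otimes>\<^bsub>A\<^esub> y"
    "(x \<otimes>\<^bsub>A\<^esub> y) \<otimes>\<^bsub>A\<^esub> z = x \<otimes>\<^bsub>A\<^esub> (y \<otimes>\<^bsub>A\<^esub> z)"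
    using assms by (simp_all add: l_distr r_distr m_assoc)
qed

lemmas (in k_algebra) A_l_distr = ring_distrs(1)[OF ring_A]
  and A_r_distr = ring_distrs(2)[OF ring_A]
  and A_assoc = ring_distrs(3)[OF ring_A]

subsection \<open>Linear maps\<close>

lemma linear_mapsI:
  "\<lbrakk>\<And>x. x \<in> carrier V \<Longrightarrow> f x \<in> carrier W;
    \<And>x y. \<lbrakk>x \<in> carrier V; y \<in> carrier V\<rbrakk> \<Longrightarrow> f (x \<oplus>\<^bsub>V\<^esub> y) = f x \<oplus>\<^bsub>W\<^esub> f y;
    \<And>c x. x \<in> carrier V \<Longrightarrow> f (c \<odot>\<^bsub>V\<^esub> x) = c \<odot>\<^bsub>W\<^esub> f x\<rbrakk> \<Longrightarrow> f \<in> linear_maps V W"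
  by (auto simp: linear_maps_def)

lemma linear_mapsD:
  assumes "f \<in> linear_maps V W"
  shows "x \<in> carrier V \<Longrightarrow> f x \<in> carrier W"
    "\<lbrakk>x \<in> carrier V; y \<in> carrier V\<rbrakk> \<Longrightarrow> f (x \<oplus>\<^bsub>V\<^esub> y) = f x \<oplus>\<^bsub>W\<^esub> f y"
    "x \<in> carrier V \<Longrightarrow> f (c \<odot>\<^bsub>V\<^esub> x) = c \<odot>\<^bsub>W\<^esub> f x"
  using assms by (auto simp: linear_maps_def)

lemma linear_maps_zero:
  assumes "f \<in> linear_maps V W" "kvec V" "kvec W"
  shows "f \<zero>\<^bsub>V\<^esub> = \<zero>\<^bsub>W\<^esub>"
proof -
  interpret V: kvec V by fact
  interpret W: kvec W by fact
  have "f \<zero>\<^bsub>V\<^esub> = f (0 \<odot>\<^bsub>V\<^esub> \<zero>\<^bsub>V\<^esub>)" by simp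
  also have "\<dots> = 0 \<odot>\<^bsub>W\<^esub> f \<zero>\<^bsub>V\<^esub>" by (rule linear_mapsD(3)[OF assms(1)]) simp
  finally show ?thesis using linear_mapsD(1)[OF assms(1)] by simp
qed

lemma linear_maps_finsum:
  assumes f: "f \<in> linear_maps V W" and V: "kvec V" and W: "kvec W" and g: "g \<in> A \<rightarrow> carrier V"
  shows "f (finsum V g A) = (\<Oplus>\<^bsub>W\<^esub>i\<in>A. f (g i))"
proof -
  interpret V: kvec V by fact
  interpret W: kvec W by fact
  show ?thesis using g
  proof (induction A rule: infinite_finite_induct)
    case (insert i A)
    then have "g \<in> A \<rightarrow> carrier V" "g i \<in> carrier V" "(\<lambda>i. f (g i)) \<in> A \<rightarrow> carrier W" "f (g i) \<in> carrier W"
      using linear_mapsD(1)[OF f] by auto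
    with insert show ?case by (simp add: linear_mapsD(2)[OF f])
  qed (auto simp: V.M.finsum_infinite W.M.finsum_infinite linear_maps_zero[OF f V W])
qed

lemma linear_maps_comp:
  "f \<in> linear_maps U V \<Longrightarrow> g \<in> linear_maps V W \<Longrightarrow> (\<lambda>x. g (f x)) \<in> linear_maps U W"
  by (rule linear_mapsI) (simp_all add: linear_mapsD)

lemma linear_maps_eq_on_span:
  assumes f: "f \<in> linear_maps V W" and g: "g \<in> linear_maps V W" and V: "kvec V" and W: "kvec W"
    and b: "b \<in> I \<rightarrow> carrier V" and eq: "\<And>i. i \<in> I \<Longrightarrow> f (b i) = g (b i)"
  shows "f (\<Oplus>\<^bsub>V\<^esub>i\<in>I. c i \<odot>\<^bsub>V\<^esub> b i) = g (\<Oplus>\<^bsub>V\<^esub>i\<in>I. c i \<odot>\<^bsub>V\<^esub> b i)"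
proof -
  interpret V: kvec V by fact
  interpret W: kvec W by fact
  have cb: "(\<lambda>i. c i \<odot>\<^bsub>V\<^esub> b i) \<in> I \<rightarrow> carrier V" using b by auto
  have "(\<Oplus>\<^bsub>W\<^esub>i\<in>I. f (c i \<odot>\<^bsub>V\<^esub> b i)) = (\<Oplus>\<^bsub>W\<^esub>i\<in>I. g (c i \<odot>\<^bsub>V\<^esub> b i))"
    using b eq linear_mapsD[OF f] linear_mapsD[OF g]
    by (intro W.M.finsum_cong') (auto simp: Pi_iff)
  then show ?thesis
    unfolding linear_maps_finsum[OF f V W cb] linear_maps_finsum[OF g V W cb] .
qed

subsection \<open>Linear extension\<close>

context kvec
begin

lemma linear_extension_superset:
  assumes "finite S" "Poly_Mapping.keys u \<subseteq> S" "f \<in> S \<rightarrow> carrier V"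
  shows "linear_extension V f u = (\<Oplus>x\<in>S. Poly_Mapping.lookup u x \<odot> f x)"
  unfolding linear_extension_def
proof (rule M.add.finprod_mono_neutral_cong_left)
  show "Poly_Mapping.lookup u i \<odot> f i = \<zero>" if "i \<in> S - Poly_Mapping.keys u" for i
  proof -
    have "f i \<in> carrier V" using that assms(3) by auto
    then show ?thesis using that by (simp add: in_keys_iff)
  qed
qed (use assms in auto)

lemma linear_extension_closed [simp]:
  "f \<in> Poly_Mapping.keys u \<rightarrow> carrier V \<Longrightarrow> linear_extension V f u \<in> carrier V"
  unfolding linear_extension_def by (intro M.finsum_closed) auto

lemma linear_extension_add:
  assumes "f \<in> Poly_Mapping.keys u \<union> Poly_Mapping.keys v \<rightarrow> carrier V"
  shows "linear_extension V f (u + v) = linear_extension V f u \<oplus> linear_extension V f v"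
proof -
  let ?S = "Poly_Mapping.keys u \<union> Poly_Mapping.keys v"
  have f: "f x \<in> carrier V" if "x \<in> ?S" for x using assms that by auto
  have "linear_extension V f (u + v) = (\<Oplus>x\<in>?S. Poly_Mapping.lookup (u + v) x \<odot> f x)"
    using assms Poly_Mapping.keys_add[of u v] by (intro linear_extension_superset) auto
  also have "\<dots> = (\<Oplus>x\<in>?S. Poly_Mapping.lookup u x \<odot> f x \<oplus> Poly_Mapping.lookup v x \<odot> f x)"
    using f by (intro M.finsum_cong') (auto simp: lookup_add smult_add_l)
  also have "\<dots> = (\<Oplus>x\<in>?S. Poly_Mapping.lookup u x \<odot> f x) \<oplus> (\<Oplus>x\<in>?S. Poly_Mapping.lookup v x \<odot> f x)"
    using f by (intro M.finsum_addf) auto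
  also have "(\<Oplus>x\<in>?S. Poly_Mapping.lookup u x \<odot> f x) = linear_extension V f u"
    using assms by (intro linear_extension_superset[symmetric]) auto
  also have "(\<Oplus>x\<in>?S. Poly_Mapping.lookup v x \<odot> f x) = linear_extension V f v"
    using assms by (intro linear_extension_superset[symmetric]) auto
  finally show ?thesis .
qed

lemma linear_extension_0 [simp]: "linear_extension V f 0 = \<zero>"
  by (simp add: linear_extension_def)

lemma linear_extension_single:
  "f x \<in> carrier V \<Longrightarrow> linear_extension V f (Poly_Mapping.single x c) = c \<odot> f x"
  using linear_extension_superset[of "{x}" "Poly_Mapping.single x c" f] by simp

lemma linear_extension_smult:
  assumes "f \<in> Poly_Mapping.keys u \<rightarrow> carrier V"
  shows "linear_extension V f (Poly_Mapping.map ((*) c) u) = c \<odot> linear_extension V f u"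
proof -
  let ?S = "Poly_Mapping.keys u"
  have l: "Poly_Mapping.lookup (Poly_Mapping.map ((*) c) u) x = c * Poly_Mapping.lookup u x" for x
    by (simp add: Poly_Mapping.map.rep_eq when_def)
  have "linear_extension V f (Poly_Mapping.map ((*) c) u)
    = (\<Oplus>x\<in>?S. (c * Poly_Mapping.lookup u x) \<odot> f x)"
    using assms by (subst linear_extension_superset[of ?S]) (auto simp: l in_keys_iff)
  also have "\<dots> = (\<Oplus>x\<in>?S. c \<odot> (Poly_Mapping.lookup u x \<odot> f x))"
    using assms by (intro M.finsum_cong') (auto simp: smult_smult Pi_iff)
  also have "\<dots> = c \<odot> linear_extension V f u"
    unfolding linear_extension_def using assms by (intro smult_finsum[symmetric]) auto
  finally show ?thesis .
qed

end

subsection \<open>Monoid algebras\<close>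

lemma lookup_smult [simp]:
  fixes c :: "'k::field"
  shows "Poly_Mapping.lookup (Poly_Mapping.map ((*) c) u) x = c * Poly_Mapping.lookup u x"
  by (simp add: Poly_Mapping.map.rep_eq when_def)

lemma keys_smult:
  fixes c :: "'k::field"
  shows "Poly_Mapping.keys (Poly_Mapping.map ((*) c) u) \<subseteq> Poly_Mapping.keys u"
  by (auto simp: in_keys_iff)

lemma poly_mapping_sum_single:
  "u = (\<Sum>x\<in>Poly_Mapping.keys u. Poly_Mapping.single x (Poly_Mapping.lookup u x))"
  by (rule poly_mapping_eqI) (simp add: lookup_sum lookup_single when_def in_keys_iff)

lemma additive_eq_on_singles:
  fixes F G :: "('a \<Rightarrow>\<^sub>0 'k::ab_group_add) \<Rightarrow> 'b::ab_group_add"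
  assumes "\<And>u v. F (u + v) = F u + F v" "\<And>u v. G (u + v) = G u + G v"
    and eq: "\<And>x c. x \<in> Poly_Mapping.keys u \<Longrightarrow> F (Poly_Mapping.single x c) = G (Poly_Mapping.single x c)"
  shows "F u = G u"
proof -
  have 0: "F 0 = 0" "G 0 = 0" using assms(1,2)[of 0 0] by auto
  have s: "F (sum f I) = (\<Sum>i\<in>I. F (f i))" "G (sum f I) = (\<Sum>i\<in>I. G (f i))" for f and I :: "'a set"
    by (induction I rule: infinite_finite_induct) (auto simp: assms(1,2) 0)
  have "F (\<Sum>x\<in>Poly_Mapping.keys u. Poly_Mapping.single x (Poly_Mapping.lookup u x))
    = G (\<Sum>x\<in>Poly_Mapping.keys u. Poly_Mapping.single x (Poly_Mapping.lookup u x))"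
    unfolding s by (intro sum.cong refl eq)
  then show ?thesis by (simp flip: poly_mapping_sum_single)
qed

lemma monoid_algebra_simps [simp]:
  "carrier (monoid_algebra M) = {f. Poly_Mapping.keys f \<subseteq> carrier M}"
  "one (monoid_algebra M) = Poly_Mapping.single \<one>\<^bsub>M\<^esub> 1"
  "ring.zero (monoid_algebra M) = 0" "add (monoid_algebra M) = (+)"
  "module.smult (monoid_algebra M) c = Poly_Mapping.map ((*) c)"
  by (simp_all add: monoid_algebra_def)

lemma monoid_algebra_mult_superset:
  assumes "finite S" "Poly_Mapping.keys u \<subseteq> S" "finite T" "Poly_Mapping.keys v \<subseteq> T"
  shows "u \<otimes>\<^bsub>monoid_algebra M\<^esub> v = (\<Sum>x\<in>S. \<Sum>y\<in>T.
    Poly_Mapping.single (x \<otimes>\<^bsub>M\<^esub> y) (Poly_Mapping.lookup u x * Poly_Mapping.lookup v y))"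
proof -
  have "(\<Sum>y\<in>Poly_Mapping.keys v. Poly_Mapping.single (x \<otimes>\<^bsub>M\<^esub> y) (Poly_Mapping.lookup u x * Poly_Mapping.lookup v y))
    = (\<Sum>y\<in>T. Poly_Mapping.single (x \<otimes>\<^bsub>M\<^esub> y) (Poly_Mapping.lookup u x * Poly_Mapping.lookup v y))" for x
    using assms by (intro sum.mono_neutral_left) (auto simp: in_keys_iff)
  then show ?thesis
    using assms unfolding monoid_algebra_def
    by (simp, intro sum.mono_neutral_left) (auto simp: in_keys_iff)
qed

lemma monoid_algebra_mult_add_l:
  "(u + v) \<otimes>\<^bsub>monoid_algebra M\<^esub> w = u \<otimes>\<^bsub>monoid_algebra M\<^esub> w + v \<otimes>\<^bsub>monoid_algebra M\<^esub> w"
proof -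
  let ?S = "Poly_Mapping.keys u \<union> Poly_Mapping.keys v"
  have S: "finite ?S" "Poly_Mapping.keys u \<subseteq> ?S" "Poly_Mapping.keys v \<subseteq> ?S" "Poly_Mapping.keys (u + v) \<subseteq> ?S"
    using Poly_Mapping.keys_add[of u v] by auto
  show ?thesis
    unfolding monoid_algebra_mult_superset[OF S(1,2) finite_keys subset_refl]
      monoid_algebra_mult_superset[OF S(1,3) finite_keys subset_refl]
      monoid_algebra_mult_superset[OF S(1,4) finite_keys subset_refl]
    by (simp add: lookup_add distrib_right single_add sum.distrib)
qed

lemma monoid_algebra_mult_add_r:
  "w \<otimes>\<^bsub>monoid_algebra M\<^esub> (u + v) = w \<otimes>\<^bsub>monoid_algebra M\<^esub> u + w \<otimes>\<^bsub>monoid_algebra M\<^esub> v"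
proof -
  let ?S = "Poly_Mapping.keys u \<union> Poly_Mapping.keys v"
  have S: "finite ?S" "Poly_Mapping.keys u \<subseteq> ?S" "Poly_Mapping.keys v \<subseteq> ?S" "Poly_Mapping.keys (u + v) \<subseteq> ?S"
    using Poly_Mapping.keys_add[of u v] by auto
  show ?thesis
    unfolding monoid_algebra_mult_superset[OF finite_keys subset_refl S(1,2)]
      monoid_algebra_mult_superset[OF finite_keys subset_refl S(1,3)]
      monoid_algebra_mult_superset[OF finite_keys subset_refl S(1,4)]
    by (simp add: lookup_add distrib_left single_add sum.distrib)
qed

lemma monoid_algebra_mult_0 [simp]:
  "0 \<otimes>\<^bsub>monoid_algebra M\<^esub> w = 0" "w \<otimes>\<^bsub>monoid_algebra M\<^esub> 0 = 0"
  by (simp_all add: monoid_algebra_def)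

lemma monoid_algebra_mult_sum:
  "sum f I \<otimes>\<^bsub>monoid_algebra M\<^esub> w = (\<Sum>i\<in>I. f i \<otimes>\<^bsub>monoid_algebra M\<^esub> w)"
  "w \<otimes>\<^bsub>monoid_algebra M\<^esub> sum f I = (\<Sum>i\<in>I. w \<otimes>\<^bsub>monoid_algebra M\<^esub> f i)"
  by (induction I rule: infinite_finite_induct) (auto simp: monoid_algebra_mult_add_l monoid_algebra_mult_add_r)

lemma monoid_algebra_single_mult [simp]:
  "Poly_Mapping.single x a \<otimes>\<^bsub>monoid_algebra M\<^esub> Poly_Mapping.single y b = Poly_Mapping.single (x \<otimes>\<^bsub>M\<^esub> y) (a * b)"
  by (subst monoid_algebra_mult_superset[of "{x}" _ "{y}"]) auto

lemma keys_monoid_algebra_mult: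
  assumes "monoid M" "Poly_Mapping.keys u \<subseteq> carrier M" "Poly_Mapping.keys v \<subseteq> carrier M"
  shows "Poly_Mapping.keys (u \<otimes>\<^bsub>monoid_algebra M\<^esub> v) \<subseteq> carrier M"
proof -
  interpret monoid M by fact
  have "Poly_Mapping.keys (u \<otimes>\<^bsub>monoid_algebra M\<^esub> v)
    \<subseteq> (\<Union>x\<in>Poly_Mapping.keys u. \<Union>y\<in>Poly_Mapping.keys v. {x \<otimes>\<^bsub>M\<^esub> y})"
    unfolding monoid_algebra_mult_superset[OF finite_keys subset_refl finite_keys subset_refl]
    by (rule order_trans[OF keys_sum], rule UN_mono[OF subset_refl], rule order_trans[OF keys_sum])
      (auto split: if_splits)
  also have "\<dots> \<subseteq> carrier M" using assms by auto
  finally show ?thesis .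
qed

lemma k_algebra_monoid_algebra:
  assumes M: "monoid M"
  shows "k_algebra (monoid_algebra M :: ('k::field, 'a \<Rightarrow>\<^sub>0 'k) module)"
proof -
  interpret monoid M by fact
  let ?A = "monoid_algebra M :: ('k, 'a \<Rightarrow>\<^sub>0 'k) module"
  have ab: "abelian_group ?A"
  proof (rule abelian_groupI)
    fix x assume "x \<in> carrier ?A"
    then show "\<exists>y\<in>carrier ?A. y \<oplus>\<^bsub>?A\<^esub> x = \<zero>\<^bsub>?A\<^esub>" by (intro bexI[of _ "- x"]) auto
  next
    fix x y assume "x \<in> carrier ?A" "y \<in> carrier ?A"
    then show "x \<oplus>\<^bsub>?A\<^esub> y \<in> carrier ?A" using Poly_Mapping.keys_add[of x y] by auto
  qed (auto simp: add.assoc add.commute)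
  have assoc: "(u \<otimes>\<^bsub>?A\<^esub> v) \<otimes>\<^bsub>?A\<^esub> w = u \<otimes>\<^bsub>?A\<^esub> (v \<otimes>\<^bsub>?A\<^esub> w)"
    if "u \<in> carrier ?A" "v \<in> carrier ?A" "w \<in> carrier ?A" for u v w
  proof -
    have 1: "(Poly_Mapping.single x a \<otimes>\<^bsub>?A\<^esub> Poly_Mapping.single y b) \<otimes>\<^bsub>?A\<^esub> w
        = Poly_Mapping.single x a \<otimes>\<^bsub>?A\<^esub> (Poly_Mapping.single y b \<otimes>\<^bsub>?A\<^esub> w)"
      if "x \<in> carrier M" "y \<in> carrier M" for x y and a b :: 'k
      by (rule additive_eq_on_singles)
        (use that \<open>w \<in> carrier ?A\<close> in \<open>auto simp: monoid_algebra_mult_add_r m_assoc mult.assoc subset_iff\<close>)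
    have 2: "(Poly_Mapping.single x a \<otimes>\<^bsub>?A\<^esub> v) \<otimes>\<^bsub>?A\<^esub> w
        = Poly_Mapping.single x a \<otimes>\<^bsub>?A\<^esub> (v \<otimes>\<^bsub>?A\<^esub> w)" if "x \<in> carrier M" for x and a :: 'k
      by (rule additive_eq_on_singles)
        (use that 1 \<open>v \<in> carrier ?A\<close> in \<open>auto simp: monoid_algebra_mult_add_r monoid_algebra_mult_add_l subset_iff\<close>)
    show ?thesis
      by (rule additive_eq_on_singles)
        (use 2 \<open>u \<in> carrier ?A\<close> in \<open>auto simp: monoid_algebra_mult_add_l subset_iff\<close>)
  qed
  have one: "\<one>\<^bsub>?A\<^esub> \<otimes>\<^bsub>?A\<^esub> u = u" "u \<otimes>\<^bsub>?A\<^esub> \<one>\<^bsub>?A\<^esub> = u" if u: "u \<in> carrier ?A" for u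
  proof -
    have "\<one>\<^bsub>?A\<^esub> \<otimes>\<^bsub>?A\<^esub> u = (\<Sum>x\<in>Poly_Mapping.keys u. Poly_Mapping.single (\<one>\<^bsub>M\<^esub> \<otimes>\<^bsub>M\<^esub> x) (Poly_Mapping.lookup u x))"
      by (subst poly_mapping_sum_single[of u]) (simp add: monoid_algebra_mult_sum)
    also have "\<dots> = (\<Sum>x\<in>Poly_Mapping.keys u. Poly_Mapping.single x (Poly_Mapping.lookup u x))"
      using u by (intro sum.cong refl) (auto simp: subset_iff)
    finally show "\<one>\<^bsub>?A\<^esub> \<otimes>\<^bsub>?A\<^esub> u = u" by (simp flip: poly_mapping_sum_single)
    have "u \<otimes>\<^bsub>?A\<^esub> \<one>\<^bsub>?A\<^esub> = (\<Sum>x\<in>Poly_Mapping.keys u. Poly_Mapping.single (x \<otimes>\<^bsub>M\<^esub> \<one>\<^bsub>M\<^esub>) (Poly_Mapping.lookup u x))"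
      by (subst poly_mapping_sum_single[of u]) (simp add: monoid_algebra_mult_sum)
    also have "\<dots> = (\<Sum>x\<in>Poly_Mapping.keys u. Poly_Mapping.single x (Poly_Mapping.lookup u x))"
      using u by (intro sum.cong refl) (auto simp: subset_iff)
    finally show "u \<otimes>\<^bsub>?A\<^esub> \<one>\<^bsub>?A\<^esub> = u" by (simp flip: poly_mapping_sum_single)
  qed
  have mon: "monoid ?A"
  proof (rule monoidI)
    fix u v assume "u \<in> carrier ?A" "v \<in> carrier ?A"
    then show "u \<otimes>\<^bsub>?A\<^esub> v \<in> carrier ?A" using keys_monoid_algebra_mult[OF M, of u v] by auto
  qed (use assoc one in auto)
  interpret R: ring ?A
    by (rule ringI[OF ab mon]) (auto simp: monoid_algebra_mult_add_l monoid_algebra_mult_add_r)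
  have sm: "Poly_Mapping.map ((*) c) u \<otimes>\<^bsub>?A\<^esub> v = Poly_Mapping.map ((*) c) (u \<otimes>\<^bsub>?A\<^esub> v)"
    "u \<otimes>\<^bsub>?A\<^esub> Poly_Mapping.map ((*) c) v = Poly_Mapping.map ((*) c) (u \<otimes>\<^bsub>?A\<^esub> v)" for c :: 'k and u v
    unfolding monoid_algebra_mult_superset[OF finite_keys subset_refl finite_keys subset_refl, where u = u and v = v]
      monoid_algebra_mult_superset[OF finite_keys keys_smult[of c u] finite_keys subset_refl[of "Poly_Mapping.keys v"]]
      monoid_algebra_mult_superset[OF finite_keys subset_refl[of "Poly_Mapping.keys u"] finite_keys keys_smult[of c v]]
    by (intro poly_mapping_eqI, simp add: lookup_sum lookup_single when_def sum_distrib_left if_distrib mult_ac cong: if_cong)+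
  have "Module.module scalars ?A"
  proof (rule moduleI[OF cring_scalars ab])
    fix c :: 'k and u assume "u \<in> carrier ?A"
    then show "c \<odot>\<^bsub>?A\<^esub> u \<in> carrier ?A" using keys_smult[of c u] by auto
  qed (auto intro!: poly_mapping_eqI simp: lookup_add algebra_simps)
  then show ?thesis
    by (intro k_algebra.intro k_algebra_axioms.intro R.ring_axioms) (simp_all add: sm)
qed

lemma linear_extension_linear:
  fixes M :: "('b, 'n) monoid_scheme" and V :: "('k::field, 'a, 'm) module_scheme"
  assumes V: "kvec V" and f: "f \<in> carrier M \<rightarrow> carrier V"
  shows "linear_extension V f \<in> linear_maps (monoid_algebra M) V"
proof -
  interpret kvec V by fact
  have f': "f \<in> Poly_Mapping.keys u \<rightarrow> carrier V" if "u \<in> carrier (monoid_algebra M :: ('k, 'b \<Rightarrow>\<^sub>0 'k) module)" for u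
    using that f by auto
  show ?thesis
  proof (rule linear_mapsI)
    fix x y assume "x \<in> carrier (monoid_algebra M :: ('k, 'b \<Rightarrow>\<^sub>0 'k) module)" "y \<in> carrier (monoid_algebra M :: ('k, 'b \<Rightarrow>\<^sub>0 'k) module)"
    from this[THEN f'] have "f \<in> Poly_Mapping.keys x \<union> Poly_Mapping.keys y \<rightarrow> carrier V" by auto
    then show "linear_extension V f (x \<oplus>\<^bsub>monoid_algebra M\<^esub> y) = linear_extension V f x \<oplus>\<^bsub>V\<^esub> linear_extension V f y"
      by (simp add: linear_extension_add)
  qed (use f' in \<open>auto simp: linear_extension_smult\<close>)
qed

lemma linear_maps_eq_on_monoid:
  fixes M :: "('b, 'n) monoid_scheme" and V :: "('k::field, 'a, 'm) module_scheme"
  assumes V: "kvec V" and M: "monoid M"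
    and f: "f \<in> linear_maps (monoid_algebra M) V" and g: "g \<in> linear_maps (monoid_algebra M) V"
    and eq: "\<And>x. x \<in> carrier M \<Longrightarrow> f (Poly_Mapping.single x 1) = g (Poly_Mapping.single x 1)"
    and u: "Poly_Mapping.keys u \<subseteq> carrier M"
  shows "f u = g u"
proof -
  let ?A = "monoid_algebra M :: ('k, 'b \<Rightarrow>\<^sub>0 'k) module"
  interpret A: k_algebra ?A by (rule k_algebra_monoid_algebra[OF M])
  have fs: "finsum ?A h I = sum h I" if "h \<in> I \<rightarrow> carrier ?A" for h :: "'b \<Rightarrow> 'b \<Rightarrow>\<^sub>0 'k" and I
    using that by (induction I rule: infinite_finite_induct) (auto simp: A.finsum_infinite Pi_iff)
  have "(\<Oplus>\<^bsub>?A\<^esub>x\<in>Poly_Mapping.keys u. Poly_Mapping.lookup u x \<odot>\<^bsub>?A\<^esub> Poly_Mapping.single x 1)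
    = (\<Sum>x\<in>Poly_Mapping.keys u. Poly_Mapping.single x (Poly_Mapping.lookup u x))"
    using u by (subst fs) (auto split: if_splits)
  also have "\<dots> = u" by (rule poly_mapping_sum_single[symmetric])
  finally have "u = (\<Oplus>\<^bsub>?A\<^esub>x\<in>Poly_Mapping.keys u. Poly_Mapping.lookup u x \<odot>\<^bsub>?A\<^esub> Poly_Mapping.single x 1)" ..
  moreover have "f \<dots> = g \<dots>"
    using u eq by (intro linear_maps_eq_on_span[OF f g A.kvec V]) auto
  ultimately show ?thesis by simp
qed

text \<open>
  The universal property of monoid algebras.
\<close>

lemma linear_extension_mult:
  fixes M :: "('b, 'n) monoid_scheme" and A :: "('k::field, 'a, 'm) module_scheme"
  assumes A: "k_algebra A" and M: "monoid M" and f: "f \<in> carrier M \<rightarrow> carrier A"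
    and fm: "\<And>x y. x \<in> carrier M \<Longrightarrow> y \<in> carrier M \<Longrightarrow> f (x \<otimes>\<^bsub>M\<^esub> y) = f x \<otimes>\<^bsub>A\<^esub> f y"
    and u: "Poly_Mapping.keys u \<subseteq> carrier M" and v: "Poly_Mapping.keys v \<subseteq> carrier M"
  shows "linear_extension A f (u \<otimes>\<^bsub>monoid_algebra M\<^esub> v) = linear_extension A f u \<otimes>\<^bsub>A\<^esub> linear_extension A f v"
proof -
  interpret A: k_algebra A by fact
  interpret V: kvec A by (rule A.kvec)
  interpret M: monoid M by fact
  let ?M = "monoid_algebra M :: ('k, 'b \<Rightarrow>\<^sub>0 'k) module"
  interpret MA: k_algebra ?M by (rule k_algebra_monoid_algebra[OF M])
  note lin = linear_extension_linear[OF A.kvec f]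
  note linD = linear_mapsD[OF lin, simplified]
  have f': "f x \<in> carrier A" if "x \<in> carrier M" for x using f that by auto
  have 1: "linear_extension A f (Poly_Mapping.single x 1 \<otimes>\<^bsub>?M\<^esub> v) = f x \<otimes>\<^bsub>A\<^esub> linear_extension A f v"
    if x: "x \<in> carrier M" for x
  proof (rule linear_maps_eq_on_monoid[OF A.kvec M _ _ _ v])
    show "(\<lambda>v. linear_extension A f (Poly_Mapping.single x 1 \<otimes>\<^bsub>?M\<^esub> v)) \<in> linear_maps ?M A"
      by (rule linear_maps_comp[OF _ lin], rule linear_mapsI)
        (use x MA.m_closed in \<open>auto simp: MA.smult_mult_right[simplified] monoid_algebra_mult_add_r\<close>)
    show "(\<lambda>v. f x \<otimes>\<^bsub>A\<^esub> linear_extension A f v) \<in> linear_maps ?M A"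
      by (rule linear_maps_comp[OF lin], rule linear_mapsI)
        (use f'[OF x] in \<open>auto simp: A.A_r_distr A.smult_mult_right\<close>)
  qed (use x f' fm in \<open>simp add: V.linear_extension_single\<close>)
  show ?thesis
  proof (rule linear_maps_eq_on_monoid[OF A.kvec M _ _ _ u])
    show "(\<lambda>u. linear_extension A f (u \<otimes>\<^bsub>?M\<^esub> v)) \<in> linear_maps ?M A"
      by (rule linear_maps_comp[OF _ lin], rule linear_mapsI)
        (use v MA.m_closed in \<open>auto simp: MA.smult_mult_left[simplified] monoid_algebra_mult_add_l\<close>)
    show "(\<lambda>u. linear_extension A f u \<otimes>\<^bsub>A\<^esub> linear_extension A f v) \<in> linear_maps ?M A"
      by (rule linear_maps_comp[OF lin], rule linear_mapsI)
        (use linD(1) v in \<open>auto simp: A.A_l_distr A.smult_mult_left\<close>)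
  qed (use f' 1 in \<open>simp add: V.linear_extension_single\<close>)
qed


section \<open>Quotients and tensor products of algebras\<close>

lemma ring_closed:
  assumes "ring A" "x \<in> carrier A"
  shows "y \<in> carrier A \<Longrightarrow> x \<oplus>\<^bsub>A\<^esub> y \<in> carrier A" "y \<in> carrier A \<Longrightarrow> x \<otimes>\<^bsub>A\<^esub> y \<in> carrier A"
    "\<ominus>\<^bsub>A\<^esub> x \<in> carrier A" "\<zero>\<^bsub>A\<^esub> \<in> carrier A" "\<one>\<^bsub>A\<^esub> \<in> carrier A" "\<zero>\<^bsub>A\<^esub> \<oplus>\<^bsub>A\<^esub> x = x"
    "\<one>\<^bsub>A\<^esub> \<otimes>\<^bsub>A\<^esub> x = x" "x \<otimes>\<^bsub>A\<^esub> \<one>\<^bsub>A\<^esub> = x" "\<ominus>\<^bsub>A\<^esub> x \<oplus>\<^bsub>A\<^esub> x = \<zero>\<^bsub>A\<^esub>"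
proof -
  interpret ring A by fact
  show "y \<in> carrier A \<Longrightarrow> x \<oplus>\<^bsub>A\<^esub> y \<in> carrier A" "y \<in> carrier A \<Longrightarrow> x \<otimes>\<^bsub>A\<^esub> y \<in> carrier A"
    "\<ominus>\<^bsub>A\<^esub> x \<in> carrier A" "\<zero>\<^bsub>A\<^esub> \<in> carrier A" "\<one>\<^bsub>A\<^esub> \<in> carrier A" "\<zero>\<^bsub>A\<^esub> \<oplus>\<^bsub>A\<^esub> x = x"
    "\<one>\<^bsub>A\<^esub> \<otimes>\<^bsub>A\<^esub> x = x" "x \<otimes>\<^bsub>A\<^esub> \<one>\<^bsub>A\<^esub> = x" "\<ominus>\<^bsub>A\<^esub> x \<oplus>\<^bsub>A\<^esub> x = \<zero>\<^bsub>A\<^esub>"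
    using assms by (simp_all add: l_neg)
qed

lemma ring_add_ac:
  assumes "ring A" "x \<in> carrier A" "y \<in> carrier A"
  shows "x \<oplus>\<^bsub>A\<^esub> y = y \<oplus>\<^bsub>A\<^esub> x"
    "z \<in> carrier A \<Longrightarrow> (x \<oplus>\<^bsub>A\<^esub> y) \<oplus>\<^bsub>A\<^esub> z = x \<oplus>\<^bsub>A\<^esub> (y \<oplus>\<^bsub>A\<^esub> z)"
proof -
  interpret ring A by fact
  show "x \<oplus>\<^bsub>A\<^esub> y = y \<oplus>\<^bsub>A\<^esub> x" using assms by (intro a_comm)
  show "z \<in> carrier A \<Longrightarrow> (x \<oplus>\<^bsub>A\<^esub> y) \<oplus>\<^bsub>A\<^esub> z = x \<oplus>\<^bsub>A\<^esub> (y \<oplus>\<^bsub>A\<^esub> z)" using assms by (intro a_assoc)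
qed

lemma quot_alg_simps:
  "carrier (quot_alg A I) = a_rcosets\<^bsub>A\<^esub> I"
  "monoid.mult (quot_alg A I) = rcoset_mult A I"
  "one (quot_alg A I) = I +>\<^bsub>A\<^esub> \<one>\<^bsub>A\<^esub>" "ring.zero (quot_alg A I) = I"
  "add (quot_alg A I) = set_add A"
  "module.smult (quot_alg A I) = (\<lambda>c Y. \<Union>x\<in>Y. I +>\<^bsub>A\<^esub> (c \<odot>\<^bsub>A\<^esub> x))"
  by (simp_all add: quot_alg_def ring.defs module.defs FactRing_def)

text \<open>
  Two-sided ideals of algebras are subspaces, so \<open>quot_alg\<close> is an algebra. It serves twice: for tensor
  products and for the Taft algebra.
\<close>

locale alg_ideal = k_algebra A + I: ideal I A
  for A :: "('k::field, 'a, 'm) module_scheme" and I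
begin

lemma ideal_smult: "x \<in> I \<Longrightarrow> c \<odot>\<^bsub>A\<^esub> x \<in> I"
proof -
  interpret kvec A by (rule kvec)
  assume x: "x \<in> I"
  then have xA: "x \<in> carrier A" by (rule I.a_Hcarr)
  have "(c \<odot>\<^bsub>A\<^esub> \<one>\<^bsub>A\<^esub>) \<otimes>\<^bsub>A\<^esub> x \<in> I" using x by (intro I.I_l_closed) auto
  then show ?thesis using xA by (simp add: smult_mult_left)
qed

lemma quot_carrier: "carrier (quot_alg A I) = (\<lambda>x. I +>\<^bsub>A\<^esub> x) ` carrier A"
  by (auto simp: quot_alg_simps A_RCOSETS_defs a_r_coset_def)

lemma quot_mult: "x \<in> carrier A \<Longrightarrow> y \<in> carrier A \<Longrightarrow>
    (I +>\<^bsub>A\<^esub> x) \<otimes>\<^bsub>quot_alg A I\<^esub> (I +>\<^bsub>A\<^esub> y) = I +>\<^bsub>A\<^esub> (x \<otimes>\<^bsub>A\<^esub> y)"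
  by (simp add: quot_alg_simps I.rcoset_mult_add)

lemma quot_add: "x \<in> carrier A \<Longrightarrow> y \<in> carrier A \<Longrightarrow>
    (I +>\<^bsub>A\<^esub> x) \<oplus>\<^bsub>quot_alg A I\<^esub> (I +>\<^bsub>A\<^esub> y) = I +>\<^bsub>A\<^esub> (x \<oplus>\<^bsub>A\<^esub> y)"
  by (simp add: quot_alg_simps I.a_rcos_sum)

lemma coset_eq_iff: "x \<in> carrier A \<Longrightarrow> y \<in> carrier A \<Longrightarrow>
    I +>\<^bsub>A\<^esub> x = I +>\<^bsub>A\<^esub> y \<longleftrightarrow> x \<ominus>\<^bsub>A\<^esub> y \<in> I"
  using ring.quotient_eq_iff_same_a_r_cos[OF ring_A I.ideal_axioms] by auto

lemma quot_smult: 
  assumes x: "x \<in> carrier A"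
  shows "c \<odot>\<^bsub>quot_alg A I\<^esub> (I +>\<^bsub>A\<^esub> x) = I +>\<^bsub>A\<^esub> (c \<odot>\<^bsub>A\<^esub> x)"
proof -
  interpret kvec A by (rule kvec)
  have eq: "I +>\<^bsub>A\<^esub> (c \<odot>\<^bsub>A\<^esub> z) = I +>\<^bsub>A\<^esub> (c \<odot>\<^bsub>A\<^esub> x)" if zx: "z \<in> I +>\<^bsub>A\<^esub> x" for z
  proof -
    obtain i where i: "i \<in> I" "z = i \<oplus>\<^bsub>A\<^esub> x" using zx by (auto simp: a_r_coset_def')
    have iA: "i \<in> carrier A" using i(1) by (rule I.a_Hcarr)
    have "c \<odot>\<^bsub>A\<^esub> z = c \<odot>\<^bsub>A\<^esub> i \<oplus>\<^bsub>A\<^esub> c \<odot>\<^bsub>A\<^esub> x" using iA x by (simp add: i smult_add_r)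
    then have "c \<odot>\<^bsub>A\<^esub> z \<in> I +>\<^bsub>A\<^esub> (c \<odot>\<^bsub>A\<^esub> x)"
      using ideal_smult[OF i(1), of c] by (auto simp: a_r_coset_def')
    then show ?thesis using x I.a_repr_independence'[of "c \<odot>\<^bsub>A\<^esub> z" "c \<odot>\<^bsub>A\<^esub> x"] by auto
  qed
  have "(\<Union>z\<in>I +>\<^bsub>A\<^esub> x. I +>\<^bsub>A\<^esub> (c \<odot>\<^bsub>A\<^esub> z)) = (\<Union>z\<in>I +>\<^bsub>A\<^esub> x. I +>\<^bsub>A\<^esub> (c \<odot>\<^bsub>A\<^esub> x))"
    by (rule SUP_cong[OF refl eq])
  also have "\<dots> = I +>\<^bsub>A\<^esub> (c \<odot>\<^bsub>A\<^esub> x)" using I.a_rcos_self[OF x] by blast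
  finally show ?thesis by (simp only: quot_alg_simps)
qed

lemma quot_zero: "\<zero>\<^bsub>quot_alg A I\<^esub> = I +>\<^bsub>A\<^esub> \<zero>\<^bsub>A\<^esub>"
  using ring.a_rcos_zero[OF ring_A I.ideal_axioms, of "\<zero>\<^bsub>A\<^esub>"] I.zero_closed
  by (simp add: quot_alg_simps)

lemma quot_one: "\<one>\<^bsub>quot_alg A I\<^esub> = I +>\<^bsub>A\<^esub> \<one>\<^bsub>A\<^esub>"
  by (simp add: quot_alg_simps)

lemma k_algebra_quot: "k_algebra (quot_alg A I)"
proof -
  interpret kvec A by (rule kvec)
  let ?Q = "quot_alg A I"
  note cl = ring_closed[OF ring_A]
  have "abelian_group ?Q"
  proof (rule abelian_groupI)
    fix x assume "x \<in> carrier ?Q"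
    then obtain a where a: "a \<in> carrier A" "x = I +>\<^bsub>A\<^esub> a" by (auto simp: quot_carrier)
    then have "(I +>\<^bsub>A\<^esub> (\<ominus>\<^bsub>A\<^esub> a)) \<oplus>\<^bsub>?Q\<^esub> x = \<zero>\<^bsub>?Q\<^esub>" by (simp add: quot_add cl quot_zero)
    then show "\<exists>y\<in>carrier ?Q. y \<oplus>\<^bsub>?Q\<^esub> x = \<zero>\<^bsub>?Q\<^esub>" using a cl by (auto simp: quot_carrier)
  next
    fix x y assume "x \<in> carrier ?Q" "y \<in> carrier ?Q"
    then obtain a b where "a \<in> carrier A" "x = I +>\<^bsub>A\<^esub> a" "b \<in> carrier A" "y = I +>\<^bsub>A\<^esub> b"
      by (auto simp: quot_carrier)
    then show "x \<oplus>\<^bsub>?Q\<^esub> y = y \<oplus>\<^bsub>?Q\<^esub> x" using ring_add_ac(1)[OF ring_A, of a b] by (simp add: quot_add)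
  qed (auto simp: quot_carrier quot_add quot_zero cl ring_add_ac(2)[OF ring_A])
  moreover have "monoid ?Q"
    by (rule monoidI) (auto simp: quot_carrier quot_mult quot_one cl ring_distrs[OF ring_A])
  ultimately have "ring ?Q"
    by (rule ringI) (auto simp: quot_carrier quot_add quot_mult cl ring_distrs[OF ring_A])
  then interpret Q: ring ?Q .
  have mod: "Module.module scalars ?Q"
    by (rule moduleI[OF cring_scalars Q.is_abelian_group])
      (auto simp: quot_carrier quot_smult quot_add smult_add_l smult_add_r smult_smult)
  show ?thesis
    by (intro k_algebra.intro mod k_algebra_axioms.intro \<open>ring ?Q\<close>)
      (auto simp: quot_carrier quot_smult quot_mult smult_mult_left smult_mult_right)
qed

lemma coset_linear: "(\<lambda>x. I +>\<^bsub>A\<^esub> x) \<in> linear_maps A (quot_alg A I)"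
  by (rule linear_mapsI) (auto simp: quot_carrier quot_add quot_smult)

end

subsection \<open>Tensor products of algebras\<close>

definition bilinear_maps where
  "bilinear_maps V W U = {f. (\<forall>v\<in>carrier V. f v \<in> linear_maps W U) \<and>
     (\<forall>w\<in>carrier W. (\<lambda>v. f v w) \<in> linear_maps V U)}"

lemma bilinear_mapsD:
  assumes "f \<in> bilinear_maps V W U"
  shows "v \<in> carrier V \<Longrightarrow> f v \<in> linear_maps W U" "w \<in> carrier W \<Longrightarrow> (\<lambda>v. f v w) \<in> linear_maps V U"
  using assms by (auto simp: bilinear_maps_def)

lemma monoid_algebra_mult_uminus:
  "(- u) \<otimes>\<^bsub>monoid_algebra M\<^esub> w = - (u \<otimes>\<^bsub>monoid_algebra M\<^esub> w)"
  "w \<otimes>\<^bsub>monoid_algebra M\<^esub> (- u) = - (w \<otimes>\<^bsub>monoid_algebra M\<^esub> u)"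
  using monoid_algebra_mult_add_l[of M "- u" u w] monoid_algebra_mult_add_r[of M w "- u" u]
  by (auto simp: eq_neg_iff_add_eq_0)

lemma monoid_algebra_mult_diff:
  "(u - v) \<otimes>\<^bsub>monoid_algebra M\<^esub> w = u \<otimes>\<^bsub>monoid_algebra M\<^esub> w - v \<otimes>\<^bsub>monoid_algebra M\<^esub> w"
  "w \<otimes>\<^bsub>monoid_algebra M\<^esub> (u - v) = w \<otimes>\<^bsub>monoid_algebra M\<^esub> u - w \<otimes>\<^bsub>monoid_algebra M\<^esub> v"
  using monoid_algebra_mult_add_l[of M u "- v" w] monoid_algebra_mult_add_r[of M w u "- v"]
  by (simp_all add: monoid_algebra_mult_uminus)

locale tensor_algebras = V: k_algebra V + W: k_algebra W
  for V :: "('k::field, 'a, 'm) module_scheme" and W :: "('k, 'b, 'n) module_scheme"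
begin

abbreviation "MA \<equiv> (monoid_algebra (V \<times>\<times> W) :: ('k, 'a \<times> 'b \<Rightarrow>\<^sub>0 'k) module)"
abbreviation "K \<equiv> tensor_kernel V W"

lemma monoid_VW: "monoid (V \<times>\<times> W)"
  by (rule DirProd_monoid) (rule ring.is_monoid[OF V.ring_A] ring.is_monoid[OF W.ring_A])+

lemma MA: "k_algebra MA" by (rule k_algebra_monoid_algebra[OF monoid_VW])

lemma MA_mod: "Module.module scalars MA"
  using k_algebra.kvec[OF MA] by (simp add: kvec_def)

lemma MA_minus: "u \<in> carrier MA \<Longrightarrow> \<ominus>\<^bsub>MA\<^esub> u = - u"
proof -
  interpret M: k_algebra MA by (rule MA)
  assume "u \<in> carrier MA"
  then show ?thesis using abelian_group.minus_equality[OF ring.is_abelian_group[OF k_algebra.ring_A[OF MA]], of "- u" u] by simp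
qed

lemma kernel_submodule: "submodule K scalars MA"
proof -
  interpret M: Module.module scalars MA by (rule MA_mod)
  have rel: "tensor_relations V W \<subseteq> carrier MA"
    using kvec.smult_in[OF V.kvec] kvec.smult_in[OF W.kvec]
    by (auto simp: tensor_relations_def ring_closed[OF V.ring_A] ring_closed[OF W.ring_A]
        dest!: Poly_Mapping.keys_diff[THEN subsetD] split: if_splits)
  let ?F = "{N. submodule N scalars MA \<and> tensor_relations V W \<subseteq> N}"
  have c: "carrier MA \<in> ?F" using M.carrier_is_submodule rel by simp
  show ?thesis
    unfolding tensor_kernel_def
  proof (rule M.submoduleI)
    show "\<Inter>?F \<subseteq> carrier MA" using c by blast
    show "\<zero>\<^bsub>MA\<^esub> \<in> \<Inter>?F"
      using subgroup.one_closed[OF submodule.axioms(1)] by fastforce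
  next
    fix a assume "a \<in> \<Inter>?F"
    then show "\<ominus>\<^bsub>MA\<^esub> a \<in> \<Inter>?F" using M.submoduleE(3) by auto
  next
    fix a b assume "a \<in> \<Inter>?F" "b \<in> \<Inter>?F"
    then show "a \<oplus>\<^bsub>MA\<^esub> b \<in> \<Inter>?F" using M.submoduleE(5)[of _ a b] by auto
  next
    fix c x assume "x \<in> \<Inter>?F"
    then show "c \<odot>\<^bsub>MA\<^esub> x \<in> \<Inter>?F" using M.submoduleE(4)[of _ c x] by auto
  qed
qed

lemma kernel_sub: "K \<subseteq> carrier MA"
proof -
  interpret M: Module.module scalars MA by (rule MA_mod)
  show ?thesis using M.submoduleE(1)[OF kernel_submodule] .
qed

lemma kernel_closed:
  "0 \<in> K" "u \<in> K \<Longrightarrow> v \<in> K \<Longrightarrow> u + v \<in> K" "u \<in> K \<Longrightarrow> Poly_Mapping.map ((*) c) u \<in> K"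
  "u \<in> K \<Longrightarrow> - u \<in> K" "(\<And>i. i \<in> I \<Longrightarrow> f i \<in> K) \<Longrightarrow> sum f I \<in> K"
proof -
  interpret M: Module.module scalars MA by (rule MA_mod)
  note E = M.submoduleE[OF kernel_submodule]
  show 0: "0 \<in> K" using subgroup.one_closed[OF submodule.axioms(1)[OF kernel_submodule]] by simp
  show 1: "u \<in> K \<Longrightarrow> v \<in> K \<Longrightarrow> u + v \<in> K" for u v using E(5)[of u v] by simp
  show "u \<in> K \<Longrightarrow> Poly_Mapping.map ((*) c) u \<in> K" using E(4)[of c u] by simp
  show "u \<in> K \<Longrightarrow> - u \<in> K" using E(3)[of u] MA_minus[of u] E(1) by auto
  show "(\<And>i. i \<in> I \<Longrightarrow> f i \<in> K) \<Longrightarrow> sum f I \<in> K"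
    by (induction I rule: infinite_finite_induct) (auto simp: 0 1)
qed

lemma kernel_relations: "tensor_relations V W \<subseteq> K" by (auto simp: tensor_kernel_def)

text \<open>
  An induction rule for the subspace generated by the bilinearity relations.
\<close>

lemma kernel_minimal:
  assumes P: "\<And>r. r \<in> tensor_relations V W \<Longrightarrow> P r" and sub: "\<And>u. P u \<Longrightarrow> u \<in> carrier MA"
    and P0: "P 0" and Pm: "\<And>u. P u \<Longrightarrow> P (- u)" and Pa: "\<And>u v. P u \<Longrightarrow> P v \<Longrightarrow> P (u + v)"
    and Ps: "\<And>c u. P u \<Longrightarrow> P (Poly_Mapping.map ((*) c) u)" and u: "u \<in> K"
  shows "P u"
proof -
  interpret M: Module.module scalars MA by (rule MA_mod)
  have "submodule {u. P u} scalars MA"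
  proof (rule M.submoduleI)
    show "\<ominus>\<^bsub>MA\<^esub> a \<in> {u. P u}" if "a \<in> {u. P u}" for a using that MA_minus[of a] sub[of a] Pm by simp
  qed (use assms in auto)
  then show ?thesis using u P by (auto simp: tensor_kernel_def)
qed

lemma relationI:
  "\<lbrakk>v \<in> carrier V; v' \<in> carrier V; w \<in> carrier W\<rbrakk> \<Longrightarrow> Poly_Mapping.single (v \<oplus>\<^bsub>V\<^esub> v', w) 1
    - Poly_Mapping.single (v, w) 1 - Poly_Mapping.single (v', w) 1 \<in> tensor_relations V W"
  "\<lbrakk>v \<in> carrier V; w \<in> carrier W; w' \<in> carrier W\<rbrakk> \<Longrightarrow> Poly_Mapping.single (v, w \<oplus>\<^bsub>W\<^esub> w') 1
    - Poly_Mapping.single (v, w) 1 - Poly_Mapping.single (v, w') 1 \<in> tensor_relations V W"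
  "\<lbrakk>v \<in> carrier V; w \<in> carrier W\<rbrakk> \<Longrightarrow> Poly_Mapping.single (c \<odot>\<^bsub>V\<^esub> v, w) 1
    - Poly_Mapping.single (v, w) c \<in> tensor_relations V W"
  "\<lbrakk>v \<in> carrier V; w \<in> carrier W\<rbrakk> \<Longrightarrow> Poly_Mapping.single (v, c \<odot>\<^bsub>W\<^esub> w) 1
    - Poly_Mapping.single (v, w) c \<in> tensor_relations V W"
  unfolding tensor_relations_def by blast+

lemma relationE:
  assumes "r \<in> tensor_relations V W"
  obtains (1) v v' w where "v \<in> carrier V" "v' \<in> carrier V" "w \<in> carrier W"
      "r = Poly_Mapping.single (v \<oplus>\<^bsub>V\<^esub> v', w) 1 - Poly_Mapping.single (v, w) 1 - Poly_Mapping.single (v', w) 1"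
  | (2) v w w' where "v \<in> carrier V" "w \<in> carrier W" "w' \<in> carrier W"
      "r = Poly_Mapping.single (v, w \<oplus>\<^bsub>W\<^esub> w') 1 - Poly_Mapping.single (v, w) 1 - Poly_Mapping.single (v, w') 1"
  | (3) c v w where "v \<in> carrier V" "w \<in> carrier W"
      "r = Poly_Mapping.single (c \<odot>\<^bsub>V\<^esub> v, w) 1 - Poly_Mapping.single (v, w) c"
  | (4) c v w where "v \<in> carrier V" "w \<in> carrier W"
      "r = Poly_Mapping.single (v, c \<odot>\<^bsub>W\<^esub> w) 1 - Poly_Mapping.single (v, w) c"
  using assms unfolding tensor_relations_def
proof (elim UnE CollectE exE conjE, goal_cases)
  case 1 then show ?case by (intro that(1))
next
  case 2 then show ?case by (intro that(2))
next
  case 3 then show ?case by (intro that(3))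
next
  case 4 then show ?case by (intro that(4))
qed

lemma relation_mult:
  assumes r: "r \<in> tensor_relations V W" and cd: "c \<in> carrier V" "d \<in> carrier W"
  shows "r \<otimes>\<^bsub>MA\<^esub> Poly_Mapping.single (c, d) 1 \<in> tensor_relations V W"
    "Poly_Mapping.single (c, d) 1 \<otimes>\<^bsub>MA\<^esub> r \<in> tensor_relations V W"
proof -
  note cl = ring_closed(2)[OF V.ring_A] ring_closed(2)[OF W.ring_A]
  note dist = ring_distrs(1,2)[OF V.ring_A] V.smult_mult_left V.smult_mult_right
    ring_distrs(1,2)[OF W.ring_A] W.smult_mult_left W.smult_mult_right
  show "r \<otimes>\<^bsub>MA\<^esub> Poly_Mapping.single (c, d) 1 \<in> tensor_relations V W"
    using r
  proof (cases rule: relationE)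
    case (1 v v' w)
    then show ?thesis using relationI(1)[of "v \<otimes>\<^bsub>V\<^esub> c" "v' \<otimes>\<^bsub>V\<^esub> c" "w \<otimes>\<^bsub>W\<^esub> d"] cd cl
      by (simp add: monoid_algebra_mult_diff dist)
  next
    case (2 v w w')
    then show ?thesis using relationI(2)[of "v \<otimes>\<^bsub>V\<^esub> c" "w \<otimes>\<^bsub>W\<^esub> d" "w' \<otimes>\<^bsub>W\<^esub> d"] cd cl
      by (simp add: monoid_algebra_mult_diff dist)
  next
    case (3 s v w)
    then show ?thesis using relationI(3)[of "v \<otimes>\<^bsub>V\<^esub> c" "w \<otimes>\<^bsub>W\<^esub> d" s] cd cl
      by (simp add: monoid_algebra_mult_diff dist)
  next
    case (4 s v w)
    then show ?thesis using relationI(4)[of "v \<otimes>\<^bsub>V\<^esub> c" "w \<otimes>\<^bsub>W\<^esub> d" s] cd cl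
      by (simp add: monoid_algebra_mult_diff dist)
  qed
  show "Poly_Mapping.single (c, d) 1 \<otimes>\<^bsub>MA\<^esub> r \<in> tensor_relations V W"
    using r
  proof (cases rule: relationE)
    case (1 v v' w)
    then show ?thesis using relationI(1)[of "c \<otimes>\<^bsub>V\<^esub> v" "c \<otimes>\<^bsub>V\<^esub> v'" "d \<otimes>\<^bsub>W\<^esub> w"] cd cl
      by (simp add: monoid_algebra_mult_diff dist)
  next
    case (2 v w w')
    then show ?thesis using relationI(2)[of "c \<otimes>\<^bsub>V\<^esub> v" "d \<otimes>\<^bsub>W\<^esub> w" "d \<otimes>\<^bsub>W\<^esub> w'"] cd cl
      by (simp add: monoid_algebra_mult_diff dist)
  next
    case (3 s v w)
    then show ?thesis using relationI(3)[of "c \<otimes>\<^bsub>V\<^esub> v" "d \<otimes>\<^bsub>W\<^esub> w" s] cd cl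
      by (simp add: monoid_algebra_mult_diff dist)
  next
    case (4 s v w)
    then show ?thesis using relationI(4)[of "c \<otimes>\<^bsub>V\<^esub> v" "d \<otimes>\<^bsub>W\<^esub> w" s] cd cl
      by (simp add: monoid_algebra_mult_diff dist)
  qed
qed

lemma smult_MA: "Poly_Mapping.map ((*) c) u \<otimes>\<^bsub>MA\<^esub> v = Poly_Mapping.map ((*) c) (u \<otimes>\<^bsub>MA\<^esub> v)"
  "u \<otimes>\<^bsub>MA\<^esub> Poly_Mapping.map ((*) c) v = Poly_Mapping.map ((*) c) (u \<otimes>\<^bsub>MA\<^esub> v)"
  if "u \<in> carrier MA" "v \<in> carrier MA"
  using k_algebra.smult_mult_left[OF MA that] k_algebra.smult_mult_right[OF MA that] by auto

lemma kernel_mult_single: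
  assumes cd: "c \<in> carrier V" "d \<in> carrier W" and u: "u \<in> K"
  shows "u \<otimes>\<^bsub>MA\<^esub> Poly_Mapping.single (c, d) 1 \<in> K \<and> Poly_Mapping.single (c, d) 1 \<otimes>\<^bsub>MA\<^esub> u \<in> K"
proof -
  define s :: "'a \<times> 'b \<Rightarrow>\<^sub>0 'k" where "s = Poly_Mapping.single (c, d) 1"
  have s: "s \<in> carrier MA" using cd by (simp add: s_def)
  have "u \<in> carrier MA \<and> u \<otimes>\<^bsub>MA\<^esub> s \<in> K \<and> s \<otimes>\<^bsub>MA\<^esub> u \<in> K"
  proof (rule kernel_minimal[OF _ _ _ _ _ _ u])
    fix r assume r: "r \<in> tensor_relations V W"
    then show "r \<in> carrier MA \<and> r \<otimes>\<^bsub>MA\<^esub> s \<in> K \<and> s \<otimes>\<^bsub>MA\<^esub> r \<in> K"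
      using relation_mult[OF r cd] kernel_relations kernel_sub unfolding s_def by blast
  next
    fix u v assume "u \<in> carrier MA \<and> u \<otimes>\<^bsub>MA\<^esub> s \<in> K \<and> s \<otimes>\<^bsub>MA\<^esub> u \<in> K"
      "v \<in> carrier MA \<and> v \<otimes>\<^bsub>MA\<^esub> s \<in> K \<and> s \<otimes>\<^bsub>MA\<^esub> v \<in> K"
    then show "u + v \<in> carrier MA \<and> (u + v) \<otimes>\<^bsub>MA\<^esub> s \<in> K \<and> s \<otimes>\<^bsub>MA\<^esub> (u + v) \<in> K"
      using Poly_Mapping.keys_add[of u v] kernel_closed(2)
      by (auto simp: monoid_algebra_mult_add_l monoid_algebra_mult_add_r)
  next
    fix a u assume h: "u \<in> carrier MA \<and> u \<otimes>\<^bsub>MA\<^esub> s \<in> K \<and> s \<otimes>\<^bsub>MA\<^esub> u \<in> K"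
    then have "Poly_Mapping.map ((*) a) u \<in> carrier MA" using keys_smult[of a u] by auto
    then show "Poly_Mapping.map ((*) a) u \<in> carrier MA \<and> Poly_Mapping.map ((*) a) u \<otimes>\<^bsub>MA\<^esub> s \<in> K
        \<and> s \<otimes>\<^bsub>MA\<^esub> Poly_Mapping.map ((*) a) u \<in> K"
      using h s smult_MA[of u s a] smult_MA[of s u a] kernel_closed(3) by auto
  qed (auto simp: monoid_algebra_mult_uminus kernel_closed)
  then show ?thesis by (simp add: s_def)
qed

text \<open>
  The relations are permuted by left and right multiplication with elements of the monoid, which makes
  the subspace generated by them an ideal.
\<close>

lemma kernel_ideal: "ideal K MA"
proof (rule idealI)
  show "ring MA" by (rule k_algebra.ring_A[OF MA])
  show "subgroup K (add_monoid MA)" using submodule.axioms(1)[OF kernel_submodule] .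
  fix u v assume u: "u \<in> K" and v: "v \<in> carrier MA"
  have uM: "u \<in> carrier MA" using u kernel_sub by blast
  have s: "Poly_Mapping.single x (1::'k) \<in> carrier MA" if "x \<in> Poly_Mapping.keys v" for x using v that by auto
  have v': "v = (\<Sum>x\<in>Poly_Mapping.keys v. Poly_Mapping.map ((*) (Poly_Mapping.lookup v x)) (Poly_Mapping.single x 1))"
    using poly_mapping_sum_single[of v] by simp
  have "v \<otimes>\<^bsub>MA\<^esub> u = (\<Sum>x\<in>Poly_Mapping.keys v. Poly_Mapping.map ((*) (Poly_Mapping.lookup v x)) (Poly_Mapping.single x 1 \<otimes>\<^bsub>MA\<^esub> u))"
    by (subst v', simp only: monoid_algebra_mult_sum, rule sum.cong[OF refl], rule smult_MA(1)[OF s uM])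
  also have "\<dots> \<in> K" using v kernel_mult_single[OF _ _ u] by (intro kernel_closed) auto
  finally show "v \<otimes>\<^bsub>MA\<^esub> u \<in> K" .
  have "u \<otimes>\<^bsub>MA\<^esub> v = (\<Sum>x\<in>Poly_Mapping.keys v. Poly_Mapping.map ((*) (Poly_Mapping.lookup v x)) (u \<otimes>\<^bsub>MA\<^esub> Poly_Mapping.single x 1))"
    by (subst v', simp only: monoid_algebra_mult_sum, rule sum.cong[OF refl], rule smult_MA(2)[OF uM s])
  also have "\<dots> \<in> K" using v kernel_mult_single[OF _ _ u] by (intro kernel_closed) auto
  finally show "u \<otimes>\<^bsub>MA\<^esub> v \<in> K" .
qed

lemma alg_ideal: "alg_ideal MA K"
  using MA kernel_ideal by (simp add: alg_ideal_def)

lemma tensor_k_algebra: "k_algebra (tensor V W)"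
  unfolding tensor_def by (rule alg_ideal.k_algebra_quot[OF alg_ideal])

lemma tensor_kvec: "kvec (tensor V W)" by (rule k_algebra.kvec[OF tensor_k_algebra])

lemma tensor_carrier: "carrier (tensor V W) = tensor_class V W ` carrier MA"
  unfolding tensor_def alg_ideal.quot_carrier[OF alg_ideal] tensor_class_def by simp

lemma tensor_class_linear: "tensor_class V W \<in> linear_maps MA (tensor V W)"
  unfolding tensor_def using alg_ideal.coset_linear[OF alg_ideal] by (simp add: tensor_class_def[abs_def])

lemma tensor_class_mult: "u \<in> carrier MA \<Longrightarrow> v \<in> carrier MA \<Longrightarrow>
  tensor_class V W u \<otimes>\<^bsub>tensor V W\<^esub> tensor_class V W v = tensor_class V W (u \<otimes>\<^bsub>MA\<^esub> v)"
  unfolding tensor_def tensor_class_def by (rule alg_ideal.quot_mult[OF alg_ideal])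

lemma tensor_one: "\<one>\<^bsub>tensor V W\<^esub> = pure_tensor V W \<one>\<^bsub>V\<^esub> \<one>\<^bsub>W\<^esub>"
  unfolding tensor_def tensor_class_def pure_tensor_def by (simp add: alg_ideal.quot_one[OF alg_ideal])

lemma tensor_class_eqI: 
  assumes "u \<in> carrier MA" "v \<in> carrier MA" "u - v \<in> K"
  shows "tensor_class V W u = tensor_class V W v"
proof -
  have "u \<ominus>\<^bsub>MA\<^esub> v = u - v" using MA_minus[OF assms(2)] by (simp add: a_minus_def)
  then show ?thesis unfolding tensor_class_def
    using alg_ideal.coset_eq_iff[OF alg_ideal assms(1,2)] assms(3) by simp
qed

lemma pure_closed [simp]: "v \<in> carrier V \<Longrightarrow> w \<in> carrier W \<Longrightarrow> pure_tensor V W v w \<in> carrier (tensor V W)"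
  by (simp add: pure_tensor_def tensor_carrier)

lemma pure_mult: "\<lbrakk>a \<in> carrier V; b \<in> carrier W; c \<in> carrier V; d \<in> carrier W\<rbrakk> \<Longrightarrow>
  pure_tensor V W a b \<otimes>\<^bsub>tensor V W\<^esub> pure_tensor V W c d = pure_tensor V W (a \<otimes>\<^bsub>V\<^esub> c) (b \<otimes>\<^bsub>W\<^esub> d)"
  by (simp add: pure_tensor_def tensor_class_mult)

lemma pure_bilinear: "pure_tensor V W \<in> bilinear_maps V W (tensor V W)"
proof -
  note cl = ring_closed(1)[OF V.ring_A] ring_closed(1)[OF W.ring_A]
    kvec.smult_in[OF V.kvec] kvec.smult_in[OF W.kvec]
  note lin = linear_mapsD[OF tensor_class_linear]
  let ?s = "\<lambda>v w. Poly_Mapping.single (v, w) 1 :: 'a \<times> 'b \<Rightarrow>\<^sub>0 'k"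
  have add: "tensor_class V W a = tensor_class V W b \<oplus>\<^bsub>tensor V W\<^esub> tensor_class V W c"
    if "a - b - c \<in> tensor_relations V W" "a \<in> carrier MA" "b \<in> carrier MA" "c \<in> carrier MA" for a b c
  proof -
    have "b + c \<in> carrier MA" using that Poly_Mapping.keys_add[of b c] by auto
    then have "tensor_class V W a = tensor_class V W (b + c)"
      using that kernel_relations by (intro tensor_class_eqI) (auto simp: algebra_simps)
    also have "\<dots> = tensor_class V W b \<oplus>\<^bsub>tensor V W\<^esub> tensor_class V W c" using lin(2)[OF that(3,4)] by simp
    finally show ?thesis .
  qed
  have smul: "tensor_class V W a = r \<odot>\<^bsub>tensor V W\<^esub> tensor_class V W (?s v w)"
    if "a - Poly_Mapping.single (v, w) r \<in> tensor_relations V W" "a \<in> carrier MA" "v \<in> carrier V" "w \<in> carrier W" for a v w r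
  proof -
    have "tensor_class V W a = tensor_class V W (Poly_Mapping.single (v, w) r)"
      using that kernel_relations by (intro tensor_class_eqI) auto
    also have "\<dots> = r \<odot>\<^bsub>tensor V W\<^esub> tensor_class V W (?s v w)" using lin(3)[of "?s v w" r] that by simp
    finally show ?thesis .
  qed
  show ?thesis
    unfolding bilinear_maps_def pure_tensor_def
    by (intro CollectI conjI ballI linear_mapsI; (rule lin(1) | rule add | rule smul); simp add: cl relationI)
qed

lemma tensor_class_expand:
  assumes u: "u \<in> carrier MA"
  shows "tensor_class V W u = (\<Oplus>\<^bsub>tensor V W\<^esub>x\<in>Poly_Mapping.keys u.
    Poly_Mapping.lookup u x \<odot>\<^bsub>tensor V W\<^esub> pure_tensor V W (fst x) (snd x))"
proof -
  interpret T: kvec "tensor V W" by (rule tensor_kvec)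
  have p: "case_prod (pure_tensor V W) \<in> carrier (V \<times>\<times> W) \<rightarrow> carrier (tensor V W)" by auto
  have "tensor_class V W u = linear_extension (tensor V W) (case_prod (pure_tensor V W)) u"
  proof (rule linear_maps_eq_on_monoid[OF tensor_kvec monoid_VW tensor_class_linear])
    show "linear_extension (tensor V W) (case_prod (pure_tensor V W)) \<in> linear_maps MA (tensor V W)"
      by (rule linear_extension_linear[OF tensor_kvec p])
  qed (use u in \<open>auto simp: T.linear_extension_single pure_tensor_def[symmetric]\<close>)
  then show ?thesis by (simp add: linear_extension_def split_def)
qed

lemma tensor_eq_on_pure:
  assumes U: "kvec U" and f: "f \<in> linear_maps (tensor V W) U" and g: "g \<in> linear_maps (tensor V W) U"
    and eq: "\<And>v w. v \<in> carrier V \<Longrightarrow> w \<in> carrier W \<Longrightarrow> f (pure_tensor V W v w) = g (pure_tensor V W v w)"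
    and t: "t \<in> carrier (tensor V W)"
  shows "f t = g t"
proof -
  obtain u where u: "u \<in> carrier MA" "t = tensor_class V W u" using t by (auto simp: tensor_carrier)
  show ?thesis unfolding u(2) tensor_class_expand[OF u(1)]
    using u(1) by (intro linear_maps_eq_on_span[OF f g tensor_kvec U] eq) auto
qed

text \<open>
  The linear extension of a bilinear map vanishes on the relations, so it is constant on each class.
\<close>

lemma lift_class:
  assumes U: "kvec U" and f: "f \<in> bilinear_maps V W U" and u: "u \<in> carrier MA"
  shows "tensor_lift U f (tensor_class V W u) = linear_extension U (case_prod f) u"
proof -
  interpret U: kvec U by fact
  let ?e = "linear_extension U (case_prod f)"
  have fc: "f v w \<in> carrier U" if "v \<in> carrier V" "w \<in> carrier W" for v w
    using bilinear_mapsD(1)[OF f that(1)] that(2) by (rule linear_mapsD)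
  have lin: "?e \<in> linear_maps MA U" by (rule linear_extension_linear[OF U]) (auto simp: fc)
  note linD = linear_mapsD[OF lin, simplified]
  have m: "?e (- u) = \<ominus>\<^bsub>U\<^esub> ?e u" if "u \<in> carrier MA" for u
  proof -
    have "- u = Poly_Mapping.map ((*) (- 1)) u" by (rule poly_mapping_eqI) simp
    then show ?thesis using linD(3)[of u "- 1"] linD(1)[of u] that U.smult_m1 by simp
  qed
  have "u \<in> carrier MA \<and> ?e u = \<zero>\<^bsub>U\<^esub>" if "u \<in> K" for u
  proof (rule kernel_minimal[OF _ _ _ _ _ _ that])
    have s: "Poly_Mapping.keys (Poly_Mapping.single (v, w) (c::'k)) \<subseteq> carrier V \<times> carrier W"
      if "v \<in> carrier V" "w \<in> carrier W" for v w c using that by auto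
    have d: "?e (a - b) = ?e a \<ominus>\<^bsub>U\<^esub> ?e b" "Poly_Mapping.keys (a - b) \<subseteq> carrier V \<times> carrier W"
      if "Poly_Mapping.keys a \<subseteq> carrier V \<times> carrier W" "Poly_Mapping.keys b \<subseteq> carrier V \<times> carrier W" for a b
      using linD(2)[of a "- b"] m[of b] that Poly_Mapping.keys_diff[of a b] by (auto simp: a_minus_def)
    fix r assume r: "r \<in> tensor_relations V W"
    then have "?e r = \<zero>\<^bsub>U\<^esub>"
    proof (cases rule: relationE)
      case (1 v v' w)
      have "f (v \<oplus>\<^bsub>V\<^esub> v') w = f v w \<oplus>\<^bsub>U\<^esub> f v' w"
        using 1 by (intro linear_mapsD(2)[OF bilinear_mapsD(2)[OF f]])
      then show ?thesis using 1 fc ring_closed(1)[OF V.ring_A] s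
        by (simp add: d U.linear_extension_single a_minus_def U.M.minus_add U.M.add.m_ac U.M.r_neg U.M.r_neg2)
    next
      case (2 v w w')
      have "f v (w \<oplus>\<^bsub>W\<^esub> w') = f v w \<oplus>\<^bsub>U\<^esub> f v w'"
        using 2 by (intro linear_mapsD(2)[OF bilinear_mapsD(1)[OF f]])
      then show ?thesis using 2 fc ring_closed(1)[OF W.ring_A] s
        by (simp add: d U.linear_extension_single a_minus_def U.M.minus_add U.M.add.m_ac U.M.r_neg U.M.r_neg2)
    next
      case (3 c v w)
      have "f (c \<odot>\<^bsub>V\<^esub> v) w = c \<odot>\<^bsub>U\<^esub> f v w"
        using 3 by (intro linear_mapsD(3)[OF bilinear_mapsD(2)[OF f]])
      then show ?thesis using 3 fc kvec.smult_in[OF V.kvec] s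
        by (simp add: d U.linear_extension_single a_minus_def U.M.r_neg)
    next
      case (4 c v w)
      have "f v (c \<odot>\<^bsub>W\<^esub> w) = c \<odot>\<^bsub>U\<^esub> f v w"
        using 4 by (intro linear_mapsD(3)[OF bilinear_mapsD(1)[OF f]])
      then show ?thesis using 4 fc kvec.smult_in[OF W.kvec] s
        by (simp add: d U.linear_extension_single a_minus_def U.M.r_neg)
    qed
    then show "r \<in> carrier MA \<and> ?e r = \<zero>\<^bsub>U\<^esub>" using r kernel_relations kernel_sub by blast
  next
    fix u v assume "u \<in> carrier MA \<and> ?e u = \<zero>\<^bsub>U\<^esub>" "v \<in> carrier MA \<and> ?e v = \<zero>\<^bsub>U\<^esub>"
    then show "u + v \<in> carrier MA \<and> ?e (u + v) = \<zero>\<^bsub>U\<^esub>"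
      using linD(2)[of u v] Poly_Mapping.keys_add[of u v] by auto
  next
    fix c u assume "u \<in> carrier MA \<and> ?e u = \<zero>\<^bsub>U\<^esub>"
    then show "Poly_Mapping.map ((*) c) u \<in> carrier MA \<and> ?e (Poly_Mapping.map ((*) c) u) = \<zero>\<^bsub>U\<^esub>"
      using linD(3)[of u c] keys_smult[of c u] by auto
  qed (auto simp: m)
  then have k: "?e (i + u) = ?e u" if "i \<in> K" for i
    using linD(2)[of i u] linD(1)[of u] u that kernel_sub by fastforce
  have "tensor_class V W u = (\<lambda>i. i + u) ` K" by (auto simp: tensor_class_def a_r_coset_def')
  then have "?e ` tensor_class V W u = {?e u}" using k kernel_closed(1) by (auto simp: image_image)
  then show ?thesis by (simp add: tensor_lift_def)
qed

lemma lift_linear: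
  assumes U: "kvec U" and f: "f \<in> bilinear_maps V W U"
  shows "tensor_lift U f \<in> linear_maps (tensor V W) U"
proof -
  interpret M: kvec MA by (rule k_algebra.kvec[OF MA])
  have fc: "f v w \<in> carrier U" if "v \<in> carrier V" "w \<in> carrier W" for v w
    using bilinear_mapsD(1)[OF f that(1)] that(2) by (rule linear_mapsD)
  have lin: "linear_extension U (case_prod f) \<in> linear_maps MA U" by (rule linear_extension_linear[OF U]) (auto simp: fc)
  note D = linear_mapsD[OF lin] and C = linear_mapsD[OF tensor_class_linear]
  show ?thesis
  proof (rule linear_mapsI)
    fix x assume "x \<in> carrier (tensor V W)"
    then obtain u where u: "u \<in> carrier MA" "x = tensor_class V W u" by (auto simp: tensor_carrier)
    then show "tensor_lift U f x \<in> carrier U" using D(1) lift_class[OF U f] by simp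
    fix c
    show "tensor_lift U f (c \<odot>\<^bsub>tensor V W\<^esub> x) = c \<odot>\<^bsub>U\<^esub> tensor_lift U f x"
      using lift_class[OF U f, of "c \<odot>\<^bsub>MA\<^esub> u"] M.smult_in[OF u(1), of c] lift_class[OF U f u(1)] C(3)[OF u(1)] D(3)[OF u(1)] u(2)
      by metis
  next
    fix x y assume "x \<in> carrier (tensor V W)" "y \<in> carrier (tensor V W)"
    then obtain u v where u: "u \<in> carrier MA" "x = tensor_class V W u" "v \<in> carrier MA" "y = tensor_class V W v"
      by (auto simp: tensor_carrier)
    then have "u \<oplus>\<^bsub>MA\<^esub> v \<in> carrier MA" using ring_closed(1)[OF k_algebra.ring_A[OF MA]] by blast
    then show "tensor_lift U f (x \<oplus>\<^bsub>tensor V W\<^esub> y) = tensor_lift U f x \<oplus>\<^bsub>U\<^esub> tensor_lift U f y"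
      using lift_class[OF U f] C(2)[OF u(1,3)] D(2)[OF u(1,3)] u by metis
  qed
qed

lemma lift_pure:
  assumes U: "kvec U" and f: "f \<in> bilinear_maps V W U" and "v \<in> carrier V" "w \<in> carrier W"
  shows "tensor_lift U f (pure_tensor V W v w) = f v w"
proof -
  have "f v w \<in> carrier U" using bilinear_mapsD(1)[OF f assms(3)] assms(4) by (rule linear_mapsD)
  then show ?thesis unfolding pure_tensor_def using assms(3,4)
    by (subst lift_class[OF U f]) (auto simp: kvec.linear_extension_single[OF U] kvec.smult_1[OF U])
qed

end


section \<open>Coordinates of tensors\<close>

definition coords :: "('k::field, 'a, 'm) module_scheme \<Rightarrow> 'a set \<Rightarrow> 'a \<Rightarrow> 'a \<Rightarrow> 'k" where
  "coords V B v = (THE c. c \<in> B \<rightarrow>\<^sub>E UNIV \<and> v = (\<Oplus>\<^bsub>V\<^esub>b\<in>B. c b \<odot>\<^bsub>V\<^esub> b))"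

locale based = kvec V for V :: "('k::field, 'a, 'm) module_scheme" (structure) +
  fixes B :: "'a set"
  assumes basis: "is_basis V B"
begin

lemma finB: "finite B" and B_sub: "B \<subseteq> carrier V" using basis by (auto simp: is_basis_def)

lemma B_in [simp, intro]: "b \<in> B \<Longrightarrow> b \<in> carrier V" using B_sub by blast

abbreviation "co v b \<equiv> coords V B v b"

lemma coords_spec:
  assumes "v \<in> carrier V"
  shows "coords V B v \<in> B \<rightarrow>\<^sub>E UNIV" "v = (\<Oplus>b\<in>B. co v b \<odot> b)"
proof -
  have "\<exists>!c. c \<in> B \<rightarrow>\<^sub>E UNIV \<and> v = (\<Oplus>b\<in>B. c b \<odot> b)" using basis assms by (simp add: is_basis_def)
  from theI'[OF this] show "coords V B v \<in> B \<rightarrow>\<^sub>E UNIV" "v = (\<Oplus>b\<in>B. co v b \<odot> b)"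
    unfolding coords_def by blast+
qed

lemma comb_closed [simp]: "(\<Oplus>b\<in>B. c b \<odot> b) \<in> carrier V" by (rule M.finsum_closed) auto

lemma coords_unique:
  assumes "v = (\<Oplus>b\<in>B. c b \<odot> b)" "b \<in> B" shows "co v b = c b"
proof -
  have v: "v \<in> carrier V" using assms by simp
  have ex: "\<exists>!c. c \<in> B \<rightarrow>\<^sub>E UNIV \<and> v = (\<Oplus>b\<in>B. c b \<odot> b)" using basis v by (simp add: is_basis_def)
  have "(\<Oplus>b\<in>B. c b \<odot> b) = (\<Oplus>b\<in>B. restrict c B b \<odot> b)" by (rule M.finsum_cong') auto
  then have "restrict c B \<in> B \<rightarrow>\<^sub>E UNIV \<and> v = (\<Oplus>b\<in>B. restrict c B b \<odot> b)" using assms(1) by simp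
  then have "coords V B v = restrict c B" using ex coords_spec[OF v] by blast
  then show ?thesis using assms(2) by simp
qed

lemma coords_linear: "b \<in> B \<Longrightarrow> (\<lambda>v. co v b) \<in> linear_maps V (scalars :: ('k, 'k) module)"
proof (rule linear_mapsI)
  fix x y assume b: "b \<in> B" and x: "x \<in> carrier V" and y: "y \<in> carrier V"
  have "x \<oplus> y = (\<Oplus>b\<in>B. co x b \<odot> b) \<oplus> (\<Oplus>b\<in>B. co y b \<odot> b)"
    using coords_spec(2)[OF x] coords_spec(2)[OF y] by simp
  also have "\<dots> = (\<Oplus>b\<in>B. co x b \<odot> b \<oplus> co y b \<odot> b)" by (rule M.finsum_addf[symmetric]) auto
  also have "\<dots> = (\<Oplus>b\<in>B. (co x b + co y b) \<odot> b)" by (rule M.finsum_cong') (auto simp: smult_add_l)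
  finally show "co (x \<oplus> y) b = co x b \<oplus>\<^bsub>scalars\<^esub> co y b" using coords_unique[OF _ b] by simp
next
  fix c x assume b: "b \<in> B" and x: "x \<in> carrier V"
  have "c \<odot> x = c \<odot> (\<Oplus>b\<in>B. co x b \<odot> b)" using coords_spec(2)[OF x] by simp
  also have "\<dots> = (\<Oplus>b\<in>B. c \<odot> (co x b \<odot> b))" by (rule smult_finsum) auto
  also have "\<dots> = (\<Oplus>b\<in>B. (c * co x b) \<odot> b)" by (rule M.finsum_cong') (auto simp: smult_smult)
  finally show "co (c \<odot> x) b = c \<odot>\<^bsub>scalars\<^esub> co x b" using coords_unique[OF _ b] by simp
qed simp

lemma coords_add: "b \<in> B \<Longrightarrow> x \<in> carrier V \<Longrightarrow> y \<in> carrier V \<Longrightarrow> co (x \<oplus> y) b = co x b + co y b"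
  and coords_smult: "b \<in> B \<Longrightarrow> x \<in> carrier V \<Longrightarrow> co (c \<odot> x) b = c * co x b"
  using linear_mapsD(2,3)[OF coords_linear] by auto

lemma coords_basis: "b \<in> B \<Longrightarrow> b' \<in> B \<Longrightarrow> co b b' = (if b = b' then 1 else 0)"
proof -
  assume b: "b \<in> B" "b' \<in> B"
  have "(\<Oplus>i\<in>B. (if b = i then 1 else 0) \<odot> i) = (\<Oplus>i\<in>B. if b = i then i else \<zero>)"
    by (rule M.finsum_cong') auto
  also have "\<dots> = b" using finB b by (subst M.finsum_singleton) auto
  finally show ?thesis using coords_unique[of b "\<lambda>i. if b = i then 1 else 0" b'] b by simp
qed

lemma linear_expand:
  assumes W: "kvec W" and f: "f \<in> linear_maps V W" and v: "v \<in> carrier V"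
  shows "f v = (\<Oplus>\<^bsub>W\<^esub>b\<in>B. co v b \<odot>\<^bsub>W\<^esub> f b)"
proof -
  interpret W: kvec W by fact
  have "f v = f (\<Oplus>b\<in>B. co v b \<odot> b)" using coords_spec(2)[OF v] by simp
  also have "\<dots> = (\<Oplus>\<^bsub>W\<^esub>b\<in>B. f (co v b \<odot> b))"
    by (rule linear_maps_finsum[OF f kvec_axioms W]) auto
  also have "\<dots> = (\<Oplus>\<^bsub>W\<^esub>b\<in>B. co v b \<odot>\<^bsub>W\<^esub> f b)"
    by (rule W.M.finsum_cong') (auto simp: linear_mapsD[OF f] B_in)
  finally show ?thesis .
qed

end

lemma finsum_Sigma_prod:
  assumes G: "abelian_monoid G" and fin: "finite A" "finite C"
    and f: "\<And>a c. a \<in> A \<Longrightarrow> c \<in> C \<Longrightarrow> f (a, c) \<in> carrier G"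
  shows "(\<Oplus>\<^bsub>G\<^esub>a\<in>A. \<Oplus>\<^bsub>G\<^esub>c\<in>C. f (a, c)) = (\<Oplus>\<^bsub>G\<^esub>x\<in>A \<times> C. f x)"
proof -
  interpret abelian_monoid G by fact
  show ?thesis using fin(1) f
  proof (induction A rule: finite_induct)
    case (insert a A)
    have "(\<Oplus>\<^bsub>G\<^esub>x\<in>insert a A \<times> C. f x) = (\<Oplus>\<^bsub>G\<^esub>x\<in>Pair a ` C \<union> A \<times> C. f x)"
      by (simp only: Times_insert_left)
    also have "\<dots> = (\<Oplus>\<^bsub>G\<^esub>x\<in>Pair a ` C. f x) \<oplus>\<^bsub>G\<^esub> (\<Oplus>\<^bsub>G\<^esub>x\<in>A \<times> C. f x)"
      using insert fin by (intro finsum_Un_disjoint) auto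
    also have "(\<Oplus>\<^bsub>G\<^esub>x\<in>Pair a ` C. f x) = (\<Oplus>\<^bsub>G\<^esub>c\<in>C. f (a, c))"
      using insert by (intro finsum_reindex) (auto simp: inj_on_def)
    finally show ?case using insert by (simp add: Pi_iff)
  qed simp
qed

subsection \<open>Bilinear maps\<close>

lemma bilinear_mapsI:
  assumes "\<And>v w. v \<in> carrier V \<Longrightarrow> w \<in> carrier W \<Longrightarrow> f v w \<in> carrier U"
    "\<And>v v' w. v \<in> carrier V \<Longrightarrow> v' \<in> carrier V \<Longrightarrow> w \<in> carrier W \<Longrightarrow> f (v \<oplus>\<^bsub>V\<^esub> v') w = f v w \<oplus>\<^bsub>U\<^esub> f v' w"
    "\<And>v w w'. v \<in> carrier V \<Longrightarrow> w \<in> carrier W \<Longrightarrow> w' \<in> carrier W \<Longrightarrow> f v (w \<oplus>\<^bsub>W\<^esub> w') = f v w \<oplus>\<^bsub>U\<^esub> f v w'"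
    "\<And>c v w. v \<in> carrier V \<Longrightarrow> w \<in> carrier W \<Longrightarrow> f (c \<odot>\<^bsub>V\<^esub> v) w = c \<odot>\<^bsub>U\<^esub> f v w"
    "\<And>c v w. v \<in> carrier V \<Longrightarrow> w \<in> carrier W \<Longrightarrow> f v (c \<odot>\<^bsub>W\<^esub> w) = c \<odot>\<^bsub>U\<^esub> f v w"
  shows "f \<in> bilinear_maps V W U"
  using assms by (auto simp: bilinear_maps_def intro!: linear_mapsI)

lemma bilinear_maps_simps:
  assumes "f \<in> bilinear_maps V W U" "v \<in> carrier V" "w \<in> carrier W"
  shows "f v w \<in> carrier U"
    "v' \<in> carrier V \<Longrightarrow> f (v \<oplus>\<^bsub>V\<^esub> v') w = f v w \<oplus>\<^bsub>U\<^esub> f v' w"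
    "w' \<in> carrier W \<Longrightarrow> f v (w \<oplus>\<^bsub>W\<^esub> w') = f v w \<oplus>\<^bsub>U\<^esub> f v w'"
    "f (c \<odot>\<^bsub>V\<^esub> v) w = c \<odot>\<^bsub>U\<^esub> f v w" "f v (c \<odot>\<^bsub>W\<^esub> w) = c \<odot>\<^bsub>U\<^esub> f v w"
  using linear_mapsD[OF bilinear_mapsD(1)[OF assms(1,2)]] linear_mapsD[OF bilinear_mapsD(2)[OF assms(1,3)]]
    assms(2,3) by auto

lemma bilinear_comp:
  assumes g: "g \<in> linear_maps U X" and f: "f \<in> bilinear_maps V W U"
  shows "(\<lambda>a b. g (f a b)) \<in> bilinear_maps V W X"
  by (rule bilinear_mapsI) (simp_all add: bilinear_maps_simps[OF f] linear_mapsD[OF g])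

lemma bilinear_comp2:
  assumes f: "f \<in> bilinear_maps V W U" and g: "g \<in> linear_maps V' V" and h: "h \<in> linear_maps W' W"
  shows "(\<lambda>a b. f (g a) (h b)) \<in> bilinear_maps V' W' U"
  by (rule bilinear_mapsI) (simp_all add: bilinear_maps_simps[OF f] linear_mapsD[OF g] linear_mapsD[OF h])

lemma bilinear_scalars:
  assumes "\<alpha> \<in> linear_maps V (scalars :: ('k::field, 'k) module)" "\<beta> \<in> linear_maps W (scalars :: ('k, 'k) module)"
  shows "(\<lambda>a b. \<alpha> a * \<beta> b) \<in> bilinear_maps V W (scalars :: ('k, 'k) module)"
  by (rule bilinear_mapsI)
    (use linear_mapsD[OF assms(1)] linear_mapsD[OF assms(2)] in \<open>simp_all add: algebra_simps\<close>)

context tensor_algebras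
begin

lemma lift_comp:
  assumes U: "kvec U" and X: "kvec X" and g: "g \<in> linear_maps U X" and f: "f \<in> bilinear_maps V W U"
    and t: "t \<in> carrier (tensor V W)"
  shows "g (tensor_lift U f t) = tensor_lift X (\<lambda>a b. g (f a b)) t"
proof (rule tensor_eq_on_pure[OF X _ _ _ t])
  note gf = bilinear_comp[OF g f]
  show "(\<lambda>t. g (tensor_lift U f t)) \<in> linear_maps (tensor V W) X"
    by (rule linear_maps_comp[OF lift_linear[OF U f] g])
  show "tensor_lift X (\<lambda>a b. g (f a b)) \<in> linear_maps (tensor V W) X" by (rule lift_linear[OF X gf])
qed (simp add: lift_pure[OF U f] lift_pure[OF X bilinear_comp[OF g f]])

text \<open>
  The value of a tensor under \<open>\<alpha> \<otimes> \<beta>\<close>. Pairings with coordinate forms are the coordinates of a tensor,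
  and they give access to the coefficients of \<open>\<Delta> x\<close>.
\<close>

definition pairing :: "('a \<Rightarrow> 'k) \<Rightarrow> ('b \<Rightarrow> 'k) \<Rightarrow> ('a \<times> 'b \<Rightarrow>\<^sub>0 'k) set \<Rightarrow> 'k" where
  "pairing \<alpha> \<beta> t = tensor_lift (scalars :: ('k, 'k) module) (\<lambda>a b. \<alpha> a * \<beta> b) t"

lemma pairing_linear:
  assumes "\<alpha> \<in> linear_maps V (scalars :: ('k, 'k) module)" "\<beta> \<in> linear_maps W (scalars :: ('k, 'k) module)"
  shows "pairing \<alpha> \<beta> \<in> linear_maps (tensor V W) (scalars :: ('k, 'k) module)"
  unfolding pairing_def[abs_def] by (rule lift_linear[OF kvec_scalars bilinear_scalars[OF assms]])

lemma pairing_pure: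
  assumes "\<alpha> \<in> linear_maps V (scalars :: ('k, 'k) module)" "\<beta> \<in> linear_maps W (scalars :: ('k, 'k) module)"
    "v \<in> carrier V" "w \<in> carrier W"
  shows "pairing \<alpha> \<beta> (pure_tensor V W v w) = \<alpha> v * \<beta> w"
  unfolding pairing_def by (rule lift_pure[OF kvec_scalars bilinear_scalars[OF assms(1,2)] assms(3,4)])

end

locale based_tensor = tensor_algebras V W + V: based V B + W: based W C
  for V :: "('k::field, 'a, 'm) module_scheme" and W :: "('k, 'b, 'n) module_scheme" and B C
begin

abbreviation "tc b c t \<equiv> pairing (\<lambda>v. coords V B v b) (\<lambda>w. coords W C w c) t"

lemma tc_linear: "b \<in> B \<Longrightarrow> c \<in> C \<Longrightarrow> (\<lambda>t. tc b c t) \<in> linear_maps (tensor V W) (scalars :: ('k, 'k) module)"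
  by (rule pairing_linear[OF V.coords_linear W.coords_linear])

lemma tc_pure: "\<lbrakk>b \<in> B; c \<in> C; v \<in> carrier V; w \<in> carrier W\<rbrakk> \<Longrightarrow>
    tc b c (pure_tensor V W v w) = coords V B v b * coords W C w c"
  by (rule pairing_pure[OF V.coords_linear W.coords_linear])

text \<open>
  Tensors of basis vectors span: both sides are linear, and they agree on pure tensors.
\<close>

lemma tensor_expand:
  assumes t: "t \<in> carrier (tensor V W)"
  shows "t = (\<Oplus>\<^bsub>tensor V W\<^esub>x\<in>B \<times> C. tc (fst x) (snd x) t \<odot>\<^bsub>tensor V W\<^esub> pure_tensor V W (fst x) (snd x))"
proof -
  interpret T: kvec "tensor V W" by (rule tensor_kvec)
  define h where "h t = (\<Oplus>\<^bsub>tensor V W\<^esub>x\<in>B \<times> C. tc (fst x) (snd x) t \<odot>\<^bsub>tensor V W\<^esub> pure_tensor V W (fst x) (snd x))" for t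
  have "t = h t"
  proof (rule tensor_eq_on_pure[OF tensor_kvec _ _ _ t, of "\<lambda>t. t" h])
    show "(\<lambda>t. t) \<in> linear_maps (tensor V W) (tensor V W)" by (rule linear_mapsI) auto
    show "h \<in> linear_maps (tensor V W) (tensor V W)"
    proof (rule linear_mapsI)
      fix x y assume xy: "x \<in> carrier (tensor V W)" "y \<in> carrier (tensor V W)"
      have "h (x \<oplus>\<^bsub>tensor V W\<^esub> y) = (\<Oplus>\<^bsub>tensor V W\<^esub>i\<in>B \<times> C.
        tc (fst i) (snd i) x \<odot>\<^bsub>tensor V W\<^esub> pure_tensor V W (fst i) (snd i) \<oplus>\<^bsub>tensor V W\<^esub>
        tc (fst i) (snd i) y \<odot>\<^bsub>tensor V W\<^esub> pure_tensor V W (fst i) (snd i))"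
        unfolding h_def by (rule T.M.finsum_cong')
          (auto simp: linear_mapsD(2)[OF tc_linear xy] T.smult_add_l)
      also have "\<dots> = h x \<oplus>\<^bsub>tensor V W\<^esub> h y" unfolding h_def by (rule T.M.finsum_addf) auto
      finally show "h (x \<oplus>\<^bsub>tensor V W\<^esub> y) = h x \<oplus>\<^bsub>tensor V W\<^esub> h y" .
    next
      fix c x assume x: "x \<in> carrier (tensor V W)"
      have "h (c \<odot>\<^bsub>tensor V W\<^esub> x) = (\<Oplus>\<^bsub>tensor V W\<^esub>i\<in>B \<times> C.
        c \<odot>\<^bsub>tensor V W\<^esub> (tc (fst i) (snd i) x \<odot>\<^bsub>tensor V W\<^esub> pure_tensor V W (fst i) (snd i)))"
        unfolding h_def by (rule T.M.finsum_cong')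
          (auto simp: linear_mapsD(3)[OF tc_linear x] T.smult_smult)
      also have "\<dots> = c \<odot>\<^bsub>tensor V W\<^esub> h x" unfolding h_def by (rule T.smult_finsum[symmetric]) auto
      finally show "h (c \<odot>\<^bsub>tensor V W\<^esub> x) = c \<odot>\<^bsub>tensor V W\<^esub> h x" .
    qed (auto simp: h_def intro!: T.M.finsum_closed)
    fix v w assume v: "v \<in> carrier V" and w: "w \<in> carrier W"
    have "pure_tensor V W v w = (\<Oplus>\<^bsub>tensor V W\<^esub>b\<in>B. coords V B v b \<odot>\<^bsub>tensor V W\<^esub> pure_tensor V W b w)"
      by (rule V.linear_expand[OF tensor_kvec bilinear_mapsD(2)[OF pure_bilinear w] v])
    also have "\<dots> = (\<Oplus>\<^bsub>tensor V W\<^esub>b\<in>B. \<Oplus>\<^bsub>tensor V W\<^esub>c\<in>C. (coords V B v b * coords W C w c) \<odot>\<^bsub>tensor V W\<^esub> pure_tensor V W b c)"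
    proof (rule T.M.finsum_cong')
      fix b assume b: "b \<in> B"
      have "coords V B v b \<odot>\<^bsub>tensor V W\<^esub> pure_tensor V W b w
        = coords V B v b \<odot>\<^bsub>tensor V W\<^esub> (\<Oplus>\<^bsub>tensor V W\<^esub>c\<in>C. coords W C w c \<odot>\<^bsub>tensor V W\<^esub> pure_tensor V W b c)"
        using W.linear_expand[OF tensor_kvec bilinear_mapsD(1)[OF pure_bilinear V.B_in[OF b]] w] by simp
      also have "\<dots> = (\<Oplus>\<^bsub>tensor V W\<^esub>c\<in>C. coords V B v b \<odot>\<^bsub>tensor V W\<^esub> (coords W C w c \<odot>\<^bsub>tensor V W\<^esub> pure_tensor V W b c))"
        using b by (intro T.smult_finsum) auto
      also have "\<dots> = (\<Oplus>\<^bsub>tensor V W\<^esub>c\<in>C. (coords V B v b * coords W C w c) \<odot>\<^bsub>tensor V W\<^esub> pure_tensor V W b c)"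
        using b by (intro T.M.finsum_cong') (auto simp: T.smult_smult)
      finally show "coords V B v b \<odot>\<^bsub>tensor V W\<^esub> pure_tensor V W b w
        = (\<Oplus>\<^bsub>tensor V W\<^esub>c\<in>C. (coords V B v b * coords W C w c) \<odot>\<^bsub>tensor V W\<^esub> pure_tensor V W b c)" .
    qed (auto intro!: T.M.finsum_closed)
    also have "\<dots> = (\<Oplus>\<^bsub>tensor V W\<^esub>x\<in>B \<times> C. (coords V B v (fst x) * coords W C w (snd x)) \<odot>\<^bsub>tensor V W\<^esub> pure_tensor V W (fst x) (snd x))"
      using finsum_Sigma_prod[OF T.M.abelian_monoid_axioms V.finB W.finB, of "\<lambda>x. (coords V B v (fst x) * coords W C w (snd x))
        \<odot>\<^bsub>tensor V W\<^esub> pure_tensor V W (fst x) (snd x)"] by simp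
    also have "\<dots> = h (pure_tensor V W v w)"
      unfolding h_def by (rule T.M.finsum_cong') (auto simp: tc_pure v w)
    finally show "pure_tensor V W v w = h (pure_tensor V W v w)" .
  qed
  then show ?thesis by (simp add: h_def)
qed

lemma tensor_linear_expand:
  assumes U: "kvec U" and f: "f \<in> linear_maps (tensor V W) U" and t: "t \<in> carrier (tensor V W)"
  shows "f t = (\<Oplus>\<^bsub>U\<^esub>x\<in>B \<times> C. tc (fst x) (snd x) t \<odot>\<^bsub>U\<^esub> f (pure_tensor V W (fst x) (snd x)))"
proof -
  interpret T: kvec "tensor V W" by (rule tensor_kvec)
  interpret U: kvec U by fact
  have "f t = f (\<Oplus>\<^bsub>tensor V W\<^esub>x\<in>B \<times> C. tc (fst x) (snd x) t \<odot>\<^bsub>tensor V W\<^esub> pure_tensor V W (fst x) (snd x))"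
    using tensor_expand[OF t] by simp
  also have "\<dots> = (\<Oplus>\<^bsub>U\<^esub>x\<in>B \<times> C. f (tc (fst x) (snd x) t \<odot>\<^bsub>tensor V W\<^esub> pure_tensor V W (fst x) (snd x)))"
    by (rule linear_maps_finsum[OF f tensor_kvec U]) auto
  also have "\<dots> = (\<Oplus>\<^bsub>U\<^esub>x\<in>B \<times> C. tc (fst x) (snd x) t \<odot>\<^bsub>U\<^esub> f (pure_tensor V W (fst x) (snd x)))"
    by (rule U.M.finsum_cong') (auto simp: linear_mapsD[OF f])
  finally show ?thesis .
qed

lemma tensor_eqI:
  assumes "t \<in> carrier (tensor V W)" "t' \<in> carrier (tensor V W)"
    and "\<And>b c. b \<in> B \<Longrightarrow> c \<in> C \<Longrightarrow> tc b c t = tc b c t'"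
  shows "t = t'"
proof -
  interpret T: kvec "tensor V W" by (rule tensor_kvec)
  have "(\<Oplus>\<^bsub>tensor V W\<^esub>x\<in>B \<times> C. tc (fst x) (snd x) t \<odot>\<^bsub>tensor V W\<^esub> pure_tensor V W (fst x) (snd x))
    = (\<Oplus>\<^bsub>tensor V W\<^esub>x\<in>B \<times> C. tc (fst x) (snd x) t' \<odot>\<^bsub>tensor V W\<^esub> pure_tensor V W (fst x) (snd x))"
    by (rule T.M.finsum_cong') (auto simp: assms(3))
  then show ?thesis using tensor_expand[OF assms(1)] tensor_expand[OF assms(2)] by simp
qed

lemma tensor_form_expand:
  assumes f: "f \<in> linear_maps (tensor V W) (scalars :: ('k, 'k) module)" and t: "t \<in> carrier (tensor V W)"
  shows "f t = (\<Sum>b\<in>B. \<Sum>c\<in>C. tc b c t * f (pure_tensor V W b c))"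
  using tensor_linear_expand[OF kvec_scalars f t] by (simp add: finsum_scalars sum.cartesian_product split_def)

lemma lift_form_expand:
  assumes f: "f \<in> bilinear_maps V W (scalars :: ('k, 'k) module)" and t: "t \<in> carrier (tensor V W)"
  shows "tensor_lift (scalars :: ('k, 'k) module) f t = (\<Sum>b\<in>B. \<Sum>c\<in>C. tc b c t * f b c)"
  unfolding tensor_form_expand[OF lift_linear[OF kvec_scalars f] t]
  by (intro sum.cong refl) (simp add: lift_pure[OF kvec_scalars f] V.B_in W.B_in)

end

subsection \<open>Tensor products of maps\<close>

locale tensor_algebras2 = A: tensor_algebras V W + B: tensor_algebras V' W'
  for V :: "('k::field, 'a, 'm) module_scheme" and W :: "('k, 'b, 'n) module_scheme"
    and V' :: "('k, 'c, 'm2) module_scheme" and W' :: "('k, 'd, 'n2) module_scheme" +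
  fixes f g
  assumes f: "f \<in> linear_maps V V'" and g: "g \<in> linear_maps W W'"
begin

lemma map_bilinear: "(\<lambda>a b. pure_tensor V' W' (f a) (g b)) \<in> bilinear_maps V W (tensor V' W')"
  by (rule bilinear_comp2[OF B.pure_bilinear f g])

lemma map_linear: "tensor_map V' W' f g \<in> linear_maps (tensor V W) (tensor V' W')"
  unfolding tensor_map_def by (rule A.lift_linear[OF B.tensor_kvec map_bilinear])

lemma map_pure: "v \<in> carrier V \<Longrightarrow> w \<in> carrier W \<Longrightarrow>
    tensor_map V' W' f g (pure_tensor V W v w) = pure_tensor V' W' (f v) (g w)"
  unfolding tensor_map_def by (rule A.lift_pure[OF B.tensor_kvec map_bilinear])

lemma map_mult:
  assumes fm: "\<And>x y. x \<in> carrier V \<Longrightarrow> y \<in> carrier V \<Longrightarrow> f (x \<otimes>\<^bsub>V\<^esub> y) = f x \<otimes>\<^bsub>V'\<^esub> f y"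
    and gm: "\<And>x y. x \<in> carrier W \<Longrightarrow> y \<in> carrier W \<Longrightarrow> g (x \<otimes>\<^bsub>W\<^esub> y) = g x \<otimes>\<^bsub>W'\<^esub> g y"
    and s: "s \<in> carrier (tensor V W)" and t: "t \<in> carrier (tensor V W)"
  shows "tensor_map V' W' f g (s \<otimes>\<^bsub>tensor V W\<^esub> t)
    = tensor_map V' W' f g s \<otimes>\<^bsub>tensor V' W'\<^esub> tensor_map V' W' f g t"
proof -
  interpret T: k_algebra "tensor V W" by (rule A.tensor_k_algebra)
  interpret T': k_algebra "tensor V' W'" by (rule B.tensor_k_algebra)
  let ?m = "tensor_map V' W' f g"
  note cl = ring_closed(2)[OF T.ring_A] ring_closed(2)[OF T'.ring_A]
  have lm: "(\<lambda>t. s \<otimes>\<^bsub>tensor V W\<^esub> t) \<in> linear_maps (tensor V W) (tensor V W)"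
    "(\<lambda>t. t \<otimes>\<^bsub>tensor V W\<^esub> s) \<in> linear_maps (tensor V W) (tensor V W)" if "s \<in> carrier (tensor V W)" for s
    using that by (auto intro!: linear_mapsI simp: cl ring_distrs[OF T.ring_A] T.smult_mult_left T.smult_mult_right)
  have lm': "(\<lambda>t. s \<otimes>\<^bsub>tensor V' W'\<^esub> t) \<in> linear_maps (tensor V' W') (tensor V' W')"
    "(\<lambda>t. t \<otimes>\<^bsub>tensor V' W'\<^esub> s) \<in> linear_maps (tensor V' W') (tensor V' W')" if "s \<in> carrier (tensor V' W')" for s
    using that by (auto intro!: linear_mapsI simp: cl ring_distrs[OF T'.ring_A] T'.smult_mult_left T'.smult_mult_right)
  note mc = linear_mapsD(1)[OF map_linear]
  have 1: "?m (pure_tensor V W v w \<otimes>\<^bsub>tensor V W\<^esub> t) = ?m (pure_tensor V W v w) \<otimes>\<^bsub>tensor V' W'\<^esub> ?m t"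
    if v: "v \<in> carrier V" and w: "w \<in> carrier W" for v w
  proof (rule A.tensor_eq_on_pure[OF B.tensor_kvec _ _ _ t])
    show "(\<lambda>t. ?m (pure_tensor V W v w \<otimes>\<^bsub>tensor V W\<^esub> t)) \<in> linear_maps (tensor V W) (tensor V' W')"
      by (rule linear_maps_comp[OF lm(1) map_linear]) (simp add: v w)
    show "(\<lambda>t. ?m (pure_tensor V W v w) \<otimes>\<^bsub>tensor V' W'\<^esub> ?m t) \<in> linear_maps (tensor V W) (tensor V' W')"
      by (rule linear_maps_comp[OF map_linear lm'(1)]) (simp add: v w mc)
    show "?m (pure_tensor V W v w \<otimes>\<^bsub>tensor V W\<^esub> pure_tensor V W a b)
      = ?m (pure_tensor V W v w) \<otimes>\<^bsub>tensor V' W'\<^esub> ?m (pure_tensor V W a b)"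
      if "a \<in> carrier V" "b \<in> carrier W" for a b
      using that v w ring_closed(2)[OF A.V.ring_A] ring_closed(2)[OF A.W.ring_A]
      by (simp add: A.pure_mult map_pure fm gm B.pure_mult linear_mapsD(1)[OF f] linear_mapsD(1)[OF g])
  qed
  show ?thesis
  proof (rule A.tensor_eq_on_pure[OF B.tensor_kvec _ _ _ s])
    show "(\<lambda>s. ?m (s \<otimes>\<^bsub>tensor V W\<^esub> t)) \<in> linear_maps (tensor V W) (tensor V' W')"
      by (rule linear_maps_comp[OF lm(2)[OF t] map_linear])
    show "(\<lambda>s. ?m s \<otimes>\<^bsub>tensor V' W'\<^esub> ?m t) \<in> linear_maps (tensor V W) (tensor V' W')"
      by (rule linear_maps_comp[OF map_linear lm'(2)]) (simp add: t mc)
  qed (rule 1)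
qed

end


section \<open>Hopf algebras in coordinates\<close>

lemma sum_fun_apply: "sum f I x = (\<Sum>i\<in>I. f i x)"
  by (induction I rule: infinite_finite_induct) auto

locale hopf_basis = hopf_algebra H
  for H :: "('k::field, 'h, 'm) hopf_scheme" (structure) +
  fixes B :: "'h set"
  assumes is_basis_B: "is_basis H B"

sublocale hopf_basis \<subseteq> HB: based H B
  by (intro based.intro based_axioms.intro kvec is_basis_B)

sublocale hopf_basis \<subseteq> TT: based_tensor H H B B
  by (intro based_tensor.intro tensor_algebras.intro k_algebra_axioms HB.based_axioms)

context hopf_basis
begin

abbreviation "Ten \<equiv> tensor H H"
abbreviation "kk \<equiv> (scalars :: ('k, 'k) module)"

text \<open>
  The coordinate model of \<open>H\<close>: functions on the carrier type that vanish outside of the basis \<open>B\<close>, with scalar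
  multiplication \<open>fsc\<close> and basis \<open>BB\<close> of indicator functions. The maps \<open>kap\<close> and \<open>iota\<close> are the coordinate
  isomorphism and its inverse; \<open>iota\<close> ignores values outside of \<open>B\<close>, which makes all transported operations
  total.
\<close>

definition fsc :: "'k \<Rightarrow> ('h \<Rightarrow> 'k) \<Rightarrow> 'h \<Rightarrow> 'k" where "fsc c v = (\<lambda>x. c * v x)"
definition iota :: "('h \<Rightarrow> 'k) \<Rightarrow> 'h" where "iota v = (\<Oplus>b\<in>B. v b \<odot> b)"
definition kap :: "'h \<Rightarrow> 'h \<Rightarrow> 'k" where "kap x = (\<lambda>b. if b \<in> B then coords H B x b else 0)"
definition ind :: "'h \<Rightarrow> 'h \<Rightarrow> 'k" where "ind b = (\<lambda>x. if x = b then 1 else 0)"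

lemma abH: "abelian_monoid H"
  using ring.is_abelian_group[OF ring_A] by (simp add: abelian_group_def)

lemmas fs_finsum_cong = abelian_monoid.finsum_cong'[OF abH]
  and fs_finsum_addf = abelian_monoid.finsum_addf[OF abH]
  and fs_finsum_closed = abelian_monoid.finsum_closed[OF abH]
  and fs_finsum_infinite = abelian_monoid.finsum_infinite[OF abH]
  and fs_finsum_singleton = abelian_monoid.finsum_singleton[OF abH]

lemma cl: "x \<in> carrier H \<Longrightarrow> y \<in> carrier H \<Longrightarrow> x \<otimes> y \<in> carrier H"
  "x \<in> carrier H \<Longrightarrow> y \<in> carrier H \<Longrightarrow> x \<oplus> y \<in> carrier H" "\<one> \<in> carrier H"
  using ring_closed[OF ring_A] ring.ring_simprules(6)[OF ring_A] by auto

lemma iota_closed [simp, intro]: "iota v \<in> carrier H" by (simp add: iota_def)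

lemma iota_add: "iota (v + w) = iota v \<oplus> iota w"
proof -
  have "iota (v + w) = (\<Oplus>b\<in>B. v b \<odot> b \<oplus> w b \<odot> b)"
    unfolding iota_def by (rule fs_finsum_cong) (auto simp: HB.smult_add_l cl)
  also have "\<dots> = iota v \<oplus> iota w" unfolding iota_def by (rule fs_finsum_addf) auto
  finally show ?thesis .
qed

lemma iota_smult: "iota (fsc c v) = c \<odot> iota v"
proof -
  have "iota (fsc c v) = (\<Oplus>b\<in>B. c \<odot> (v b \<odot> b))"
    unfolding iota_def by (rule fs_finsum_cong) (auto simp: HB.smult_smult fsc_def)
  also have "\<dots> = c \<odot> iota v" unfolding iota_def by (rule HB.smult_finsum[symmetric]) auto
  finally show ?thesis .
qed

lemma iota_kap: "x \<in> carrier H \<Longrightarrow> iota (kap x) = x"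
proof -
  assume x: "x \<in> carrier H"
  have "iota (kap x) = (\<Oplus>b\<in>B. coords H B x b \<odot> b)"
    unfolding iota_def kap_def by (rule fs_finsum_cong) auto
  then show ?thesis using HB.coords_spec(2)[OF x] by simp
qed

lemma kap_iota: "kap (iota v) = (\<lambda>b. if b \<in> B then v b else 0)"
  unfolding kap_def using HB.coords_unique[OF iota_def] by auto

lemma kap_add: "x \<in> carrier H \<Longrightarrow> y \<in> carrier H \<Longrightarrow> kap (x \<oplus> y) = kap x + kap y"
  by (rule ext) (auto simp: kap_def HB.coords_add)

lemma kap_smult: "x \<in> carrier H \<Longrightarrow> kap (c \<odot> x) = fsc c (kap x)"
  by (rule ext) (auto simp: kap_def HB.coords_smult fsc_def)

lemma kap_zero: "kap \<zero> = 0"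
  using kap_smult[of \<zero> 0] by (simp add: fsc_def fun_eq_iff)

lemma kap_inj: "x \<in> carrier H \<Longrightarrow> y \<in> carrier H \<Longrightarrow> kap x = kap y \<Longrightarrow> x = y"
  using iota_kap by metis

lemma kap_finsum: "f \<in> I \<rightarrow> carrier H \<Longrightarrow> kap (finsum H f I) = (\<Sum>i\<in>I. kap (f i))"
proof (induction I rule: infinite_finite_induct)
  case (insert i I)
  then show ?case by (simp add: kap_add Pi_iff fs_finsum_closed)
qed (auto simp: kap_zero fs_finsum_infinite)

lemma iota_ind: "b \<in> B \<Longrightarrow> iota (ind b) = b"
proof -
  assume b: "b \<in> B"
  have "iota (ind b) = (\<Oplus>i\<in>B. if b = i then i else \<zero>)"
    unfolding iota_def ind_def by (rule fs_finsum_cong) auto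
  then show ?thesis using b HB.finB by (simp add: fs_finsum_singleton)
qed

lemma kap_basis: "b \<in> B \<Longrightarrow> kap b = ind b"
  by (rule ext) (auto simp: kap_def HB.coords_basis ind_def)

lemma inj_ind: "inj_on ind X"
  by (rule inj_onI) (metis ind_def zero_neq_one)

sublocale K: kspace fsc
  by unfold_locales (auto simp: fsc_def fun_eq_iff algebra_simps)

definition BB :: "('h \<Rightarrow> 'k) set" where "BB = ind ` B"
definition VB :: "('h \<Rightarrow> 'k) set" where "VB = K.span BB"

lemma fin_BB: "finite BB" by (simp add: BB_def HB.finB)
lemma card_BB: "card BB = card B" by (simp add: BB_def card_image inj_ind)

lemma sum_BB: "(\<Sum>\<beta>\<in>BB. g \<beta>) = (\<Sum>b\<in>B. g (ind b))"
  by (simp add: BB_def sum.reindex inj_ind)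

lemma fun_expand: "(\<Sum>b\<in>B. fsc (v b) (ind b)) = (\<lambda>b. if b \<in> B then v b else 0)"
  using HB.finB by (auto simp: sum_fun_apply fsc_def ind_def fun_eq_iff if_distrib[of "\<lambda>t. _ * t"] cong: if_cong)

lemma VB_iff: "v \<in> VB \<longleftrightarrow> (\<forall>x. x \<notin> B \<longrightarrow> v x = 0)"
proof
  assume "v \<in> VB"
  then show "\<forall>x. x \<notin> B \<longrightarrow> v x = 0"
    unfolding VB_def by (induction rule: K.span_induct_alt) (auto simp: fsc_def BB_def ind_def split: if_splits)
next
  assume "\<forall>x. x \<notin> B \<longrightarrow> v x = 0"
  then have "v = (\<Sum>b\<in>B. fsc (v b) (ind b))" unfolding fun_expand by auto
  also have "\<dots> \<in> VB" unfolding VB_def by (intro K.span_sum K.span_scale K.span_base) (auto simp: BB_def)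
  finally show "v \<in> VB" .
qed

lemma VB_kap: "kap x \<in> VB" by (auto simp: VB_iff kap_def)
lemma kap_iota_V: "v \<in> VB \<Longrightarrow> kap (iota v) = v" by (auto simp: VB_iff kap_iota)

lemma indep_BB: "K.independent BB"
proof (rule K.independent_if_scalars_zero[OF fin_BB])
  fix f x assume s: "(\<Sum>x\<in>BB. fsc (f x) x) = 0" and x: "x \<in> BB"
  then obtain b where b: "b \<in> B" "x = ind b" by (auto simp: BB_def)
  have "(\<Sum>b\<in>B. fsc (f (ind b)) (ind b)) = 0" using s by (simp add: sum_BB)
  then have "(\<lambda>b. if b \<in> B then f (ind b) else 0) = 0" using fun_expand[of "\<lambda>b. f (ind b)"] by simp
  from fun_cong[OF this, of b] show "f x = 0" using b by simp
qed

text \<open>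
  The structure constants of \<open>\<Delta>\<close>. In the coordinate model they become \<open>dlc\<close>, while counit, product, unit and
  antipode become \<open>ep\<close>, \<open>ml\<close>, \<open>un\<close> and \<open>an\<close>.
\<close>

definition DD :: "'h \<Rightarrow> 'h \<Rightarrow> 'h \<Rightarrow> 'k" where "DD b c x = TT.tc b c (comult H x)"

definition dlc :: "('h \<Rightarrow> 'k) \<Rightarrow> ('h \<Rightarrow> 'k) \<Rightarrow> ('h \<Rightarrow> 'k) \<Rightarrow> 'k" where
  "dlc x \<beta> \<gamma> = (if \<beta> \<in> BB \<and> \<gamma> \<in> BB then DD (iota \<beta>) (iota \<gamma>) (iota x) else 0)"

definition ep :: "('h \<Rightarrow> 'k) \<Rightarrow> 'k" where "ep v = counit H (iota v)"
definition ml :: "('h \<Rightarrow> 'k) \<Rightarrow> ('h \<Rightarrow> 'k) \<Rightarrow> 'h \<Rightarrow> 'k" where "ml v w = kap (iota v \<otimes> iota w)"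
definition un :: "'h \<Rightarrow> 'k" where "un = kap \<one>"
definition an :: "('h \<Rightarrow> 'k) \<Rightarrow> 'h \<Rightarrow> 'k" where "an v = kap (antipode H (iota v))"

lemma iota_BB: "\<beta> \<in> BB \<Longrightarrow> iota \<beta> \<in> B" by (auto simp: BB_def iota_ind)

lemma dlc_ind: "b \<in> B \<Longrightarrow> c \<in> B \<Longrightarrow> dlc x (ind b) (ind c) = DD b c (iota x)"
  by (simp add: dlc_def BB_def iota_ind)

lemma com_closed: "x \<in> carrier H \<Longrightarrow> comult H x \<in> carrier Ten"
  by (rule linear_mapsD(1)[OF comult_linear])

lemma com_linear_tc: "b \<in> B \<Longrightarrow> c \<in> B \<Longrightarrow> (\<lambda>x. DD b c x) \<in> linear_maps H kk"
  unfolding DD_def by (rule linear_maps_comp[OF comult_linear TT.tc_linear])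

text \<open>
  A linear map applied to \<open>\<Delta> x\<close> is a Sweedler sum in coordinates.
\<close>

lemma lift_kap:
  assumes f: "f \<in> bilinear_maps H H H" and x: "x \<in> carrier H"
  shows "kap (tensor_lift H f (comult H x)) = (\<Sum>b\<in>B. \<Sum>c\<in>B. fsc (DD b c x) (kap (f b c)))"
proof -
  note fc = bilinear_maps_simps(1)[OF f]
  have "tensor_lift H f (comult H x) = (\<Oplus>i\<in>B \<times> B. DD (fst i) (snd i) x \<odot> f (fst i) (snd i))"
    unfolding DD_def
    by (subst TT.tensor_linear_expand[OF kvec TT.lift_linear[OF kvec f] com_closed[OF x]], rule fs_finsum_cong)
      (auto simp: TT.lift_pure[OF kvec f] fc)
  then have "kap (tensor_lift H f (comult H x)) = (\<Sum>i\<in>B\<times>B. kap (DD (fst i) (snd i) x \<odot> f (fst i) (snd i)))"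
    using fc by (subst kap_finsum[symmetric]) auto
  also have "\<dots> = (\<Sum>i\<in>B\<times>B. fsc (DD (fst i) (snd i) x) (kap (f (fst i) (snd i))))"
    using fc by (intro sum.cong refl kap_smult) auto
  finally show ?thesis by (simp add: sum.cartesian_product split_def)
qed

lemma tensor_algs: "tensor_algebras H H" "tensor_algebras H Ten" "tensor_algebras Ten H"
  by (intro tensor_algebras.intro k_algebra_axioms TT.tensor_k_algebra)+

text \<open>
  Both sides are the values of the two terms of the coassociativity axiom under the form \<open>la\<close> that reads off the
  coefficient of \<open>b \<otimes> (c \<otimes> d)\<close>.
\<close>

lemma DD_coassoc:
  assumes b: "b \<in> B" and c: "c \<in> B" and d: "d \<in> B" and x: "x \<in> carrier H"
  shows "(\<Sum>e\<in>B. DD e d x * DD b c e) = (\<Sum>e\<in>B. DD b e x * DD c d e)"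
proof -
  interpret HT: tensor_algebras H Ten by (rule tensor_algs)
  interpret TH: tensor_algebras Ten H by (rule tensor_algs)
  have id: "id \<in> linear_maps H H" by (rule linear_mapsI) auto
  interpret M1: tensor_algebras2 H H Ten H "comult H" id
    by (intro tensor_algebras2.intro tensor_algebras2_axioms.intro tensor_algs comult_linear id)
  interpret M2: tensor_algebras2 H H H Ten id "comult H"
    by (intro tensor_algebras2.intro tensor_algebras2_axioms.intro tensor_algs comult_linear id)
  let ?U = "tensor H Ten" and ?p = "pure_tensor H H" and ?q = "pure_tensor H Ten"
  note kU = HT.tensor_kvec
  have pq: "(\<lambda>a b. ?q a (?p b t)) \<in> bilinear_maps H H ?U" if "t \<in> carrier H" for t
    using bilinear_comp2[OF HT.pure_bilinear id bilinear_mapsD(2)[OF TT.pure_bilinear that]] by simp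
  define A where "A s t = tensor_lift ?U (\<lambda>a b. ?q a (?p b t)) s" for s t
  have A_lin: "(\<lambda>s. A s t) \<in> linear_maps Ten ?U" if "t \<in> carrier H" for t
    unfolding A_def by (rule TT.lift_linear[OF kU pq[OF that]])
  have A_pure: "A (?p a b) t = ?q a (?p b t)" if "t \<in> carrier H" "a \<in> carrier H" "b \<in> carrier H" for a b t
    unfolding A_def by (rule TT.lift_pure[OF kU pq[OF that(1)] that(2,3)])
  interpret UU: kvec ?U by (rule kU)
  note qs = bilinear_maps_simps[OF HT.pure_bilinear] and ps = bilinear_maps_simps[OF TT.pure_bilinear]
  \<comment> \<open>\<open>tensor_assoc\<close> is a lift of a lift; bilinearity of the inner one in its second argument is checked on pure tensors.\<close>
  have A_lin2: "(\<lambda>t. A s t) \<in> linear_maps H ?U" if s: "s \<in> carrier Ten" for s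
  proof (rule linear_mapsI)
    fix t t' assume t: "t \<in> carrier H" "t' \<in> carrier H"
    have l: "(\<lambda>s. A s t \<oplus>\<^bsub>?U\<^esub> A s t') \<in> linear_maps Ten ?U"
      by (rule linear_mapsI) (use t linear_mapsD[OF A_lin] in
        \<open>simp_all add: UU.smult_add_r UU.M.add.m_ac UU.M.add.m_closed\<close>)
    show "A s (t \<oplus> t') = A s t \<oplus>\<^bsub>?U\<^esub> A s t'"
      by (rule TT.tensor_eq_on_pure[OF kU A_lin l _ s]) (use t cl in \<open>simp_all add: A_pure ps qs\<close>)
  next
    fix r t assume t: "t \<in> carrier H"
    have l: "(\<lambda>s. r \<odot>\<^bsub>?U\<^esub> A s t) \<in> linear_maps Ten ?U"
      by (rule linear_mapsI) (use t linear_mapsD[OF A_lin] in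
        \<open>simp_all add: UU.smult_add_r UU.smult_smult mult.commute\<close>)
    show "A s (r \<odot> t) = r \<odot>\<^bsub>?U\<^esub> A s t"
      by (rule TT.tensor_eq_on_pure[OF kU A_lin l _ s]) (use t in \<open>simp_all add: A_pure ps qs\<close>)
  qed (use linear_mapsD(1)[OF A_lin] s in auto)
  have A_bil: "A \<in> bilinear_maps Ten H ?U" using A_lin A_lin2 by (auto simp: bilinear_maps_def)
  have assoc: "tensor_assoc H H H = tensor_lift ?U A"
    by (simp add: tensor_assoc_def Let_def A_def[abs_def])
  define la where "la = HT.pairing (\<lambda>a. coords H B a b) (\<lambda>t. TT.tc c d t)"
  have la: "la \<in> linear_maps ?U kk"
    unfolding la_def by (rule HT.pairing_linear[OF HB.coords_linear[OF b] TT.tc_linear[OF c d]])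
  have la_pure: "la (?q a t) = coords H B a b * TT.tc c d t" if "a \<in> carrier H" "t \<in> carrier Ten" for a t
    unfolding la_def by (rule HT.pairing_pure[OF HB.coords_linear[OF b] TT.tc_linear[OF c d] that])
  let ?t = "comult H x"
  have t: "?t \<in> carrier Ten" by (rule com_closed[OF x])
  have "la (tensor_map H Ten id (comult H) ?t)
    = (\<Sum>b'\<in>B. \<Sum>e\<in>B. TT.tc b' e ?t * la (tensor_map H Ten id (comult H) (?p b' e)))"
    by (rule TT.tensor_form_expand[OF linear_maps_comp[OF M2.map_linear la] t])
  also have "\<dots> = (\<Sum>b'\<in>B. if b' = b then (\<Sum>e\<in>B. DD b e x * DD c d e) else 0)"
    by (intro sum.cong refl)
      (auto simp: M2.map_pure la_pure com_closed HB.coords_basis b DD_def sum_distrib_left)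
  also have "\<dots> = (\<Sum>e\<in>B. DD b e x * DD c d e)" using b HB.finB by simp
  finally have R: "la (tensor_map H Ten id (comult H) ?t) = (\<Sum>e\<in>B. DD b e x * DD c d e)" .
  have f1: "(\<lambda>t. la (tensor_assoc H H H (tensor_map Ten H (comult H) id t))) \<in> linear_maps Ten kk"
    unfolding assoc by (rule linear_maps_comp[OF linear_maps_comp[OF M1.map_linear TH.lift_linear[OF kU A_bil]] la])
  have ap: "la (tensor_assoc H H H (tensor_map Ten H (comult H) id (?p b' e))) = DD b c b' * coords H B e d"
    if b': "b' \<in> B" and e: "e \<in> B" for b' e
  proof -
    have "tensor_assoc H H H (tensor_map Ten H (comult H) id (?p b' e)) = A (comult H b') e"
      unfolding assoc using b' e by (simp add: M1.map_pure TH.lift_pure[OF kU A_bil] com_closed)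
    also have "la \<dots> = tensor_lift kk (\<lambda>a b2. la (?q a (?p b2 e))) (comult H b')"
      unfolding A_def using b' e by (intro TT.lift_comp[OF kU kvec_scalars la pq com_closed]) auto
    also have "\<dots> = (\<Sum>a\<in>B. \<Sum>b2\<in>B. TT.tc a b2 (comult H b') * la (?q a (?p b2 e)))"
      using b' e by (intro TT.lift_form_expand bilinear_comp[OF la pq] com_closed) auto
    also have "\<dots> = (\<Sum>a\<in>B. \<Sum>b2\<in>B. if a = b then (if b2 = c then DD b c b' * coords H B e d else 0) else 0)"
      using e by (intro sum.cong refl) (auto simp: la_pure TT.tc_pure c d HB.coords_basis b DD_def)
    also have "\<dots> = (\<Sum>a\<in>B. if a = b then (\<Sum>b2\<in>B. if b2 = c then DD b c b' * coords H B e d else 0) else 0)"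
      by (intro sum.cong refl) auto
    also have "\<dots> = DD b c b' * coords H B e d" using b c HB.finB by simp
    finally show ?thesis .
  qed
  have "la (tensor_assoc H H H (tensor_map Ten H (comult H) id ?t))
    = (\<Sum>b'\<in>B. \<Sum>e\<in>B. TT.tc b' e ?t * (DD b c b' * coords H B e d))"
    by (subst TT.tensor_form_expand[OF f1 t]) (intro sum.cong refl, simp add: ap)
  also have "\<dots> = (\<Sum>b'\<in>B. \<Sum>e\<in>B. if e = d then DD b' d x * DD b c b' else 0)"
    by (intro sum.cong refl) (auto simp: HB.coords_basis d DD_def)
  also have "\<dots> = (\<Sum>b'\<in>B. DD b' d x * DD b c b')" using d HB.finB by simp
  finally show ?thesis using coassoc[OF x] R by simp
qed

lemma coalg: "fd_coalgebra fsc VB BB dlc ep"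
proof unfold_locales
  show "finite BB" "K.independent BB" "VB = K.span BB" by (rule fin_BB indep_BB VB_def)+
  show "dlc (x + y) b c = dlc x b c + dlc y b c" for x y b c
    using linear_mapsD(2)[OF com_linear_tc[OF iota_BB iota_BB]] by (auto simp: dlc_def iota_add)
  show "dlc (fsc r x) b c = r * dlc x b c" for r x b c
    using linear_mapsD(3)[OF com_linear_tc[OF iota_BB iota_BB]] by (auto simp: dlc_def iota_smult)
  show "K.lform ep"
    using linear_mapsD(2,3)[OF counit_linear] by (auto simp: K.lform_def ep_def iota_add iota_smult)
  show "(\<Sum>e\<in>BB. dlc x e d * dlc e b c) = (\<Sum>e\<in>BB. dlc x b e * dlc e c d)"
    if "b \<in> BB" "c \<in> BB" "d \<in> BB" for b c d x
    using that DD_coassoc[OF iota_BB iota_BB iota_BB iota_closed]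
    unfolding sum_BB by (auto simp: dlc_def iota_ind BB_def iota_BB)
  note cb = linear_mapsD[OF counit_linear, simplified]
  have 1: "(\<lambda>a b. counit H a \<odot> b) \<in> bilinear_maps H H H" "(\<lambda>a b. counit H b \<odot> a) \<in> bilinear_maps H H H"
    by (rule bilinear_mapsI; simp add: cb HB.smult_add_l HB.smult_add_r HB.smult_smult mult.commute)+
  show "(\<Sum>b\<in>BB. \<Sum>c\<in>BB. fsc (dlc x b c) (fsc (ep b) c)) = x" if x: "x \<in> VB" for x
  proof -
    have "x = kap (tensor_lift H (\<lambda>a b. counit H a \<odot> b) (comult H (iota x)))"
      by (simp add: counit_left kap_iota_V x)
    also have "\<dots> = (\<Sum>b\<in>B. \<Sum>c\<in>B. fsc (DD b c (iota x)) (kap (counit H b \<odot> c)))"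
      by (rule lift_kap[OF 1(1)]) simp
    also have "\<dots> = (\<Sum>b\<in>B. \<Sum>c\<in>B. fsc (dlc x (ind b) (ind c)) (fsc (ep (ind b)) (ind c)))"
      by (intro sum.cong refl) (simp add: dlc_ind kap_smult kap_basis ep_def iota_ind)
    finally show ?thesis by (simp add: sum_BB)
  qed
  show "(\<Sum>b\<in>BB. \<Sum>c\<in>BB. fsc (dlc x b c) (fsc (ep c) b)) = x" if x: "x \<in> VB" for x
  proof -
    have "x = kap (tensor_lift H (\<lambda>a b. counit H b \<odot> a) (comult H (iota x)))"
      by (simp add: counit_right kap_iota_V x)
    also have "\<dots> = (\<Sum>b\<in>B. \<Sum>c\<in>B. fsc (DD b c (iota x)) (kap (counit H c \<odot> b)))"
      by (rule lift_kap[OF 1(2)]) simp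
    also have "\<dots> = (\<Sum>b\<in>B. \<Sum>c\<in>B. fsc (dlc x (ind b) (ind c)) (fsc (ep (ind c)) (ind b)))"
      by (intro sum.cong refl) (simp add: dlc_ind kap_smult kap_basis ep_def iota_ind)
    finally show ?thesis by (simp add: sum_BB)
  qed
qed

end

sublocale hopf_basis \<subseteq> C: fd_coalgebra fsc VB BB dlc ep
  by (rule coalg)

context hopf_basis
begin

lemma DD_mult:
  assumes e: "e \<in> B" and f: "f \<in> B" and x: "x \<in> carrier H" and y: "y \<in> carrier H"
  shows "DD e f (x \<otimes> y) = (\<Sum>a\<in>B. \<Sum>b\<in>B. \<Sum>c\<in>B. \<Sum>d\<in>B.
    DD a b x * (DD c d y * (coords H B (a \<otimes> c) e * coords H B (b \<otimes> d) f)))"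
proof -
  interpret T: k_algebra Ten by (rule TT.tensor_k_algebra)
  note tcl = ring_closed(2)[OF T.ring_A]
  have lm: "(\<lambda>t. s \<otimes>\<^bsub>Ten\<^esub> t) \<in> linear_maps Ten Ten" "(\<lambda>t. t \<otimes>\<^bsub>Ten\<^esub> s) \<in> linear_maps Ten Ten"
    if "s \<in> carrier Ten" for s
    using that by (auto intro!: linear_mapsI simp: tcl ring_distrs[OF T.ring_A] T.smult_mult_left T.smult_mult_right)
  have "comult H (x \<otimes> y) = comult H x \<otimes>\<^bsub>Ten\<^esub> comult H y"
    using ring_hom_mult[OF comult_hom x y] .
  then have "DD e f (x \<otimes> y) = TT.tc e f (comult H x \<otimes>\<^bsub>Ten\<^esub> comult H y)" by (simp add: DD_def)
  also have "\<dots> = (\<Sum>a\<in>B. \<Sum>b\<in>B. DD a b x * TT.tc e f (pure_tensor H H a b \<otimes>\<^bsub>Ten\<^esub> comult H y))"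
    unfolding DD_def
    by (rule TT.tensor_form_expand[OF linear_maps_comp[OF lm(2)[OF com_closed[OF y]] TT.tc_linear[OF e f]] com_closed[OF x]])
  also have "\<dots> = (\<Sum>a\<in>B. \<Sum>b\<in>B. DD a b x * (\<Sum>c\<in>B. \<Sum>d\<in>B. DD c d y *
      TT.tc e f (pure_tensor H H a b \<otimes>\<^bsub>Ten\<^esub> pure_tensor H H c d)))"
    unfolding DD_def
    by (intro sum.cong refl arg_cong2[of _ _ _ _ "(*)"]
        TT.tensor_form_expand[OF linear_maps_comp[OF lm(1) TT.tc_linear[OF e f]] com_closed[OF y]]) auto
  also have "\<dots> = (\<Sum>a\<in>B. \<Sum>b\<in>B. \<Sum>c\<in>B. \<Sum>d\<in>B.
    DD a b x * (DD c d y * (coords H B (a \<otimes> c) e * coords H B (b \<otimes> d) f)))"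
    by (simp add: sum_distrib_left TT.pure_mult TT.tc_pure e f cl cong: sum.cong)
  finally show ?thesis .
qed

lemma hopf: "fd_hopf fsc VB BB dlc ep ml un an"
proof (unfold_locales)
  have mc: "iota x \<otimes> iota y \<in> carrier H" for x y by (simp add: cl)
  note sl = linear_mapsD[OF antipode_linear, simplified]
  show "K.bil ml"
    unfolding K.bil_def K.lmap_def ml_def
    by (auto simp: iota_add iota_smult A_l_distr A_r_distr smult_mult_left smult_mult_right kap_add kap_smult mc)
  show "ml x y \<in> VB" for x y by (simp add: ml_def VB_kap)
  show "ml (ml x y) z = ml x (ml y z)" for x y z
    by (simp add: ml_def iota_kap mc A_assoc)
  show "un \<in> VB" by (simp add: un_def VB_kap)
  show "ml un x = x" if "x \<in> VB" for x
    using that ring_closed(7)[OF ring_A, of "iota x"] by (simp add: ml_def un_def iota_kap cl kap_iota_V)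
  show "ml x un = x" if "x \<in> VB" for x
    using that ring_closed(8)[OF ring_A, of "iota x"] by (simp add: ml_def un_def iota_kap cl kap_iota_V)
  show "ep (ml x y) = ep x * ep y" for x y
    using ring_hom_mult[OF counit_hom, of "iota x" "iota y"] by (simp add: ep_def ml_def iota_kap mc)
  show "ep un = 1" using ring_hom_one[OF counit_hom] by (simp add: ep_def un_def iota_kap cl)
  show "K.lmap an"
    by (auto simp: K.lmap_def an_def iota_add iota_smult sl kap_add kap_smult)
  show "an x \<in> VB" for x by (simp add: an_def VB_kap)
  show "C.sw (\<lambda>a b. ml (an a) b) x = fsc (ep x) un" for x
  proof -
    have "(\<lambda>a b. antipode H a \<otimes> b) \<in> bilinear_maps H H H"
      by (rule bilinear_mapsI) (simp_all add: sl cl A_l_distr A_r_distr smult_mult_left smult_mult_right)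
    from lift_kap[OF this, of "iota x"]
    have "kap (counit H (iota x) \<odot> \<one>) = (\<Sum>b\<in>B. \<Sum>c\<in>B. fsc (DD b c (iota x)) (kap (antipode H b \<otimes> c)))"
      by (simp add: antipode_left)
    also have "\<dots> = C.sw (\<lambda>a b. ml (an a) b) x"
      unfolding C.sw_def sum_BB by (intro sum.cong refl) (simp add: dlc_ind ml_def an_def iota_ind iota_kap sl)
    finally show ?thesis by (simp add: kap_smult cl ep_def un_def)
  qed
  show "C.sw (\<lambda>a b. ml a (an b)) x = fsc (ep x) un" for x
  proof -
    have "(\<lambda>a b. a \<otimes> antipode H b) \<in> bilinear_maps H H H"
      by (rule bilinear_mapsI) (simp_all add: sl cl A_l_distr A_r_distr smult_mult_left smult_mult_right)
    from lift_kap[OF this, of "iota x"]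
    have "kap (counit H (iota x) \<odot> \<one>) = (\<Sum>b\<in>B. \<Sum>c\<in>B. fsc (DD b c (iota x)) (kap (b \<otimes> antipode H c)))"
      by (simp add: antipode_right)
    also have "\<dots> = C.sw (\<lambda>a b. ml a (an b)) x"
      unfolding C.sw_def sum_BB by (intro sum.cong refl) (simp add: dlc_ind ml_def an_def iota_ind iota_kap sl)
    finally show ?thesis by (simp add: kap_smult cl ep_def un_def)
  qed
  have kexp: "kap x = (\<Sum>b\<in>B. fsc (coords H B x b) (ind b))" for x
    unfolding fun_expand by (simp add: kap_def)
  have Fk: "F (kap x) (kap y) = (\<Sum>e\<in>B. \<Sum>f\<in>B. fsc (coords H B x e * coords H B y f) (F (ind e) (ind f)))"
    if F: "K.bil F" for F x y
    by (simp add: kexp K.bil_simps[OF F] K.scale_sum_right, subst sum.swap) (simp add: mult.commute)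
  show "C.sw F un = F un un" if F: "K.bil F" for F
  proof -
    have "comult H \<one> = pure_tensor H H \<one> \<one>" using ring_hom_one[OF comult_hom] TT.tensor_one by simp
    then have "DD b c \<one> = coords H B \<one> b * coords H B \<one> c" if "b \<in> B" "c \<in> B" for b c
      using that by (simp add: DD_def TT.tc_pure cl)
    then have "C.sw F un = (\<Sum>b\<in>B. \<Sum>c\<in>B. fsc (coords H B \<one> b * coords H B \<one> c) (F (ind b) (ind c)))"
      unfolding C.sw_def sum_BB by (intro sum.cong refl) (simp add: dlc_ind un_def iota_kap cl)
    also have "\<dots> = F un un"
      unfolding un_def by (rule Fk[OF F, symmetric])
    finally show ?thesis .
  qed
  show "C.sw F (ml x y) = C.sw (\<lambda>a b. C.sw (\<lambda>c d. F (ml a c) (ml b d)) y) x" if F: "K.bil F" for F x y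
  proof -
    let ?X = "iota x" and ?Y = "iota y"
    let ?k = "\<lambda>a b c d e f. DD a b ?X * (DD c d ?Y * (coords H B (a \<otimes> c) e * coords H B (b \<otimes> d) f))"
    have "C.sw (\<lambda>a b. C.sw (\<lambda>c d. F (ml a c) (ml b d)) y) x
      = (\<Sum>a\<in>B. \<Sum>b\<in>B. \<Sum>c\<in>B. \<Sum>d\<in>B. \<Sum>e\<in>B. \<Sum>f\<in>B. fsc (?k a b c d e f) (F (ind e) (ind f)))"
      unfolding C.sw_def sum_BB
      by (simp add: dlc_ind ml_def iota_ind Fk[OF F] K.scale_sum_right cong: sum.cong)
    also have "\<dots> = (\<Sum>a\<in>B. \<Sum>b\<in>B. \<Sum>e\<in>B. \<Sum>f\<in>B. \<Sum>c\<in>B. \<Sum>d\<in>B. fsc (?k a b c d e f) (F (ind e) (ind f)))"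
      by (rule sum.cong[OF refl], rule sum.cong[OF refl], rule C.sum_swap4)
    also have "\<dots> = (\<Sum>e\<in>B. \<Sum>f\<in>B. \<Sum>a\<in>B. \<Sum>b\<in>B. \<Sum>c\<in>B. \<Sum>d\<in>B. fsc (?k a b c d e f) (F (ind e) (ind f)))"
      by (rule C.sum_swap4)
    also have "\<dots> = (\<Sum>e\<in>B. \<Sum>f\<in>B. fsc (DD e f (?X \<otimes> ?Y)) (F (ind e) (ind f)))"
      by (simp add: DD_mult K.scale_sum_left cong: sum.cong)
    also have "\<dots> = C.sw F (ml x y)"
      unfolding C.sw_def sum_BB by (intro sum.cong refl) (simp add: dlc_ind ml_def iota_kap mc)
    finally show ?thesis by simp
  qed
qed

end

sublocale hopf_basis \<subseteq> F: fd_hopf fsc VB BB dlc ep ml un an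
  by (rule hopf)


section \<open>Subcoalgebras in coordinates\<close>

context hopf_basis
begin

lemma coords_iota: "b \<in> B \<Longrightarrow> coords H B (iota v) b = v b"
  using fun_cong[OF kap_iota[of v], of b] by (simp add: kap_def)

lemma kap_expand: "kap x = (\<Sum>b\<in>B. fsc (coords H B x b) (ind b))"
  unfolding fun_expand by (simp add: kap_def)

lemma R_expand: "C.R \<alpha> x = (\<Sum>b\<in>B. \<Sum>c\<in>B. fsc (DD b c (iota x)) (fsc (\<alpha> (ind c)) (ind b)))"
  unfolding C.R_def C.sw_def sum_BB by (intro sum.cong refl) (simp add: dlc_ind)

lemma L_expand: "C.L \<alpha> x = (\<Sum>b\<in>B. \<Sum>c\<in>B. fsc (DD b c (iota x)) (fsc (\<alpha> (ind b)) (ind c)))"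
  unfolding C.L_def C.sw_def sum_BB by (intro sum.cong refl) (simp add: dlc_ind)

lemma fsc_apply [simp]: "fsc c v x = c * v x" by (simp add: fsc_def)

lemma coord_form: "K.lform (\<lambda>w. w c)" by (simp add: K.lform_def)

text \<open>
  The coordinates of \<open>R\<close> at coordinate forms are the structure constants. Through them, statements about all
  \<open>R \<alpha> x\<close> become statements about tensors.
\<close>

lemma R_coord: "b \<in> B \<Longrightarrow> c \<in> B \<Longrightarrow> C.R (\<lambda>w. w c) x b = DD b c (iota x)"
proof -
  assume b: "b \<in> B" and c: "c \<in> B"
  have "C.R (\<lambda>w. w c) x b = (\<Sum>b'\<in>B. \<Sum>c'\<in>B. if b' = b then (if c' = c then DD b c (iota x) else 0) else 0)"
    unfolding R_expand sum_fun_apply by (intro sum.cong refl) (auto simp: ind_def)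
  also have "\<dots> = (\<Sum>b'\<in>B. if b' = b then (\<Sum>c'\<in>B. if c' = c then DD b c (iota x) else 0) else 0)"
    by (intro sum.cong refl) auto
  also have "\<dots> = DD b c (iota x)" using b c HB.finB by simp
  finally show ?thesis .
qed

lemma glike_grouplike:
  assumes v: "C.glike v" shows "grouplike H (iota v)"
proof -
  have "comult H (iota v) = pure_tensor H H (iota v) (iota v)"
  proof (rule TT.tensor_eqI)
    fix b c assume bc: "b \<in> B" "c \<in> B"
    have "TT.tc b c (comult H (iota v)) = C.R (\<lambda>w. w c) v b" using R_coord[OF bc] by (simp add: DD_def)
    also have "\<dots> = v c * v b" using C.glikeD(3)[OF v coord_form] by simp
    finally show "TT.tc b c (comult H (iota v)) = TT.tc b c (pure_tensor H H (iota v) (iota v))"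
      using bc by (simp add: TT.tc_pure coords_iota)
  qed (simp_all add: com_closed)
  moreover have "counit H (iota v) = 1" using C.glikeD(2)[OF v] by (simp add: ep_def)
  ultimately show ?thesis by (simp add: grouplike_def)
qed

lemma skew_comult:
  assumes x: "C.skew u un x"
  shows "comult H (iota x) = pure_tensor H H (iota x) \<one> \<oplus>\<^bsub>Ten\<^esub> pure_tensor H H (iota u) (iota x)"
proof (rule TT.tensor_eqI)
  interpret T: k_algebra Ten by (rule TT.tensor_k_algebra)
  show "pure_tensor H H (iota x) \<one> \<oplus>\<^bsub>Ten\<^esub> pure_tensor H H (iota u) (iota x) \<in> carrier Ten"
    by (intro ring_closed(1)[OF T.ring_A]) (simp_all add: cl)
  fix b c assume bc: "b \<in> B" "c \<in> B"
  have "TT.tc b c (comult H (iota x)) = C.R (\<lambda>w. w c) x b" using R_coord[OF bc] by (simp add: DD_def)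
  also have "\<dots> = un c * x b + x c * u b" using x coord_form by (simp add: C.skew_def)
  also have "\<dots> = TT.tc b c (pure_tensor H H (iota x) \<one>) + TT.tc b c (pure_tensor H H (iota u) (iota x))"
    using bc by (simp add: TT.tc_pure coords_iota cl) (simp add: un_def kap_def)
  also have "\<dots> = TT.tc b c (pure_tensor H H (iota x) \<one> \<oplus>\<^bsub>Ten\<^esub> pure_tensor H H (iota u) (iota x))"
    using linear_mapsD(2)[OF TT.tc_linear[OF bc], of "pure_tensor H H (iota x) \<one>" "pure_tensor H H (iota u) (iota x)"]
    by (simp add: cl)
  finally show "TT.tc b c (comult H (iota x))
    = TT.tc b c (pure_tensor H H (iota x) \<one> \<oplus>\<^bsub>Ten\<^esub> pure_tensor H H (iota u) (iota x))" .
qed (simp add: com_closed)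

lemma grouplike_glike:
  assumes g: "grouplike H g" shows "C.glike (kap g)"
proof -
  have gH: "g \<in> carrier H" using g by (simp add: grouplike_def)
  have D: "DD b c g = coords H B g b * coords H B g c" if "b \<in> B" "c \<in> B" for b c
    using g that by (simp add: DD_def grouplike_def TT.tc_pure)
  have "C.R \<alpha> (kap g) = fsc (\<alpha> (kap g)) (kap g)" if al: "K.lform \<alpha>" for \<alpha>
  proof -
    have "C.R \<alpha> (kap g) = (\<Sum>b\<in>B. \<Sum>c\<in>B. fsc (coords H B g b * coords H B g c) (fsc (\<alpha> (ind c)) (ind b)))"
      unfolding R_expand by (intro sum.cong refl) (simp add: D iota_kap gH)
    also have "\<dots> = (\<Sum>b\<in>B. fsc (\<Sum>c\<in>B. coords H B g c * \<alpha> (ind c)) (fsc (coords H B g b) (ind b)))"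
      by (intro sum.cong refl) (simp add: K.scale_sum_left sum_distrib_left mult_ac)
    also have "\<dots> = fsc (\<Sum>c\<in>B. coords H B g c * \<alpha> (ind c)) (kap g)"
      by (simp only: kap_expand K.scale_sum_right)
    also have "(\<Sum>c\<in>B. coords H B g c * \<alpha> (ind c)) = \<alpha> (kap g)"
      by (simp add: kap_expand K.lform_simps[OF al])
    finally show ?thesis .
  qed
  moreover have "ep (kap g) = 1" using g by (simp add: ep_def iota_kap grouplike_def)
  ultimately show ?thesis by (simp add: C.glike_def VB_kap)
qed

lemma tc_class_linear:
  "b \<in> B \<Longrightarrow> c \<in> B \<Longrightarrow> (\<lambda>u. TT.tc b c (tensor_class H H u)) \<in> linear_maps TT.MA kk"
  by (rule linear_maps_comp[OF TT.tensor_class_linear TT.tc_linear])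

lemma tc_class_single:
  assumes "b \<in> B" "c \<in> B" "s \<in> carrier H" "t \<in> carrier H"
  shows "TT.tc b c (tensor_class H H (Poly_Mapping.single (s, t) 1)) = coords H B s b * coords H B t c"
  using TT.tc_pure[OF assms] by (simp add: pure_tensor_def)

lemma tc_class_sum:
  assumes bc: "b \<in> B" "c \<in> B" and st: "\<And>e. e \<in> E \<Longrightarrow> s e \<in> carrier H \<and> t e \<in> carrier H"
  shows "TT.tc b c (tensor_class H H (\<Sum>e\<in>E. Poly_Mapping.single (s e, t e) 1))
    = (\<Sum>e\<in>E. coords H B (s e) b * coords H B (t e) c)"
  using st
proof (induction E rule: infinite_finite_induct)
  case (insert e E)
  let ?u = "\<Sum>e\<in>E. Poly_Mapping.single (s e, t e) (1::'k)"
  have "Poly_Mapping.keys ?u \<subseteq> carrier H \<times> carrier H"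
    using keys_sum[of "\<lambda>e. Poly_Mapping.single (s e, t e) (1::'k)" E] insert.prems by fastforce
  then have "TT.tc b c (tensor_class H H (Poly_Mapping.single (s e, t e) 1 + ?u))
    = TT.tc b c (tensor_class H H (Poly_Mapping.single (s e, t e) 1)) + TT.tc b c (tensor_class H H ?u)"
    using linear_mapsD(2)[OF tc_class_linear[OF bc], of "Poly_Mapping.single (s e, t e) 1" ?u] insert.prems by simp
  then show ?case using insert bc by (simp add: tc_class_single)
qed (use linear_maps_zero[OF tc_class_linear[OF bc] k_algebra.kvec[OF TT.MA] kvec_scalars] in simp_all)

lemma tc_class_expand:
  assumes bc: "b \<in> B" "c \<in> B" and u: "Poly_Mapping.keys u \<subseteq> carrier H \<times> carrier H"
  shows "TT.tc b c (tensor_class H H u)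
    = (\<Sum>z\<in>Poly_Mapping.keys u. Poly_Mapping.lookup u z * (coords H B (fst z) b * coords H B (snd z) c))"
proof -
  have "TT.tc b c (tensor_class H H u) = linear_extension kk (\<lambda>(s, t). coords H B s b * coords H B t c) u"
    unfolding TT.pairing_def
    using u by (intro TT.lift_class[OF kvec_scalars bilinear_scalars] HB.coords_linear bc) auto
  then show ?thesis by (simp add: linear_extension_def finsum_scalars split_def)
qed

text \<open>
  The two actions computed from an arbitrary representative of \<open>\<Delta> s\<close>.
\<close>

lemma RL_class:
  assumes al: "K.lform \<alpha>" and s: "s \<in> carrier H" and u: "Poly_Mapping.keys u \<subseteq> carrier H \<times> carrier H"
    and c: "comult H s = tensor_class H H u"
  shows "C.R \<alpha> (kap s) = (\<Sum>z\<in>Poly_Mapping.keys u. fsc (Poly_Mapping.lookup u z * \<alpha> (kap (snd z))) (kap (fst z)))"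
    and "C.L \<alpha> (kap s) = (\<Sum>z\<in>Poly_Mapping.keys u. fsc (Poly_Mapping.lookup u z * \<alpha> (kap (fst z))) (kap (snd z)))"
proof -
  have D: "DD b c s = (\<Sum>z\<in>Poly_Mapping.keys u. Poly_Mapping.lookup u z * (coords H B (fst z) b * coords H B (snd z) c))"
    if "b \<in> B" "c \<in> B" for b c
    unfolding DD_def assms(4) by (rule tc_class_expand[OF that u])
  note als = K.lform_simps[OF al]
  have "C.R \<alpha> (kap s) = (\<Sum>b\<in>B. \<Sum>c\<in>B. \<Sum>z\<in>Poly_Mapping.keys u.
      fsc (Poly_Mapping.lookup u z * (coords H B (snd z) c * \<alpha> (ind c))) (fsc (coords H B (fst z) b) (ind b)))"
    unfolding R_expand
    by (intro sum.cong refl) (simp add: D iota_kap s K.scale_sum_left sum_distrib_left mult_ac)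
  also have "\<dots> = (\<Sum>z\<in>Poly_Mapping.keys u. \<Sum>b\<in>B. \<Sum>c\<in>B.
      fsc (Poly_Mapping.lookup u z * (coords H B (snd z) c * \<alpha> (ind c))) (fsc (coords H B (fst z) b) (ind b)))"
    by (subst sum.swap, rule trans[OF _ sum.swap]) (rule sum.cong[OF refl], rule sum.cong[OF refl], simp)
  also have "\<dots> = (\<Sum>z\<in>Poly_Mapping.keys u. fsc (Poly_Mapping.lookup u z * \<alpha> (kap (snd z))) (kap (fst z)))"
    by (simp add: kap_expand als K.scale_sum_right K.scale_sum_left sum_distrib_left mult_ac)
  finally show "C.R \<alpha> (kap s) = (\<Sum>z\<in>Poly_Mapping.keys u. fsc (Poly_Mapping.lookup u z * \<alpha> (kap (snd z))) (kap (fst z)))" .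
  have "C.L \<alpha> (kap s) = (\<Sum>b\<in>B. \<Sum>c\<in>B. \<Sum>z\<in>Poly_Mapping.keys u.
      fsc (Poly_Mapping.lookup u z * (coords H B (fst z) b * \<alpha> (ind b))) (fsc (coords H B (snd z) c) (ind c)))"
    unfolding L_expand
    by (intro sum.cong refl) (simp add: D iota_kap s K.scale_sum_left sum_distrib_left mult_ac)
  also have "\<dots> = (\<Sum>z\<in>Poly_Mapping.keys u. \<Sum>b\<in>B. \<Sum>c\<in>B.
      fsc (Poly_Mapping.lookup u z * (coords H B (fst z) b * \<alpha> (ind b))) (fsc (coords H B (snd z) c) (ind c)))"
    by (subst sum.swap, rule trans[OF _ sum.swap]) (rule sum.cong[OF refl], rule sum.cong[OF refl], simp)
  also have "\<dots> = (\<Sum>z\<in>Poly_Mapping.keys u. fsc (Poly_Mapping.lookup u z * \<alpha> (kap (fst z))) (kap (snd z)))"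
    by (simp add: kap_expand als K.scale_sum_right K.scale_sum_left sum_distrib_left mult_ac, subst sum.swap, simp)
  finally show "C.L \<alpha> (kap s) = (\<Sum>z\<in>Poly_Mapping.keys u. fsc (Poly_Mapping.lookup u z * \<alpha> (kap (fst z))) (kap (snd z)))" .
qed

definition stable :: "('h \<Rightarrow> 'k) set \<Rightarrow> bool" where
  "stable D \<longleftrightarrow> C.Rstable D \<and> (\<forall>\<alpha> x. K.lform \<alpha> \<longrightarrow> x \<in> D \<longrightarrow> C.L \<alpha> x \<in> D)"

lemma iota_0: "iota 0 = \<zero>"
  using iota_kap[of \<zero>] by (simp add: kap_zero)

lemma iota_uminus: "iota (- v) = \<ominus> iota v"
proof -
  have "- v = fsc (- 1) v" by (simp add: fsc_def fun_eq_iff)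
  then have "iota (- v) = (- 1) \<odot> iota v" by (simp only: iota_smult)
  then show ?thesis using HB.smult_m1[of "iota v"] by simp
qed

lemma HB_module: "Module.module scalars H"
  using kvec by (simp add: kvec_def)

text \<open>
  If \<open>e\<close> runs through a basis of \<open>D\<close> with dual forms \<open>e\<^sup>*\<close>, then \<open>\<Delta> v = \<Sum> e \<otimes> L e\<^sup>* v\<close>, and both factors
  are in \<open>D\<close>.
\<close>

lemma stable_subcoalgebra:
  assumes D: "stable D" shows "subcoalgebra H (iota ` D)"
proof -
  have sD: "K.subspace D" and DV: "D \<subseteq> VB" using D by (auto simp: stable_def C.Rstable_def)
  have sub: "submodule (iota ` D) scalars H"
  proof (rule Module.module.submoduleI[OF HB_module])
    show "\<zero> \<in> iota ` D" using K.subspace_0[OF sD] iota_0 by force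
    show "\<ominus> a \<in> iota ` D" if aD: "a \<in> iota ` D" for a
    proof -
      obtain v where v: "v \<in> D" "a = iota v" using aD by blast
      then show ?thesis using K.subspace_neg[OF sD v(1)] iota_uminus[of v] by force
    qed
    show "a \<oplus> b \<in> iota ` D" if ab: "a \<in> iota ` D" "b \<in> iota ` D" for a b
    proof -
      obtain v w where v: "v \<in> D" "a = iota v" "w \<in> D" "b = iota w" using ab by blast
      then show ?thesis using K.subspace_add[OF sD v(1,3)] iota_add[of v w] by force
    qed
    show "a \<odot> b \<in> iota ` D" if bD: "b \<in> iota ` D" for a b
    proof -
      obtain v where v: "v \<in> D" "b = iota v" using bD by blast
      then show ?thesis using K.subspace_scale[OF sD v(1), of a] iota_smult[of a v] by force
    qed
  qed auto
  obtain E where E: "finite E" "K.independent E" "K.span E = D" "E \<subseteq> D"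
    using C.finite_basis[OF sD DV] by metis
  have "comult H (iota v) \<in> tensor_class H H ` {u. Poly_Mapping.keys u \<subseteq> iota ` D \<times> iota ` D}" if v: "v \<in> D" for v
  proof -
    define u where "u = (\<Sum>e\<in>E. Poly_Mapping.single (iota e, iota (C.L (K.dual E e) v)) (1::'k))"
    have Lv: "C.L (K.dual E e) v \<in> D" for e using D v K.dual(1)[OF E(2)] by (auto simp: stable_def)
    have k: "Poly_Mapping.keys u \<subseteq> iota ` D \<times> iota ` D"
      unfolding u_def using keys_sum[of "\<lambda>e. Poly_Mapping.single (iota e, iota (C.L (K.dual E e) v)) (1::'k)" E] E(4) Lv
      by fastforce
    have "comult H (iota v) = tensor_class H H u"
    proof (rule TT.tensor_eqI)
      show "comult H (iota v) \<in> carrier Ten" by (simp add: com_closed)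
      have "Poly_Mapping.keys u \<subseteq> carrier H \<times> carrier H" using k by auto
      then show "tensor_class H H u \<in> carrier Ten" by (simp add: TT.tensor_carrier)
      fix b c assume bc: "b \<in> B" "c \<in> B"
      have "C.R (\<lambda>w. w c) v \<in> D" using D v coord_form by (auto simp: stable_def C.Rstable_def)
      then have "C.R (\<lambda>w. w c) v = (\<Sum>e\<in>E. fsc (K.dual E e (C.R (\<lambda>w. w c) v)) e)"
        using K.dual_expand[OF E(2,1)] E(3) by simp
      also have "\<dots> = (\<Sum>e\<in>E. fsc (C.L (K.dual E e) v c) e)"
        using C.form_R_L[OF K.dual(1)[OF E(2)] coord_form] by simp
      finally have "C.R (\<lambda>w. w c) v b = (\<Sum>e\<in>E. C.L (K.dual E e) v c * e b)" by (simp add: sum_fun_apply)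
      then have "TT.tc b c (comult H (iota v)) = (\<Sum>e\<in>E. e b * C.L (K.dual E e) v c)"
        using R_coord[OF bc] by (simp add: DD_def mult.commute)
      also have "\<dots> = TT.tc b c (tensor_class H H u)"
        unfolding u_def by (subst tc_class_sum[OF bc]) (simp_all add: coords_iota bc)
      finally show "TT.tc b c (comult H (iota v)) = TT.tc b c (tensor_class H H u)" .
    qed
    then show ?thesis using k by blast
  qed
  then show ?thesis unfolding subcoalgebra_def using sub by blast
qed

lemma subcoalgebra_stable:
  assumes N: "subcoalgebra H N" shows "stable (kap ` N)"
proof -
  have sub: "submodule N scalars H" using N by (simp add: subcoalgebra_def)
  note E = Module.module.submoduleE[OF HB_module sub]
  have NH: "s \<in> carrier H" if "s \<in> N" for s using E(1) that by blast
  have "K.subspace (kap ` N)"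
  proof (rule K.subspaceI)
    obtain a where a: "a \<in> N" using E(2) by blast
    have "(0::'k) \<odot> a \<in> N" using E(4)[of 0 a] a by simp
    then show "0 \<in> kap ` N" using NH[OF a] kap_zero by force
  next
    fix x y assume "x \<in> kap ` N" "y \<in> kap ` N"
    then obtain s t where "s \<in> N" "t \<in> N" "x = kap s" "y = kap t" by blast
    then show "x + y \<in> kap ` N" using E(5)[of s t] kap_add[of s t] NH by force
  next
    fix c x assume "x \<in> kap ` N"
    then obtain s where "s \<in> N" "x = kap s" by blast
    then show "fsc c x \<in> kap ` N" using E(4)[of c s] kap_smult[of s c] NH by force
  qed
  moreover have "C.R \<alpha> x \<in> kap ` N \<and> C.L \<alpha> x \<in> kap ` N" if al: "K.lform \<alpha>" and x: "x \<in> kap ` N" for \<alpha> x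
  proof -
    obtain s where s: "s \<in> N" "x = kap s" using x by blast
    then obtain u where u: "comult H s = tensor_class H H u" "Poly_Mapping.keys u \<subseteq> N \<times> N"
      using N by (auto simp: subcoalgebra_def)
    then have uH: "Poly_Mapping.keys u \<subseteq> carrier H \<times> carrier H" using NH by auto
    show ?thesis unfolding s(2) RL_class[OF al NH[OF s(1)] uH u(1)]
      using u(2) by (intro conjI K.subspace_sum calculation K.subspace_scale) auto
  qed
  ultimately show ?thesis unfolding stable_def C.Rstable_def using VB_kap by auto
qed

text \<open>
  A stable subspace of least dimension inside the given one corresponds to a simple subcoalgebra.
\<close>

lemma pointed_coalg:
  assumes P: "pointed H" shows "C.pointed_coalg"
  unfolding C.pointed_coalg_def
proof (intro allI impI)
  fix C0 assume C0: "C.Rstable C0" "\<forall>\<alpha> x. K.lform \<alpha> \<longrightarrow> x \<in> C0 \<longrightarrow> C.L \<alpha> x \<in> C0" "C0 \<noteq> {0}"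
  define Q where "Q D \<longleftrightarrow> stable D \<and> D \<noteq> {0} \<and> D \<subseteq> C0" for D
  have "Q C0" using C0 by (auto simp: Q_def stable_def)
  then obtain D where D: "Q D" and Dmin: "\<And>D'. Q D' \<Longrightarrow> K.dim D \<le> K.dim D'"
    using ex_has_least_nat[of Q C0 K.dim] by blast
  have st: "stable D" and sD: "K.subspace D" and DV: "D \<subseteq> VB" using D by (auto simp: Q_def stable_def C.Rstable_def)
  have ki: "kap ` iota ` D = D" using DV kap_iota_V by (force simp: image_image)
  have "simple_subcoalgebra H (iota ` D)"
    unfolding simple_subcoalgebra_def
  proof (intro conjI allI impI stable_subcoalgebra[OF st])
    show "iota ` D \<noteq> {\<zero>}" using ki D kap_zero by (auto simp: Q_def)
    fix N assume N: "subcoalgebra H N \<and> N \<subseteq> iota ` D"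
    then have "stable (kap ` N)" by (simp add: subcoalgebra_stable)
    moreover have ND: "kap ` N \<subseteq> D" using N ki by blast
    have NH: "N \<subseteq> carrier H" using N by auto
    have iN: "iota ` kap ` N = N"
      unfolding image_image using NH by (subst image_cong[OF refl, of N _ "\<lambda>x. x"]) (auto simp: iota_kap)
    show "N = {\<zero>} \<or> N = iota ` D"
    proof (cases "kap ` N = {0}")
      case True then show ?thesis using iN iota_0 by auto
    next
      case False
      then have "Q (kap ` N)" using calculation ND D by (auto simp: Q_def)
      then have "K.dim D \<le> K.dim (kap ` N)" by (rule Dmin)
      then have "kap ` N = D"
        using C.dim_strict_mono_V[of "kap ` N" D] ND sD DV calculation
        by (auto simp: stable_def C.Rstable_def psubset_eq)
      then show ?thesis using iN by auto
    qed
  qed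
  then obtain g where g: "grouplike H g" "iota ` D = range (\<lambda>c. c \<odot> g)" using P by (auto simp: pointed_def)
  have gH: "g \<in> carrier H" using g by (simp add: grouplike_def)
  have "(1::'k) \<odot> g \<in> iota ` D" unfolding g(2) by blast
  then have "g \<in> iota ` D" using gH by simp
  then have "kap g \<in> D" using ki by blast
  then show "\<exists>g\<in>C0. C.glike g" using grouplike_glike[OF g(1)] D by (auto simp: Q_def)
qed

end


section \<open>Isomorphisms with group algebras\<close>

lemma kvec_cong:
  assumes V: "kvec V" and eq: "carrier V' = carrier V" "add V' = add V" "ring.zero V' = ring.zero V" "module.smult V' = module.smult V"
  shows "kvec V'"
proof -
  interpret V: kvec V by fact
  have ab: "abelian_group V'"
    by (rule abelian_groupI)
      (auto simp: eq V.M.add.m_closed V.M.add.m_assoc intro: V.M.add.m_comm bexI[of _ "\<ominus>\<^bsub>V\<^esub> x" for x] V.M.l_neg)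
  show ?thesis
    by (rule kvecI, rule moduleI[OF cring_scalars ab])
      (auto simp: eq V.smult_add_l V.smult_add_r V.smult_smult)
qed

lemma k_algebra_cong:
  assumes A: "k_algebra A" and eq: "carrier A' = carrier A" "add A' = add A" "ring.zero A' = ring.zero A"
    "module.smult A' = module.smult A" "monoid.mult A' = monoid.mult A" "one A' = one A"
  shows "k_algebra A'"
proof -
  interpret A: k_algebra A by fact
  have kv: "kvec A'" by (rule kvec_cong[OF A.kvec eq(1-4)])
  then interpret V': kvec A' .
  note cl = ring_closed[OF A.ring_A]
  have mon: "monoid A'"
    by (rule monoidI) (auto simp: eq cl ring_distrs[OF A.ring_A])
  have "ring A'"
    by (rule ringI[OF V'.M.abelian_group_axioms mon]) (auto simp: eq cl ring_distrs[OF A.ring_A])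
  then show ?thesis
    using kv by (intro k_algebra.intro k_algebra_axioms.intro)
      (auto simp: kvec_def eq A.smult_mult_left A.smult_mult_right)
qed

text \<open>
  Hopf algebras extend the records of algebras. A tensor product of Hopf algebras depends only on their
  underlying algebras.
\<close>

lemma tensor_cong:
  assumes "carrier V' = carrier V" "add V' = add V" "module.smult V' = module.smult V"
    "monoid.mult V' = monoid.mult V" "one V' = one V"
    and "carrier W' = carrier W" "add W' = add W" "module.smult W' = module.smult W"
    "monoid.mult W' = monoid.mult W" "one W' = one W"
  shows "tensor V' W' = tensor V W" "pure_tensor V' W' = pure_tensor V W"
proof -
  have 1: "V' \<times>\<times> W' = V \<times>\<times> W" using assms by (simp add: DirProd_def)
  have 2: "tensor_relations V' W' = tensor_relations V W" using assms by (simp add: tensor_relations_def)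
  have 3: "tensor_kernel V' W' = tensor_kernel V W" by (simp add: tensor_kernel_def 1 2)
  show "tensor V' W' = tensor V W" by (simp add: tensor_def 1 3)
  show "pure_tensor V' W' = pure_tensor V W"
    by (intro ext) (simp add: pure_tensor_def tensor_class_def 1 3)
qed

subsection \<open>Bijectivity on bases\<close>

context kvec
begin

text \<open>
  The span of a finite family, as the set of its linear combinations.
\<close>

lemma combs_closed:
  assumes t: "t \<in> I \<rightarrow> carrier V"
  defines "S \<equiv> range (\<lambda>c. \<Oplus>i\<in>I. c i \<odot> t i)"
  shows "S \<subseteq> carrier V" "\<zero> \<in> S" "v \<in> S \<Longrightarrow> w \<in> S \<Longrightarrow> v \<oplus> w \<in> S" "v \<in> S \<Longrightarrow> c \<odot> v \<in> S"
    "finite J \<Longrightarrow> h \<in> J \<rightarrow> S \<Longrightarrow> finsum V h J \<in> S"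
    "finite I \<Longrightarrow> i \<in> I \<Longrightarrow> t i \<in> S"
proof -
  have tc: "t i \<in> carrier V" if "i \<in> I" for i using t that by auto
  have ct: "(\<lambda>i. c i \<odot> t i) \<in> I \<rightarrow> carrier V" for c using t by auto
  show S: "S \<subseteq> carrier V" using M.finsum_closed[OF ct] unfolding S_def by auto
  have "(\<Oplus>i\<in>I. 0 \<odot> t i) = (\<Oplus>i\<in>I. \<zero>)" by (rule M.finsum_cong') (use tc in auto)
  then show z: "\<zero> \<in> S" unfolding S_def image_iff by (intro bexI[of _ "\<lambda>_. 0"]) auto
  show add: "v \<oplus> w \<in> S" if vw: "v \<in> S" "w \<in> S" for v w
  proof -
    obtain c d where cd: "v = (\<Oplus>i\<in>I. c i \<odot> t i)" "w = (\<Oplus>i\<in>I. d i \<odot> t i)" using vw unfolding S_def by blast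
    have "(\<Oplus>i\<in>I. (c i + d i) \<odot> t i) = (\<Oplus>i\<in>I. c i \<odot> t i \<oplus> d i \<odot> t i)"
      by (rule M.finsum_cong') (use tc in \<open>auto simp: smult_add_l\<close>)
    also have "\<dots> = v \<oplus> w" unfolding cd by (rule M.finsum_addf[OF ct ct])
    finally show ?thesis unfolding S_def image_iff by (intro bexI[of _ "\<lambda>i. c i + d i"]) auto
  qed
  show "c \<odot> v \<in> S" if "v \<in> S" for v c
  proof -
    obtain d where d: "v = (\<Oplus>i\<in>I. d i \<odot> t i)" using \<open>v \<in> S\<close> unfolding S_def by blast
    have "c \<odot> v = (\<Oplus>i\<in>I. c \<odot> (d i \<odot> t i))" unfolding d by (rule smult_finsum[OF ct])
    also have "\<dots> = (\<Oplus>i\<in>I. (c * d i) \<odot> t i)"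
      by (rule M.finsum_cong') (use tc in \<open>auto simp: smult_smult\<close>)
    finally show ?thesis unfolding S_def image_iff by (intro bexI[of _ "\<lambda>i. c * d i"]) auto
  qed
  show "finsum V h J \<in> S" if "finite J" "h \<in> J \<rightarrow> S" for h J
    using that
  proof (induction J)
    case (insert j J)
    then have h: "h \<in> J \<rightarrow> carrier V" "h j \<in> carrier V" using S by auto
    have "finsum V h (insert j J) = h j \<oplus> finsum V h J"
      using insert.hyps h by (rule M.finsum_insert)
    then show ?case using insert by (simp add: add)
  qed (simp add: z)
  show "t i \<in> S" if I: "finite I" and i: "i \<in> I"
  proof -
    have "(\<Oplus>j\<in>I. (if j = i then 1 else 0) \<odot> t j) = (\<Oplus>j\<in>I. if i = j then t j else \<zero>)"
      by (rule M.finsum_cong') (use tc in auto)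
    also have "\<dots> = t i" using I i tc by (intro M.finsum_singleton) auto
    finally show ?thesis unfolding S_def image_iff by (intro bexI[of _ "\<lambda>j. if j = i then 1 else 0"]) auto
  qed
qed

end

text \<open>
  A spanning family that is mapped bijectively onto a basis is itself a basis.
\<close>

lemma (in based) linear_bij:
  assumes T: "kvec T" and \<theta>: "\<theta> \<in> linear_maps T V" and t: "t \<in> I \<rightarrow> carrier T"
    and bij: "bij_betw (\<lambda>i. \<theta> (t i)) I B"
    and sp: "\<And>y. y \<in> carrier T \<Longrightarrow> y \<in> range (\<lambda>c. \<Oplus>\<^bsub>T\<^esub>i\<in>I. c i \<odot>\<^bsub>T\<^esub> t i)"
  shows "bij_betw \<theta> (carrier T) (carrier V)"
proof -
  interpret T: kvec T by fact
  let ?b = "\<lambda>i. \<theta> (t i)" and ?j = "inv_into I (\<lambda>i. \<theta> (t i))"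
  have im: "?b ` I = B" and inj: "inj_on ?b I" using bij unfolding bij_betw_def by blast+
  have bc: "?b i \<in> carrier V" if "i \<in> I" for i using t linear_mapsD(1)[OF \<theta>] that by auto
  have \<theta>c: "\<theta> (\<Oplus>\<^bsub>T\<^esub>i\<in>I. c i \<odot>\<^bsub>T\<^esub> t i) = (\<Oplus>b\<in>B. c (?j b) \<odot> b)" for c
  proof -
    have "\<theta> (\<Oplus>\<^bsub>T\<^esub>i\<in>I. c i \<odot>\<^bsub>T\<^esub> t i) = (\<Oplus>i\<in>I. \<theta> (c i \<odot>\<^bsub>T\<^esub> t i))"
      by (rule linear_maps_finsum[OF \<theta> T kvec_axioms]) (use t in auto)
    also have "\<dots> = (\<Oplus>i\<in>I. c (?j (?b i)) \<odot> ?b i)"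
      by (rule M.finsum_cong') (use t bc in \<open>auto simp: inv_into_f_f[OF inj] linear_mapsD(3)[OF \<theta>] Pi_iff\<close>)
    also have "\<dots> = (\<Oplus>b\<in>?b ` I. c (?j b) \<odot> b)"
      by (rule M.finsum_reindex[OF _ inj, symmetric]) (use bc in auto)
    finally show ?thesis unfolding im .
  qed
  show ?thesis
    unfolding bij_betw_def
  proof
    show "inj_on \<theta> (carrier T)"
    proof (rule inj_onI)
      fix y z assume y: "y \<in> carrier T" and z: "z \<in> carrier T" and eq: "\<theta> y = \<theta> z"
      obtain c d where c: "y = (\<Oplus>\<^bsub>T\<^esub>i\<in>I. c i \<odot>\<^bsub>T\<^esub> t i)" and d: "z = (\<Oplus>\<^bsub>T\<^esub>i\<in>I. d i \<odot>\<^bsub>T\<^esub> t i)"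
        using sp[OF y] sp[OF z] by blast
      have "c i = d i" if i: "i \<in> I" for i
      proof -
        have b: "?b i \<in> B" using im i by blast
        have "coords V B (\<theta> y) (?b i) = c i" "coords V B (\<theta> z) (?b i) = d i"
          using coords_unique[OF \<theta>c b] inv_into_f_f[OF inj i] unfolding c d by auto
        then show ?thesis using eq by simp
      qed
      then show "y = z" unfolding c d by (intro T.M.finsum_cong') (use t in auto)
    qed
    show "\<theta> ` carrier T = carrier V"
    proof
      show "\<theta> ` carrier T \<subseteq> carrier V" using linear_mapsD(1)[OF \<theta>] by auto
      show "carrier V \<subseteq> \<theta> ` carrier T"
      proof
        fix v assume v: "v \<in> carrier V"
        let ?y = "\<Oplus>\<^bsub>T\<^esub>i\<in>I. coords V B v (?b i) \<odot>\<^bsub>T\<^esub> t i"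
        have "\<theta> ?y = (\<Oplus>b\<in>B. coords V B v b \<odot> b)" unfolding \<theta>c
          by (rule M.finsum_cong') (use f_inv_into_f[of _ ?b I] im in auto)
        also have "\<dots> = v" using coords_spec(2)[OF v] by simp
        finally have "v = \<theta> ?y" by simp
        moreover have "?y \<in> carrier T" by (rule T.M.finsum_closed) (use t in auto)
        ultimately show "v \<in> \<theta> ` carrier T" by (rule image_eqI)
      qed
    qed
  qed
qed

subsection \<open>Isomorphisms from bijective homomorphisms\<close>

text \<open>
  In the applications \<open>L\<close> is a group algebra or a Taft algebra, out of which maps are easy to define. The wanted
  isomorphism is the inverse of \<open>\<theta>\<close>, and its compatibility with the coalgebra structure can be checked on
  generators of \<open>L\<close>.
\<close>

locale algebra_bijection = H: hopf_algebra H
  for H :: "('k::field, 'h, 'm) hopf_scheme" and L :: "('k, 'l, 'n) hopf_scheme" and \<theta> +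
  assumes L: "k_algebra L" and \<theta>: "\<theta> \<in> linear_maps L H"
    and \<theta>_mult: "\<And>x y. x \<in> carrier L \<Longrightarrow> y \<in> carrier L \<Longrightarrow> \<theta> (x \<otimes>\<^bsub>L\<^esub> y) = \<theta> x \<otimes>\<^bsub>H\<^esub> \<theta> y"
    and \<theta>_one: "\<theta> \<one>\<^bsub>L\<^esub> = \<one>\<^bsub>H\<^esub>" and \<theta>_bij: "bij_betw \<theta> (carrier L) (carrier H)"
begin

definition \<psi> where "\<psi> = inv_into (carrier L) \<theta>"

lemma \<theta>_\<psi>: "x \<in> carrier H \<Longrightarrow> \<theta> (\<psi> x) = x" and \<psi>_\<theta>: "y \<in> carrier L \<Longrightarrow> \<psi> (\<theta> y) = y"
  and \<psi>_closed: "x \<in> carrier H \<Longrightarrow> \<psi> x \<in> carrier L"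
  using \<theta>_bij by (auto simp: \<psi>_def bij_betw_def f_inv_into_f inv_into_into)

lemma \<psi>_eq: "y \<in> carrier L \<Longrightarrow> \<theta> y = x \<Longrightarrow> \<psi> x = y" using \<psi>_\<theta> by blast

lemma \<psi>_linear: "\<psi> \<in> linear_maps H L"
proof (rule linear_mapsI)
  note cl = ring_closed(1)[OF k_algebra.ring_A[OF L]] kvec.smult_in[OF k_algebra.kvec[OF L]]
  show "\<psi> (x \<oplus>\<^bsub>H\<^esub> y) = \<psi> x \<oplus>\<^bsub>L\<^esub> \<psi> y" if "x \<in> carrier H" "y \<in> carrier H" for x y
    using that by (intro \<psi>_eq) (simp_all add: cl \<psi>_closed linear_mapsD[OF \<theta>] \<theta>_\<psi>)
  show "\<psi> (c \<odot>\<^bsub>H\<^esub> x) = c \<odot>\<^bsub>L\<^esub> \<psi> x" if "x \<in> carrier H" for c x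
    using that by (intro \<psi>_eq) (simp_all add: cl \<psi>_closed linear_mapsD[OF \<theta>] \<theta>_\<psi>)
qed (rule \<psi>_closed)

lemma \<psi>_mult: "x \<in> carrier H \<Longrightarrow> y \<in> carrier H \<Longrightarrow> \<psi> (x \<otimes>\<^bsub>H\<^esub> y) = \<psi> x \<otimes>\<^bsub>L\<^esub> \<psi> y"
  using ring_closed(2)[OF k_algebra.ring_A[OF L]] by (intro \<psi>_eq) (simp_all add: \<psi>_closed \<theta>_mult \<theta>_\<psi>)

lemma \<psi>_one: "\<psi> \<one>\<^bsub>H\<^esub> = \<one>\<^bsub>L\<^esub>"
  using ring.ring_simprules(6)[OF k_algebra.ring_A[OF L]] \<theta>_one by (intro \<psi>_eq)

lemma \<psi>_ring_iso: "\<psi> \<in> ring_iso H L"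
proof -
  have "bij_betw \<psi> (carrier H) (carrier L)" unfolding \<psi>_def using \<theta>_bij by (rule bij_betw_inv_into)
  then show ?thesis
    by (auto simp: ring_iso_def ring_hom_def \<psi>_mult \<psi>_one linear_mapsD[OF \<psi>_linear])
qed

lemma tensors: "tensor_algebras2 H H L L \<psi> \<psi>"
  by (intro tensor_algebras2.intro tensor_algebras.intro tensor_algebras2_axioms.intro
      H.k_algebra_axioms L \<psi>_linear)

lemma hopf_isomorphicI:
  assumes com: "\<And>y. y \<in> carrier L \<Longrightarrow> comult L y = tensor_map L L \<psi> \<psi> (comult H (\<theta> y))"
    and cou: "\<And>y. y \<in> carrier L \<Longrightarrow> counit L y = counit H (\<theta> y)"
    and ant: "\<And>y. y \<in> carrier L \<Longrightarrow> antipode L y = \<psi> (antipode H (\<theta> y))"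
  shows "hopf_isomorphic H L"
proof -
  have "\<psi> \<in> hopf_iso H L"
    unfolding hopf_iso_def
    by (simp add: \<psi>_ring_iso \<psi>_linear com cou ant \<psi>_closed \<theta>_\<psi>)
  then show ?thesis unfolding hopf_isomorphic_def by blast
qed

end

subsection \<open>Group algebras\<close>

lemma group_algebra_simps [simp]:
  "carrier (group_algebra G) = carrier (monoid_algebra G)"
  "monoid.mult (group_algebra G) = monoid.mult (monoid_algebra G)"
  "one (group_algebra G) = one (monoid_algebra G)"
  "ring.zero (group_algebra G) = ring.zero (monoid_algebra G)"
  "add (group_algebra G) = add (monoid_algebra G)"
  "module.smult (group_algebra G) = module.smult (monoid_algebra G)"
  "comult (group_algebra G) = linear_extension (tensor (monoid_algebra G) (monoid_algebra G))
     (\<lambda>x. pure_tensor (monoid_algebra G) (monoid_algebra G) (Poly_Mapping.single x 1) (Poly_Mapping.single x 1))"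
  "counit (group_algebra G) = linear_extension scalars (\<lambda>x. 1)"
  "antipode (group_algebra G) = linear_extension (monoid_algebra G) (\<lambda>x. Poly_Mapping.single (inv\<^bsub>G\<^esub> x) 1)"
  by (simp_all add: group_algebra_def Let_def module.defs hopf.defs)

context hopf_algebra
begin

lemma antipode_grouplike:
  assumes "grouplike H g" shows "antipode H g \<otimes> g = \<one>" "g \<otimes> antipode H g = \<one>"
proof -
  interpret T: tensor_algebras H H by (intro tensor_algebras.intro k_algebra_axioms)
  note sl = linear_mapsD[OF antipode_linear, simplified]
  note cl = ring_closed(1,2)[OF ring_A] kvec.smult_in[OF kvec]
  have g: "g \<in> carrier H" "comult H g = pure_tensor H H g g" "counit H g = 1" using assms by (auto simp: grouplike_def)
  have one: "\<one> \<in> carrier H" by (rule ring.ring_simprules(6)[OF ring_A])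
  have 1: "(\<lambda>a b. antipode H a \<otimes> b) \<in> bilinear_maps H H H"
    by (rule bilinear_mapsI) (simp_all add: sl cl A_l_distr A_r_distr smult_mult_left smult_mult_right)
  have 2: "(\<lambda>a b. a \<otimes> antipode H b) \<in> bilinear_maps H H H"
    by (rule bilinear_mapsI) (simp_all add: sl cl A_l_distr A_r_distr smult_mult_left smult_mult_right)
  show "antipode H g \<otimes> g = \<one>"
    using antipode_left[OF g(1)] T.lift_pure[OF kvec 1 g(1,1)] kvec.smult_1[OF kvec one] by (simp add: g(2,3))
  show "g \<otimes> antipode H g = \<one>"
    using antipode_right[OF g(1)] T.lift_pure[OF kvec 2 g(1,1)] kvec.smult_1[OF kvec one] by (simp add: g(2,3))
qed

text \<open>
  The linear extension of \<open>\<phi>\<close> maps the basis of the group algebra onto a basis of \<open>H\<close>, and the structure maps of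
  the group algebra are determined by their values on that basis.
\<close>

lemma group_algebra_iso:
  fixes G :: "('g, 'z) monoid_scheme"
  assumes G: "group G" and bas: "is_basis H {g. grouplike H g}"
    and \<phi>: "bij_betw \<phi> (carrier G) {g. grouplike H g}"
    and \<phi>m: "\<And>x y. x \<in> carrier G \<Longrightarrow> y \<in> carrier G \<Longrightarrow> \<phi> (x \<otimes>\<^bsub>G\<^esub> y) = \<phi> x \<otimes> \<phi> y"
  shows "hopf_isomorphic H (group_algebra G :: ('k, 'g \<Rightarrow>\<^sub>0 'k) hopf)"
proof -
  interpret G: group G by fact
  let ?Gs = "{g. grouplike H g}"
  let ?kG = "monoid_algebra G :: ('k, 'g \<Rightarrow>\<^sub>0 'k) module" and ?L = "group_algebra G :: ('k, 'g \<Rightarrow>\<^sub>0 'k) hopf"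
  interpret Bs: based H ?Gs by (intro based.intro based_axioms.intro kvec bas)
  have kG: "k_algebra ?kG" by (rule k_algebra_monoid_algebra) (rule G.monoid_axioms)
  have L: "k_algebra ?L" by (rule k_algebra_cong[OF kG]) simp_all
  have \<phi>im: "\<phi> ` carrier G = ?Gs" using \<phi> unfolding bij_betw_def by blast
  have \<phi>g: "grouplike H (\<phi> x)" if "x \<in> carrier G" for x using imageI[OF that, of \<phi>] unfolding \<phi>im by simp
  have \<phi>c: "\<phi> x \<in> carrier H" if "x \<in> carrier G" for x
    using \<phi>g[OF that] unfolding grouplike_def by blast
  have \<phi>gc: "comult H (\<phi> x) = pure_tensor H H (\<phi> x) (\<phi> x)" and \<phi>ge: "counit H (\<phi> x) = 1" if "x \<in> carrier G" for x
    using \<phi>g[OF that] unfolding grouplike_def by blast+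
  have \<phi>1: "\<phi> \<one>\<^bsub>G\<^esub> = \<one>"
  proof -
    have e: "\<phi> \<one>\<^bsub>G\<^esub> \<otimes> \<phi> \<one>\<^bsub>G\<^esub> = \<phi> \<one>\<^bsub>G\<^esub>" using \<phi>m[of "\<one>\<^bsub>G\<^esub>" "\<one>\<^bsub>G\<^esub>"] by simp
    let ?g = "\<phi> \<one>\<^bsub>G\<^esub>"
    have gc: "?g \<in> carrier H" "antipode H ?g \<in> carrier H" using \<phi>c linear_mapsD(1)[OF antipode_linear] by auto
    have "?g = (antipode H ?g \<otimes> ?g) \<otimes> ?g" using antipode_grouplike[OF \<phi>g] ring_closed(7)[OF ring_A gc(1)] by simp
    also have "\<dots> = antipode H ?g \<otimes> (?g \<otimes> ?g)" using gc by (simp add: A_assoc)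
    finally show ?thesis using e antipode_grouplike[OF \<phi>g] by simp
  qed
  define \<theta> where "\<theta> = linear_extension H \<phi>"
  have \<theta>: "\<theta> \<in> linear_maps ?kG H" unfolding \<theta>_def by (rule linear_extension_linear[OF kvec]) (simp add: \<phi>c)
  have \<theta>s: "\<theta> (Poly_Mapping.single x 1) = \<phi> x" if "x \<in> carrier G" for x
    unfolding \<theta>_def using \<phi>c[OF that] by (simp add: kvec.linear_extension_single[OF kvec] kvec.smult_1[OF kvec])
  have finG: "finite (carrier G)" using Bs.finB unfolding bij_betw_finite[OF \<phi>] .
  have bij: "bij_betw \<theta> (carrier ?kG) (carrier H)"
  proof (rule Bs.linear_bij[OF k_algebra.kvec[OF kG] \<theta>, of "\<lambda>x. Poly_Mapping.single x 1" "carrier G"])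
    show "bij_betw (\<lambda>x. \<theta> (Poly_Mapping.single x 1)) (carrier G) ?Gs"
      using \<phi> by (subst bij_betw_cong[OF \<theta>s])
    fix y assume y: "y \<in> carrier ?kG"
    have e: "(\<lambda>x. Poly_Mapping.single x 1) \<in> carrier G \<rightarrow> carrier ?kG" by auto
    have id: "(\<lambda>y. y) \<in> linear_maps ?kG ?kG" by (rule linear_mapsI) auto
    have "y = linear_extension ?kG (\<lambda>x. Poly_Mapping.single x 1) y"
      by (rule linear_maps_eq_on_monoid[OF k_algebra.kvec[OF kG] G.monoid_axioms id linear_extension_linear[OF k_algebra.kvec[OF kG] e]])
        (use y in \<open>simp_all add: kvec.linear_extension_single[OF k_algebra.kvec[OF kG]]\<close>)
    also have "\<dots> = (\<Oplus>\<^bsub>?kG\<^esub>x\<in>carrier G. Poly_Mapping.lookup y x \<odot>\<^bsub>?kG\<^esub> Poly_Mapping.single x 1)"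
      by (rule kvec.linear_extension_superset[OF k_algebra.kvec[OF kG] finG _ e]) (use y in simp)
    finally show "y \<in> range (\<lambda>c. \<Oplus>\<^bsub>?kG\<^esub>x\<in>carrier G. c x \<odot>\<^bsub>?kG\<^esub> Poly_Mapping.single x 1)"
      by (rule image_eqI[where x="Poly_Mapping.lookup y", OF _ UNIV_I])
  qed auto
  interpret AB: algebra_bijection H ?L \<theta>
  proof (intro algebra_bijection.intro algebra_bijection_axioms.intro hopf_algebra_axioms L)
    show "\<theta> \<in> linear_maps ?L H" using \<theta> by (simp add: linear_maps_def)
    show "\<theta> (x \<otimes>\<^bsub>?L\<^esub> y) = \<theta> x \<otimes> \<theta> y" if "x \<in> carrier ?L" "y \<in> carrier ?L" for x y
      unfolding \<theta>_def using that \<phi>c \<phi>m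
      by (simp, intro linear_extension_mult[OF k_algebra_axioms G.monoid_axioms]) auto
    show "\<theta> \<one>\<^bsub>?L\<^esub> = \<one>" using \<theta>s[of "\<one>\<^bsub>G\<^esub>"] \<phi>1 by simp
    show "bij_betw \<theta> (carrier ?L) (carrier H)" using bij by simp
  qed
  interpret T2: tensor_algebras2 H H ?L ?L AB.\<psi> AB.\<psi> by (rule AB.tensors)
  have \<psi>\<phi>: "AB.\<psi> (\<phi> x) = Poly_Mapping.single x 1" if "x \<in> carrier G" for x
    using that \<theta>s by (intro AB.\<psi>_eq) auto
  have tc: "tensor ?L ?L = tensor ?kG ?kG" "pure_tensor ?L ?L = pure_tensor ?kG ?kG"
    by (rule tensor_cong; simp)+
  interpret TG: tensor_algebras ?kG ?kG by (intro tensor_algebras.intro kG)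
  show ?thesis
  proof (rule AB.hopf_isomorphicI)
    fix y assume "y \<in> carrier ?L"
    then have y: "Poly_Mapping.keys y \<subseteq> carrier G" by simp
    let ?e = "\<lambda>x. Poly_Mapping.single x (1::'k)"
    have pp: "(\<lambda>x. pure_tensor ?kG ?kG (?e x) (?e x)) \<in> carrier G \<rightarrow> carrier (tensor ?kG ?kG)" by auto
    have c1: "comult ?L \<in> linear_maps ?kG (tensor ?kG ?kG)"
      using linear_extension_linear[OF TG.tensor_kvec pp] by simp
    have c2: "(\<lambda>y. tensor_map ?L ?L AB.\<psi> AB.\<psi> (comult H (\<theta> y))) \<in> linear_maps ?kG (tensor ?kG ?kG)"
      using linear_maps_comp[OF linear_maps_comp[OF \<theta> comult_linear] T2.map_linear] by (simp add: tc)
    show "comult ?L y = tensor_map ?L ?L AB.\<psi> AB.\<psi> (comult H (\<theta> y))"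
    proof (rule linear_maps_eq_on_monoid[OF TG.tensor_kvec G.monoid_axioms c1 c2 _ y])
      fix x assume x: "x \<in> carrier G"
      have "comult ?L (?e x) = pure_tensor ?kG ?kG (?e x) (?e x)"
        using x by (simp add: kvec.linear_extension_single[OF TG.tensor_kvec] kvec.smult_1[OF TG.tensor_kvec])
      also have "\<dots> = tensor_map ?L ?L AB.\<psi> AB.\<psi> (pure_tensor H H (\<phi> x) (\<phi> x))"
        using x by (simp add: T2.map_pure \<phi>c \<psi>\<phi> tc)
      also have "\<dots> = tensor_map ?L ?L AB.\<psi> AB.\<psi> (comult H (\<theta> (?e x)))"
        using \<phi>gc[OF x] by (simp add: \<theta>s x)
      finally show "comult ?L (?e x) = tensor_map ?L ?L AB.\<psi> AB.\<psi> (comult H (\<theta> (?e x)))" .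
    qed
    have k1: "counit ?L \<in> linear_maps ?kG (scalars :: ('k, 'k) module)"
      using linear_extension_linear[OF kvec_scalars, of "\<lambda>x. 1" G] by simp
    show "counit ?L y = counit H (\<theta> y)"
    proof (rule linear_maps_eq_on_monoid[OF kvec_scalars G.monoid_axioms k1 linear_maps_comp[OF \<theta> counit_linear] _ y])
      fix x assume x: "x \<in> carrier G"
      show "counit ?L (?e x) = counit H (\<theta> (?e x))"
        using \<phi>ge[OF x] x by (simp add: \<theta>s kvec.linear_extension_single[OF kvec_scalars])
    qed
    have a1: "antipode ?L \<in> linear_maps ?kG ?kG"
      using linear_extension_linear[OF k_algebra.kvec[OF kG], of "\<lambda>x. ?e (inv\<^bsub>G\<^esub> x)" G] by simp
    have a2: "(\<lambda>y. AB.\<psi> (antipode H (\<theta> y))) \<in> linear_maps ?kG ?kG"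
      using linear_maps_comp[OF linear_maps_comp[OF \<theta> antipode_linear] AB.\<psi>_linear] by (simp add: linear_maps_def)
    show "antipode ?L y = AB.\<psi> (antipode H (\<theta> y))"
    proof (rule linear_maps_eq_on_monoid[OF k_algebra.kvec[OF kG] G.monoid_axioms a1 a2 _ y])
      fix x assume x: "x \<in> carrier G"
      let ?g = "\<phi> x" and ?h = "\<phi> (inv\<^bsub>G\<^esub> x)"
      have gc: "?g \<in> carrier H" "antipode H ?g \<in> carrier H" "?h \<in> carrier H"
        using \<phi>c x linear_mapsD(1)[OF antipode_linear] by auto
      have gh: "?g \<otimes> ?h = \<one>" using \<phi>m[of x "inv\<^bsub>G\<^esub> x"] x \<phi>1 by simp
      have "antipode H ?g = antipode H ?g \<otimes> (?g \<otimes> ?h)" using gh ring_closed(8)[OF ring_A gc(2)] by simp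
      also have "\<dots> = (antipode H ?g \<otimes> ?g) \<otimes> ?h" using gc by (simp add: A_assoc)
      also have "\<dots> = ?h" using antipode_grouplike(1)[OF \<phi>g[OF x]] ring_closed(7)[OF ring_A gc(3)] by simp
      finally have "AB.\<psi> (antipode H ?g) = ?e (inv\<^bsub>G\<^esub> x)" using x \<psi>\<phi> by simp
      then show "antipode ?L (?e x) = AB.\<psi> (antipode H (\<theta> (?e x)))"
        using x by (simp add: \<theta>s kvec.linear_extension_single[OF k_algebra.kvec[OF kG]] kvec.smult_1[OF k_algebra.kvec[OF kG]])
    qed
  qed
qed

end

subsection \<open>Transfer from coordinates\<close>

context hopf_basis
begin

lemma basis_transfer:
  assumes X: "finite X" "K.independent X" "K.span X = VB"
  shows "is_basis H (iota ` X)"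
proof -
  have XV: "x \<in> VB" if "x \<in> X" for x using that X(3) K.span_base by blast
  have inj: "inj_on iota X" using XV kap_iota_V by (metis inj_onI)
  have kf: "kap (\<Oplus>h\<in>iota ` X. c h \<odot> h) = (\<Sum>x\<in>X. fsc (c (iota x)) x)" for c
  proof -
    have "kap (\<Oplus>h\<in>iota ` X. c h \<odot> h) = (\<Sum>h\<in>iota ` X. kap (c h \<odot> h))" by (rule kap_finsum) auto
    also have "\<dots> = (\<Sum>x\<in>X. kap (c (iota x) \<odot> iota x))" by (simp add: sum.reindex[OF inj])
    also have "\<dots> = (\<Sum>x\<in>X. fsc (c (iota x)) x)"
      by (intro sum.cong refl) (simp add: kap_smult kap_iota_V XV)
    finally show ?thesis .
  qed
  have fc: "(\<Oplus>h\<in>iota ` X. c h \<odot> h) \<in> carrier H" for c by (rule fs_finsum_closed) auto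
  show ?thesis
    unfolding is_basis_def
  proof (intro conjI ballI)
    show "finite (iota ` X)" using X by simp
    show "iota ` X \<subseteq> carrier H" by auto
    fix v assume v: "v \<in> carrier H"
    define c0 where "c0 = restrict (\<lambda>h. K.dual X (kap h) (kap v)) (iota ` X)"
    show "\<exists>!c. c \<in> iota ` X \<rightarrow>\<^sub>E UNIV \<and> v = (\<Oplus>h\<in>iota ` X. c h \<odot> h)"
    proof (rule ex1I[of _ c0])
      have "kap v = (\<Sum>x\<in>X. fsc (K.dual X x (kap v)) x)"
        by (rule K.dual_expand[OF X(2,1)]) (simp add: X(3) VB_kap)
      also have "\<dots> = kap (\<Oplus>h\<in>iota ` X. c0 h \<odot> h)"
        unfolding kf by (intro sum.cong refl) (simp add: c0_def kap_iota_V XV)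
      finally have "v = (\<Oplus>h\<in>iota ` X. c0 h \<odot> h)" by (rule kap_inj[OF v fc])
      then show "c0 \<in> iota ` X \<rightarrow>\<^sub>E UNIV \<and> v = (\<Oplus>h\<in>iota ` X. c0 h \<odot> h)" by (simp add: c0_def)
      fix c assume c: "c \<in> iota ` X \<rightarrow>\<^sub>E UNIV \<and> v = (\<Oplus>h\<in>iota ` X. c h \<odot> h)"
      have "(\<Sum>x\<in>X. fsc (c (iota x)) x) = kap v" unfolding kf[symmetric] using c by simp
      also have "\<dots> = (\<Sum>x\<in>X. fsc (c0 (iota x)) x)" unfolding kf[symmetric] using \<open>v = (\<Oplus>h\<in>iota ` X. c0 h \<odot> h)\<close> by simp
      finally have "(\<Sum>x\<in>X. fsc (c (iota x) - c0 (iota x)) x) = 0"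
        by (simp only: K.scale_left_diff_distrib sum_subtractf right_minus_eq)
      from K.independentD[OF X(2,1) subset_refl this]
      have z: "c (iota x) - c0 (iota x) = 0" if "x \<in> X" for x using that by simp
      show "c = c0"
      proof
        fix h show "c h = c0 h"
        proof (cases "h \<in> iota ` X")
          case True
          then obtain x where "x \<in> X" "h = iota x" by (rule imageE)
          then show ?thesis using z[of x] by simp
        next
          case False
          have "c h = undefined" using conjunct1[OF c] False by (rule PiE_arb)
          then show ?thesis using False unfolding c0_def by simp
        qed
      qed
    qed
  qed
qed

lemma grouplikes_iota: "{g. grouplike H g} = iota ` C.GL"
proof
  show "{g. grouplike H g} \<subseteq> iota ` C.GL"
  proof
    fix g assume "g \<in> {g. grouplike H g}"
    then have "kap g \<in> C.GL" "g = iota (kap g)" using grouplike_glike by (auto simp: C.GL_def grouplike_def iota_kap)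
    then show "g \<in> iota ` C.GL" by blast
  qed
qed (auto simp: C.GL_def glike_grouplike)

lemma grouplike_basis:
  assumes "VB = K.span C.GL"
  shows "is_basis H {g. grouplike H g}" "card {g. grouplike H g} = card B"
proof -
  show "is_basis H {g. grouplike H g}"
    unfolding grouplikes_iota using assms by (intro basis_transfer C.finite_GL C.indep_GL) simp
  have "inj_on iota C.GL" using C.GL_V kap_iota_V by (metis inj_onI subsetD)
  then have "card {g. grouplike H g} = card C.GL" unfolding grouplikes_iota by (rule card_image)
  also have "\<dots> = card B"
    using C.dim_V assms K.dim_span_eq_card_independent[OF C.indep_GL] card_BB by simp
  finally show "card {g. grouplike H g} = card B" .
qed

lemma grouplike_mult: "grouplike H g \<Longrightarrow> grouplike H h \<Longrightarrow> grouplike H (g \<otimes> h)"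
proof -
  assume g: "grouplike H g" and h: "grouplike H h"
  then have c: "g \<in> carrier H" "h \<in> carrier H" by (auto simp: grouplike_def)
  have "grouplike H (iota (ml (kap g) (kap h)))"
    by (intro glike_grouplike F.glike_mul grouplike_glike g h)
  then show ?thesis using c by (simp add: ml_def iota_kap cl)
qed

lemma grouplike_antipode: "grouplike H g \<Longrightarrow> grouplike H (antipode H g)"
proof -
  assume g: "grouplike H g"
  then have c: "g \<in> carrier H" by (auto simp: grouplike_def)
  have "grouplike H (iota (an (kap g)))" by (intro glike_grouplike F.glike_S grouplike_glike g)
  then show ?thesis using c linear_mapsD(1)[OF antipode_linear] by (simp add: an_def iota_kap)
qed

lemma grouplike_one: "grouplike H \<one>"
  using glike_grouplike[OF F.e1_glike] by (simp add: un_def iota_kap cl)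

lemma group_grouplikes: "group \<lparr>carrier = {g. grouplike H g}, monoid.mult = (\<otimes>), one = \<one>\<rparr>" (is "group ?G")
proof (rule groupI)
  fix x assume "x \<in> carrier ?G"
  then show "\<exists>y\<in>carrier ?G. y \<otimes>\<^bsub>?G\<^esub> x = \<one>\<^bsub>?G\<^esub>"
    using grouplike_antipode antipode_grouplike(1) by (intro bexI[of _ "antipode H x"]) auto
qed (auto simp: grouplike_mult grouplike_one A_assoc grouplike_def[THEN iffD1] ring_closed(7)[OF ring_A] dest: grouplike_def[THEN iffD1])

lemma antipode_mult: "x \<in> carrier H \<Longrightarrow> y \<in> carrier H \<Longrightarrow> antipode H (x \<otimes> y) = antipode H y \<otimes> antipode H x"
proof -
  assume c: "x \<in> carrier H" "y \<in> carrier H"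
  have "an (ml (kap x) (kap y)) = ml (an (kap y)) (an (kap x))"
    by (rule F.S_anti_mul) (simp_all add: VB_kap)
  then have "iota (an (ml (kap x) (kap y))) = iota (ml (an (kap y)) (an (kap x)))" by simp
  then show ?thesis using c linear_mapsD(1)[OF antipode_linear] by (simp add: an_def ml_def iota_kap cl)
qed

lemma iota_un: "iota un = \<one>" by (simp add: un_def iota_kap cl)

lemma iota_pw: "iota (F.pw v n) = iota v [^]\<^bsub>H\<^esub> n"
proof (induction n)
  case (Suc n)
  have "iota (F.pw v (Suc n)) = iota v \<otimes> iota (F.pw v n)" by (simp add: ml_def iota_kap cl)
  then show ?case
    using Suc monoid.nat_pow_Suc2[OF ring.is_monoid[OF ring_A], of "iota v" n] by simp
qed (simp add: iota_un)

end


section \<open>Free algebras\<close>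

abbreviation word_prod where "word_prod A f w \<equiv> foldr (\<lambda>i y. f i \<otimes>\<^bsub>A\<^esub> y) w \<one>\<^bsub>A\<^esub>"

lemma words_simps [simp]: "carrier words = UNIV" "v \<otimes>\<^bsub>words\<^esub> w = v @ w" "\<one>\<^bsub>words\<^esub> = []"
  by (simp_all add: words_def)

lemma monoid_words: "monoid words" by (rule monoidI) simp_all

lemma k_algebra_free: "k_algebra (free_algebra :: ('k::field, 'a list \<Rightarrow>\<^sub>0 'k) module)"
  by (rule k_algebra_monoid_algebra[OF monoid_words])

lemma word_mult: "word v \<otimes>\<^bsub>free_algebra\<^esub> word w = word (v @ w)"
  by (simp add: word_def)

text \<open>
  Structure maps of the Taft algebra are evaluations of the free algebra. This lemma identifies such an evaluation
  with a composite of known maps; as it is stated for an arbitrary multiplication on a vector space, it also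
  covers maps to the opposite algebra.
\<close>

lemma free_eval_unique:
  assumes A: "kvec A" and F: "F \<in> linear_maps free_algebra A" and F1: "F (word []) = \<one>\<^bsub>A\<^esub>"
    and Fc: "\<And>i w. F (word (i # w)) = f i \<otimes>\<^bsub>A\<^esub> F (word w)"
  shows "F z = free_eval A f z"
proof -
  have wp: "word_prod A f w = F (word w)" for w by (induction w) (simp_all add: F1 Fc)
  have wc: "(\<lambda>w. word_prod A f w) \<in> carrier words \<rightarrow> carrier A"
    unfolding wp using linear_mapsD(1)[OF F] by simp
  have wc': "word_prod A f w \<in> carrier A" for w using wc by auto
  show ?thesis
    unfolding free_eval_def
  proof (rule linear_maps_eq_on_monoid[OF A monoid_words F linear_extension_linear[OF A wc]])
    show "F (Poly_Mapping.single w 1) = linear_extension A (\<lambda>w. word_prod A f w) (Poly_Mapping.single w 1)" for w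
      unfolding kvec.linear_extension_single[where f="\<lambda>w. word_prod A f w", OF A wc'] kvec.smult_1[OF A wc']
      by (simp add: wp word_def)
  qed simp
qed

context k_algebra
begin

context
  fixes f :: "'i \<Rightarrow> 'a" assumes f: "\<And>i. f i \<in> carrier A"
begin

lemma word_prod_closed: "word_prod A f w \<in> carrier A"
  by (induction w) (use f ring_closed(2)[OF ring_A] ring.ring_simprules(6)[OF ring_A] in auto)

lemma word_prod_append: "word_prod A f (v @ w) = word_prod A f v \<otimes> word_prod A f w"
proof (induction v)
  case (Cons i v)
  then show ?case using A_assoc[OF f word_prod_closed word_prod_closed] by simp
qed (use ring_closed(7)[OF ring_A word_prod_closed] in simp)

lemma free_eval_linear: "free_eval A f \<in> linear_maps free_algebra A"
  unfolding free_eval_def by (rule linear_extension_linear[OF kvec]) (simp add: word_prod_closed)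

lemma free_eval_word: "free_eval A f (word w) = word_prod A f w"
  unfolding free_eval_def word_def
  by (simp add: kvec.linear_extension_single[where f="\<lambda>w. word_prod A f w", OF kvec word_prod_closed] kvec.smult_1[OF kvec word_prod_closed])

lemma free_eval_mult: "free_eval A f (v \<otimes>\<^bsub>free_algebra\<^esub> w) = free_eval A f v \<otimes> free_eval A f w"
  unfolding free_eval_def
  by (rule linear_extension_mult[OF k_algebra_axioms monoid_words]) (simp_all add: word_prod_closed word_prod_append[simplified] word_prod_append del: foldr_append)

lemma free_eval_kernel: "ideal {z. free_eval A f z = \<zero>} free_algebra"
proof -
  let ?F = "free_algebra :: ('k, 'i list \<Rightarrow>\<^sub>0 'k) module" and ?K = "{z. free_eval A f z = \<zero>}"
  interpret F: k_algebra ?F by (rule k_algebra_free)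
  interpret kv: kvec A by (rule kvec)
  note lin = linear_mapsD[OF free_eval_linear, simplified]
  have ab: "abelian_group ?F" by (rule ring.is_abelian_group[OF F.ring_A])
  have z: "\<zero> \<in> carrier A" by (rule ring.ring_simprules(2)[OF ring_A])
  have zz: "\<zero> \<oplus> \<zero> = \<zero>" by (rule ring_closed(6)[OF ring_A z])
  have z0: "free_eval A f 0 = \<zero>"
    using linear_maps_zero[OF free_eval_linear F.kvec kvec] by simp
  have l0: "\<zero> \<otimes> a = \<zero>" "a \<otimes> \<zero> = \<zero>" if "a \<in> carrier A" for a
    using that ring.ring_simprules(24,25)[OF ring_A] by auto
  have inv: "\<ominus>\<^bsub>?F\<^esub> a \<in> ?K" if "a \<in> ?K" for a
  proof -
    have "\<ominus>\<^bsub>?F\<^esub> a = (- 1) \<odot>\<^bsub>?F\<^esub> a" by (rule kvec.smult_m1[OF F.kvec, symmetric]) simp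
    then show ?thesis using that lin(3)[of "-1" a] by simp
  qed
  show ?thesis
  proof (rule idealI[OF F.ring_A])
    show "subgroup ?K (add_monoid ?F)"
      by (rule group.subgroupI[OF abelian_group.a_group[OF ab]])
        (use z0 lin(2) zz inv in \<open>auto simp: a_inv_def\<close>)
    show "w \<otimes>\<^bsub>?F\<^esub> a \<in> ?K" "a \<otimes>\<^bsub>?F\<^esub> w \<in> ?K" if "a \<in> ?K" for a w
      using that lin(1) l0 by (simp_all add: free_eval_mult)
  qed
qed

end
end

context alg_ideal
begin

text \<open>
  The choice of a representative by \<open>the_elem\<close> is legitimate for maps that vanish on the ideal.
\<close>

lemma linear_on_coset:
  assumes V: "kvec V" and F: "F \<in> linear_maps A V" and F0: "\<And>i. i \<in> I \<Longrightarrow> F i = \<zero>\<^bsub>V\<^esub>" and z: "z \<in> carrier A"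
  shows "F ` (I +>\<^bsub>A\<^esub> z) = {F z}"
proof -
  have "F y = F z" if yz: "y \<in> I +>\<^bsub>A\<^esub> z" for y
  proof -
    obtain i where i: "i \<in> I" "y = i \<oplus>\<^bsub>A\<^esub> z" using yz by (auto simp: a_r_coset_def')
    have "F y = F i \<oplus>\<^bsub>V\<^esub> F z" unfolding i(2) by (rule linear_mapsD(2)[OF F I.a_Hcarr[OF i(1)] z])
    also have "\<dots> = F z"
    proof -
      interpret V: kvec V by fact
      show ?thesis using F0[OF i(1)] linear_mapsD(1)[OF F z] by simp
    qed
    finally show ?thesis .
  qed
  moreover have "z \<in> I +>\<^bsub>A\<^esub> z" by (rule I.a_rcos_self[OF z])
  ultimately show ?thesis by blast
qed

end


section \<open>A spanning set of the Taft algebra\<close>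

lemma taft_simps [simp]:
  "carrier (taft p \<omega>) = carrier (taft_alg p \<omega>)"
  "monoid.mult (taft p \<omega>) = monoid.mult (taft_alg p \<omega>)"
  "one (taft p \<omega>) = one (taft_alg p \<omega>)"
  "ring.zero (taft p \<omega>) = ring.zero (taft_alg p \<omega>)"
  "add (taft p \<omega>) = add (taft_alg p \<omega>)"
  "module.smult (taft p \<omega>) = module.smult (taft_alg p \<omega>)"
  "comult (taft p \<omega>) = (\<lambda>Y. the_elem (free_eval (tensor (taft_alg p \<omega>) (taft_alg p \<omega>)) (taft_comult_gen p \<omega>) ` Y))"
  "counit (taft p \<omega>) = (\<lambda>Y. the_elem (free_eval scalars taft_counit_gen ` Y))"
  "antipode (taft p \<omega>) = (\<lambda>Y. the_elem (free_eval (opposite_alg (taft_alg p \<omega>)) (taft_antipode_gen p \<omega>) ` Y))"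
  by (simp_all add: taft_def Let_def module.defs hopf.defs)

text \<open>
  Only an upper bound for the dimension of the Taft algebra is shown here: it is spanned by the classes \<open>t (a, l)\<close>
  of \<open>g\<^sup>a x\<^sup>l\<close> with \<open>a, l < p\<close>. Their independence follows later from a map to a Hopf algebra in which the images
  are independent.
\<close>

locale taft_quotient =
  fixes p :: nat and \<omega> :: "'k::field"
  assumes p0: "0 < p" and w0: "\<omega> \<noteq> 0"
begin

abbreviation "FA \<equiv> free_algebra :: ('k, taft_gen list \<Rightarrow>\<^sub>0 'k) module"
abbreviation "J \<equiv> taft_ideal p \<omega>"
abbreviation "T \<equiv> taft_alg p \<omega>"

lemma relations_carrier: "taft_relations p \<omega> \<subseteq> carrier FA" by simp

lemma alg_ideal_J: "alg_ideal FA J"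
  unfolding taft_ideal_def
  by (intro alg_ideal.intro k_algebra_free ring.genideal_ideal[OF k_algebra.ring_A[OF k_algebra_free] relations_carrier])

sublocale Q: alg_ideal FA J by (rule alg_ideal_J)

lemma k_algebra_T: "k_algebra T" unfolding taft_alg_def by (rule Q.k_algebra_quot)
lemma kvec_T: "kvec T" by (rule k_algebra.kvec[OF k_algebra_T])

definition q :: "(taft_gen list \<Rightarrow>\<^sub>0 'k) \<Rightarrow> (taft_gen list \<Rightarrow>\<^sub>0 'k) set" where "q z = J +>\<^bsub>FA\<^esub> z"
abbreviation "qw w \<equiv> q (word w)"

lemma q_linear: "q \<in> linear_maps FA T" unfolding taft_alg_def q_def[abs_def] by (rule Q.coset_linear)
lemma q_closed [simp]: "q z \<in> carrier T" using linear_mapsD(1)[OF q_linear] by simp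
lemma q_surj: "y \<in> carrier T \<Longrightarrow> \<exists>z. y = q z" by (auto simp: taft_alg_def Q.quot_carrier q_def)
lemma q_one: "\<one>\<^bsub>T\<^esub> = qw []" by (simp add: taft_alg_def Q.quot_one q_def word_def)

lemma qw_append: "qw v \<otimes>\<^bsub>T\<^esub> qw w = qw (v @ w)"
  unfolding taft_alg_def q_def by (subst Q.quot_mult) (simp_all add: word_mult)

lemma q_eqI: "x - y \<in> J \<Longrightarrow> q x = q y"
proof -
  assume xy: "x - y \<in> J"
  have "\<ominus>\<^bsub>FA\<^esub> y = (- 1) \<odot>\<^bsub>FA\<^esub> y" by (rule kvec.smult_m1[OF Q.kvec, symmetric]) simp
  also have "\<dots> = - y" by (rule poly_mapping_eqI) simp
  finally have "x \<ominus>\<^bsub>FA\<^esub> y = x - y" by (simp add: a_minus_def)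
  then show ?thesis using xy unfolding q_def by (subst Q.coset_eq_iff) simp_all
qed

lemma relations_J: "taft_relations p \<omega> \<subseteq> J"
  unfolding taft_ideal_def
  by (rule ring.genideal_self[OF k_algebra.ring_A[OF k_algebra_free] relations_carrier])

lemma q_g: "qw (replicate p Gen_g @ w) = qw w"
proof -
  have "qw (replicate p Gen_g) = qw []" using relations_J by (intro q_eqI) (auto simp: taft_relations_def)
  then show ?thesis by (metis append_Nil qw_append)
qed

lemma q_x: "qw (v @ replicate p Gen_x) = \<zero>\<^bsub>T\<^esub>"
proof -
  have "qw (replicate p Gen_x) = q 0" using relations_J by (intro q_eqI) (auto simp: taft_relations_def)
  also have z: "q 0 = \<zero>\<^bsub>T\<^esub>" using linear_maps_zero[OF q_linear Q.kvec kvec_T] by simp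
  finally show ?thesis
    using ring.ring_simprules(25)[OF k_algebra.ring_A[OF k_algebra_T] q_closed] by (simp flip: qw_append)
qed

lemma q_gx: "qw ([Gen_g, Gen_x] @ w) = \<omega> \<odot>\<^bsub>T\<^esub> qw ([Gen_x, Gen_g] @ w)"
proof -
  have "qw [Gen_g, Gen_x] = q (Poly_Mapping.single [Gen_x, Gen_g] \<omega>)"
    using relations_J by (intro q_eqI) (auto simp: taft_relations_def)
  also have "Poly_Mapping.single [Gen_x, Gen_g] \<omega> = \<omega> \<odot>\<^bsub>FA\<^esub> word [Gen_x, Gen_g]" by (simp add: word_def)
  also have "q \<dots> = \<omega> \<odot>\<^bsub>T\<^esub> qw [Gen_x, Gen_g]" by (rule linear_mapsD(3)[OF q_linear]) simp
  finally have e: "qw [Gen_g, Gen_x] = \<omega> \<odot>\<^bsub>T\<^esub> qw [Gen_x, Gen_g]" .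
  show ?thesis unfolding qw_append[symmetric] e by (rule k_algebra.smult_mult_left[OF k_algebra_T q_closed q_closed])
qed

definition t :: "nat \<times> nat \<Rightarrow> (taft_gen list \<Rightarrow>\<^sub>0 'k) set" where
  "t i = qw (replicate (fst i) Gen_g @ replicate (snd i) Gen_x)"

definition "I = {..<p} \<times> {..<p}"
definition "S = range (\<lambda>c. \<Oplus>\<^bsub>T\<^esub>i\<in>I. c i \<odot>\<^bsub>T\<^esub> t i)"

lemma t_closed: "t \<in> I \<rightarrow> carrier T" by (simp add: t_def)
lemma finI: "finite I" by (simp add: I_def)

lemmas S_closed = kvec.combs_closed[OF kvec_T t_closed, folded S_def]

lemma q_xg: "qw (Gen_x # replicate a Gen_g @ w) = (inverse \<omega> ^ a) \<odot>\<^bsub>T\<^esub> qw (replicate a Gen_g @ Gen_x # w)"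
proof (induction a)
  case (Suc a)
  let ?v = "Gen_x # replicate a Gen_g @ w"
  note sm = kvec.smult_smult[OF kvec_T q_closed] and s1 = kvec.smult_1[OF kvec_T q_closed]
  have "qw (Gen_x # replicate (Suc a) Gen_g @ w) = inverse \<omega> \<odot>\<^bsub>T\<^esub> qw ([Gen_g] @ ?v)"
    using q_gx[of "replicate a Gen_g @ w"] w0 by (simp add: sm s1)
  also have "\<dots> = inverse \<omega> \<odot>\<^bsub>T\<^esub> (qw [Gen_g] \<otimes>\<^bsub>T\<^esub> qw ?v)" by (simp only: qw_append)
  also have "\<dots> = inverse \<omega> \<odot>\<^bsub>T\<^esub> ((inverse \<omega> ^ a) \<odot>\<^bsub>T\<^esub> qw ([Gen_g] @ replicate a Gen_g @ Gen_x # w))"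
    unfolding Suc by (simp only: k_algebra.smult_mult_right[OF k_algebra_T q_closed q_closed] qw_append)
  finally show ?case by (simp add: sm)
qed (simp add: kvec.smult_1[OF kvec_T])

text \<open>
  Multiplying a monomial by a generator raises an exponent, up to a power of \<open>\<omega>\<close>; an exponent that
  reaches \<open>p\<close> is reset or annihilates the monomial.
\<close>

lemma gen_t: "i \<in> I \<Longrightarrow> qw [j] \<otimes>\<^bsub>T\<^esub> t i \<in> S"
proof -
  assume "i \<in> I"
  then obtain a l where i: "i = (a, l)" "a < p" "l < p" by (auto simp: I_def)
  let ?l = "replicate l Gen_x"
  show ?thesis
  proof (cases j)
    case Gen_g
    have "qw [j] \<otimes>\<^bsub>T\<^esub> t i = qw (replicate (Suc a) Gen_g @ ?l)" by (simp add: t_def i qw_append Gen_g)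
    also have "\<dots> = t (if Suc a = p then (0, l) else (Suc a, l))"
    proof (cases "Suc a = p")
      case True show ?thesis unfolding True q_g by (simp add: t_def)
    next
      case False then show ?thesis by (simp add: t_def)
    qed
    also have "\<dots> \<in> S" using i p0 by (intro S_closed(6) finI) (auto simp: I_def)
    finally show ?thesis .
  next
    case Gen_x
    have "qw [j] \<otimes>\<^bsub>T\<^esub> t i = qw (Gen_x # replicate a Gen_g @ ?l)" by (simp add: t_def i qw_append Gen_x)
    also have "\<dots> = (inverse \<omega> ^ a) \<odot>\<^bsub>T\<^esub> qw (replicate a Gen_g @ replicate (Suc l) Gen_x)" by (simp add: q_xg)
    also have "qw (replicate a Gen_g @ replicate (Suc l) Gen_x) \<in> S"
    proof (cases "Suc l = p")
      case True then show ?thesis using S_closed(2) q_x by simp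
    next
      case False
      have "qw (replicate a Gen_g @ replicate (Suc l) Gen_x) = t (a, Suc l)" by (simp add: t_def)
      also have "\<dots> \<in> S" using i False by (intro S_closed(6) finI) (auto simp: I_def)
      finally show ?thesis .
    qed
    then have "(inverse \<omega> ^ a) \<odot>\<^bsub>T\<^esub> qw (replicate a Gen_g @ replicate (Suc l) Gen_x) \<in> S" by (rule S_closed(4))
    finally show ?thesis .
  qed
qed

lemma gen_S: "y \<in> S \<Longrightarrow> qw [j] \<otimes>\<^bsub>T\<^esub> y \<in> S"
proof -
  assume "y \<in> S"
  then obtain c where c: "y = (\<Oplus>\<^bsub>T\<^esub>i\<in>I. c i \<odot>\<^bsub>T\<^esub> t i)" by (auto simp: S_def)
  interpret TT: k_algebra T by (rule k_algebra_T)
  have tc: "t i \<in> carrier T" for i by (simp add: t_def)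
  have lin: "(\<lambda>y. qw [j] \<otimes>\<^bsub>T\<^esub> y) \<in> linear_maps T T"
    by (rule linear_mapsI) (simp_all add: ring_closed(2)[OF TT.ring_A] TT.A_r_distr TT.smult_mult_right)
  have "qw [j] \<otimes>\<^bsub>T\<^esub> y = (\<Oplus>\<^bsub>T\<^esub>i\<in>I. qw [j] \<otimes>\<^bsub>T\<^esub> (c i \<odot>\<^bsub>T\<^esub> t i))"
    unfolding c by (rule linear_maps_finsum[OF lin kvec_T kvec_T]) (simp add: tc kvec.smult_in[OF kvec_T])
  also have "\<dots> \<in> S"
  proof (rule S_closed(5)[OF finI], rule Pi_I)
    fix i assume "i \<in> I"
    then have "c i \<odot>\<^bsub>T\<^esub> (qw [j] \<otimes>\<^bsub>T\<^esub> t i) \<in> S" by (intro S_closed(4) gen_t)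
    then show "qw [j] \<otimes>\<^bsub>T\<^esub> (c i \<odot>\<^bsub>T\<^esub> t i) \<in> S" by (simp add: TT.smult_mult_right tc)
  qed
  finally show ?thesis .
qed

lemma qw_S: "qw w \<in> S"
proof (induction w)
  case Nil
  have "qw [] = t (0, 0)" by (simp add: t_def)
  also have "\<dots> \<in> S" by (rule S_closed(6)[OF finI]) (simp add: I_def p0)
  finally show ?case .
next
  case (Cons j w)
  then show ?case using gen_S[OF Cons, of j] by (simp add: qw_append)
qed

lemma spans_T: "y \<in> carrier T \<Longrightarrow> y \<in> S"
proof -
  assume "y \<in> carrier T"
  then obtain z where z: "y = q z" using q_surj by blast
  have "q z = free_eval T (\<lambda>i. qw [i]) z"
    by (rule free_eval_unique[OF kvec_T q_linear]) (simp_all add: q_one qw_append)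
  also have "\<dots> = (\<Oplus>\<^bsub>T\<^esub>w\<in>Poly_Mapping.keys z. Poly_Mapping.lookup z w \<odot>\<^bsub>T\<^esub> word_prod T (\<lambda>i. qw [i]) w)"
    unfolding free_eval_def linear_extension_def ..
  also have "\<dots> \<in> S"
  proof (rule S_closed(5), simp, rule Pi_I, rule S_closed(4))
    fix w
    have "word_prod T (\<lambda>i. qw [i]) w = qw w" by (induction w) (simp_all add: q_one qw_append)
    then show "word_prod T (\<lambda>i. qw [i]) w \<in> S" using qw_S by simp
  qed
  finally show ?thesis unfolding z .
qed

end


section \<open>Recognition of Taft algebras\<close>

text \<open>
  The basis of monomials makes the evaluation map from the Taft algebra bijective. The last assumption holds in
  every finite-dimensional Hopf algebra (\<open>S_anti_mul\<close>) and allows the antipode to be computed on generators.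
\<close>

locale taft_hopf = hopf_algebra H + taft_quotient p \<omega>
  for H :: "('k::field, 'h, 'm) hopf_scheme" (structure) and p and \<omega> :: 'k +
  fixes u x :: 'h
  assumes u: "grouplike H u" and x [simp]: "x \<in> carrier H"
    and comult_x: "comult H x = pure_tensor H H x \<one> \<oplus>\<^bsub>tensor H H\<^esub> pure_tensor H H u x"
    and counit_x: "counit H x = 0"
    and up: "u [^] p = \<one>" and xp: "x [^] p = \<zero>" and ux: "u \<otimes> x = \<omega> \<odot> (x \<otimes> u)"
    and mons_basis: "is_basis H ((\<lambda>(a, l). u [^] a \<otimes> x [^] l) ` ({..<p} \<times> {..<p}))"
    and mons_inj: "inj_on (\<lambda>(a, l). u [^] a \<otimes> x [^] l) ({..<p} \<times> {..<p})"
    and antipode_mult: "\<And>a b. a \<in> carrier H \<Longrightarrow> b \<in> carrier H \<Longrightarrow>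
      antipode H (a \<otimes> b) = antipode H b \<otimes> antipode H a"
begin

lemma uH [simp]: "u \<in> carrier H" using u unfolding grouplike_def by blast

definition gen :: "taft_gen \<Rightarrow> 'h" where "gen j = (case j of Gen_g \<Rightarrow> u | Gen_x \<Rightarrow> x)"

lemma gen_simps: "gen Gen_g = u" "gen Gen_x = x" by (simp_all add: gen_def)

lemma gen_closed [simp]: "gen j \<in> carrier H" by (cases j) (simp_all add: gen_simps)

text \<open>
  The evaluation \<open>\<Phi>\<close> of the free algebra kills the Taft relations and induces \<open>\<theta>\<close> on the Taft algebra.
\<close>

definition "\<Phi> = free_eval H gen"

lemma \<Phi>_linear: "\<Phi> \<in> linear_maps FA H" unfolding \<Phi>_def by (rule free_eval_linear) simp
lemma \<Phi>_closed [simp]: "\<Phi> z \<in> carrier H" using linear_mapsD(1)[OF \<Phi>_linear] by simp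
lemma \<Phi>_word: "\<Phi> (word w) = word_prod H gen w" unfolding \<Phi>_def by (rule free_eval_word) simp
lemma \<Phi>_mult: "\<Phi> (v \<otimes>\<^bsub>FA\<^esub> w) = \<Phi> v \<otimes> \<Phi> w" unfolding \<Phi>_def by (rule free_eval_mult) simp
lemma \<Phi>_Cons: "\<Phi> (word (i # w)) = gen i \<otimes> \<Phi> (word w)" by (simp add: \<Phi>_word)
lemma \<Phi>_Nil: "\<Phi> (word []) = \<one>" by (simp add: \<Phi>_word)

lemma \<Phi>_diff: "\<Phi> v = \<Phi> w \<Longrightarrow> \<Phi> (v - w) = \<zero>"
proof -
  assume e: "\<Phi> v = \<Phi> w"
  interpret kv: kvec H by (rule kvec)
  have "v - w = v \<oplus>\<^bsub>FA\<^esub> ((- 1) \<odot>\<^bsub>FA\<^esub> w)" by (rule poly_mapping_eqI) (simp add: lookup_add lookup_minus)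
  then have "\<Phi> (v - w) = \<Phi> (v \<oplus>\<^bsub>FA\<^esub> ((- 1) \<odot>\<^bsub>FA\<^esub> w))" by (rule arg_cong)
  also have "\<dots> = \<Phi> v \<oplus> \<Phi> ((- 1) \<odot>\<^bsub>FA\<^esub> w)" by (rule linear_mapsD(2)[OF \<Phi>_linear]) simp_all
  also have "\<Phi> ((- 1) \<odot>\<^bsub>FA\<^esub> w) = (- 1) \<odot> \<Phi> w" by (rule linear_mapsD(3)[OF \<Phi>_linear]) simp
  also have "\<Phi> v \<oplus> (- 1) \<odot> \<Phi> w = \<Phi> w \<oplus> (- 1) \<odot> \<Phi> w" by (simp only: e)
  also have "\<dots> = (1 + - 1) \<odot> \<Phi> w" using kv.smult_add_l[of "\<Phi> w" 1 "- 1"] by simp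
  finally show ?thesis by simp
qed

lemma word_prod_replicate: "word_prod H gen (replicate n j) = gen j [^] n"
proof (induction n)
  case (Suc n)
  then show ?case using monoid.nat_pow_Suc2[OF ring.is_monoid[OF ring_A] gen_closed, of j n] by simp
qed simp

lemma \<Phi>_J: "z \<in> J \<Longrightarrow> \<Phi> z = \<zero>"
proof -
  assume z: "z \<in> J"
  let ?K = "{z. free_eval H gen z = \<zero>}"
  have "taft_relations p \<omega> \<subseteq> ?K"
  proof -
    have "\<Phi> (word (replicate p Gen_g) - word []) = \<zero>"
      using up by (intro \<Phi>_diff) (simp add: \<Phi>_word word_prod_replicate gen_simps del: foldr_replicate)
    moreover have "\<Phi> (word (replicate p Gen_x)) = \<zero>"
      using xp by (simp add: \<Phi>_word word_prod_replicate gen_simps del: foldr_replicate)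
    moreover have "\<Phi> (word [Gen_g, Gen_x] - Poly_Mapping.single [Gen_x, Gen_g] \<omega>) = \<zero>"
    proof (rule \<Phi>_diff)
      have "Poly_Mapping.single [Gen_x, Gen_g] \<omega> = \<omega> \<odot>\<^bsub>FA\<^esub> word [Gen_x, Gen_g]" by (simp add: word_def)
      then have "\<Phi> (Poly_Mapping.single [Gen_x, Gen_g] \<omega>) = \<omega> \<odot> \<Phi> (word [Gen_x, Gen_g])"
        using linear_mapsD(3)[OF \<Phi>_linear] by simp
      then show "\<Phi> (word [Gen_g, Gen_x]) = \<Phi> (Poly_Mapping.single [Gen_x, Gen_g] \<omega>)"
        using ux ring_closed(8)[OF ring_A] by (simp add: \<Phi>_word gen_simps)
    qed
    ultimately show ?thesis unfolding taft_relations_def \<Phi>_def by simp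
  qed
  then have "J \<subseteq> ?K" unfolding taft_ideal_def
    by (rule ring.genideal_minimal[OF Q.ring_A free_eval_kernel, rotated]) simp
  then show ?thesis using z unfolding \<Phi>_def by blast
qed

definition "\<theta> Y = the_elem (\<Phi> ` Y)"

lemma on_coset: "kvec V \<Longrightarrow> F \<in> linear_maps FA V \<Longrightarrow> (\<And>i. i \<in> J \<Longrightarrow> F i = \<zero>\<^bsub>V\<^esub>) \<Longrightarrow> the_elem (F ` q z) = F z"
  unfolding q_def using Q.linear_on_coset[of V F z] by simp

lemma \<theta>_q [simp]: "\<theta> (q z) = \<Phi> z"
  unfolding \<theta>_def by (rule on_coset[OF kvec \<Phi>_linear \<Phi>_J])

lemma q_linD: "q (v + w) = q v \<oplus>\<^bsub>T\<^esub> q w" "q (Poly_Mapping.map ((*) c) v) = c \<odot>\<^bsub>T\<^esub> q v" "q (v \<otimes>\<^bsub>FA\<^esub> w) = q v \<otimes>\<^bsub>T\<^esub> q w"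
  using linear_mapsD(2,3)[OF q_linear] unfolding taft_alg_def q_def by (simp_all add: Q.quot_mult)

lemma \<theta>_linear: "\<theta> \<in> linear_maps T H"
proof (rule linear_mapsI)
  fix y assume "y \<in> carrier T"
  then obtain v where v: "y = q v" using q_surj by blast
  show "\<theta> y \<in> carrier H" by (simp add: v)
  show "\<theta> (c \<odot>\<^bsub>T\<^esub> y) = c \<odot> \<theta> y" for c
    using linear_mapsD(3)[OF \<Phi>_linear, of v c] by (simp add: v flip: q_linD)
  fix z assume "z \<in> carrier T"
  then obtain w where w: "z = q w" using q_surj by blast
  show "\<theta> (y \<oplus>\<^bsub>T\<^esub> z) = \<theta> y \<oplus> \<theta> z"
    using linear_mapsD(2)[OF \<Phi>_linear, of v w] by (simp add: v w flip: q_linD)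
qed

lemma \<theta>_mult: "y \<in> carrier T \<Longrightarrow> z \<in> carrier T \<Longrightarrow> \<theta> (y \<otimes>\<^bsub>T\<^esub> z) = \<theta> y \<otimes> \<theta> z"
proof -
  assume "y \<in> carrier T" "z \<in> carrier T"
  then obtain v w where "y = q v" "z = q w" using q_surj by metis
  then show ?thesis by (simp add: \<Phi>_mult flip: q_linD)
qed

lemma \<theta>_t: "\<theta> (t i) = (\<lambda>(a, l). u [^] a \<otimes> x [^] l) i"
  unfolding t_def \<theta>_q \<Phi>_word word_prod_append[OF gen_closed] word_prod_replicate
  by (simp add: gen_simps split_beta)

lemma \<theta>_bij: "bij_betw \<theta> (carrier T) (carrier H)"
proof (rule based.linear_bij[OF based.intro[OF kvec based_axioms.intro[OF mons_basis]] kvec_T \<theta>_linear t_closed])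
  show "bij_betw (\<lambda>i. \<theta> (t i)) I ((\<lambda>(a, l). u [^] a \<otimes> x [^] l) ` ({..<p} \<times> {..<p}))"
    unfolding \<theta>_t I_def using mons_inj by (rule inj_on_imp_bij_betw)
qed (use spans_T in \<open>simp add: S_def\<close>)

abbreviation "L \<equiv> taft p \<omega>"

lemma algebra_bijection: "algebra_bijection H L \<theta>"
proof (intro algebra_bijection.intro algebra_bijection_axioms.intro hopf_algebra_axioms)
  show "k_algebra L" by (rule k_algebra_cong[OF k_algebra_T]) simp_all
  show "\<theta> \<in> linear_maps L H" using \<theta>_linear by (simp add: linear_maps_def)
  show "\<theta> \<one>\<^bsub>L\<^esub> = \<one>" by (simp add: q_one \<Phi>_Nil)
qed (simp_all add: \<theta>_mult \<theta>_bij)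

sublocale AB: algebra_bijection H L \<theta> by (rule algebra_bijection)
sublocale T2: tensor_algebras2 H H L L AB.\<psi> AB.\<psi> by (rule AB.tensors)

abbreviation "TT \<equiv> tensor T T"

lemma tensor_L: "tensor L L = TT" "pure_tensor L L = pure_tensor T T"
  by (rule tensor_cong; simp)+

lemma \<psi>_\<Phi>: "AB.\<psi> (\<Phi> z) = q z" by (rule AB.\<psi>_eq) simp_all

lemma \<psi>_gen: "AB.\<psi> u = taft_elem p \<omega> Gen_g" "AB.\<psi> x = taft_elem p \<omega> Gen_x"
  using \<psi>_\<Phi>[of "word [Gen_g]"] \<psi>_\<Phi>[of "word [Gen_x]"] ring_closed(8)[OF ring_A]
  by (simp_all add: \<Phi>_word gen_simps taft_elem_def q_def)

lemma kvec_TT: "kvec TT" using T2.B.tensor_kvec by (simp add: tensor_L)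

text \<open>
  Both sides, composed with the projection from the free algebra, are algebra maps with the same values
  on the generators. The same argument gives the counit and, with the opposite algebra, the antipode.
\<close>

lemma taft_comult: "y \<in> carrier T \<Longrightarrow> comult L y = tensor_map L L AB.\<psi> AB.\<psi> (comult H (\<theta> y))"
proof -
  assume "y \<in> carrier T"
  then obtain z where z: "y = q z" using q_surj by blast
  define F where "F v = tensor_map L L AB.\<psi> AB.\<psi> (comult H (\<Phi> v))" for v
  note hom = ring_hom_memE[OF comult_hom]
  have one: "\<one> \<in> carrier H" by (rule ring.ring_simprules(6)[OF ring_A])
  have F: "F \<in> linear_maps FA TT" unfolding F_def[abs_def]
    using linear_maps_comp[OF linear_maps_comp[OF \<Phi>_linear comult_linear] T2.map_linear] by (simp add: tensor_L)
  have cg: "tensor_map L L AB.\<psi> AB.\<psi> (comult H (gen i)) = taft_comult_gen p \<omega> i" for i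
  proof (cases i)
    case Gen_g
    have "comult H u = pure_tensor H H u u" using u unfolding grouplike_def by blast
    then show ?thesis
      by (simp add: Gen_g gen_simps T2.map_pure \<psi>_gen taft_comult_gen_def tensor_L Let_def)
  next
    case Gen_x
    then show ?thesis
      using linear_mapsD(2)[OF T2.map_linear T2.A.pure_closed[OF x one] T2.A.pure_closed[OF uH x]] one AB.\<psi>_one
      by (simp add: gen_simps comult_x T2.map_pure \<psi>_gen taft_comult_gen_def tensor_L Let_def)
  qed
  have Fe: "F v = free_eval TT (taft_comult_gen p \<omega>) v" for v
  proof (rule free_eval_unique[OF kvec_TT F])
    have "F (word []) = pure_tensor L L \<one>\<^bsub>L\<^esub> \<one>\<^bsub>L\<^esub>"
      using one AB.\<psi>_one by (simp add: F_def \<Phi>_Nil hom(4) T2.A.tensor_one T2.map_pure)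
    then show "F (word []) = \<one>\<^bsub>TT\<^esub>" unfolding T2.B.tensor_one[symmetric] tensor_L(1) .
    show "F (word (i # w)) = taft_comult_gen p \<omega> i \<otimes>\<^bsub>TT\<^esub> F (word w)" for i w
    proof -
      have "F (word (i # w)) = tensor_map L L AB.\<psi> AB.\<psi> (comult H (gen i) \<otimes>\<^bsub>tensor H H\<^esub> comult H (\<Phi> (word w)))"
        by (simp add: F_def \<Phi>_Cons hom(2))
      also have "\<dots> = tensor_map L L AB.\<psi> AB.\<psi> (comult H (gen i)) \<otimes>\<^bsub>tensor L L\<^esub> F (word w)"
        unfolding F_def by (rule T2.map_mult) (simp_all add: AB.\<psi>_mult hom(1))
      finally show ?thesis by (simp add: cg tensor_L)
    qed
  qed
  have "F v = \<zero>\<^bsub>TT\<^esub>" if "v \<in> J" for v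
  proof -
    have "F 0 = \<zero>\<^bsub>TT\<^esub>" using linear_maps_zero[OF F Q.kvec kvec_TT] by simp
    moreover have "F v = F 0" using \<Phi>_J[OF that] linear_maps_zero[OF \<Phi>_linear Q.kvec kvec] by (simp add: F_def)
    ultimately show ?thesis by simp
  qed
  from on_coset[OF kvec_TT F this, of z] have "the_elem (F ` q z) = F z" .
  moreover have "comult L y = the_elem (F ` q z)" unfolding Fe z by simp
  ultimately show ?thesis by (simp add: z F_def)
qed

lemma taft_counit: "y \<in> carrier T \<Longrightarrow> counit L y = counit H (\<theta> y)"
proof -
  assume "y \<in> carrier T"
  then obtain z where z: "y = q z" using q_surj by blast
  define F where "F v = counit H (\<Phi> v)" for v
  note hom = ring_hom_memE[OF counit_hom]
  have F: "F \<in> linear_maps FA (scalars :: ('k, 'k) module)" unfolding F_def[abs_def]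
    by (rule linear_maps_comp[OF \<Phi>_linear counit_linear])
  have cu: "counit H u = 1" using u unfolding grouplike_def by blast
  have Fe: "F v = free_eval scalars taft_counit_gen v" for v
  proof (rule free_eval_unique[OF kvec_scalars F])
    show "F (word []) = \<one>\<^bsub>scalars\<^esub>" using hom(4) by (simp add: F_def \<Phi>_Nil)
    show "F (word (i # w)) = taft_counit_gen i \<otimes>\<^bsub>scalars\<^esub> F (word w)" for i w
      by (cases i) (simp_all add: F_def \<Phi>_Cons hom(2) gen_simps taft_counit_gen_def cu counit_x)
  qed
  have "F v = \<zero>\<^bsub>scalars\<^esub>" if "v \<in> J" for v
    using \<Phi>_J[OF that] linear_maps_zero[OF counit_linear kvec kvec_scalars] by (simp add: F_def)
  from on_coset[OF kvec_scalars F this, of z] have "the_elem (F ` q z) = F z" .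
  moreover have "counit L y = the_elem (F ` q z)" unfolding Fe z by simp
  ultimately show ?thesis by (simp add: z F_def)
qed

text \<open>
  Apply \<open>S(x\<^sub>1) x\<^sub>2 = \<epsilon>(x) 1\<close> to \<open>\<Delta> x = x \<otimes> 1 + u \<otimes> x\<close>.
\<close>

lemma antipode_x: "antipode H x = \<ominus> (antipode H u \<otimes> x)"
proof -
  interpret kv: kvec H by (rule kvec)
  have one: "\<one> \<in> carrier H" by (rule ring.ring_simprules(6)[OF ring_A])
  note sl = linear_mapsD[OF antipode_linear, simplified]
  note cl = ring_closed(1,2)[OF ring_A] kv.smult_in
  have bil: "(\<lambda>a b. antipode H a \<otimes> b) \<in> bilinear_maps H H H"
    by (rule bilinear_mapsI) (simp_all add: sl cl A_l_distr A_r_distr smult_mult_left smult_mult_right)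
  have "tensor_lift H (\<lambda>a b. antipode H a \<otimes> b) (comult H x)
    = tensor_lift H (\<lambda>a b. antipode H a \<otimes> b) (pure_tensor H H x \<one>)
      \<oplus> tensor_lift H (\<lambda>a b. antipode H a \<otimes> b) (pure_tensor H H u x)"
    unfolding comult_x
    by (rule linear_mapsD(2)[OF T2.A.lift_linear[OF kvec bil] T2.A.pure_closed[OF x one] T2.A.pure_closed[OF uH x]])
  also have "\<dots> = antipode H x \<oplus> antipode H u \<otimes> x"
    using one x sl(1) ring_closed(8)[OF ring_A] by (simp add: T2.A.lift_pure[OF kvec bil])
  finally have "antipode H x \<oplus> antipode H u \<otimes> x = \<zero>"
    using antipode_left[OF x] kv.smult_0[OF one] by (simp add: counit_x)
  then show ?thesis using abelian_group.minus_equality[OF ring.is_abelian_group[OF ring_A]] sl(1) cl by simp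
qed

lemma taft_antipode: "y \<in> carrier T \<Longrightarrow> antipode L y = AB.\<psi> (antipode H (\<theta> y))"
proof -
  assume "y \<in> carrier T"
  then obtain z where z: "y = q z" using q_surj by blast
  let ?O = "opposite_alg T"
  define F where "F v = AB.\<psi> (antipode H (\<Phi> v))" for v
  interpret TK: k_algebra T by (rule k_algebra_T)
  have O: "kvec ?O" by (rule kvec_cong[OF kvec_T]) (simp_all add: opposite_alg_def)
  have F: "F \<in> linear_maps FA ?O" unfolding F_def[abs_def]
    using linear_maps_comp[OF linear_maps_comp[OF \<Phi>_linear antipode_linear] AB.\<psi>_linear]
    by (simp add: opposite_alg_def linear_maps_def)
  have one: "\<one> \<in> carrier H" by (rule ring.ring_simprules(6)[OF ring_A])
  have ac: "antipode H v \<in> carrier H" if "v \<in> carrier H" for v using linear_mapsD(1)[OF antipode_linear that] .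
  note \<psi>c = AB.\<psi>_closed[simplified]
  let ?g = "taft_elem p \<omega> Gen_g"
  have inv: "inv\<^bsub>T\<^esub> ?g = AB.\<psi> (antipode H u)"
  proof (rule monoid.inv_char[OF ring.is_monoid[OF TK.ring_A]])
    show "?g \<in> carrier T" unfolding \<psi>_gen[symmetric] by (rule \<psi>c) simp
    show "AB.\<psi> (antipode H u) \<in> carrier T" by (intro \<psi>c ac) simp
    show "?g \<otimes>\<^bsub>T\<^esub> AB.\<psi> (antipode H u) = \<one>\<^bsub>T\<^esub>" "AB.\<psi> (antipode H u) \<otimes>\<^bsub>T\<^esub> ?g = \<one>\<^bsub>T\<^esub>"
      using antipode_grouplike[OF u] AB.\<psi>_one AB.\<psi>_mult[OF uH ac[OF uH]] AB.\<psi>_mult[OF ac[OF uH] uH]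
      by (simp_all flip: \<psi>_gen)
  qed
  have neg: "AB.\<psi> (\<ominus> v) = \<ominus>\<^bsub>T\<^esub> AB.\<psi> v" if "v \<in> carrier H" for v
    using linear_mapsD(3)[OF AB.\<psi>_linear that, of "- 1"] kvec.smult_m1[OF kvec that] kvec.smult_m1[OF kvec_T \<psi>c[OF that]]
    by simp
  have ag: "AB.\<psi> (antipode H (gen i)) = taft_antipode_gen p \<omega> i" for i
  proof (cases i)
    case Gen_g then show ?thesis by (simp add: gen_simps taft_antipode_gen_def inv Let_def)
  next
    case Gen_x then show ?thesis
      using neg[OF ring_closed(2)[OF ring_A ac[OF uH] x]] AB.\<psi>_mult[OF ac[OF uH] x]
      by (simp add: gen_simps antipode_x taft_antipode_gen_def inv Let_def \<psi>_gen)
  qed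
  have a1: "antipode H \<one> = \<one>"
    using antipode_grouplike(1)[of \<one>] ring_closed(8)[OF ring_A ac[OF one]] ring_hom_memE(4)[OF counit_hom]
      ring_hom_memE(4)[OF comult_hom] T2.A.tensor_one one by (simp add: grouplike_def)
  have Fe: "F v = free_eval ?O (taft_antipode_gen p \<omega>) v" for v
  proof (rule free_eval_unique[OF O F])
    show "F (word []) = \<one>\<^bsub>?O\<^esub>" using AB.\<psi>_one by (simp add: F_def \<Phi>_Nil a1 opposite_alg_def)
    show "F (word (i # w)) = taft_antipode_gen p \<omega> i \<otimes>\<^bsub>?O\<^esub> F (word w)" for i w
      using AB.\<psi>_mult[OF ac ac, of "\<Phi> (word w)" "gen i"]
      by (simp add: F_def \<Phi>_Cons antipode_mult ag opposite_alg_def)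
  qed
  have "F v = \<zero>\<^bsub>?O\<^esub>" if "v \<in> J" for v
  proof -
    have "F 0 = \<zero>\<^bsub>?O\<^esub>" using linear_maps_zero[OF F Q.kvec O] by simp
    moreover have "F v = F 0" using \<Phi>_J[OF that] linear_maps_zero[OF \<Phi>_linear Q.kvec kvec] by (simp add: F_def)
    ultimately show ?thesis by simp
  qed
  from on_coset[OF O F this, of z] have "the_elem (F ` q z) = F z" .
  moreover have "antipode L y = the_elem (F ` q z)" unfolding Fe z by simp
  ultimately show ?thesis by (simp add: z F_def)
qed

theorem taft_iso: "hopf_isomorphic H L"
  by (rule AB.hopf_isomorphicI) (simp_all only: taft_simps(1) taft_comult taft_counit taft_antipode)

end


section \<open>Groups whose order is the square of a prime\<close>

context group
begin

lemma root_of_power: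
  assumes a: "a \<in> carrier G" and p: "Factorial_Ring.prime (ord a)" and i: "a [^] (i::int) \<noteq> \<one>"
  obtains m :: int where "(a [^] i) [^] m = a"
proof -
  have "\<not> int (ord a) dvd i" using i int_pow_eq_id[OF a] by simp
  then have "coprime i (int (ord a))" using p by (metis prime_int_nat_transfer prime_imp_coprime coprime_commute of_nat_0_le_iff nat_int prime_nat_int_transfer)
  then obtain m v where "m * i + v * int (ord a) = 1" using bezout_int[of i "int (ord a)"] by auto
  then have "i * m = 1 + int (ord a) * (- v)" by (simp add: algebra_simps)
  then have "int (ord a) dvd i * m - 1" by simp
  then have "a [^] (i * m) = a [^] (1::int)" using int_pow_eq[OF a, of "i * m" 1] by (simp add: dvd_diff_commute)
  then show ?thesis using a by (intro that[of m]) (simp add: int_pow_pow)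
qed

lemma conj_eq_iff: "g \<in> carrier G \<Longrightarrow> z \<in> carrier G \<Longrightarrow> y \<in> carrier G \<Longrightarrow> inv g \<otimes> z \<otimes> g = y \<longleftrightarrow> z \<otimes> g = g \<otimes> y"
  by (simp add: m_assoc inv_solve_left')

lemma conj_hom:
  assumes g: "g \<in> carrier G" shows "(\<lambda>z. inv g \<otimes> z \<otimes> g) \<in> hom G G"
proof (rule homI)
  fix y z assume yz: "y \<in> carrier G" "z \<in> carrier G"
  have "g \<otimes> (inv g \<otimes> (z \<otimes> g)) = z \<otimes> g" using g yz m_assoc[of g "inv g" "z \<otimes> g"] by simp
  then show "inv g \<otimes> (y \<otimes> z) \<otimes> g = (inv g \<otimes> y \<otimes> g) \<otimes> (inv g \<otimes> z \<otimes> g)" using g yz by (simp add: m_assoc)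
qed (use g in simp)

lemma powers_bij:
  assumes "finite (carrier G)" "a \<in> carrier G" "ord a = card (carrier G)"
  shows "bij_betw (\<lambda>i::int. a [^] i) {0..<int (card (carrier G))} (carrier G)"
proof -
  let ?f = "\<lambda>i::int. a [^] i"
  have inj: "inj_on ?f {0..<int (card (carrier G))}"
  proof (rule inj_onI)
    fix i j assume ij: "i \<in> {0..<int (card (carrier G))}" "j \<in> {0..<int (card (carrier G))}" "?f i = ?f j"
    then have "int (card (carrier G)) dvd j - i" using int_pow_eq[OF assms(2), of i j] assms(3) by simp
    then have "j mod int (card (carrier G)) = i mod int (card (carrier G))" by (rule mod_eq_dvd_iff[THEN iffD2])
    then show "i = j" using ij by simp
  qed
  have "?f ` {0..<int (card (carrier G))} = carrier G"
    using assms by (intro card_subset_eq) (auto simp: card_image[OF inj])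
  then show ?thesis using inj unfolding bij_betw_def by blast
qed

lemma int_pow_mod_ord: "a \<in> carrier G \<Longrightarrow> a [^] (i mod int (ord a)) = a [^] i"
  by (simp add: int_pow_eq mod_eq_dvd_iff[symmetric])

context
  fixes p :: nat
  assumes fin: "finite (carrier G)" and p: "Factorial_Ring.prime p" and card: "card (carrier G) = p ^ 2"
    and ords: "\<And>a. a \<in> carrier G \<Longrightarrow> a \<noteq> \<one> \<Longrightarrow> ord a = p"
begin

lemma power_mod: "a \<in> carrier G \<Longrightarrow> a [^] (i mod int p) = a [^] i"
  using ords[of a] int_pow_mod_ord[of a i] by (cases "a = \<one>") auto

lemma square_bij:
  assumes f: "f \<in> {0..<int p} \<times> {0..<int p} \<rightarrow> carrier G" and inj: "inj_on f ({0..<int p} \<times> {0..<int p})"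
  shows "bij_betw f ({0..<int p} \<times> {0..<int p}) (carrier G)"
proof -
  have "f ` ({0..<int p} \<times> {0..<int p}) = carrier G"
    using f card by (intro card_subset_eq fin) (auto simp: card_image[OF inj] card_cartesian_product power2_eq_square)
  then show ?thesis using inj unfolding bij_betw_def by blast
qed

lemma eq_mod: "i \<in> {0..<int p} \<Longrightarrow> j \<in> {0..<int p} \<Longrightarrow> int p dvd i - j \<Longrightarrow> i = j"
  using mod_eq_dvd_iff[of i "int p" j] by simp

text \<open>
  Otherwise conjugation by \<open>g\<close> moves \<open>a\<close> outside of its cyclic subgroup, and the products \<open>a\<^sup>i g a\<^sup>j\<close> with
  \<open>0 \<le> i, j < p\<close> are pairwise distinct: they exhaust the group. One of them is \<open>1\<close>, which makes \<open>g\<close> a power of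
  \<open>a\<close>, a contradiction.
\<close>

lemma conj_power:
  assumes a: "a \<in> carrier G" and g: "g \<in> carrier G"
  shows "\<exists>i::int. inv g \<otimes> a \<otimes> g = a [^] i"
proof (rule ccontr)
  assume no: "\<nexists>i::int. inv g \<otimes> a \<otimes> g = a [^] i"
  have a1: "a \<noteq> \<one>"
  proof
    assume "a = \<one>"
    then have "inv g \<otimes> a \<otimes> g = a [^] (0::int)" using g by simp
    then show False using no by blast
  qed
  define h where "h z = inv g \<otimes> z \<otimes> g" for z
  have h: "h \<in> hom G G" unfolding h_def[abs_def] using g by (rule conj_hom)
  have key: "i = i'" if e: "h (a [^] (i - i')) = a [^] (j::int)" and r: "i \<in> {0..<int p}" "i' \<in> {0..<int p}" for i i' j
  proof (rule ccontr)
    assume "i \<noteq> i'"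
    then have "a [^] (i - i') \<noteq> \<one>" using eq_mod[OF r] ords[OF a a1] int_pow_eq_id[OF a] by auto
    then obtain m where m: "(a [^] (i - i')) [^] (m::int) = a"
      using root_of_power[OF a] ords[OF a a1] p by metis
    have "h a = h (a [^] (i - i')) [^] m"
      using hom_int_pow[OF h _ is_group is_group, of "a [^] (i - i')" m] a m by simp
    also have "\<dots> = a [^] (j * m)" unfolding e using a by (simp add: int_pow_pow)
    finally show False using no unfolding h_def by blast
  qed
  define f where "f = (\<lambda>(i::int, j::int). a [^] i \<otimes> g \<otimes> a [^] j)"
  have "inj_on f ({0..<int p} \<times> {0..<int p})"
  proof (rule inj_onI)
    fix y z assume y: "y \<in> {0..<int p} \<times> {0..<int p}" and z: "z \<in> {0..<int p} \<times> {0..<int p}" and e: "f y = f z"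
    obtain i j i' j' where ij: "y = (i, j)" "z = (i', j')" by (cases y, cases z)
    have e1: "a [^] i \<otimes> (g \<otimes> a [^] j) = a [^] i' \<otimes> (g \<otimes> a [^] j')" using e a g by (simp add: f_def ij m_assoc)
    have "a [^] (i - i') \<otimes> g = g \<otimes> a [^] (j' - j)"
    proof -
      have "a [^] (- i') \<otimes> (a [^] i \<otimes> (g \<otimes> a [^] j)) \<otimes> a [^] (- j) = a [^] (- i') \<otimes> (a [^] i' \<otimes> (g \<otimes> a [^] j')) \<otimes> a [^] (- j)"
        by (simp only: e1)
      moreover have "a [^] (- i') \<otimes> (a [^] k \<otimes> (g \<otimes> a [^] l)) \<otimes> a [^] (- j) = a [^] (k - i') \<otimes> g \<otimes> a [^] (l - j)" for k l :: int
      proof -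
        have "a [^] (k - i') = a [^] (- i') \<otimes> a [^] k" "a [^] (l - j) = a [^] l \<otimes> a [^] (- j)"
          using a int_pow_mult[of a "- i'" k] int_pow_mult[of a l "- j"] by simp_all
        then show ?thesis using a g by (simp add: m_assoc)
      qed
      ultimately show ?thesis using a g by simp
    qed
    then have "h (a [^] (i - i')) = a [^] (j' - j)" using a g by (simp add: h_def conj_eq_iff)
    with key y z ij have ii: "i = i'" by auto
    then have "a [^] j = a [^] j'" using e1 a g by simp
    then have "int p dvd j' - j" using int_pow_eq[OF a] ords[OF a a1] by simp
    then have "j' = j" using y z ij by (intro eq_mod) auto
    then show "y = z" using ii ij by simp
  qed
  then have "bij_betw f ({0..<int p} \<times> {0..<int p}) (carrier G)"
    by (rule square_bij[rotated]) (use a g in \<open>auto simp: f_def\<close>)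
  then have "\<one> \<in> f ` ({0..<int p} \<times> {0..<int p})" unfolding bij_betw_def by simp
  then obtain z where "\<one> = f z" by blast
  then have one: "\<one> = a [^] fst z \<otimes> g \<otimes> a [^] snd z" by (simp add: f_def split_beta)
  define i j where "i = fst z" and "j = snd z"
  note one = one[folded i_def j_def]
  have "g = a [^] (- i) \<otimes> (a [^] i \<otimes> g \<otimes> a [^] j) \<otimes> a [^] (- j)"
  proof -
    have "a [^] (- i) \<otimes> a [^] i = \<one>" "a [^] j \<otimes> a [^] (- j) = \<one>" using a by (simp_all flip: int_pow_mult)
    then have "a [^] (- i) \<otimes> (a [^] i \<otimes> g) = g" "g \<otimes> a [^] j \<otimes> a [^] (- j) = g"
      using a g m_assoc[of "a [^] (- i)" "a [^] i" g] by (simp_all add: m_assoc)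
    then show ?thesis using a g m_assoc[of "a [^] (- i)" "a [^] i \<otimes> g" "a [^] j"] by simp
  qed
  also have "\<dots> = a [^] (- i - j)" unfolding one[symmetric] using a int_pow_mult[of a "- i" "- j"] by simp
  finally have gi: "g = a [^] (- i - j)" .
  have "a \<otimes> g = g \<otimes> a" unfolding gi using a int_pow_mult[of a 1 "- i - j"] int_pow_mult[of a "- i - j" 1] by (simp add: add.commute)
  then have "inv g \<otimes> a \<otimes> g = a [^] (1::int)" using a g by (simp add: m_assoc inv_solve_left')
  then show False using no by blast
qed

lemma trivial_intersection:
  assumes a: "a \<in> carrier G" and b: "b \<in> carrier G" "b \<notin> range (\<lambda>i::int. a [^] i)"
    and e: "a [^] (i::int) = b [^] (j::int)"
  shows "b [^] j = \<one>"
proof (rule ccontr)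
  assume n: "b [^] j \<noteq> \<one>"
  have "b \<noteq> \<one>" using n by auto
  then obtain m :: int where "(b [^] j) [^] m = b" using root_of_power[OF b(1) _ n] ords[OF b(1)] p by metis
  then have "b = a [^] (i * m)" using a by (simp add: int_pow_pow flip: e)
  then show False using b(2) by blast
qed

text \<open>
  Take \<open>a \<noteq> 1\<close> and \<open>b\<close> outside of the subgroup generated by \<open>a\<close>. Both generate normal subgroups, which meet
  trivially, so the commutator of \<open>a\<close> and \<open>b\<close> is trivial, and \<open>(i, j) \<mapsto> a\<^sup>i b\<^sup>j\<close> is an isomorphism.
\<close>

lemma elementary_abelian:
  obtains \<phi> where "bij_betw \<phi> ({0..<int p} \<times> {0..<int p}) (carrier G)"
    "\<And>i j k l. \<phi> ((i + k) mod int p, (j + l) mod int p) = \<phi> (i, j) \<otimes> \<phi> (k, l)"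
proof -
  have p1: "1 < p" using p by (rule prime_gt_1_nat)
  have "carrier G \<noteq> {\<one>}" 
  proof
    assume "carrier G = {\<one>}"
    then have "p * p = 1" using card by (simp add: power2_eq_square)
    then show False using p1 by simp
  qed
  then obtain a where a: "a \<in> carrier G" "a \<noteq> \<one>" by auto
  let ?A = "range (\<lambda>i::int. a [^] i)"
  have "?A \<subseteq> (\<lambda>i::int. a [^] i) ` {0..<int p}"
  proof (rule image_subsetI)
    fix i :: int
    show "a [^] i \<in> (\<lambda>i::int. a [^] i) ` {0..<int p}"
      using p1 a by (intro image_eqI[of _ _ "i mod int p"]) (simp_all add: power_mod)
  qed
  then have "card ?A \<le> p" using surj_card_le[of "{0..<int p}" ?A "\<lambda>i. a [^] i"] by simp
  also have "p < card (carrier G)" using card p1 by (simp add: power2_eq_square)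
  finally have "?A \<noteq> carrier G" by auto
  then obtain b where b: "b \<in> carrier G" "b \<notin> ?A" using a by auto
  have b1: "b \<noteq> \<one>" using b(2) int_pow_0[of G a] by (metis rangeI)
  note tri = trivial_intersection[OF a(1) b]
  have comm: "a \<otimes> b = b \<otimes> a"
  proof -
    obtain k :: int where k: "inv b \<otimes> a \<otimes> b = a [^] k" using conj_power[OF a(1) b(1)] by blast
    obtain l :: int where l: "inv a \<otimes> b \<otimes> a = b [^] l" using conj_power[OF b(1) a(1)] by blast
    have "inv a \<otimes> inv b \<otimes> a = inv (inv a \<otimes> b \<otimes> a)" using a b by (simp add: inv_mult_group m_assoc)
    also have "\<dots> = b [^] (- l)" unfolding l using b by (simp add: int_pow_neg)
    finally have l': "inv a \<otimes> inv b \<otimes> a \<otimes> b = b [^] (1 - l)" using b int_pow_mult[of b "- l" 1] by simp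
    have "a [^] (k - 1) = inv a \<otimes> a [^] k" using a int_pow_mult[of a "- 1" k] by (simp add: int_pow_neg)
    also have "\<dots> = b [^] (1 - l)" unfolding l'[symmetric] k[symmetric] using a b by (simp add: m_assoc)
    finally have "b [^] (1 - l) = \<one>" by (rule tri)
    with l' have "inv a \<otimes> (inv b \<otimes> (a \<otimes> b)) = \<one>" using a b by (simp add: m_assoc)
    then show ?thesis using a b by (metis inv_closed inv_solve_left m_closed r_one inv_inv)
  qed
  have comm': "a [^] (k::int) \<otimes> b [^] (l::int) = b [^] l \<otimes> a [^] k" for k l
  proof -
    have "a \<otimes> b [^] l = b [^] l \<otimes> a" for l :: int
    proof -
      define h where "h z = inv a \<otimes> z \<otimes> a" for z
      have h: "h \<in> hom G G" unfolding h_def[abs_def] using a(1) by (rule conj_hom)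
      have "h b = b" using a b comm by (simp add: h_def conj_eq_iff)
      then have "h (b [^] l) = b [^] l" using hom_int_pow[OF h b(1) is_group is_group] by simp
      then show ?thesis using a b by (simp add: h_def conj_eq_iff)
    qed
    note c = this
    define h where "h z = inv (b [^] l) \<otimes> z \<otimes> b [^] l" for z
    have h: "h \<in> hom G G" unfolding h_def[abs_def] using b(1) by (intro conj_hom) simp
    have "h a = a" using a b c[of l] by (simp add: h_def conj_eq_iff)
    then have "h (a [^] k) = a [^] k" using hom_int_pow[OF h a(1) is_group is_group] by simp
    then show ?thesis using a b by (simp add: h_def conj_eq_iff)
  qed
  define \<phi> where "\<phi> = (\<lambda>(i::int, j::int). a [^] i \<otimes> b [^] j)"
  show ?thesis
  proof (rule that[of \<phi>])
    show "bij_betw \<phi> ({0..<int p} \<times> {0..<int p}) (carrier G)"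
    proof (rule square_bij)
      show "inj_on \<phi> ({0..<int p} \<times> {0..<int p})"
      proof (rule inj_onI)
        fix y z assume y: "y \<in> {0..<int p} \<times> {0..<int p}" and z: "z \<in> {0..<int p} \<times> {0..<int p}" and e: "\<phi> y = \<phi> z"
        obtain i j k l where ij: "y = (i, j)" "z = (k, l)" by (cases y, cases z)
        have e1: "a [^] i \<otimes> b [^] j = a [^] k \<otimes> b [^] l" using e by (simp add: \<phi>_def ij)
        have "a [^] (i - k) = b [^] (l - j)"
        proof -
          have "a [^] (- k) \<otimes> (a [^] i \<otimes> b [^] j) \<otimes> b [^] (- j) = a [^] (- k) \<otimes> (a [^] k \<otimes> b [^] l) \<otimes> b [^] (- j)"
            by (simp only: e1)
          moreover have "a [^] (- k) \<otimes> (a [^] m \<otimes> b [^] n) \<otimes> b [^] (- j) = a [^] (m - k) \<otimes> b [^] (n - j)" for m n :: int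
          proof -
            have "a [^] (m - k) = a [^] (- k) \<otimes> a [^] m" "b [^] (n - j) = b [^] n \<otimes> b [^] (- j)"
              using a b int_pow_mult[of a "- k" m] int_pow_mult[of b n "- j"] by simp_all
            then show ?thesis using a b by (simp add: m_assoc)
          qed
          ultimately show ?thesis using a b by simp
        qed
        with tri[OF this] have "a [^] (i - k) = \<one>" "b [^] (l - j) = \<one>" by simp_all
        then have "int p dvd i - k" "int p dvd l - j"
          using int_pow_eq_id[OF a(1)] int_pow_eq_id[OF b(1)] ords[OF a] ords[OF b(1) b1] by auto
        then have "i = k" "l = j" using y z ij by (auto intro: eq_mod)
        then show "y = z" using ij by simp
      qed
    qed (use a b in \<open>auto simp: \<phi>_def\<close>)
    show "\<phi> ((i + k) mod int p, (j + l) mod int p) = \<phi> (i, j) \<otimes> \<phi> (k, l)" for i j k l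
    proof -
      have "\<phi> ((i + k) mod int p, (j + l) mod int p) = (a [^] i \<otimes> a [^] k) \<otimes> (b [^] j \<otimes> b [^] l)"
        using a b by (simp add: \<phi>_def power_mod int_pow_mult)
      also have "\<dots> = a [^] i \<otimes> (a [^] k \<otimes> b [^] j) \<otimes> b [^] l" using a b by (simp add: m_assoc)
      also have "\<dots> = a [^] i \<otimes> (b [^] j \<otimes> a [^] k) \<otimes> b [^] l" by (simp only: comm')
      also have "\<dots> = \<phi> (i, j) \<otimes> \<phi> (k, l)" using a b by (simp add: \<phi>_def m_assoc)
      finally show ?thesis .
    qed
  qed
qed

end

theorem group_prime_squared:
  assumes fin: "finite (carrier G)" and p: "Factorial_Ring.prime p" and card: "card (carrier G) = p ^ 2"
  shows "(\<exists>\<phi>. bij_betw \<phi> (carrier (integer_mod_group (p ^ 2))) (carrier G) \<and>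
      (\<forall>x y. \<phi> (x \<otimes>\<^bsub>integer_mod_group (p ^ 2)\<^esub> y) = \<phi> x \<otimes> \<phi> y)) \<or>
    (\<exists>\<phi>. bij_betw \<phi> (carrier (integer_mod_group p \<times>\<times> integer_mod_group p)) (carrier G) \<and>
      (\<forall>x y. \<phi> (x \<otimes>\<^bsub>integer_mod_group p \<times>\<times> integer_mod_group p\<^esub> y) = \<phi> x \<otimes> \<phi> y))"
proof (cases "\<exists>a\<in>carrier G. ord a = p ^ 2")
  have p0: "p \<noteq> 0" using p by auto
  case True
  then obtain a where a: "a \<in> carrier G" "ord a = p ^ 2" by blast
  have c: "carrier (integer_mod_group (p ^ 2)) = {0..<int (card (carrier G))}" using p0 by (simp add: carrier_integer_mod_group card)
  have "bij_betw (\<lambda>i::int. a [^] i) (carrier (integer_mod_group (p ^ 2))) (carrier G)"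
    unfolding c by (rule powers_bij[OF fin a(1)]) (simp add: a card)
  moreover have "a [^] (x \<otimes>\<^bsub>integer_mod_group (p ^ 2)\<^esub> y) = a [^] x \<otimes> a [^] y" for x y :: int
    using int_pow_mod_ord[OF a(1), of "x + y"] a by (simp add: int_pow_mult)
  ultimately show ?thesis by blast
next
  have p0: "p \<noteq> 0" using p by auto
  case False
  have "ord a = p" if a: "a \<in> carrier G" "a \<noteq> \<one>" for a
  proof -
    have "ord a dvd p ^ 2" using ord_dvd_group_order[OF a(1)] card by (simp add: Coset.order_def)
    then obtain i where i: "i \<le> 2" "ord a = p ^ i" using divides_primepow_nat[OF p] by blast
    have "i \<noteq> 2" "i \<noteq> 0" using False i a ord_eq_1[OF a(1)] by auto
    then have "i = 1" using i(1) by simp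
    then show ?thesis using i by simp
  qed
  from elementary_abelian[OF fin p card this] obtain \<phi>
    where "bij_betw \<phi> ({0..<int p} \<times> {0..<int p}) (carrier G)"
      "\<And>i j k l. \<phi> ((i + k) mod int p, (j + l) mod int p) = \<phi> (i, j) \<otimes> \<phi> (k, l)" by blast
  then have "bij_betw \<phi> (carrier (integer_mod_group p \<times>\<times> integer_mod_group p)) (carrier G) \<and>
      (\<forall>x y. \<phi> (x \<otimes>\<^bsub>integer_mod_group p \<times>\<times> integer_mod_group p\<^esub> y) = \<phi> x \<otimes> \<phi> y)"
    using p0 by (simp add: carrier_integer_mod_group mult_DirProd')
  then show ?thesis by blast
qed

end


section \<open>Pointed Hopf algebras of prime squared dimension\<close>

context hopf_basis
begin

text \<open>
  The basis of monomials found in coordinates is carried over to \<open>H\<close>. Independence and distinctness of the monomials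
  come for free, since they span and there are only \<open>p\<^sup>2\<close> of them.
\<close>

lemma taft_case:
  assumes P: "taft_pair fsc VB BB dlc ep ml un an u x \<omega> p"
  shows "hopf_isomorphic H (taft p \<omega>)" "primitive_root_of_unity p \<omega>"
proof -
  interpret P: taft_pair fsc VB BB dlc ep ml un an u x \<omega> p by fact
  let ?I = "{..<p} \<times> {..<p}"
  let ?m = "\<lambda>(a, l). P.mm a l"
  have imm: "iota (P.mm a l) = iota u [^] a \<otimes> iota x [^] l" for a l
    unfolding iota_pw[symmetric] P.mm_def by (simp add: ml_def iota_kap cl)
  have im: "iota \<circ> ?m = (\<lambda>(a, l). iota u [^] a \<otimes> iota x [^] l)" by (auto simp: fun_eq_iff imm)
  have spn: "K.span (?m ` ?I) = VB"
  proof
    show "K.span (?m ` ?I) \<subseteq> VB" by (rule K.span_minimal) auto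
    show "VB \<subseteq> K.span (?m ` ?I)"
    proof
      fix v assume "v \<in> VB"
      then obtain c where v: "v = (\<Sum>l<p. \<Sum>a<p. fsc (c a l) (P.mm a l))" by (rule P.mm_spans)
      show "v \<in> K.span (?m ` ?I)"
        unfolding v by (intro K.span_sum K.span_scale K.span_base) (auto intro: image_eqI[of _ _ "(a, l)" for a l])
    qed
  qed
  have cI: "card ?I = p ^ 2" by (simp add: power2_eq_square)
  have dV: "K.dim VB = p ^ 2" using C.dim_V P.cB by simp
  obtain A where A: "A \<subseteq> ?m ` ?I" "K.independent A" "?m ` ?I \<subseteq> K.span A"
    using K.maximal_independent_subset[of "?m ` ?I"] by blast
  have "K.span A = VB" using A(1,3) spn K.span_mono K.span_minimal[OF A(3)] by blast
  then have cA: "card A = p ^ 2" using dV K.dim_span_eq_card_independent[OF A(2)] by simp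
  have cm: "card (?m ` ?I) \<le> p ^ 2" unfolding cI[symmetric] by (rule card_image_le) simp
  have Aeq: "A = ?m ` ?I" by (rule card_seteq[OF _ A(1)]) (use cm cA in simp_all)
  have ceq: "card (?m ` ?I) = card ?I" using cA cI unfolding Aeq by simp
  have bas: "is_basis H (iota ` ?m ` ?I)" using A(2) spn unfolding Aeq by (intro basis_transfer) auto
  have minj: "inj_on ?m ?I" using ceq by (intro eq_card_imp_inj_on) simp_all
  have iinj: "inj_on iota (?m ` ?I)"
    by (rule inj_on_inverseI[of _ kap]) (auto simp: kap_iota_V)
  have tinj: "inj_on (iota \<circ> ?m) ?I" using minj iinj by (rule comp_inj_on)
  have eps_x: "counit H (iota x) = 0" using P.eps_x by (simp add: ep_def)
  have "taft_hopf H p \<omega> (iota u) (iota x)"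
  proof unfold_locales
    show "0 < p" using P.p2 by simp
    show "\<omega> \<noteq> 0" by (rule P.w0)
    show "grouplike H (iota u)" by (rule glike_grouplike[OF P.u])
    show "iota x \<in> carrier H" by simp
    show "comult H (iota x) = pure_tensor H H (iota x) \<one> \<oplus>\<^bsub>tensor H H\<^esub> pure_tensor H H (iota u) (iota x)"
      by (rule skew_comult[OF P.x])
    show "counit H (iota x) = 0" by (rule eps_x)
    show "iota u [^] p = \<one>" unfolding iota_pw[symmetric] P.up by (rule iota_un)
    show "iota x [^] p = \<zero>" unfolding iota_pw[symmetric] P.pw_x_p by (rule iota_0)
    have "iota (ml u x) = iota (fsc \<omega> (ml x u))" unfolding P.ux ..
    then show "iota u \<otimes> iota x = \<omega> \<odot> (iota x \<otimes> iota u)" by (simp add: ml_def iota_kap cl iota_smult)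
    show "is_basis H ((\<lambda>(a, l). iota u [^] a \<otimes> iota x [^] l) ` ?I)"
      using bas unfolding image_comp im .
    show "inj_on (\<lambda>(a, l). iota u [^] a \<otimes> iota x [^] l) ?I" using tinj unfolding im .
  qed (rule antipode_mult)
  then interpret TH: taft_hopf H p \<omega> "iota u" "iota x" .
  show "hopf_isomorphic H (taft p \<omega>)" by (rule TH.taft_iso)
  show "primitive_root_of_unity p \<omega>"
    unfolding primitive_root_of_unity_def using P.p2 P.wp P.wm by auto
qed

lemma group_case:
  assumes sp: "VB = K.span C.GL" and p: "Factorial_Ring.prime p" and cB: "card B = p ^ 2"
  shows "hopf_isomorphic H (group_algebra (integer_mod_group p \<times>\<times> integer_mod_group p) :: ('k, int \<times> int \<Rightarrow>\<^sub>0 'k) hopf) \<or>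
    hopf_isomorphic H (group_algebra (integer_mod_group (p ^ 2)) :: ('k, int \<Rightarrow>\<^sub>0 'k) hopf)"
proof -
  let ?G = "\<lparr>carrier = {g. grouplike H g}, monoid.mult = (\<otimes>), one = \<one>\<rparr>"
  interpret G: group ?G by (rule group_grouplikes)
  have bas: "is_basis H {g. grouplike H g}" and c: "card (carrier ?G) = p ^ 2"
    using grouplike_basis[OF sp] cB by simp_all
  have fin: "finite (carrier ?G)" using bas unfolding is_basis_def by simp
  from G.group_prime_squared[OF fin p c] show ?thesis
  proof (elim disjE exE conjE)
    fix \<phi> assume "bij_betw \<phi> (carrier (integer_mod_group (p\<^sup>2))) (carrier ?G)"
      "\<forall>x y. \<phi> (x \<otimes>\<^bsub>integer_mod_group (p\<^sup>2)\<^esub> y) = \<phi> x \<otimes>\<^bsub>?G\<^esub> \<phi> y"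
    then show ?thesis
      by (intro disjI2 group_algebra_iso[OF group_integer_mod_group bas, of \<phi>]) simp_all
  next
    fix \<phi> assume "bij_betw \<phi> (carrier (integer_mod_group p \<times>\<times> integer_mod_group p)) (carrier ?G)"
      "\<forall>x y. \<phi> (x \<otimes>\<^bsub>integer_mod_group p \<times>\<times> integer_mod_group p\<^esub> y) = \<phi> x \<otimes>\<^bsub>?G\<^esub> \<phi> y"
    then show ?thesis
      by (intro disjI1 group_algebra_iso[OF DirProd_group[OF group_integer_mod_group group_integer_mod_group] bas, of \<phi>]) (simp_all add: mult_DirProd')
  qed
qed

end

theorem theorem3p1:
  fixes p :: nat and H :: "('k::alg_closed_field, 'h) hopf"
  assumes "Factorial_Ring.prime p"
    and "CHAR('k) \<noteq> p"
    and "hopf_algebra H"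
    and "pointed H"
    and "has_dimension H (p ^ 2)"
  shows "(\<exists>\<omega>. primitive_root_of_unity p \<omega> \<and> hopf_isomorphic H (taft p \<omega>)) \<or>
    hopf_isomorphic H
      (group_algebra (integer_mod_group p \<times>\<times> integer_mod_group p) :: ('k, int \<times> int \<Rightarrow>\<^sub>0 'k) hopf) \<or>
    hopf_isomorphic H
      (group_algebra (integer_mod_group (p ^ 2)) :: ('k, int \<Rightarrow>\<^sub>0 'k) hopf)"
proof -
  obtain B where B: "is_basis H B" "card B = p ^ 2" using assms(5) unfolding has_dimension_def by blast
  interpret hopf_basis H B by (intro hopf_basis.intro hopf_basis_axioms.intro assms(3) B(1))
  have ch: "of_nat p \<noteq> (0::'k)"
  proof
    assume "of_nat p = (0::'k)"
    then have "CHAR('k) dvd p" by (simp add: of_nat_eq_0_iff_char_dvd)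
    then have "CHAR('k) = 1" using assms(1,2) prime_nat_iff by blast
    then show False using CHAR_not_1 by simp
  qed
  have root: "\<exists>z. poly q z = 0" if "0 < Polynomial.degree q" for q :: "'k poly"
    using that by (rule alg_closed_imp_poly_has_root)
  show ?thesis
  proof (cases "VB = K.span C.GL")
    case True
    then show ?thesis using group_case[OF True assms(1) B(2)] by blast
  next
    case False
    have "card BB = p ^ 2" using card_BB B(2) by simp
    then obtain u x \<omega> where "taft_pair fsc VB BB dlc ep ml un an u x \<omega> p"
      using F.pointed_p2_cases[OF root pointed_coalg[OF assms(4)] assms(1) ch _ False] by blast
    then show ?thesis using taft_case by blast
  qed
qed

end
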